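(* Let $g:\mathbb{R}^d\to\mathbb{R}^d$ be an invertible map with inverse $h$, let $G$ and $H$ be the Jacobian matrices of $g$ and $h$, and assume that $\operatorname{tr}\left(H\langle\nabla_zG(h),h\rangle\right)\in L^\infty(\mathbb{R}^d)$. Define $A=H^{-1}(H^{-1})^T:\mathbb{R}^d\to\mathbb{R}^{d\times d}$ and let $u\in\mathfrak{A}(\mathbb{R}^d\times(0,T),h)$ be a non-trivial solution to $\operatorname{div}(A\nabla u)+\partial_tu=0$ in $\mathbb{R}^d\times(0,T)$. For every $t\in(0,T)$, define $$\mathcal{H}(t)=\int_{\mathbb{R}^d}|u(x,t)|^2e^{-\frac{|h(x)|^2}{4t}}dx,\qquad \mathcal{D}(t)=\int_{\mathbb{R}^d}\langle A(x)\nabla u(x,t),\nabla u(x,t)\rangle e^{-\frac{|h(x)|^2}{4t}}dx,\qquad \mathcal{L}(t)=\frac{t\,\mathcal{D}(t)}{\mathcal{H}(t)}.$$ Set $\widetilde{\mathcal{L}}(t)=t^{\Upsilon}\mathcal{L}(t)$, where $\Upsilon\ge\left\|\operatorname{tr}\left(H\langle\nabla_zG(h),h\rangle\right)\right\|_{L^\infty(\mathbb{R}^d)}$. Then $\widetilde{\mathcal{L}}(t)$ is monotonically non-decreasing in $t$.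
   Context: Setting: $g$ is a $C^2$ diffeomorphism of $\mathbb{R}^d$ onto itself with inverse $h$ and $\det G>0$, where $G(z)=\left(\frac{\partial g_i}{\partial z_j}(z)\right)_{i,j}$ and $H(x)=\left(\frac{\partial h_i}{\partial x_j}(x)\right)_{i,j}=G(h(x))^{-1}$. Notation: $\operatorname{tr}\left(H\langle\nabla_zG(h),h\rangle\right)(x)=\sum_{i=1}^dh_i(x)\operatorname{tr}\left(H(x)\frac{\partial G}{\partial z_i}(h(x))\right)$. $\nabla$ and $\operatorname{div}$ are with respect to $x$. Moderate $h$-growth at infinity: a continuous function $u:\mathbb{R}^d\times(0,T)\to\mathbb{R}$ with locally integrable weak first order derivatives has moderate $h$-growth at infinity if the functions $\mathcal{H}(t)$ and $\mathcal{D}(t)$ given in the statement, and $\mathcal{T}(t)=\int_{\mathbb{R}^d}\left|\frac{\partial u}{\partial t}(x,t)\right|^2e^{-\frac{|h(x)|^2}{4t}}dx$, all belong to $L^1([0,T],t^{-d/2}dt)$. The class $\mathfrak{A}(\mathbb{R}^d\times(0,T),h)$: let (all derivatives weak) $$J(x,t)=\frac1d\left[2\left\langle A\nabla\frac{\partial u}{\partial t},H^Th\right\rangle+\frac{\partial u}{\partial t}\operatorname{tr}\left(H\langle\nabla_zG(h),h\rangle\right)+2t\frac{\partial^2u}{\partial t^2}\right],$$ $$\mathcal{I}(t)=\int_{\mathbb{R}^d}|u|\left|\langle A\nabla u,H^Th\rangle+2t\,\partial_tu\right|e^{-\frac{|h(x)|^2}{4t}}dx,\quad \mathcal{J}(t)=\int_{\mathbb{R}^d}|J(x,t)||u(x,t)|e^{-\frac{|h(x)|^2}{4t}}dx,$$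 $$\mathcal{K}(t)=\int_{\mathbb{R}^d}|J(x,t)|\left|\langle A\nabla u,H^Th\rangle+2t\,\partial_tu\right|e^{-\frac{|h(x)|^2}{4t}}dx.$$ Then $u\in\mathfrak{A}(\mathbb{R}^d\times(0,T),h)$ if $u$ is regular enough that these functionals are defined for every $t\in(0,T)$, $u$ has moderate $h$-growth at infinity, and for every $t_0\in(0,T)$ there exist $\varepsilon\in(0,t_0)$ with $\mathcal{I}\in L^\infty[t_0-\varepsilon,t_0]$ and $p>1$ with $\mathcal{J},\mathcal{K}\in L^p([0,t_0],t^{-d/2}dt)$. *)

theory Defs
  imports "HOL-Analysis.Analysis" "HOL-Probability.Essential_Supremum"
begin

section \<open>Smooth functions and weak derivatives\<close>

primrec Ck :: "nat \<Rightarrow> ('a::euclidean_space \<Rightarrow> 'b::real_normed_vector) \<Rightarrow> bool" where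
  "Ck 0 f \<longleftrightarrow> continuous_on UNIV f"
| "Ck (Suc k) f \<longleftrightarrow> (\<forall>x. f differentiable (at x)) \<and>
     (\<forall>b\<in>Basis. Ck k (\<lambda>x. frechet_derivative f (at x) b))"

definition test_function :: "'a::euclidean_space set \<Rightarrow> ('a \<Rightarrow> real) \<Rightarrow> bool" where
  "test_function \<Omega> \<phi> \<longleftrightarrow> (\<forall>k. Ck k \<phi>) \<and>
     compact (closure {x. \<phi> x \<noteq> 0}) \<and> closure {x. \<phi> x \<noteq> 0} \<subseteq> \<Omega>"

text \<open>Borel representatives are used throughout; every Lebesgue measurable function has one.\<close>

definition locally_integrable :: "'a::euclidean_space set \<Rightarrow> ('a \<Rightarrow> real) \<Rightarrow> bool" where
  "locally_integrable \<Omega> f \<longleftrightarrow> (\<forall>K. compact K \<and> K \<subseteq> \<Omega> \<longrightarrow> set_integrable lborel K f)"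

text \<open>\<open>weak_deriv \<Omega> e f f'\<close>: on the open set \<open>\<Omega>\<close>, \<open>f'\<close> is a weak derivative of \<open>f\<close>
  in the direction \<open>e\<close>. It is unique up to null sets.\<close>

definition weak_deriv ::
    "'a::euclidean_space set \<Rightarrow> 'a \<Rightarrow> ('a \<Rightarrow> real) \<Rightarrow> ('a \<Rightarrow> real) \<Rightarrow> bool" where
  "weak_deriv \<Omega> e f f' \<longleftrightarrow> locally_integrable \<Omega> f \<and> locally_integrable \<Omega> f' \<and>
     (\<forall>\<phi>. test_function \<Omega> \<phi> \<longrightarrow>
        (LINT x:\<Omega>|lborel. f x * frechet_derivative \<phi> (at x) e) = - (LINT x:\<Omega>|lborel. f' x * \<phi> x))"

definition is_weak_gradient :: "(real^'d \<Rightarrow> real) \<Rightarrow> (real^'d \<Rightarrow> real^'d) \<Rightarrow> bool" where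
  "is_weak_gradient f F \<longleftrightarrow> (\<forall>i. weak_deriv UNIV (axis i 1) f (\<lambda>x. F x $ i))"

text \<open>Points of space-time are pairs \<open>(x, t)\<close>; gradients are with respect to \<open>x\<close> only.\<close>

definition cylinder :: "real \<Rightarrow> ((real^'d) \<times> real) set" where
  "cylinder T = UNIV \<times> {0<..<T}"

definition is_weak_xgradient ::
    "real \<Rightarrow> ((real^'d) \<times> real \<Rightarrow> real) \<Rightarrow> ((real^'d) \<times> real \<Rightarrow> real^'d) \<Rightarrow> bool" where
  "is_weak_xgradient T f F \<longleftrightarrow>
     (\<forall>i. weak_deriv (cylinder T) (axis i 1, 0) f (\<lambda>p. F p $ i))"

definition is_weak_tderiv ::
    "real \<Rightarrow> ((real^'d) \<times> real \<Rightarrow> real) \<Rightarrow> ((real^'d) \<times> real \<Rightarrow> real) \<Rightarrow> bool" where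
  "is_weak_tderiv T f f' \<longleftrightarrow> weak_deriv (cylinder T) (0, 1) f f'"

text \<open>A space-time weak gradient of \<open>u\<close> determines its restriction to the slice at time \<open>t\<close>
  only for almost every \<open>t\<close>. So that integrals over individual slices make sense for every \<open>t\<close>,
  the gradient at time \<open>t\<close> is the weak gradient of \<open>u (\<cdot>, t)\<close>. The choice is immaterial under an
  integral over \<open>x\<close>, provided that a weak gradient of the slice exists, which the function class
  below demands.\<close>

definition xgrad :: "((real^'d) \<times> real \<Rightarrow> real) \<Rightarrow> real^'d \<Rightarrow> real \<Rightarrow> real^'d" where
  "xgrad u x t = (SOME F. is_weak_gradient (\<lambda>y. u (y, t)) F) x"

section \<open>The change of variables and the coefficients\<close>

definition C2_diffeo :: "(real^'d \<Rightarrow> real^'d) \<Rightarrow> (real^'d \<Rightarrow> real^'d) \<Rightarrow> bool" where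
  "C2_diffeo g h \<longleftrightarrow> Ck 2 g \<and> Ck 2 h \<and> (\<forall>z. h (g z) = z) \<and> (\<forall>x. g (h x) = x)"

definition Jac :: "(real^'d \<Rightarrow> real^'d) \<Rightarrow> real^'d \<Rightarrow> real^'d^'d" where
  "Jac f x = jacobian f (at x)"

definition coeffA :: "(real^'d \<Rightarrow> real^'d) \<Rightarrow> real^'d \<Rightarrow> real^'d^'d" where
  "coeffA h x = matrix_inv (Jac h x) ** transpose (matrix_inv (Jac h x))"

text \<open>The function \<open>tr (H \<langle>\<nabla>\<^sub>z G(h), h\<rangle>)\<close>, with \<open>G = Jac g\<close> and \<open>H = Jac h\<close>.\<close>

definition trHG :: "(real^'d \<Rightarrow> real^'d) \<Rightarrow> (real^'d \<Rightarrow> real^'d) \<Rightarrow> real^'d \<Rightarrow> real" where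
  "trHG g h x =
     (\<Sum>i\<in>UNIV. h x $ i * trace (Jac h x ** frechet_derivative (Jac g) (at (h x)) (axis i 1)))"

section \<open>Function spaces\<close>

definition Linf_norm :: "'a measure \<Rightarrow> ('a \<Rightarrow> real) \<Rightarrow> ereal" where
  "Linf_norm M f = esssup M (\<lambda>x. ereal \<bar>f x\<bar>)"

definition in_Linf :: "'a measure \<Rightarrow> ('a \<Rightarrow> real) \<Rightarrow> bool" where
  "in_Linf M f \<longleftrightarrow> f \<in> borel_measurable M \<and> Linf_norm M f < \<infinity>"

definition in_Lp :: "real \<Rightarrow> 'a measure \<Rightarrow> ('a \<Rightarrow> real) \<Rightarrow> bool" where
  "in_Lp p M f \<longleftrightarrow> f \<in> borel_measurable M \<and> integrable M (\<lambda>x. \<bar>f x\<bar> powr p)"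

text \<open>The measure \<open>t\<^sup>-\<^sup>d\<^sup>/\<^sup>2 dt\<close> on a set \<open>I\<close> of positive times. Below, intervals starting at \<open>0\<close>
  are taken without this endpoint (and \<open>[0,T]\<close> without \<open>T\<close>), where the functionals are undefined.\<close>

definition time_measure :: "nat \<Rightarrow> real set \<Rightarrow> real measure" where
  "time_measure d I = density (restrict_space lborel I) (\<lambda>t. ennreal (t powr (- (real d / 2))))"

section \<open>The functionals\<close>

definition gauss :: "(real^'d \<Rightarrow> real^'d) \<Rightarrow> real \<Rightarrow> real^'d \<Rightarrow> real" where
  "gauss h t x = exp (- ((norm (h x))\<^sup>2 / (4 * t)))"

text \<open>The names ending in \<open>_ig\<close> are integrands; they are separate because Bochner integrals of
  non-integrable functions are \<open>0\<close>, so that integrability has to be required explicitly.\<close>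

definition H_ig where
  "H_ig h u t x = \<bar>u (x, t)\<bar>\<^sup>2 * gauss h t x"
  for h :: "real^'d \<Rightarrow> real^'d" and u :: "(real^'d) \<times> real \<Rightarrow> real" and t :: real

definition D_ig where
  "D_ig h u t x = ((coeffA h x *v xgrad u x t) \<bullet> xgrad u x t) * gauss h t x"
  for h :: "real^'d \<Rightarrow> real^'d" and u :: "(real^'d) \<times> real \<Rightarrow> real" and t :: real

definition T_ig where
  "T_ig h ut t x = \<bar>ut (x, t)\<bar>\<^sup>2 * gauss h t x"
  for h :: "real^'d \<Rightarrow> real^'d" and ut :: "(real^'d) \<times> real \<Rightarrow> real" and t :: real

definition H_fun :: "(real^'d \<Rightarrow> real^'d) \<Rightarrow> ((real^'d) \<times> real \<Rightarrow> real) \<Rightarrow> real \<Rightarrow> real" where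
  "H_fun h u t = (LINT x|lborel. H_ig h u t x)"

definition D_fun :: "(real^'d \<Rightarrow> real^'d) \<Rightarrow> ((real^'d) \<times> real \<Rightarrow> real) \<Rightarrow> real \<Rightarrow> real" where
  "D_fun h u t = (LINT x|lborel. D_ig h u t x)"

definition L_fun :: "(real^'d \<Rightarrow> real^'d) \<Rightarrow> ((real^'d) \<times> real \<Rightarrow> real) \<Rightarrow> real \<Rightarrow> real" where
  "L_fun h u t = t * D_fun h u t / H_fun h u t"

definition T_fun :: "(real^'d \<Rightarrow> real^'d) \<Rightarrow> ((real^'d) \<times> real \<Rightarrow> real) \<Rightarrow> real \<Rightarrow> real" where
  "T_fun h ut t = (LINT x|lborel. T_ig h ut t x)"

text \<open>\<open>flow\<close> is \<open>\<langle>A \<nabla>u, H\<^sup>T h\<rangle> + 2 t \<partial>\<^sub>t u\<close>. In \<open>Jfn\<close>, \<open>Dut\<close> and \<open>utt\<close> stand for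
  \<open>\<nabla>\<partial>\<^sub>t u\<close> and \<open>\<partial>\<^sub>t\<partial>\<^sub>t u\<close>.\<close>

definition flow where
  "flow h u ut x t =
     (coeffA h x *v xgrad u x t) \<bullet> (transpose (Jac h x) *v h x) + 2 * t * ut (x, t)"
  for h :: "real^'d \<Rightarrow> real^'d" and u ut :: "(real^'d) \<times> real \<Rightarrow> real" and t :: real

definition Jfn where
  "Jfn g h ut Dut utt x t = 1 / real CARD('d) *
     (2 * ((coeffA h x *v Dut (x, t)) \<bullet> (transpose (Jac h x) *v h x))
      + ut (x, t) * trHG g h x + 2 * t * utt (x, t))"
  for g h :: "real^'d \<Rightarrow> real^'d" and ut utt :: "(real^'d) \<times> real \<Rightarrow> real"
    and Dut :: "(real^'d) \<times> real \<Rightarrow> real^'d" and t :: real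

definition I_ig where
  "I_ig h u ut t x = \<bar>u (x, t)\<bar> * \<bar>flow h u ut x t\<bar> * gauss h t x"
  for h :: "real^'d \<Rightarrow> real^'d"

definition J_ig where
  "J_ig g h u ut Dut utt t x = \<bar>Jfn g h ut Dut utt x t\<bar> * \<bar>u (x, t)\<bar> * gauss h t x"
  for g h :: "real^'d \<Rightarrow> real^'d"

definition K_ig where
  "K_ig g h u ut Dut utt t x = \<bar>Jfn g h ut Dut utt x t\<bar> * \<bar>flow h u ut x t\<bar> * gauss h t x"
  for g h :: "real^'d \<Rightarrow> real^'d"

definition I_fun where
  "I_fun h u ut t = (LINT x|lborel. I_ig h u ut t x)"
  for h :: "real^'d \<Rightarrow> real^'d"

definition J_fun where
  "J_fun g h u ut Dut utt t = (LINT x|lborel. J_ig g h u ut Dut utt t x)"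
  for g h :: "real^'d \<Rightarrow> real^'d"

definition K_fun where
  "K_fun g h u ut Dut utt t = (LINT x|lborel. K_ig g h u ut Dut utt t x)"
  for g h :: "real^'d \<Rightarrow> real^'d"

section \<open>Moderate growth, the class of solutions, and the equation\<close>

definition moderate_growth ::
    "real \<Rightarrow> (real^'d \<Rightarrow> real^'d) \<Rightarrow> ((real^'d) \<times> real \<Rightarrow> real) \<Rightarrow> bool" where
  "moderate_growth T h u \<longleftrightarrow>
     continuous_on (cylinder T) u \<and>
     (\<exists>Du. is_weak_xgradient T u Du) \<and>
     (\<forall>t\<in>{0<..<T}. \<exists>F. is_weak_gradient (\<lambda>x. u (x, t)) F) \<and>
     (\<exists>ut. is_weak_tderiv T u ut \<and>
        (\<forall>t\<in>{0<..<T}. integrable lborel (H_ig h u t) \<and> integrable lborel (D_ig h u t) \<and>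
                      integrable lborel (T_ig h ut t)) \<and>
        in_Lp 1 (time_measure CARD('d) {0<..<T}) (H_fun h u) \<and>
        in_Lp 1 (time_measure CARD('d) {0<..<T}) (D_fun h u) \<and>
        in_Lp 1 (time_measure CARD('d) {0<..<T}) (T_fun h ut))"

definition class_A ::
    "real \<Rightarrow> (real^'d \<Rightarrow> real^'d) \<Rightarrow> (real^'d \<Rightarrow> real^'d) \<Rightarrow> ((real^'d) \<times> real \<Rightarrow> real) set" where
  "class_A T g h = {u. moderate_growth T h u \<and>
     (\<exists>ut Dut utt. is_weak_tderiv T u ut \<and> is_weak_xgradient T ut Dut \<and> is_weak_tderiv T ut utt \<and>
        (\<forall>t\<in>{0<..<T}. integrable lborel (I_ig h u ut t) \<and>
                      integrable lborel (J_ig g h u ut Dut utt t) \<and>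
                      integrable lborel (K_ig g h u ut Dut utt t)) \<and>
        (\<forall>t0\<in>{0<..<T}.
           (\<exists>\<epsilon>\<in>{0<..<t0}. in_Linf (restrict_space lborel {t0-\<epsilon>..t0}) (I_fun h u ut)) \<and>
           (\<exists>p>1. in_Lp p (time_measure CARD('d) {0<..t0}) (J_fun g h u ut Dut utt) \<and>
                  in_Lp p (time_measure CARD('d) {0<..t0}) (K_fun g h u ut Dut utt))))}"

text \<open>Weak formulation of \<open>div (A \<nabla>u) + \<partial>\<^sub>t u = 0\<close> in the cylinder.\<close>

definition weak_solution ::
    "real \<Rightarrow> (real^'d \<Rightarrow> real^'d^'d) \<Rightarrow> ((real^'d) \<times> real \<Rightarrow> real) \<Rightarrow> bool" where
  "weak_solution T A u \<longleftrightarrow>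
     (\<exists>Du ut. is_weak_xgradient T u Du \<and> is_weak_tderiv T u ut \<and>
        (\<forall>\<phi>. test_function (cylinder T) \<phi> \<longrightarrow>
           (LINT p:cylinder T|lborel.
              - ((A (fst p) *v Du p) \<bullet> (\<chi> i. frechet_derivative \<phi> (at p) (axis i 1, 0)))
              + ut p * \<phi> p) = 0))"

end

theory Submission
  imports Defs "HOL-Probability.Probability_Measure"
begin

text \<open>In the similarity variables \<open>x = g (sqrt t *\<^sub>R y)\<close> the functionals become weighted integrals of
  \<open>v y t = u (g (sqrt t *\<^sub>R y), t)\<close> and of its gradient \<open>P\<close> against \<open>W y t = exp (- |y|\<^sup>2 / 4) * det (G (sqrt t *\<^sub>R y))\<close>,
  powers of \<open>t\<close> cancel, and \<open>L_fun\<close> is the quotient \<open>D / H\<close> of the energy of \<open>P\<close> and the norm of \<open>v\<close>.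
  By Jacobi's formula the logarithmic derivative of \<open>W\<close> in \<open>t\<close> is \<open>trHG / (2 * t)\<close>, so that
  \<open>t powr c * W\<close> increases and \<open>t powr (- c) * W\<close> decreases for \<open>c = \<Upsilon> / 2\<close>. The equation says that
  the time derivative \<open>Q\<close> of \<open>v\<close> along the flow represents the weighted energy form between any
  two times. Cauchy-Schwarz for \<open>Q\<close> then gives the monotonicity. As \<open>u\<close> is only weakly
  differentiable, derivatives in time are replaced by difference quotients, and only almost every
  slice of the equation is used.\<close>

text \<open>Formally, with \<open>c = \<Upsilon> / 2\<close>, the functions
  \<open>X = t powr c * D\<close> and \<open>Y = t powr (- c) * H\<close> satisfy
  \<open>X' \<ge> 2 * t powr c * t * B\<close> and \<open>Y' \<le> 2 * t powr (- c) * M\<close>,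
  where \<open>B\<close> is the weighted square norm of \<open>Q\<close> and \<open>M\<close> its
  pairing with \<open>v\<close>. Testing the equation with \<open>v\<close> gives
  \<open>D = t * M\<close>, so \<open>X' / X - Y' / Y \<ge> 2 * (B / M - M / H) \<ge> 0\<close>. The
  constant \<open>c\<close> is half of \<Upsilon> because the determinant is evaluated at radius
  \<open>sqrt t\<close>; the quotient \<open>X / Y\<close> then carries the full power. The obstacle
  is that the derivative of \<open>D\<close> formally contains the gradient of \<open>Q\<close>,
  about which the locale \<open>frequency\<close> assumes nothing. Convexity avoids it: the equation
  at a single time \<open>s\<close>, tested with the difference of \<open>v\<close> at times
  \<open>r\<close> and \<open>s\<close>, already bounds the growth of the energy from
  \<open>s\<close> to \<open>r\<close>. This requires that, outside one null set of times, a slice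
  of the equation holds for all test functions at once. Since \<open>D\<close> is not known to be
  continuous in time, the last comparison uses Gronwall's inequality in place of a logarithmic
  derivative.\<close>

lemmas lintable_add = Bochner_Integration.integrable_add
  and lintable_bound = Bochner_Integration.integrable_bound
  and lintable_cong = Bochner_Integration.integrable_cong
  and lintable_diff = Bochner_Integration.integrable_diff
  and lintable_sum = Bochner_Integration.integrable_sum
  and lint_add = Bochner_Integration.integral_add
  and lint_cong = Bochner_Integration.integral_cong
  and lint_diff = Bochner_Integration.integral_diff
  and lint_sum = Bochner_Integration.integral_sum

abbreviation (input) indc :: "'a set \<Rightarrow> 'a \<Rightarrow> 'b::zero_neq_one" where "indc \<equiv> indicator"
abbreviation (input) borel_fun :: "('a::topological_space \<Rightarrow> 'b::topological_space) \<Rightarrow> bool" where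
 "borel_fun f \<equiv> f \<in> borel_measurable borel"
abbreviation (input) intble :: "('a::euclidean_space \<Rightarrow> 'b::{banach, second_countable_topology}) \<Rightarrow> bool" where
 "intble f \<equiv> integrable lborel f"

section \<open>Square integrable functions\<close>

definition L2 :: "'a measure \<Rightarrow> ('a \<Rightarrow> real) \<Rightarrow> bool" where
 "L2 M f \<longleftrightarrow> f \<in> borel_measurable M \<and> integrable M (\<lambda>x. (f x)\<^sup>2)"

lemma L2_measurable [measurable_dest]: "L2 M f \<Longrightarrow> f \<in> borel_measurable M"
 by (simp add: L2_def)

lemma L2_square_integrable: "L2 M f \<Longrightarrow> integrable M (\<lambda>x. (f x)\<^sup>2)"
 by (simp add: L2_def)

lemma L2_mult_integrable:
 assumes "L2 M f" "L2 M g"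
 shows "integrable M (\<lambda>x. f x * g x)"
proof (rule lintable_bound)
 show "integrable M (\<lambda>x. (f x)\<^sup>2 + (g x)\<^sup>2)"
  using assms by (simp add: L2_def)
 show "(\<lambda>x. f x * g x) \<in> borel_measurable M"
  using assms by (auto simp: L2_def)
 show "AE x in M. norm (f x * g x) \<le> norm ((f x)\<^sup>2 + (g x)\<^sup>2)"
 proof (rule AE_I2)
  fix x
  have "0 \<le> (\<bar>f x\<bar> - \<bar>g x\<bar>)\<^sup>2" by simp
  then have "2 * (\<bar>f x\<bar> * \<bar>g x\<bar>) \<le> (f x)\<^sup>2 + (g x)\<^sup>2"
   by (simp add: power2_diff algebra_simps)
  moreover have "0 \<le> \<bar>f x\<bar> * \<bar>g x\<bar>" by simp
  ultimately have "\<bar>f x\<bar> * \<bar>g x\<bar> \<le> (f x)\<^sup>2 + (g x)\<^sup>2" by linarith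
  then show "norm (f x * g x) \<le> norm ((f x)\<^sup>2 + (g x)\<^sup>2)"
   by (simp add: abs_mult)
 qed
qed

lemma L2_add:
 assumes "L2 M f" "L2 M g"
 shows "L2 M (\<lambda>x. f x + g x)"
proof -
 have "integrable M (\<lambda>x. (f x)\<^sup>2 + (g x)\<^sup>2 + 2 * (f x * g x))"
  using L2_mult_integrable[OF assms] assms by (simp add: L2_def)
 then have "integrable M (\<lambda>x. (f x + g x)\<^sup>2)"
  by (simp add: power2_sum algebra_simps)
 then show ?thesis using assms by (auto simp: L2_def)
qed

lemma L2_cmult: "L2 M f \<Longrightarrow> L2 M (\<lambda>x. c * f x)"
 by (auto simp: L2_def power_mult_distrib)

lemma L2_diff: "L2 M f \<Longrightarrow> L2 M g \<Longrightarrow> L2 M (\<lambda>x. f x - g x)"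
 using L2_add[of M f "\<lambda>x. - 1 * g x"] L2_cmult[of M g "- 1"] by simp

lemma L2_zero [simp]: "L2 M (\<lambda>x. 0)"
 by (simp add: L2_def)

lemma L2_sum: "(\<And>i. i \<in> I \<Longrightarrow> L2 M (f i)) \<Longrightarrow> L2 M (\<lambda>x. \<Sum>i\<in>I. f i x)"
 by (induction I rule: infinite_finite_induct) (auto intro: L2_add)

lemma L2_bound:
 assumes "L2 M g" and [measurable]: "f \<in> borel_measurable M"
  and le: "AE x in M. \<bar>f x\<bar> \<le> C * \<bar>g x\<bar>"
 shows "L2 M f"
 unfolding L2_def
proof
 show "integrable M (\<lambda>x. (f x)\<^sup>2)"
 proof (rule lintable_bound)
  show "integrable M (\<lambda>x. C\<^sup>2 * (g x)\<^sup>2)" using assms(1) by (simp add: L2_def)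
  show "AE x in M. norm ((f x)\<^sup>2) \<le> norm (C\<^sup>2 * (g x)\<^sup>2)"
   using le
  proof eventually_elim
   case (elim x)
   have "(\<bar>f x\<bar>)\<^sup>2 \<le> (C * \<bar>g x\<bar>)\<^sup>2" using elim by (intro power_mono) auto
   then show ?case by (simp add: power_mult_distrib)
  qed
 qed simp
qed fact

lemma L2_Cauchy_Schwarz:
 assumes "L2 M f" "L2 M g"
 shows "(\<integral>x. f x * g x \<partial>M)\<^sup>2 \<le> (\<integral>x. (f x)\<^sup>2 \<partial>M) * (\<integral>x. (g x)\<^sup>2 \<partial>M)"
proof -
 let ?A = "\<integral>x. (f x)\<^sup>2 \<partial>M" and ?B = "\<integral>x. (g x)\<^sup>2 \<partial>M" and ?C = "\<integral>x. f x * g x \<partial>M"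
 have fg: "integrable M (\<lambda>x. f x * g x)" by (rule L2_mult_integrable[OF assms])
 \<comment> \<open>The square norm of \<open>f - t * g\<close> as a polynomial in \<open>t\<close>.
   Its value at \<open>t = ?C / ?B\<close> is the claim divided by \<open>?B\<close>; if
   \<open>?B = 0\<close>, then \<open>g\<close> vanishes almost everywhere.\<close>
 have quad: "0 \<le> ?A - 2 * t * ?C + t\<^sup>2 * ?B" for t
 proof -
  have "0 \<le> (\<integral>x. (f x - t * g x)\<^sup>2 \<partial>M)" by simp
  also have "(\<lambda>x. (f x - t * g x)\<^sup>2) = (\<lambda>x. (f x)\<^sup>2 - 2 * t * (f x * g x) + t\<^sup>2 * (g x)\<^sup>2)"
   by (simp add: power2_diff fun_eq_iff power_mult_distrib)
  also have "(\<integral>x. (f x)\<^sup>2 - 2 * t * (f x * g x) + t\<^sup>2 * (g x)\<^sup>2 \<partial>M) = ?A - 2 * t * ?C + t\<^sup>2 * ?B"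
   using fg assms by (simp add: L2_def)
  finally show ?thesis .
 qed
 show ?thesis
 proof (cases "?B = 0")
  case True
  have "AE x in M. (g x)\<^sup>2 = 0"
   using True assms by (subst (asm) integral_nonneg_eq_0_iff_AE) (auto simp: L2_def)
  then have "?C = (\<integral>x. 0 \<partial>M)"
   using assms by (intro integral_cong_AE) (auto simp: L2_def)
  then show ?thesis by simp
 next
  case False
  then have B: "?B > 0" by (simp add: order_less_le)
  have "0 \<le> ?B * (?A - 2 * (?C / ?B) * ?C + (?C / ?B)\<^sup>2 * ?B)"
   using quad[of "?C / ?B"] B by simp
  also have "\<dots> = ?A * ?B - ?C\<^sup>2"
   using B by (simp add: field_simps power2_eq_square)
  finally show ?thesis by simp
 qed
qed

lemma L2_abs_integral_le:
 assumes "L2 M f" "L2 M g"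
 shows "\<bar>\<integral>x. f x * g x \<partial>M\<bar> \<le> sqrt (\<integral>x. (f x)\<^sup>2 \<partial>M) * sqrt (\<integral>x. (g x)\<^sup>2 \<partial>M)"
 using real_sqrt_le_mono[OF L2_Cauchy_Schwarz[OF assms]] by (simp add: real_sqrt_mult)

lemma L2_pairing_tendsto:
 assumes "\<And>n. L2 M (f n)" "L2 M f'" "L2 M g"
  and "(\<lambda>n. \<integral>x. (f n x - f' x)\<^sup>2 \<partial>M) \<longlonglongrightarrow> 0"
 shows "(\<lambda>n. \<integral>x. f n x * g x \<partial>M) \<longlonglongrightarrow> (\<integral>x. f' x * g x \<partial>M)"
proof -
 have "(\<lambda>n. sqrt (\<integral>x. (f n x - f' x)\<^sup>2 \<partial>M) * sqrt (\<integral>x. (g x)\<^sup>2 \<partial>M)) \<longlonglongrightarrow> sqrt 0 * sqrt (\<integral>x. (g x)\<^sup>2 \<partial>M)"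
  by (intro tendsto_intros assms)
 then have lim: "(\<lambda>n. sqrt (\<integral>x. (f n x - f' x)\<^sup>2 \<partial>M) * sqrt (\<integral>x. (g x)\<^sup>2 \<partial>M)) \<longlonglongrightarrow> 0" by simp
 have "(\<lambda>n. (\<integral>x. f n x * g x \<partial>M) - (\<integral>x. f' x * g x \<partial>M)) \<longlonglongrightarrow> 0"
 proof (rule Lim_null_comparison[OF _ lim], rule always_eventually, rule allI)
  fix n
  have "(\<integral>x. f n x * g x \<partial>M) - (\<integral>x. f' x * g x \<partial>M) = (\<integral>x. (f n x - f' x) * g x \<partial>M)"
   using L2_mult_integrable[OF assms(1,3)] L2_mult_integrable[OF assms(2,3)]
   by (simp add: left_diff_distrib)
  then show "norm ((\<integral>x. f n x * g x \<partial>M) - (\<integral>x. f' x * g x \<partial>M))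
    \<le> sqrt (\<integral>x. (f n x - f' x)\<^sup>2 \<partial>M) * sqrt (\<integral>x. (g x)\<^sup>2 \<partial>M)"
   using L2_abs_integral_le[OF L2_diff[OF assms(1,2)] assms(3)] by simp
 qed
 then show ?thesis by (simp add: LIM_zero_iff)
qed

section \<open>Continuity of translations and convergence of averages\<close>

lemma translate_lborel:
 fixes f :: "'a::euclidean_space \<Rightarrow> real"
 assumes [measurable]: "borel_fun f"
 shows integrable_translate_lborel: "intble (\<lambda>x. f (x + h)) \<longleftrightarrow> intble f"
  and integral_translate_lborel: "(LBINT x. f (x + h)) = (LBINT x. f x)"
proof -
 have *: "lborel = distr lborel borel (\<lambda>x. x + h)"
  proof -
  have "(\<lambda>x. x + h) = (+) h" by (auto simp: fun_eq_iff add.commute)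
  then show ?thesis using lborel_distr_plus[of h] by simp
 qed
 show "intble (\<lambda>x. f (x + h)) \<longleftrightarrow> intble f"
  by (subst (2) *) (simp add: integrable_distr_eq)
 show "(LBINT x. f (x + h)) = (LBINT x. f x)"
  by (subst (2) *) (simp add: integral_distr)
qed

lemma nn_integral_translate_lborel:
 fixes f :: "'a::euclidean_space \<Rightarrow> ennreal"
 assumes [measurable]: "borel_fun f"
 shows "(\<integral>\<^sup>+x. f (x + h) \<partial>lborel) = (\<integral>\<^sup>+x. f x \<partial>lborel)"
proof -
 have *: "lborel = distr lborel borel (\<lambda>x. x + h)"
  proof -
  have "(\<lambda>x. x + h) = (+) h" by (auto simp: fun_eq_iff add.commute)
  then show ?thesis using lborel_distr_plus[of h] by simp
 qed
 show ?thesis by (subst (2) *) (simp add: nn_integral_distr)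
qed

text \<open>On the boundary of \<open>U\<close> the translated indicators need not converge
  pointwise. Openness of \<open>U\<close> still gives convergence of the positive part of
  \<open>indc U x - indc U (x + h n)\<close> at every point. Both indicators have the same integral,
  so the positive and the negative part of the difference contribute equally.\<close>

lemma translation_continuous_open:
 fixes U :: "'a::euclidean_space set"
 assumes U: "open U" "emeasure lborel U < \<infinity>" and h: "h \<longlonglongrightarrow> 0"
 shows "(\<lambda>n. (LBINT x. \<bar>indc U (x + h n) - indc U x\<bar>)) \<longlonglongrightarrow> (0::real)"
proof -
 let ?i = "indc U :: 'a \<Rightarrow> real"
 have [measurable]: "borel_fun ?i" using U by simp
 have i: "intble ?i" and ih: "intble (\<lambda>x. ?i (x + h n))" for n
  using U by (auto simp: integrable_translate_lborel)
 have m: "intble (\<lambda>x. max 0 (?i x - ?i (x + h n)))" for n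
  using i ih by (intro integrable_max lintable_diff) auto
 have "(LBINT x. \<bar>?i (x + h n) - ?i x\<bar>) = 2 * (LBINT x. max 0 (?i x - ?i (x + h n)))" for n
 proof -
  have "\<bar>?i (x + h n) - ?i x\<bar> = 2 * max 0 (?i x - ?i (x + h n)) + (?i (x + h n) - ?i x)" for x by (simp add: max_def abs_if)
  then show ?thesis using i ih m integral_translate_lborel[of ?i "h n"] by simp
 qed
 moreover have "(\<lambda>n. (LBINT x. max 0 (?i x - ?i (x + h n)))) \<longlonglongrightarrow> (\<integral>x. 0 \<partial>(lborel :: 'a measure))"
 proof (rule integral_dominated_convergence[OF _ _ i])
  show "AE x in lborel. (\<lambda>n. max 0 (?i x - ?i (x + h n))) \<longlonglongrightarrow> 0"
  proof (rule AE_I2)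
   fix x
   have "(\<lambda>n. x + h n) \<longlonglongrightarrow> x" using tendsto_add[OF tendsto_const h, of x] by simp
   then have "x \<in> U \<Longrightarrow> eventually (\<lambda>n. x + h n \<in> U) sequentially" using U(1) by (rule topological_tendstoD)
   then have "eventually (\<lambda>n. max 0 (?i x - ?i (x + h n)) = 0) sequentially"
    by (cases "x \<in> U") (auto elim: eventually_mono)
   then show "(\<lambda>n. max 0 (?i x - ?i (x + h n))) \<longlonglongrightarrow> 0" by (rule tendsto_eventually)
  qed
  show "AE x in lborel. norm (max 0 (?i x - ?i (x + h n))) \<le> ?i x" for n by (auto simp: indicator_def)
 qed auto
 ultimately show ?thesis using tendsto_mult_right_zero[of _ _ 2] by simp
qed

text \<open>Functions on which translation is continuous form a closed set in \<open>L1\<close>.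
  Translation preserves the distance of \<open>f\<close> and \<open>g\<close>, so this distance
  enters twice, which explains the choice of \<open>r / 4\<close> below.\<close>

lemma translation_approximation:
 fixes f :: "'a::euclidean_space \<Rightarrow> real"
 assumes f: "intble f"
  and g: "\<And>e. e > 0 \<Longrightarrow> \<exists>g. intble g \<and> (LBINT x. \<bar>f x - g x\<bar>) \<le> e \<and> (\<lambda>n. (LBINT x. \<bar>g (x + h n) - g x\<bar>)) \<longlonglongrightarrow> 0"
 shows "(\<lambda>n. (LBINT x. \<bar>f (x + h n) - f x\<bar>)) \<longlonglongrightarrow> 0"
proof (rule LIMSEQ_I)
 fix r :: real assume "r > 0"
 then obtain g where g: "intble g" "(LBINT x. \<bar>f x - g x\<bar>) \<le> r / 4" "(\<lambda>n. (LBINT x. \<bar>g (x + h n) - g x\<bar>)) \<longlonglongrightarrow> 0"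
  using assms(2)[of "r / 4"] by auto
 have [measurable]: "borel_fun f" "borel_fun g" using f g by auto
 have fg: "(LBINT x. \<bar>f (x + h n) - f x\<bar>) \<le> 2 * (LBINT x. \<bar>f x - g x\<bar>) + (LBINT x. \<bar>g (x + h n) - g x\<bar>)" for n
 proof -
  have fh: "intble (\<lambda>x. f (x + h n))" "intble (\<lambda>x. g (x + h n))" using f g by (auto simp: integrable_translate_lborel)
  have "(LBINT x. \<bar>f (x + h n) - f x\<bar>) \<le> (LBINT x. \<bar>f (x + h n) - g (x + h n)\<bar> + \<bar>f x - g x\<bar> + \<bar>g (x + h n) - g x\<bar>)"
   using f g fh by (intro integral_mono) auto
  then show ?thesis using f g fh integral_translate_lborel[of "\<lambda>x. \<bar>f x - g x\<bar>" "h n"] by simp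
 qed
 obtain N where "\<And>n. n \<ge> N \<Longrightarrow> norm ((LBINT x. \<bar>g (x + h n) - g x\<bar>) - 0) < r / 2"
  using LIMSEQ_D[OF g(3), of "r / 2"] \<open>r > 0\<close> by auto
 then have "norm ((LBINT x. \<bar>f (x + h n) - f x\<bar>) - 0) < r" if "n \<ge> N" for n
  using fg[of n] g(2) that by fastforce
 then show "\<exists>N. \<forall>n\<ge>N. norm ((LBINT x. \<bar>f (x + h n) - f x\<bar>) - 0) < r" by blast
qed

text \<open>Induction over integrable functions: outer regularity reduces a set of finite measure to
  an open one, and dominated convergence treats limits of simple functions.\<close>

lemma translation_continuous_L1:
 fixes f :: "'a::euclidean_space \<Rightarrow> real"
 assumes h: "h \<longlonglongrightarrow> 0" and "intble f"
 shows "(\<lambda>n. (LBINT x. \<bar>f (x + h n) - f x\<bar>)) \<longlonglongrightarrow> 0"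
 using assms(2)
proof (induction rule: integrable_induct)
 case (base A c)
 have A: "A \<in> sets borel" "emeasure lborel A < \<infinity>" "intble (indc A :: 'a \<Rightarrow> real)" using base by auto
 have "(\<lambda>n. (LBINT x. \<bar>indc A (x + h n) - indc A x\<bar>)) \<longlonglongrightarrow> (0::real)"
 proof (rule translation_approximation[OF A(3)])
  fix e :: real assume "e > 0"
  then obtain U where U: "open U" "A \<subseteq> U" "emeasure lborel (U - A) < ennreal e"
   using outer_regular_lborel[OF A(1), of e] by auto
  have "emeasure lborel U = emeasure lborel A + emeasure lborel (U - A)"
   using U A by (subst plus_emeasure) (auto simp: Un_absorb1 Int_Diff)
  then have Uf: "emeasure lborel U < \<infinity>" using A(2) U(3) by (auto simp: less_top[symmetric] top_unique)
  have "(LBINT x. \<bar>indc A x - indc U x :: real\<bar>) = (LBINT x. indc (U - A) x)"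
   using U(2) by (intro lint_cong) (auto simp: indicator_def)
  also have "\<dots> \<le> e" using U A \<open>e > 0\<close> by (simp add: measure_def enn2real_leI less_imp_le)
  finally show "\<exists>g. intble g \<and> (LBINT x. \<bar>indc A x - g x\<bar>) \<le> e \<and> (\<lambda>n. (LBINT x. \<bar>g (x + h n) - g x\<bar>)) \<longlonglongrightarrow> (0::real)"
   using U Uf translation_continuous_open[OF U(1) Uf h] by (intro exI[of _ "indc U"]) auto
 qed
 from tendsto_mult_right_zero[OF this, of "\<bar>c\<bar>"]
 have "(\<lambda>n. (LBINT x. \<bar>c\<bar> * \<bar>indc A (x + h n) - indc A x\<bar>)) \<longlonglongrightarrow> 0" by simp
 moreover have "\<bar>c\<bar> * \<bar>indc A (x + h n) - indc A x\<bar> = \<bar>indc A (x + h n) *\<^sub>R c - indc A x *\<^sub>R c\<bar>" for x n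
  by (simp add: indicator_def)
 ultimately show ?case by (simp only:)
next
 case (add f g)
 have [measurable]: "borel_fun f" "borel_fun g" using add by auto
 have i: "intble (\<lambda>x. f (x + h n))" "intble (\<lambda>x. g (x + h n))" for n using add by (auto simp: integrable_translate_lborel)
 show ?case
 proof (rule tendsto_sandwich[OF _ _ tendsto_const])
  have "(LBINT x. \<bar>f (x + h n) + g (x + h n) - (f x + g x)\<bar>) \<le> (LBINT x. \<bar>f (x + h n) - f x\<bar> + \<bar>g (x + h n) - g x\<bar>)" for n
   using add i by (intro integral_mono) auto
  also have "\<dots> n = (LBINT x. \<bar>f (x + h n) - f x\<bar>) + (LBINT x. \<bar>g (x + h n) - g x\<bar>)" for n using add i by simp
  finally show "\<forall>\<^sub>F n in sequentially. (LBINT x. \<bar>f (x + h n) + g (x + h n) - (f x + g x)\<bar>) \<le> (LBINT x. \<bar>f (x + h n) - f x\<bar>) + (LBINT x. \<bar>g (x + h n) - g x\<bar>)" by simp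
  show "(\<lambda>n. (LBINT x. \<bar>f (x + h n) - f x\<bar>) + (LBINT x. \<bar>g (x + h n) - g x\<bar>)) \<longlonglongrightarrow> 0"
   using tendsto_add[OF add(3,4)] by simp
 qed simp
next
 case (lim f s)
 have [measurable]: "borel_fun f" "s i \<in> borel_measurable borel" for i using lim by auto
 have "(\<lambda>i. (LBINT x. \<bar>f x - s i x\<bar>)) \<longlonglongrightarrow> (\<integral>x. 0 \<partial>(lborel :: 'a measure))"
 proof (rule integral_dominated_convergence[where w="\<lambda>x. 3 * \<bar>f x\<bar>"])
  show "AE x in lborel. (\<lambda>i. \<bar>f x - s i x\<bar>) \<longlonglongrightarrow> 0"
   using tendsto_rabs_zero[OF LIM_zero[OF lim(2)]] by (auto simp: abs_minus_commute)
  show "AE x in lborel. norm \<bar>f x - s i x\<bar> \<le> 3 * \<bar>f x\<bar>" for i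
  proof (rule AE_I2)
   fix x show "norm \<bar>f x - s i x\<bar> \<le> 3 * \<bar>f x\<bar>" using lim(3)[of x i] by simp
  qed
 qed (use lim in auto)
 then have l: "(\<lambda>i. (LBINT x. \<bar>f x - s i x\<bar>)) \<longlonglongrightarrow> 0" by simp
 show ?case
 proof (rule translation_approximation[OF lim(4)])
  fix e :: real assume "e > 0"
  then have "eventually (\<lambda>i. (LBINT x. \<bar>f x - s i x\<bar>) < e) sequentially" by (rule order_tendstoD(2)[OF l])
  then obtain i where "(LBINT x. \<bar>f x - s i x\<bar>) < e" by (auto simp: eventually_sequentially)
  then show "\<exists>g. intble g \<and> (LBINT x. \<bar>f x - g x\<bar>) \<le> e \<and> (\<lambda>n. (LBINT x. \<bar>g (x + h n) - g x\<bar>)) \<longlonglongrightarrow> 0"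
   using lim(1,5) by (intro exI[of _ "s i"]) auto
 qed
qed

text \<open>Mollification averages the translates of \<open>f\<close> against a smooth density, the
  Steklov average against the uniform distribution on a time interval. Both average over a
  probability measure concentrated near 0, so one estimate serves both. With the nonnegative
  integral the order of integration can be exchanged before the average itself is known to be
  integrable.\<close>

lemma average_translation_tendsto:
 fixes f :: "'a::euclidean_space \<Rightarrow> real" and t :: "nat \<Rightarrow> 'a measure"
 assumes f: "intble f" and t: "\<And>n. prob_space (t n)" "\<And>n. sets (t n) = sets borel"
  and conc: "\<And>n. AE k in t n. norm k \<le> m n" and m: "m \<longlonglongrightarrow> 0"
 shows "\<exists>b. b \<longlonglongrightarrow> 0 \<and> (\<forall>n. 0 \<le> b n \<and> (\<integral>\<^sup>+x. \<integral>\<^sup>+k. ennreal \<bar>f (x + k) - f x\<bar> \<partial>t n \<partial>lborel) = ennreal (b n))"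
proof -
 have [measurable]: "borel_fun f" using f by auto
 have fk: "intble (\<lambda>x. f (x + k))" for k using f by (simp add: integrable_translate_lborel)
 define w where "w k = (LBINT x. \<bar>f (x + k) - f x\<bar>)" for k
 let ?I = "\<lambda>n. \<integral>\<^sup>+x. \<integral>\<^sup>+k. ennreal \<bar>f (x + k) - f x\<bar> \<partial>t n \<partial>lborel"
 have eq: "?I n = (\<integral>\<^sup>+k. ennreal (w k) \<partial>t n)" for n
 proof -
  interpret prob_space "t n" by fact
  note [measurable_cong] = t(2)[of n]
  interpret pair_sigma_finite lborel "t n" ..
  have "?I n = (\<integral>\<^sup>+k. \<integral>\<^sup>+x. ennreal \<bar>f (x + k) - f x\<bar> \<partial>lborel \<partial>t n)"
   by (rule Fubini'[symmetric]) measurable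
  also have "\<dots> = (\<integral>\<^sup>+k. ennreal (w k) \<partial>t n)"
   unfolding w_def using f fk by (intro nn_integral_cong nn_integral_eq_integral) auto
  finally show ?thesis .
 qed
 have le: "?I n \<le> ennreal e" if "AE k in t n. w k \<le> e" for n e
 proof -
  interpret prob_space "t n" by fact
  have "?I n \<le> (\<integral>\<^sup>+k. ennreal e \<partial>t n)" unfolding eq
   using that by (intro nn_integral_mono_AE) (auto elim!: eventually_mono intro: ennreal_leI)
  then show ?thesis by (simp add: emeasure_space_1)
 qed
 \<comment> \<open>This crude bound only makes \<open>?I n\<close> finite, so that it may be
   replaced by a real number.\<close>
 have "w k \<le> 2 * (LBINT x. \<bar>f x\<bar>)" for k
 proof -
  have "w k \<le> (LBINT x. \<bar>f (x + k)\<bar> + \<bar>f x\<bar>)" unfolding w_def using f fk by (intro integral_mono) auto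
  then show ?thesis using f fk integral_translate_lborel[of "\<lambda>x. \<bar>f x\<bar>" k] by simp
 qed
 then have bnd: "?I n \<le> ennreal (2 * (LBINT x. \<bar>f x\<bar>))" for n by (intro le) simp
 have fin: "?I n = ennreal (enn2real (?I n))" for n
  using le_less_trans[OF bnd[of n] ennreal_less_top] by (simp add: ennreal_enn2real)
 have "(\<lambda>n. enn2real (?I n)) \<longlonglongrightarrow> 0"
 proof (rule LIMSEQ_I)
  fix r :: real assume r: "r > 0"
  have "eventually (\<lambda>k. w k < r / 2) (nhds 0)"
  proof (rule sequentially_imp_eventually_nhds_within[where s=UNIV, simplified], intro allI impI)
   fix h :: "nat \<Rightarrow> 'a" assume h: "h \<longlonglongrightarrow> 0"
   show "eventually (\<lambda>n. w (h n) < r / 2) sequentially"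
    unfolding w_def using r by (intro order_tendstoD(2)[OF translation_continuous_L1[OF h f]]) simp
  qed
  then obtain d where d: "d > 0" "\<And>k. norm k < d \<Longrightarrow> w k < r / 2" by (auto simp: eventually_nhds_metric dist_norm)
  obtain N where N: "\<And>n. n \<ge> N \<Longrightarrow> \<bar>m n\<bar> < d" using LIMSEQ_D[OF m d(1)] by auto
  have "norm (enn2real (?I n) - 0) < r" if "n \<ge> N" for n
  proof -
   have "AE k in t n. w k \<le> r / 2"
    using conc[of n] by eventually_elim (use N[OF that] d(2) in \<open>force intro: less_imp_le\<close>)
   from enn2real_mono[OF le[OF this]] show ?thesis using r by simp
  qed
  then show "\<exists>N. \<forall>n\<ge>N. norm (enn2real (?I n) - 0) < r" by blast
 qed
 then show ?thesis using fin by (intro exI[of _ "\<lambda>n. enn2real (?I n)"]) auto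
qed

lemma average_tendsto_L1:
 fixes f :: "'a::euclidean_space \<Rightarrow> real" and e :: "nat \<Rightarrow> 'a measure"
 assumes f: "intble f" and e: "\<And>n. prob_space (e n)" "\<And>n. sets (e n) = sets borel"
  and conc: "\<And>n. AE k in e n. norm k \<le> d n" and d: "d \<longlonglongrightarrow> 0"
 shows "intble (\<lambda>x. \<integral>k. f (x + k) \<partial>e n)"
  and "(\<lambda>n. (LBINT x. \<bar>(\<integral>k. f (x + k) \<partial>e n) - f x\<bar>)) \<longlonglongrightarrow> 0"
proof -
 have [measurable]: "borel_fun f" using f by auto
 obtain b where b: "b \<longlonglongrightarrow> 0" "\<And>n. 0 \<le> b n"
  "\<And>n. (\<integral>\<^sup>+x. \<integral>\<^sup>+k. ennreal \<bar>f (x + k) - f x\<bar> \<partial>e n \<partial>lborel) = ennreal (b n)"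
  using average_translation_tendsto[OF f e conc d] by blast
 define S where "S n x = (\<integral>k. f (x + k) \<partial>e n)" for n x
 have est: "intble (\<lambda>x. S n x - f x)" "(LBINT x. \<bar>S n x - f x\<bar>) \<le> b n" for n
 proof -
  interpret prob_space "e n" by fact
  note [measurable_cong] = e(2)[of n]
  have [measurable]: "S n \<in> borel_measurable borel" unfolding S_def by measurable
  have "AE x in lborel. (\<integral>\<^sup>+k. ennreal \<bar>f (x + k) - f x\<bar> \<partial>e n) \<noteq> \<infinity>"
   by (rule nn_integral_PInf_AE) (simp_all add: b)
  then have "AE x in lborel. ennreal \<bar>S n x - f x\<bar> \<le> (\<integral>\<^sup>+k. ennreal \<bar>f (x + k) - f x\<bar> \<partial>e n)"
  proof eventually_elim
   case (elim x)
   then have i: "integrable (e n) (\<lambda>k. f (x + k) - f x)" by (intro integrableI_bounded) (auto simp: less_top)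
   then have "integrable (e n) (\<lambda>k. f (x + k) - f x + f x)" by (intro lintable_add) auto
   then have "S n x - f x = (\<integral>k. f (x + k) - f x \<partial>e n)" by (simp add: S_def prob_space)
   then show ?case using integral_norm_bound_ennreal[OF i] by simp
  qed
  then have le: "(\<integral>\<^sup>+x. ennreal \<bar>S n x - f x\<bar> \<partial>lborel) \<le> ennreal (b n)"
   unfolding b(3)[symmetric] by (rule nn_integral_mono_AE)
  show i: "intble (\<lambda>x. S n x - f x)" by (rule integrableI_bounded) (use le in \<open>auto intro: le_less_trans\<close>)
  show "(LBINT x. \<bar>S n x - f x\<bar>) \<le> b n"
   using le nn_integral_eq_integral[OF integrable_abs[OF i]] b(2) by simp
 qed
 show "intble (\<lambda>x. \<integral>k. f (x + k) \<partial>e n)"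
  using lintable_add[OF est(1)[of n] f] by (simp add: S_def)
 show "(\<lambda>n. (LBINT x. \<bar>(\<integral>k. f (x + k) \<partial>e n) - f x\<bar>)) \<longlonglongrightarrow> 0"
  by (rule tendsto_sandwich[OF _ _ tendsto_const b(1)]) (use est(2) in \<open>auto simp: S_def\<close>)
qed

text \<open>The \<open>L2\<close> case reduces to the \<open>L1\<close> case for the signed square.\<close>

lemma square_diff_le_signed_squares: "(a - b)\<^sup>2 \<le> \<bar>2 * (a * \<bar>a\<bar>) - 2 * (b * \<bar>b\<bar>)\<bar>" for a b :: real
proof -
 \<comment> \<open>For equal signs this is \<open>\<bar>a - b\<bar> \<le> \<bar>a + b\<bar>\<close>.
   For opposite signs the signed squares add up, and there the factor 2 is needed.\<close>
 have same: "(a - b)\<^sup>2 \<le> \<bar>2 * a\<^sup>2 - 2 * b\<^sup>2\<bar>" if "a * b \<ge> 0"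
 proof -
  have "\<bar>a - b\<bar> \<le> \<bar>a + b\<bar>" unfolding abs_le_square_iff using that by (simp add: power2_eq_square algebra_simps)
  then have "\<bar>a - b\<bar> * \<bar>a - b\<bar> \<le> \<bar>a - b\<bar> * \<bar>a + b\<bar>" by (rule mult_left_mono) simp
  also have "\<dots> = \<bar>a\<^sup>2 - b\<^sup>2\<bar>" by (simp add: abs_mult[symmetric] power2_eq_square algebra_simps)
  finally show ?thesis by (simp add: power2_eq_square)
 qed
 have opp: "(a - b)\<^sup>2 \<le> 2 * a\<^sup>2 + 2 * b\<^sup>2" using zero_le_power2[of "a + b"] by (simp add: power2_eq_square algebra_simps)
 consider "a \<ge> 0" "b \<ge> 0" | "a \<le> 0" "b \<le> 0" | "a \<ge> 0" "b \<le> 0" | "a \<le> 0" "b \<ge> 0" by linarith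
 then show ?thesis
 proof cases
  case 1 then show ?thesis using same by (simp add: power2_eq_square)
 next
  case 2
  then have "2 * (a * \<bar>a\<bar>) - 2 * (b * \<bar>b\<bar>) = - (2 * a\<^sup>2 - 2 * b\<^sup>2)" by (simp add: power2_eq_square)
  then show ?thesis using same 2 by (simp only: abs_minus_cancel mult_nonpos_nonpos)
 next
  case 3
  then have "2 * (a * \<bar>a\<bar>) - 2 * (b * \<bar>b\<bar>) = 2 * a\<^sup>2 + 2 * b\<^sup>2" by (simp add: power2_eq_square)
  then show ?thesis using opp by linarith
 next
  case 4
  then have "2 * (a * \<bar>a\<bar>) - 2 * (b * \<bar>b\<bar>) = - (2 * a\<^sup>2 + 2 * b\<^sup>2)" by (simp add: power2_eq_square)
  then show ?thesis using opp by linarith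
 qed
qed

lemma average_tendsto_L2:
 fixes f :: "'a::euclidean_space \<Rightarrow> real" and e :: "nat \<Rightarrow> 'a measure"
 assumes f: "L2 lborel f" and e: "\<And>n. prob_space (e n)" "\<And>n. sets (e n) = sets borel"
  and conc: "\<And>n. AE k in e n. norm k \<le> d n" and d: "d \<longlonglongrightarrow> 0"
 shows "L2 lborel (\<lambda>x. \<integral>k. f (x + k) \<partial>e n)"
  and "(\<lambda>n. (LBINT x. ((\<integral>k. f (x + k) \<partial>e n) - f x)\<^sup>2)) \<longlonglongrightarrow> 0"
proof -
 have [measurable]: "borel_fun f" using f by (simp add: L2_def)
 define g where "g x = 2 * (f x * \<bar>f x\<bar>)" for x
 have gi: "intble g" unfolding g_def[abs_def]
  by (rule lintable_bound[OF integrable_mult_right[OF L2_square_integrable[OF f], of 2]])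
   (auto simp: abs_mult power2_eq_square)
 obtain b where b: "b \<longlonglongrightarrow> 0" "\<And>n. 0 \<le> b n"
  "\<And>n. (\<integral>\<^sup>+x. \<integral>\<^sup>+k. ennreal \<bar>g (x + k) - g x\<bar> \<partial>e n \<partial>lborel) = ennreal (b n)"
  using average_translation_tendsto[OF gi e conc d] by blast
 define S where "S n x = (\<integral>k. f (x + k) \<partial>e n)" for n x
 have est: "L2 lborel (\<lambda>x. S n x - f x)" "(LBINT x. (S n x - f x)\<^sup>2) \<le> b n" for n
 proof -
  interpret prob_space "e n" by fact
  note [measurable_cong] = e(2)[of n]
  have [measurable]: "S n \<in> borel_measurable borel" unfolding S_def by measurable
  have [measurable]: "borel_fun g" using gi by auto
  have "AE x in lborel. (\<integral>\<^sup>+k. ennreal \<bar>g (x + k) - g x\<bar> \<partial>e n) \<noteq> \<infinity>"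
   by (rule nn_integral_PInf_AE) (simp_all add: b)
  then have "AE x in lborel. ennreal ((S n x - f x)\<^sup>2) \<le> (\<integral>\<^sup>+k. ennreal \<bar>g (x + k) - g x\<bar> \<partial>e n)"
  proof eventually_elim
   case (elim x)
   then have i: "integrable (e n) (\<lambda>k. g (x + k) - g x)" by (intro integrableI_bounded) (auto simp: less_top)
   have sq: "(f (x + k) - f x)\<^sup>2 \<le> \<bar>g (x + k) - g x\<bar>" for k unfolding g_def by (rule square_diff_le_signed_squares)
   have L: "L2 (e n) (\<lambda>k. f (x + k) - f x)" unfolding L2_def
    using sq by (auto intro!: lintable_bound[OF i])
   \<comment> \<open>Cauchy-Schwarz against the constant 1 is Jensen's inequality for the square
     under the probability measure \<open>e n\<close>.\<close>
   have one: "L2 (e n) (\<lambda>k. 1)" by (simp add: L2_def)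
   have "integrable (e n) (\<lambda>k. f (x + k) - f x)" using L2_mult_integrable[OF L one] by simp
   then have "integrable (e n) (\<lambda>k. f (x + k) - f x + f x)" by (intro lintable_add) auto
   then have "S n x - f x = (\<integral>k. (f (x + k) - f x) * 1 \<partial>e n)" by (simp add: S_def prob_space)
   then have "(S n x - f x)\<^sup>2 \<le> (\<integral>k. (f (x + k) - f x)\<^sup>2 \<partial>e n)"
    using L2_Cauchy_Schwarz[OF L one] by (simp add: prob_space)
   also have "\<dots> \<le> (\<integral>k. \<bar>g (x + k) - g x\<bar> \<partial>e n)"
    by (intro integral_mono L2_square_integrable[OF L] integrable_abs i sq)
   finally show ?case by (subst nn_integral_eq_integral[OF integrable_abs[OF i]]) (auto intro: ennreal_leI)
  qed
  then have le: "(\<integral>\<^sup>+x. ennreal ((S n x - f x)\<^sup>2) \<partial>lborel) \<le> ennreal (b n)"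
   unfolding b(3)[symmetric] by (rule nn_integral_mono_AE)
  have i: "intble (\<lambda>x. (S n x - f x)\<^sup>2)" by (rule integrableI_bounded) (use le in \<open>auto intro: le_less_trans\<close>)
  then show "L2 lborel (\<lambda>x. S n x - f x)" by (simp add: L2_def)
  show "(LBINT x. (S n x - f x)\<^sup>2) \<le> b n" using le nn_integral_eq_integral[OF i] b(2) by simp
 qed
 show "L2 lborel (\<lambda>x. \<integral>k. f (x + k) \<partial>e n)"
  using L2_add[OF est(1)[of n] f] by (simp add: S_def)
 show "(\<lambda>n. (LBINT x. ((\<integral>k. f (x + k) \<partial>e n) - f x)\<^sup>2)) \<longlonglongrightarrow> 0"
  by (rule tendsto_sandwich[OF _ _ tendsto_const b(1)]) (use est(2) in \<open>auto simp: S_def\<close>)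
qed

section \<open>Smooth kernels\<close>

text \<open>The standard smooth function that is flat at 0, \<open>exp (- (1 / t))\<close>, divided
  by a power of \<open>t\<close>. By \<open>psi_has_derivative\<close> the derivative of a member of
  this family is a combination of two other members, which is what makes \<open>smooth_alg\<close>
  closed under differentiation.\<close>

definition psi :: "nat \<Rightarrow> real \<Rightarrow> real" where
 "psi k t = (if t > 0 then exp (- (1 / t)) / t ^ k else 0)"

lemma psi_nonneg: "psi k t \<ge> 0"
 by (simp add: psi_def)

lemma psi_tendsto_0: "(psi k \<longlongrightarrow> 0) (at 0)"
proof (rule filterlim_split_at)
 have "eventually (\<lambda>t::real. t < 0) (at_left 0)"
  by (simp add: eventually_at_filter)
 then have "eventually (\<lambda>t. psi k t = 0) (at_left 0)"
  by eventually_elim (simp add: psi_def)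
 then show "(psi k \<longlongrightarrow> 0) (at_left 0)" by (rule tendsto_eventually)
 have "((\<lambda>x::real. x ^ k / exp x) \<longlongrightarrow> 0) at_top" by (rule tendsto_power_div_exp_0)
 then have "((\<lambda>t::real. inverse t ^ k / exp (inverse t)) \<longlongrightarrow> 0) (at_right 0)"
  by (rule filterlim_compose[OF _ filterlim_inverse_at_top_right])
 moreover have "eventually (\<lambda>t::real. t > 0) (at_right 0)"
  by (simp add: eventually_at_filter)
 then have "eventually (\<lambda>t. inverse t ^ k / exp (inverse t) = psi k t) (at_right 0)"
  by eventually_elim (simp add: psi_def exp_minus field_simps power_one_over inverse_eq_divide)
 ultimately show "(psi k \<longlongrightarrow> 0) (at_right 0)" by (rule Lim_transform_eventually)
qed

lemma psi_has_derivative: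
 "(psi k has_real_derivative (psi (k + 2) t - real k * psi (k + 1) t)) (at t)"
proof -
 consider "t < 0" | "t = 0" | "t > 0" by linarith
 then show ?thesis
 proof cases
  case 1
  have "(psi k has_real_derivative 0) (at t)"
   by (rule has_field_derivative_transform_within_open[of "\<lambda>_. 0" _ _ "{..<0}"]) (use 1 in \<open>auto simp: psi_def\<close>)
  then show ?thesis using 1 by (simp add: psi_def)
 next
  case 2
  \<comment> \<open>The difference quotient of \<open>psi k\<close> at 0 is
    \<open>psi (k + 1)\<close>, which tends to 0.\<close>
  have "((\<lambda>h. (psi k (0 + h) - psi k 0) / h) \<longlongrightarrow> 0) (at 0)"
  proof (rule Lim_transform_eventually[OF psi_tendsto_0[of "k + 1"]])
   show "eventually (\<lambda>h. psi (k + 1) h = (psi k (0 + h) - psi k 0) / h) (at 0)"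
    by (auto simp: eventually_at_filter psi_def)
  qed
  then have "(psi k has_real_derivative 0) (at 0)" by (simp add: DERIV_def)
  then show ?thesis using 2 by (simp add: psi_def)
 next
  case 3
  have "((\<lambda>t. exp (- (1 / t)) / t ^ k) has_real_derivative (psi (k + 2) t - real k * psi (k + 1) t)) (at t)"
   using 3
   by (auto intro!: derivative_eq_intros simp: psi_def power2_eq_square)
    (cases k; simp add: field_simps)
  then show ?thesis
   by (rule has_field_derivative_transform_within_open[of _ _ _ "{0<..}"]) (use 3 in \<open>auto simp: psi_def\<close>)
 qed
qed

text \<open>An algebra of functions that is closed under differentiation by construction.\<close>

inductive smooth_alg :: "('a::euclidean_space \<Rightarrow> real) \<Rightarrow> bool" where
 const: "smooth_alg (\<lambda>x. c)"
| inner: "smooth_alg (\<lambda>x. x \<bullet> b)"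
| add: "smooth_alg f \<Longrightarrow> smooth_alg g \<Longrightarrow> smooth_alg (\<lambda>x. f x + g x)"
| mult: "smooth_alg f \<Longrightarrow> smooth_alg g \<Longrightarrow> smooth_alg (\<lambda>x. f x * g x)"
| psi: "smooth_alg f \<Longrightarrow> smooth_alg (\<lambda>x. psi k (f x))"

lemma smooth_alg_diff: "smooth_alg f \<Longrightarrow> smooth_alg g \<Longrightarrow> smooth_alg (\<lambda>x. f x - g x)"
 using smooth_alg.add[of f "\<lambda>x. - 1 * g x"] smooth_alg.mult[OF smooth_alg.const[of "- 1"], of g] by simp

lemma smooth_alg_sum: "(\<And>i. i \<in> I \<Longrightarrow> smooth_alg (f i)) \<Longrightarrow> smooth_alg (\<lambda>x. \<Sum>i\<in>I. f i x)"
 by (induction I rule: infinite_finite_induct) (auto intro: smooth_alg.intros)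

lemma smooth_alg_compose:
 assumes "smooth_alg f" "\<And>b. smooth_alg (\<lambda>x. L x \<bullet> b)"
 shows "smooth_alg (\<lambda>x. f (L x))"
 using assms(1) by induction (auto intro: smooth_alg.intros assms(2))

text \<open>The gradient is an explicit argument, so that products, compositions and integration by
  parts can be stated with formulas for it.\<close>

definition c1 :: "('a::euclidean_space \<Rightarrow> real) \<Rightarrow> ('a \<Rightarrow> 'a) \<Rightarrow> bool" where
 "c1 f F \<longleftrightarrow> (\<forall>x. (f has_derivative (\<lambda>h. F x \<bullet> h)) (at x)) \<and> continuous_on UNIV F"

lemma c1_has_derivative: "c1 f F \<Longrightarrow> (f has_derivative (\<lambda>h. F x \<bullet> h)) (at x)"
 by (simp add: c1_def)

lemma c1_gradient_continuous: "c1 f F \<Longrightarrow> continuous_on UNIV F"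
 by (simp add: c1_def)

lemma c1_continuous: "c1 f F \<Longrightarrow> continuous_on UNIV f"
 by (rule continuous_at_imp_continuous_on) (blast intro: has_derivative_continuous c1_has_derivative)

lemma smooth_alg_has_gradient:
 assumes "smooth_alg f"
 shows "\<exists>F. (\<forall>x. (f has_derivative (\<lambda>h. F x \<bullet> h)) (at x)) \<and> (\<forall>b. smooth_alg (\<lambda>x. F x \<bullet> b))"
 using assms
proof induction
 case (const c)
 show ?case by (intro exI[of _ "\<lambda>x. 0"]) (auto intro: smooth_alg.intros)
next
 case (inner b)
 show ?case by (intro exI[of _ "\<lambda>x. b"])
   (auto intro!: smooth_alg.intros derivative_eq_intros simp: inner_commute)
next
 case (add f g)
 then obtain F G where *: "\<And>x. (f has_derivative (\<lambda>h. F x \<bullet> h)) (at x)" "\<And>b. smooth_alg (\<lambda>x. F x \<bullet> b)"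
  "\<And>x. (g has_derivative (\<lambda>h. G x \<bullet> h)) (at x)" "\<And>b. smooth_alg (\<lambda>x. G x \<bullet> b)" by blast
 show ?case
  by (intro exI[of _ "\<lambda>x. F x + G x"])
   (auto intro!: smooth_alg.intros * derivative_eq_intros simp: inner_add_left)
next
 case (mult f g)
 then obtain F G where *: "\<And>x. (f has_derivative (\<lambda>h. F x \<bullet> h)) (at x)" "\<And>b. smooth_alg (\<lambda>x. F x \<bullet> b)"
  "\<And>x. (g has_derivative (\<lambda>h. G x \<bullet> h)) (at x)" "\<And>b. smooth_alg (\<lambda>x. G x \<bullet> b)" by blast
 show ?case
  by (intro exI[of _ "\<lambda>x. f x *\<^sub>R G x + g x *\<^sub>R F x"])
   (auto intro!: smooth_alg.intros * mult.hyps derivative_eq_intros simp: inner_add_left algebra_simps)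
next
 case (psi f k)
 then obtain F where *: "\<And>x. (f has_derivative (\<lambda>h. F x \<bullet> h)) (at x)" "\<And>b. smooth_alg (\<lambda>x. F x \<bullet> b)"
  by blast
 have "((\<lambda>x. psi k (f x)) has_derivative (\<lambda>h. ((psi (k + 2) (f x) - real k * psi (k + 1) (f x)) *\<^sub>R F x) \<bullet> h)) (at x)" for x
  using has_derivative_compose[OF *(1) psi_has_derivative[of k, unfolded has_field_derivative_def]]
  by simp
 moreover have "smooth_alg (\<lambda>x. ((psi (k + 2) (f x) - real k * psi (k + 1) (f x)) *\<^sub>R F x) \<bullet> b)" for b
  by (auto intro!: smooth_alg.intros smooth_alg_diff * psi.hyps)
 ultimately show ?case
  by (intro exI[of _ "\<lambda>x. (psi (k + 2) (f x) - real k * psi (k + 1) (f x)) *\<^sub>R F x"]) blast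
qed

lemma smooth_alg_c1:
 assumes "smooth_alg f"
 shows "\<exists>F. c1 f F \<and> (\<forall>b. smooth_alg (\<lambda>x. F x \<bullet> b))"
proof -
 from smooth_alg_has_gradient[OF assms] obtain F where
  F: "\<And>x. (f has_derivative (\<lambda>h. F x \<bullet> h)) (at x)" "\<And>b. smooth_alg (\<lambda>x. F x \<bullet> b)" by blast
 have "continuous_on UNIV (\<lambda>x. F x \<bullet> b)" for b
 proof -
  from smooth_alg_has_gradient[OF F(2)[of b]] obtain G where
   G: "\<And>x. ((\<lambda>x. F x \<bullet> b) has_derivative (\<lambda>h. G x \<bullet> h)) (at x)" by blast
  show ?thesis
   by (rule continuous_at_imp_continuous_on, rule ballI, rule has_derivative_continuous, rule G)
 qed
 then have "continuous_on UNIV F" by (rule continuous_on_componentwise[THEN iffD2, OF ballI])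
 then show ?thesis using F by (auto simp: c1_def)
qed

lemma smooth_alg_Ck: "smooth_alg f \<Longrightarrow> Ck k f"
proof (induction k arbitrary: f)
 case 0
 then show ?case using smooth_alg_c1[OF 0] c1_continuous by auto
next
 case (Suc k)
 from smooth_alg_c1[OF Suc.prems] obtain F where F: "c1 f F" "\<And>b. smooth_alg (\<lambda>x. F x \<bullet> b)" by blast
 have "frechet_derivative f (at x) = (\<lambda>h. F x \<bullet> h)" for x
  using frechet_derivative_at[OF c1_has_derivative[OF F(1)]] by simp
 then show ?case
  using F(2) Suc.IH differentiableI[OF c1_has_derivative[OF F(1)]] by simp
qed

text \<open>Positive exactly in the open ball of radius \<open>e\<close>, if \<open>e\<close> is
  positive. The norm enters squared because its square is a polynomial in the coordinates, which
  places the function in \<open>smooth_alg\<close>.\<close>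

definition eta_raw :: "real \<Rightarrow> 'a::euclidean_space \<Rightarrow> real" where
 "eta_raw e x = psi 0 (e\<^sup>2 - (norm x)\<^sup>2)"

definition eta :: "real \<Rightarrow> 'a::euclidean_space \<Rightarrow> real" where
 "eta e x = eta_raw e x / (\<integral>y. eta_raw e y \<partial>(lborel :: 'a measure))"

lemma smooth_alg_eta_raw: "smooth_alg (eta_raw e :: 'a::euclidean_space \<Rightarrow> real)"
proof -
 have "smooth_alg (\<lambda>x::'a. psi 0 (e\<^sup>2 - (\<Sum>b\<in>Basis. (x \<bullet> b) * (x \<bullet> b))))"
  by (intro smooth_alg.intros smooth_alg_diff smooth_alg_sum)
 moreover have "(norm x)\<^sup>2 = (\<Sum>b\<in>Basis. (x \<bullet> b) * (x \<bullet> b))" for x :: 'a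
  by (simp add: power2_norm_eq_inner euclidean_inner[of x x])
 ultimately show ?thesis by (simp add: eta_raw_def[abs_def])
qed

lemma eta_raw_continuous: "continuous_on UNIV (eta_raw e :: 'a::euclidean_space \<Rightarrow> real)"
 using smooth_alg_Ck[OF smooth_alg_eta_raw, of 0] by simp

lemma eta_raw_pos: "norm x < e \<Longrightarrow> eta_raw e x > 0"
 by (simp add: eta_raw_def psi_def power_strict_mono)

lemma eta_raw_eq_0:
 assumes "norm x \<ge> e" "e > 0"
 shows "eta_raw e x = 0"
proof -
 have "e\<^sup>2 \<le> (norm x)\<^sup>2" using assms by (intro power_mono) auto
 then show ?thesis by (simp add: eta_raw_def psi_def)
qed

lemma continuous_compact_support_integrable:
 fixes f :: "'a::euclidean_space \<Rightarrow> 'b::euclidean_space"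
 assumes "continuous_on UNIV f" and "\<And>x. norm x > R \<Longrightarrow> f x = 0"
 shows "intble f"
proof -
 have "intble (\<lambda>x. indc (cball 0 R) x *\<^sub>R f x)"
  using assms(1) by (intro borel_integrable_compact) (auto intro: continuous_on_subset)
 moreover have "(\<lambda>x. indc (cball 0 R) x *\<^sub>R f x) = f"
  using assms(2) by (auto simp: fun_eq_iff indicator_def not_le)
 ultimately show ?thesis by simp
qed

lemma eta_raw_integrable: "e > 0 \<Longrightarrow> intble (eta_raw e :: 'a::euclidean_space \<Rightarrow> real)"
 by (rule continuous_compact_support_integrable[OF eta_raw_continuous, of e]) (auto intro: eta_raw_eq_0)

lemma eta_raw_integral_pos:
 assumes "e > 0"
 shows "(\<integral>y. eta_raw e y \<partial>(lborel :: 'a::euclidean_space measure)) > 0"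
proof -
 have "(\<integral>y. eta_raw e y \<partial>(lborel :: 'a measure)) \<noteq> 0"
 proof
  assume "(\<integral>y. eta_raw e y \<partial>(lborel :: 'a measure)) = 0"
  then have "AE y in (lborel :: 'a measure). eta_raw e y = 0"
   using eta_raw_integrable[OF assms]
   by (subst (asm) integral_nonneg_eq_0_iff_AE) (auto simp: eta_raw_def psi_nonneg)
  then have "AE y in (lborel :: 'a measure). y \<notin> ball 0 e"
   by eventually_elim (use eta_raw_pos in \<open>auto simp: less_le\<close>)
  then have "emeasure lborel (ball (0::'a) e) = 0"
   by (subst (asm) AE_iff_measurable[of "ball 0 e"]) auto
  then show False
   using open_not_negligible[of "ball (0::'a) e"] assms
   by (auto simp: negligible_iff_null_sets null_sets_def)
 qed
 moreover have "(\<integral>y. eta_raw e y \<partial>(lborel :: 'a measure)) \<ge> 0"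
  by (simp add: eta_raw_def psi_nonneg)
 ultimately show ?thesis by linarith
qed

lemma smooth_alg_eta: "smooth_alg (eta e :: 'a::euclidean_space \<Rightarrow> real)"
proof -
 have "smooth_alg (\<lambda>x::'a. eta_raw e x * (1 / (\<integral>y. eta_raw e y \<partial>(lborel :: 'a measure))))"
  by (intro smooth_alg.intros smooth_alg_eta_raw)
 then show ?thesis by (simp add: eta_def[abs_def])
qed

lemma eta_continuous: "continuous_on S (eta e :: 'a::euclidean_space \<Rightarrow> real)"
 by (rule continuous_on_subset[of UNIV]) (use smooth_alg_Ck[OF smooth_alg_eta, of 0] in auto)

lemma eta_measurable [measurable]: "borel_fun (eta e :: 'a::euclidean_space \<Rightarrow> real)"
 by (intro borel_measurable_continuous_onI eta_continuous)

lemma eta_nonneg: "e > 0 \<Longrightarrow> eta e x \<ge> 0"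
 using eta_raw_integral_pos[of e, where 'a='a] by (simp add: eta_def eta_raw_def psi_nonneg)

lemma eta_eq_0: "norm x \<ge> e \<Longrightarrow> e > 0 \<Longrightarrow> eta e x = 0"
 by (simp add: eta_def eta_raw_eq_0)

lemma eta_minus: "eta e (- x) = eta e x" "eta e (x - y) = eta e (y - x)"
 by (simp_all add: eta_def eta_raw_def norm_minus_commute)

lemma eta_integrable: "e > 0 \<Longrightarrow> intble (eta e :: 'a::euclidean_space \<Rightarrow> real)"
 by (simp add: eta_def[abs_def] eta_raw_integrable)

lemma eta_integral:
 "e > 0 \<Longrightarrow> (\<integral>x. eta e x \<partial>(lborel :: 'a::euclidean_space measure)) = 1"
 using eta_raw_integral_pos[of e, where 'a='a] by (simp add: eta_def)

definition deta :: "real \<Rightarrow> 'a::euclidean_space \<Rightarrow> 'a" where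
 "deta e = (SOME F. c1 (eta e) F)"

lemma c1_eta: "c1 (eta e :: 'a::euclidean_space \<Rightarrow> real) (deta e)"
 using smooth_alg_c1[OF smooth_alg_eta[of e]] someI_ex[of "c1 (eta e :: 'a \<Rightarrow> real)"]
 unfolding deta_def by blast

lemma deta_continuous: "continuous_on S (deta e :: 'a::euclidean_space \<Rightarrow> 'a)"
 by (rule continuous_on_subset[OF c1_gradient_continuous[OF c1_eta] subset_UNIV])

lemma deta_measurable [measurable]: "borel_fun (deta e :: 'a::euclidean_space \<Rightarrow> 'a)"
 by (intro borel_measurable_continuous_onI deta_continuous)

lemma gradient_eq_0_outside:
 assumes "c1 f F" "\<And>x. norm x > R \<Longrightarrow> f x = 0" "norm x > R"
 shows "F x = 0"
proof -
 have "(f has_derivative (\<lambda>h. 0)) (at x)"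
 proof (rule has_derivative_transform_within_open[of "\<lambda>x. 0" _ _ _ "{y. norm y > R}"])
  show "open {y::'a. norm y > R}" by (intro open_Collect_less continuous_intros)
 qed (use assms in auto)
 from has_derivative_unique[OF c1_has_derivative[OF assms(1)] this]
 have "F x \<bullet> F x = 0" by metis
 then show ?thesis by simp
qed

lemma deta_eq_0: "norm x > e \<Longrightarrow> e > 0 \<Longrightarrow> deta e x = 0"
 by (rule gradient_eq_0_outside[OF c1_eta, of e]) (auto intro: eta_eq_0)

lemma test_function_smooth_alg:
 assumes "smooth_alg \<phi>" "compact K" "K \<subseteq> \<Omega>" "\<And>x. x \<notin> K \<Longrightarrow> \<phi> x = 0"
 shows "test_function \<Omega> \<phi>"
proof -
 have "closure {x. \<phi> x \<noteq> 0} \<subseteq> K"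
  using assms by (intro closure_minimal compact_imp_closed) auto
 moreover have "compact (closure {x. \<phi> x \<noteq> 0})"
  using calculation assms(2) by (metis closed_closure compact_Int_closed inf.absorb_iff2)
 ultimately show ?thesis
  using smooth_alg_Ck[OF assms(1)] assms(3) by (auto simp: test_function_def)
qed

lemma smooth_alg_eta_shift: "smooth_alg (\<lambda>y. eta e (x - y))"
proof (rule smooth_alg_compose[OF smooth_alg_eta])
 fix b show "smooth_alg (\<lambda>y. (x - y) \<bullet> b)"
  unfolding inner_diff_left by (intro smooth_alg_diff smooth_alg.intros)
qed

lemma test_function_eta:
 assumes "e > 0" "cball x e \<subseteq> \<Omega>"
 shows "test_function \<Omega> (\<lambda>y. eta e (x - y))"
proof (rule test_function_smooth_alg[OF smooth_alg_eta_shift _ assms(2)])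
 show "eta e (x - y) = 0" if "y \<notin> cball x e" for y
  using that assms by (intro eta_eq_0) (auto simp: dist_norm)
qed auto

lemma frechet_derivative_eta_shift:
 "frechet_derivative (\<lambda>y. eta d (x - y)) (at y) e = - (deta d (x - y) \<bullet> e)"
proof -
 have "((\<lambda>y. eta d (x - y)) has_derivative (\<lambda>h. deta d (x - y) \<bullet> (- h))) (at y)"
  by (rule has_derivative_compose[OF _ c1_has_derivative[OF c1_eta]]) (auto intro!: derivative_eq_intros)
 from frechet_derivative_at[OF this] show ?thesis by (metis inner_minus_right)
qed

section \<open>Mollification\<close>

definition moll :: "real \<Rightarrow> ('a::euclidean_space \<Rightarrow> real) \<Rightarrow> 'a \<Rightarrow> real" where
 "moll e f x = (LBINT y. f y * eta e (x - y))"

text \<open>The derivative falls on the kernel; \<open>c1_moll\<close> identifies this as the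
  gradient of \<open>moll e f\<close>.\<close>

definition dmoll :: "real \<Rightarrow> ('a::euclidean_space \<Rightarrow> real) \<Rightarrow> 'a \<Rightarrow> 'a" where
 "dmoll e f x = (LBINT y. f y *\<^sub>R deta e (x - y))"

lemma uniform_continuous_compact_support:
 fixes F :: "'a::euclidean_space \<Rightarrow> 'b::euclidean_space"
 assumes "continuous_on UNIV F" "\<And>x. norm x > R \<Longrightarrow> F x = 0" "e > 0"
 shows "\<exists>d>0. \<forall>x y. norm (x - y) < d \<longrightarrow> norm (F x - F y) < e"
proof -
 have "uniformly_continuous_on (cball 0 (R + 1)) F"
  using assms(1) by (intro compact_uniformly_continuous) (auto intro: continuous_on_subset)
 then obtain d where d: "d > 0" "\<And>x y. x \<in> cball 0 (R + 1) \<Longrightarrow> y \<in> cball 0 (R + 1) \<Longrightarrow> dist y x < d \<Longrightarrow> dist (F y) (F x) < e"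
  unfolding uniformly_continuous_on_def using assms(3) by metis
 show ?thesis
 proof (intro exI[of _ "min d 1"] conjI allI impI)
  fix x y :: 'a assume xy: "norm (x - y) < min d 1"
  show "norm (F x - F y) < e"
  proof (cases "x \<in> cball 0 (R + 1) \<and> y \<in> cball 0 (R + 1)")
   case True
   then show ?thesis using d(2)[of y x] xy by (simp add: dist_norm)
  next
   case False
   have "norm x \<le> norm y + norm (x - y)" "norm y \<le> norm x + norm (x - y)"
    using norm_triangle_sub[of x y] norm_triangle_sub[of y x] by (auto simp: norm_minus_commute)
   then have "norm x > R" "norm y > R" using False xy by auto
   then show ?thesis using assms by simp
  qed
 qed (use d in auto)
qed

lemma bounded_compact_support:
 fixes F :: "'a::euclidean_space \<Rightarrow> 'b::euclidean_space"
 assumes "continuous_on UNIV F" "\<And>x. norm x > R \<Longrightarrow> F x = 0"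
 shows "\<exists>C\<ge>0. \<forall>x. norm (F x) \<le> C"
proof -
 have "compact (F ` cball 0 R)"
  using assms(1) by (intro compact_continuous_image) (auto intro: continuous_on_subset)
 then obtain C where C: "\<And>x. x \<in> cball 0 R \<Longrightarrow> norm (F x) \<le> C"
  by (meson bounded_iff compact_imp_bounded image_eqI)
 have "norm (F x) \<le> max 0 C" for x
 proof (cases "norm x \<le> R")
  case True
  then show ?thesis using C[of x] by simp
 next
  case False
  then show ?thesis using assms(2)[of x] by simp
 qed
 then show ?thesis by (intro exI[of _ "max 0 C"]) auto
qed

lemma integrable_bounded_mult:
 fixes f :: "'a \<Rightarrow> real" and k :: "'a \<Rightarrow> 'b::euclidean_space"
 assumes f: "integrable M f" and [measurable]: "k \<in> borel_measurable M" and k: "\<And>x. norm (k x) \<le> C"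
 shows "integrable M (\<lambda>x. f x *\<^sub>R k x)"
proof (rule lintable_bound)
 show "integrable M (\<lambda>x. C * f x)" using f by simp
 show "AE x in M. norm (f x *\<^sub>R k x) \<le> norm (C * f x)"
 proof (rule AE_I2)
  fix x
  have "norm (f x *\<^sub>R k x) \<le> C * \<bar>f x\<bar>" using mult_right_mono[OF k[of x], of "\<bar>f x\<bar>"] by (simp add: mult.commute)
  also have "\<dots> \<le> norm (C * f x)" by (simp add: abs_mult mult_right_mono)
  finally show "norm (f x *\<^sub>R k x) \<le> norm (C * f x)" .
 qed
qed (use f in auto)

lemma moll_integrable:
 fixes f :: "'a::euclidean_space \<Rightarrow> real"
 assumes f: "intble f" and "e > 0"
 shows "intble (\<lambda>y. f y * eta e (x - y))" "intble (\<lambda>y. f y *\<^sub>R deta e (x - y))"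
proof -
 have "\<exists>C\<ge>0. \<forall>x::'a. norm (eta e x) \<le> C"
  by (rule bounded_compact_support[OF eta_continuous, of e]) (auto intro: eta_eq_0 assms(2))
 then obtain C where "\<And>x::'a. norm (eta e x) \<le> C" by blast
 then show "intble (\<lambda>y. f y * eta e (x - y))"
  using integrable_bounded_mult[OF f, of "\<lambda>y. eta e (x - y)" C] by simp
 have "\<exists>C\<ge>0. \<forall>x::'a. norm (deta e x) \<le> C"
  by (rule bounded_compact_support[OF deta_continuous, of e]) (auto intro: deta_eq_0 assms(2))
 then obtain C where "\<And>x::'a. norm (deta e x) \<le> C" by blast
 then show "intble (\<lambda>y. f y *\<^sub>R deta e (x - y))"
  using integrable_bounded_mult[OF f, of "\<lambda>y. deta e (x - y)" C] by simp
qed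

lemma dmoll_inner:
 assumes "intble f" "e > 0"
 shows "dmoll e f x \<bullet> b = (LBINT y. f y * (deta e (x - y) \<bullet> b))"
proof -
 have "dmoll e f x \<bullet> b = (LBINT y. (f y *\<^sub>R deta e (x - y)) \<bullet> b)"
  unfolding dmoll_def by (rule integral_inner_left[symmetric]) (use moll_integrable(2)[OF assms] in auto)
 then show ?thesis by simp
qed

text \<open>Dividing by \<open>I + 1\<close> in place of \<open>I\<close> spares a case distinction
  when an integral or a measure \<open>I\<close> is 0.\<close>

lemma divide_Suc_bounds:
 fixes I r :: real
 assumes "I \<ge> 0" "r > 0"
 shows "r / (I + 1) > 0" "r / (I + 1) * I < r"
 using assms by (auto simp: field_simps)

text \<open>By uniform continuity of \<open>deta\<close>, the first order expansion of the kernel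
  has an error below \<open>r * norm h\<close>, uniformly in the base point. Integrated against
  \<open>f\<close> it is at most \<open>r * norm h\<close> times the \<open>L1\<close> norm of
  \<open>f\<close>, so integrability of \<open>f\<close> is all that differentiability under the
  integral takes.\<close>

lemma c1_moll:
 fixes f :: "'a::euclidean_space \<Rightarrow> real"
 assumes f: "intble f" and e: "b > 0"
 shows "c1 (moll b f) (dmoll b f)"
 unfolding c1_def
proof (intro conjI allI)
 let ?I = "(LBINT y. \<bar>f y\<bar>)"
 have I0: "?I \<ge> 0" by simp
 have unif: "\<exists>d>0. \<forall>x y :: 'a. norm (x - y) < d \<longrightarrow> norm (deta b x - deta b y) < r" if "r > 0" for r
  by (rule uniform_continuous_compact_support[of _ b, OF deta_continuous _ that]) (auto intro: deta_eq_0 e)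
 have diffest: "norm (moll b f (x + h) - moll b f x - dmoll b f x \<bullet> h) \<le> r * ?I * norm h"
  if d: "\<And>x y :: 'a. norm (x - y) < d \<Longrightarrow> norm (deta b x - deta b y) < r" and h: "norm h < d" for r d h x
 proof -
  have pt: "\<bar>eta b (z + h) - eta b z - deta b z \<bullet> h\<bar> \<le> r * norm h" for z
  proof -
   \<comment> \<open>The kernel minus its linear part at \<open>z\<close>: its gradient is small
     near \<open>z\<close>, and the mean value inequality bounds its increment.\<close>
   define k where "k w = eta b w - deta b z \<bullet> w" for w
   have "norm (k (z + h) - k z) \<le> r * norm (z + h - z)"
   proof (rule differentiable_bound[of "cball z (norm h)" k "\<lambda>w v. (deta b w - deta b z) \<bullet> v"])
    show "convex (cball z (norm h))" by simp
    fix w assume w: "w \<in> cball z (norm h)"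
    have "(k has_derivative (\<lambda>v. deta b w \<bullet> v - deta b z \<bullet> v)) (at w)"
     unfolding k_def
     by (rule has_derivative_diff[OF c1_has_derivative[OF c1_eta] has_derivative_inner_right[OF has_derivative_ident]])
    then show "(k has_derivative (\<lambda>v. (deta b w - deta b z) \<bullet> v)) (at w within cball z (norm h))"
     unfolding inner_diff_left by (rule has_derivative_at_withinI)
    have "norm (deta b w - deta b z) < r"
     using w h by (intro d) (auto simp: dist_norm norm_minus_commute)
    then have "norm ((deta b w - deta b z) \<bullet> v) \<le> r * norm v" for v
     using Cauchy_Schwarz_ineq2[of "deta b w - deta b z" v]
      mult_right_mono[of "norm (deta b w - deta b z)" r "norm v"] by simp
    then show "onorm (\<lambda>v. (deta b w - deta b z) \<bullet> v) \<le> r" by (rule onorm_le)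
   qed (auto simp: dist_norm)
   then show ?thesis by (simp add: k_def inner_add_right algebra_simps)
  qed
  have int: "intble (\<lambda>y. f y * (deta b (x - y) \<bullet> h))"
   using integrable_inner_left[of h lborel "\<lambda>y. f y *\<^sub>R deta b (x - y)"] moll_integrable(2)[OF f e] by simp
  have eq: "moll b f (x + h) - moll b f x - dmoll b f x \<bullet> h
   = (LBINT y. f y * eta b (x + h - y) - f y * eta b (x - y) - f y * (deta b (x - y) \<bullet> h))"
   unfolding dmoll_inner[OF f e] moll_def using int moll_integrable(1)[OF f e] by simp
  have "norm (LBINT y. f y * eta b (x + h - y) - f y * eta b (x - y) - f y * (deta b (x - y) \<bullet> h))
   \<le> (LBINT y. norm (f y * eta b (x + h - y) - f y * eta b (x - y) - f y * (deta b (x - y) \<bullet> h)))"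
   by (rule integral_norm_bound)
  also have "\<dots> \<le> (LBINT y. r * norm h * \<bar>f y\<bar>)"
  proof (rule integral_mono)
   show "intble (\<lambda>y. norm (f y * eta b (x + h - y) - f y * eta b (x - y) - f y * (deta b (x - y) \<bullet> h)))"
    using int moll_integrable(1)[OF f e] by simp
   show "intble (\<lambda>y. r * norm h * \<bar>f y\<bar>)" using f by simp
   fix y
   have "norm (f y * eta b (x + h - y) - f y * eta b (x - y) - f y * (deta b (x - y) \<bullet> h))
    = \<bar>f y\<bar> * \<bar>eta b ((x - y) + h) - eta b (x - y) - deta b (x - y) \<bullet> h\<bar>"
   proof -
    have "f y * eta b (x + h - y) - f y * eta b (x - y) - f y * (deta b (x - y) \<bullet> h)
     = f y * (eta b ((x - y) + h) - eta b (x - y) - deta b (x - y) \<bullet> h)"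
     by (simp add: right_diff_distrib add.commute add_diff_eq)
    then show ?thesis by (simp only: real_norm_def abs_mult)
   qed
   also have "\<dots> \<le> \<bar>f y\<bar> * (r * norm h)" by (intro mult_left_mono pt) auto
   finally show "norm (f y * eta b (x + h - y) - f y * eta b (x - y) - f y * (deta b (x - y) \<bullet> h)) \<le> r * norm h * \<bar>f y\<bar>"
    by (simp add: mult.commute)
  qed
  also have "\<dots> = r * ?I * norm h" by simp
  finally show ?thesis unfolding eq .
 qed
 show "(moll b f has_derivative (\<lambda>h. dmoll b f x \<bullet> h)) (at x)" for x
  unfolding has_derivative_at_alt
 proof (intro conjI allI impI bounded_linear_inner_right)
  fix r :: real assume "r > 0"
  define r' where "r' = r / (?I + 1)"
  have r': "r' > 0" "r' * ?I \<le> r" using divide_Suc_bounds[OF I0 \<open>r > 0\<close>] by (simp_all add: r'_def)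
  obtain d where d: "d > 0" "\<And>x y :: 'a. norm (x - y) < d \<Longrightarrow> norm (deta b x - deta b y) < r'"
   using unif[OF r'(1)] by blast
  show "\<exists>d>0. \<forall>y. norm (y - x) < d \<longrightarrow> norm (moll b f y - moll b f x - dmoll b f x \<bullet> (y - x)) \<le> r * norm (y - x)"
  proof (intro exI[of _ d] conjI allI impI d(1))
   fix y assume "norm (y - x) < d"
   from diffest[OF d(2) this, of x]
   have "norm (moll b f y - moll b f x - dmoll b f x \<bullet> (y - x)) \<le> r' * ?I * norm (y - x)" by simp
   also have "\<dots> \<le> r * norm (y - x)" by (intro mult_right_mono r') auto
   finally show "norm (moll b f y - moll b f x - dmoll b f x \<bullet> (y - x)) \<le> r * norm (y - x)" .
  qed
 qed
 show "continuous_on UNIV (dmoll b f)"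
  unfolding continuous_on_iff
 proof (intro ballI allI impI)
  fix x :: 'a and r :: real assume "r > 0"
  define r' where "r' = r / (?I + 1)"
  have r': "r' > 0" "r' * ?I < r" using divide_Suc_bounds[OF I0 \<open>r > 0\<close>] by (simp_all add: r'_def)
  obtain d where d: "d > 0" "\<And>x y :: 'a. norm (x - y) < d \<Longrightarrow> norm (deta b x - deta b y) < r'"
   using unif[OF r'(1)] by blast
  show "\<exists>d>0. \<forall>x'\<in>UNIV. dist x' x < d \<longrightarrow> dist (dmoll b f x') (dmoll b f x) < r"
  proof (intro exI[of _ d] conjI ballI impI d(1))
   fix x' assume "dist x' x < d"
   then have dd: "norm (deta b (x' - y) - deta b (x - y)) \<le> r'" for y
    by (intro less_imp_le d(2)) (simp add: dist_norm)
   have "dist (dmoll b f x') (dmoll b f x) = norm (LBINT y. f y *\<^sub>R deta b (x' - y) - f y *\<^sub>R deta b (x - y))"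
    unfolding dist_norm dmoll_def using moll_integrable(2)[OF f e] by simp
   also have "\<dots> \<le> (LBINT y. norm (f y *\<^sub>R deta b (x' - y) - f y *\<^sub>R deta b (x - y)))"
    by (rule integral_norm_bound)
   also have "\<dots> \<le> (LBINT y. r' * \<bar>f y\<bar>)"
   proof (rule integral_mono)
    fix y
    have "norm (f y *\<^sub>R deta b (x' - y) - f y *\<^sub>R deta b (x - y)) = \<bar>f y\<bar> * norm (deta b (x' - y) - deta b (x - y))"
     by (metis norm_scaleR scaleR_diff_right)
    also have "\<dots> \<le> \<bar>f y\<bar> * r'" by (intro mult_left_mono dd) auto
    finally show "norm (f y *\<^sub>R deta b (x' - y) - f y *\<^sub>R deta b (x - y)) \<le> r' * \<bar>f y\<bar>"
     by (simp add: mult.commute)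
   qed (use f moll_integrable(2)[OF f e] in auto)
   also have "\<dots> < r" using r' by simp
   finally show "dist (dmoll b f x') (dmoll b f x) < r" .
  qed
 qed
qed

text \<open>The kernel is a probability density supported in the ball of radius \<open>d\<close>, so
  only values of \<open>f\<close> near \<open>x\<close> enter. Applied with a modulus of uniform
  continuity, this gives uniform convergence on compact sets.\<close>

lemma moll_close:
 fixes f :: "'a::euclidean_space \<Rightarrow> real"
 assumes f: "intble f" and e: "d > 0"
  and close: "\<And>y. norm (y - x) < d \<Longrightarrow> \<bar>f y - c\<bar> \<le> r"
 shows "\<bar>moll d f x - c\<bar> \<le> r"
proof -
 have i: "intble (\<lambda>y. eta d (x - y))" "(LBINT y. eta d (x - y)) = 1"
 proof -
  have eq: "(\<lambda>y. eta d (x - y)) = (\<lambda>y. eta d (y + (- x)))"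
   by (simp add: fun_eq_iff eta_minus(2)[of d x])
  show "intble (\<lambda>y. eta d (x - y))"
   unfolding eq by (subst integrable_translate_lborel) (auto intro: eta_integrable e)
  show "(LBINT y. eta d (x - y)) = 1"
   unfolding eq by (subst integral_translate_lborel) (auto intro: eta_integral e)
 qed
 have eq: "moll d f x - c = (LBINT y. f y * eta d (x - y) - c * eta d (x - y))"
  unfolding moll_def using i moll_integrable(1)[OF f e] by simp
 have "\<bar>(LBINT y. f y * eta d (x - y) - c * eta d (x - y))\<bar> \<le> (LBINT y. \<bar>f y * eta d (x - y) - c * eta d (x - y)\<bar>)"
  using integral_norm_bound[of lborel "\<lambda>y. f y * eta d (x - y) - c * eta d (x - y)"] by simp
 also have "\<dots> \<le> (LBINT y. r * eta d (x - y))"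
 proof (rule integral_mono)
  fix y
  have "\<bar>f y * eta d (x - y) - c * eta d (x - y)\<bar> = \<bar>f y - c\<bar> * eta d (x - y)"
   using eta_nonneg[OF e, of "x - y"] by (simp add: abs_mult[symmetric] left_diff_distrib[symmetric] abs_mult)
  also have "\<dots> \<le> r * eta d (x - y)"
  proof (cases "norm (y - x) < d")
   case True
   then show ?thesis by (intro mult_right_mono close eta_nonneg e)
  next
   case False
   then have "eta d (x - y) = 0" by (intro eta_eq_0 e) (simp add: norm_minus_commute)
   then show ?thesis by simp
  qed
  finally show "\<bar>f y * eta d (x - y) - c * eta d (x - y)\<bar> \<le> r * eta d (x - y)" .
 qed (use i moll_integrable(1)[OF f e] in auto)
 finally show ?thesis unfolding eq using i by simp
qed

text \<open>One fixed sequence serves as mollification radius, distance to the boundary, difference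
  step and time step. All its members are at most 1, which is used wherever a ball is enlarged by
  1.\<close>

definition eps :: "nat \<Rightarrow> real" where "eps n = inverse (real (Suc n))"

lemma eps_pos [simp]: "eps n > 0" by (simp add: eps_def)
lemma eps_tendsto: "eps \<longlonglongrightarrow> 0"
 unfolding eps_def[abs_def] by (rule LIMSEQ_inverse_real_of_nat)

lemma eventually_eps_less: "r > 0 \<Longrightarrow> eventually (\<lambda>n. eps n < r) sequentially"
 by (rule order_tendstoD(2)[OF eps_tendsto])

text \<open>Brings the mollification into the form of an average of translates, to which
  \<open>average_tendsto_L1\<close> and \<open>average_tendsto_L2\<close> apply.\<close>

lemma moll_average:
 fixes f :: "'a::euclidean_space \<Rightarrow> real"
 assumes [measurable]: "borel_fun f" and e: "d > 0"
 shows "moll d f x = (\<integral>k. f (x + k) \<partial>density lborel (\<lambda>k. ennreal (eta d k)))"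
proof -
 have "(\<integral>k. f (x + k) \<partial>density lborel (\<lambda>k. ennreal (eta d k))) = (LBINT k. eta d k * f (x + k))"
  by (subst integral_density) (auto intro: eta_nonneg e)
 also have "\<dots> = (LBINT k. eta d ((k + (- x))) * f (x + (k + (- x))))"
  by (rule integral_translate_lborel[symmetric, of "\<lambda>k. eta d k * f (x + k)"]) simp
 also have "\<dots> = moll d f x"
  unfolding moll_def by (intro lint_cong) (auto simp: eta_minus(2)[of d x])
 finally show ?thesis by simp
qed

lemma eta_prob:
 assumes e: "d > 0"
 shows "prob_space (density lborel (\<lambda>k::'a::euclidean_space. ennreal (eta d k)))"
  "AE k in density lborel (\<lambda>k::'a. ennreal (eta d k)). norm k \<le> d"
proof -
 show "prob_space (density lborel (\<lambda>k::'a. ennreal (eta d k)))"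
 proof (rule prob_spaceI)
  have "emeasure (density lborel (\<lambda>k::'a. ennreal (eta d k))) (space (density lborel (\<lambda>k::'a. ennreal (eta d k))))
   = (\<integral>\<^sup>+k. ennreal (eta d k) \<partial>(lborel :: 'a measure))"
   by (subst emeasure_density) auto
  also have "\<dots> = ennreal 1"
   using eta_nonneg[OF e, where 'a='a] eta_integral[OF e, where 'a='a]
   by (subst nn_integral_eq_integral[OF eta_integrable[OF e, where 'a='a]]) auto
  finally show "emeasure (density lborel (\<lambda>k::'a. ennreal (eta d k))) (space (density lborel (\<lambda>k::'a. ennreal (eta d k)))) = 1" by simp
 qed
 show "AE k in density lborel (\<lambda>k::'a. ennreal (eta d k)). norm k \<le> d"
 proof (subst AE_density)
  show "AE k in lborel. 0 < ennreal (eta d (k::'a)) \<longrightarrow> norm k \<le> d"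
  proof (rule AE_I2, rule impI, rule ccontr)
   fix k :: 'a assume "0 < ennreal (eta d k)" "\<not> norm k \<le> d"
   then show False using eta_eq_0[of d k] e by simp
  qed
 qed simp
qed

lemma moll_tendsto_L2:
 fixes f :: "'a::euclidean_space \<Rightarrow> real"
 assumes f: "L2 lborel f"
 shows "L2 lborel (moll (eps n) f)"
  and "(\<lambda>n. (LBINT x. (moll (eps n) f x - f x)\<^sup>2)) \<longlonglongrightarrow> 0"
proof -
 have fm: "borel_fun f" using f by (simp add: L2_def)
 note * = average_tendsto_L2[of f "\<lambda>n. density lborel (\<lambda>k. ennreal (eta (eps n) k))" eps,
   OF f eta_prob(1)[OF eps_pos] _ eta_prob(2)[OF eps_pos] eps_tendsto]
 show "L2 lborel (moll (eps n) f)"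
  using *(1)[of n] by (simp add: moll_average[OF fm eps_pos, symmetric])
 show "(\<lambda>n. (LBINT x. (moll (eps n) f x - f x)\<^sup>2)) \<longlonglongrightarrow> 0"
  using *(2) by (simp add: moll_average[OF fm eps_pos, symmetric])
qed

lemma moll_tendsto_L1:
 fixes f :: "'a::euclidean_space \<Rightarrow> real"
 assumes f: "intble f"
 shows "intble (moll (eps n) f)"
  and "(\<lambda>n. (LBINT x. \<bar>moll (eps n) f x - f x\<bar>)) \<longlonglongrightarrow> 0"
proof -
 have fm: "borel_fun f" using f by auto
 note * = average_tendsto_L1[of f "\<lambda>n. density lborel (\<lambda>k. ennreal (eta (eps n) k))" eps,
   OF f eta_prob(1)[OF eps_pos] _ eta_prob(2)[OF eps_pos] eps_tendsto]
 show "intble (moll (eps n) f)"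
  using *(1)[of n] by (simp add: moll_average[OF fm eps_pos, symmetric])
 show "(\<lambda>n. (LBINT x. \<bar>moll (eps n) f x - f x\<bar>)) \<longlonglongrightarrow> 0"
  using *(2) by (simp add: moll_average[OF fm eps_pos, symmetric])
qed

section \<open>Slices of functions and null sets on products\<close>

lemma lborel_snd:
 fixes f :: "'a::euclidean_space \<times> 'b::euclidean_space \<Rightarrow> real"
 assumes "intble f"
 shows lborel_AE_integrable_snd: "AE t in lborel. intble (\<lambda>x. f (x, t))"
  and lborel_integrable_snd: "intble (\<lambda>t. (LBINT x. f (x, t)))"
  and lborel_integral_snd: "(LBINT t. (LBINT x. f (x, t))) = (LBINT p. f p)"
proof -
 have *: "integrable (lborel \<Otimes>\<^sub>M lborel) (\<lambda>(x, t). f (x, t))"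
  using assms by (simp add: lborel_prod)
 show "AE t in lborel. intble (\<lambda>x. f (x, t))"
  using lborel_pair.AE_integrable_snd[OF *] by simp
 show "intble (\<lambda>t. (LBINT x. f (x, t)))"
  using lborel_pair.integrable_snd[OF *] by simp
 show "(LBINT t. (LBINT x. f (x, t))) = (LBINT p. f p)"
  using lborel_pair.integral_snd[OF *] by (simp add: lborel_prod)
qed

lemma lborel_AE_snd:
 assumes "AE p in (lborel :: ('a::euclidean_space \<times> 'b::euclidean_space) measure). Q p"
 shows "AE t in lborel. AE x in lborel. Q (x, t)"
proof -
 \<comment> \<open>Exchanging the two almost-everywhere quantifiers requires measurability. The null
   set \<open>N\<close> has it, the exceptional set of \<open>Q\<close> perhaps not.\<close>
 obtain N where N: "{p. \<not> Q p} \<subseteq> N" "N \<in> null_sets (lborel :: ('a \<times> 'b) measure)"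
  using assms by (auto simp: eventually_ae_filter)
 have [measurable]: "N \<in> sets (borel :: ('a \<times> 'b) measure)" using N(2) by auto
 have "AE p in (lborel \<Otimes>\<^sub>M lborel). p \<notin> N"
  using N(2) by (simp add: lborel_prod AE_not_in)
 then have "AE x in lborel. AE t in lborel. (x, t) \<notin> N" by (rule lborel_pair.AE_pair)
 moreover have "{x \<in> space (lborel \<Otimes>\<^sub>M lborel). (fst x, snd x) \<notin> N} \<in> sets (lborel \<Otimes>\<^sub>M lborel)"
 proof -
  have "{x \<in> space (lborel \<Otimes>\<^sub>M lborel). (fst x, snd x) \<notin> N} = - N" by (auto simp: space_pair_measure)
  moreover have "- N \<in> sets borel" by measurable
  moreover have "sets (lborel \<Otimes>\<^sub>M lborel) = sets (borel :: ('a \<times> 'b) measure)"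
   by (metis lborel_prod sets_lborel)
  ultimately show ?thesis by metis
 qed
 ultimately have "AE t in lborel. AE x in lborel. (x, t) \<notin> N"
  using lborel_pair.AE_commute[of "\<lambda>x t. (x, t) \<notin> N"] by blast
 then show ?thesis
 proof eventually_elim
  case (elim t)
  then show ?case by eventually_elim (use N(1) in blast)
 qed
qed

section \<open>Weak derivatives and uniqueness\<close>

lemma locally_integrable_cut:
 assumes "locally_integrable \<Omega> f" "compact K" "K \<subseteq> \<Omega>"
 shows "intble (\<lambda>x. indc K x * f x)"
 using assms by (simp add: locally_integrable_def set_integrable_def)

lemma continuous_imp_locally_integrable:
 assumes "continuous_on \<Omega> f"
 shows "locally_integrable \<Omega> f"
 unfolding locally_integrable_def set_integrable_def
 using assms by (blast intro: borel_integrable_compact continuous_on_subset)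

text \<open>For open \<Omega> an exhaustion by compact sets: bounded points at distance at least
  \<open>eps n\<close> from the complement.\<close>

definition exh :: "'a::euclidean_space set \<Rightarrow> nat \<Rightarrow> 'a set" where
 "exh \<Omega> n = cball 0 (real n) \<inter> {x. ball x (eps n) \<subseteq> \<Omega>}"

lemma exh_compact: "compact (exh \<Omega> n)"
proof -
 have "{x. ball x (eps n) \<subseteq> \<Omega>} = - (\<Union>y\<in>-\<Omega>. ball y (eps n))"
  by (auto simp: dist_commute subset_iff)
 then have "closed {x. ball x (eps n) \<subseteq> \<Omega>}" by (auto intro: open_UN)
 then show ?thesis unfolding exh_def by (rule compact_Int_closed[OF compact_cball])
qed

lemma exh_subset: "exh \<Omega> n \<subseteq> \<Omega>"
 by (auto simp: exh_def intro: eps_pos)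

lemma eps_antimono: "m \<le> n \<Longrightarrow> eps n \<le> eps m"
 by (simp add: eps_def field_simps)

lemma exh_mono: "m \<le> n \<Longrightarrow> exh \<Omega> m \<subseteq> exh \<Omega> n"
 unfolding exh_def using subset_ball[OF eps_antimono[of m n]] by fastforce

lemma exh_UN:
 assumes "open \<Omega>"
 shows "(\<Union>n. exh \<Omega> n) = \<Omega>"
proof (intro equalityI subsetI)
 fix x assume "x \<in> \<Omega>"
 then obtain e where e: "e > 0" "ball x e \<subseteq> \<Omega>" using assms by (meson openE)
 obtain N1 where N1: "\<And>n. n \<ge> N1 \<Longrightarrow> eps n < e"
  using eventually_eps_less[OF e(1)] by (auto simp: eventually_sequentially)
 obtain N2 where N2: "real N2 \<ge> norm x" using real_arch_simple by blast
 have "x \<in> exh \<Omega> (max N1 N2)"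
  using N1[of "max N1 N2"] N2 e by (auto simp: exh_def subset_iff)
 then show "x \<in> (\<Union>n. exh \<Omega> n)" by blast
qed (use exh_subset in blast)

text \<open>Local integrability directly gives measurability of the restrictions to compact subsets
  only; the function itself is their limit along the exhaustion.\<close>

lemma locally_integrable_measurable:
 assumes "locally_integrable \<Omega> f" "open \<Omega>"
 shows "borel_fun (\<lambda>x. indc \<Omega> x * f x)"
proof (rule borel_measurable_LIMSEQ_real)
 show "borel_fun (\<lambda>x. indc (exh \<Omega> n) x * f x)" for n
  using locally_integrable_cut[OF assms(1) exh_compact exh_subset, of n] by auto
 fix x
 show "(\<lambda>n. indc (exh \<Omega> n) x * f x) \<longlonglongrightarrow> indc \<Omega> x * f x"
 proof (cases "x \<in> \<Omega>")
  case True
  then obtain n where n: "x \<in> exh \<Omega> n" using exh_UN[OF assms(2)] by blast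
  then have "x \<in> exh \<Omega> m" if "m \<ge> n" for m using exh_mono[OF that] by blast
  then have "eventually (\<lambda>m. indc (exh \<Omega> m) x * f x = indc \<Omega> x * f x) sequentially"
   unfolding eventually_sequentially using True by (intro exI[of _ n]) simp
  then show ?thesis by (rule tendsto_eventually)
 next
  case False
  then have "x \<notin> exh \<Omega> n" for n using exh_subset by blast
  then show ?thesis using False by simp
 qed
qed

lemma moll_cut_eq:
 assumes "e > 0" "cball x e \<subseteq> S" "S \<subseteq> \<Omega>"
 shows "moll e (\<lambda>y. indc S y * f y) x = (LINT y:\<Omega>|lborel. f y * eta e (x - y))"
 unfolding moll_def set_lebesgue_integral_def
proof (rule lint_cong[OF refl])
 fix y
 show "indc S y * f y * eta e (x - y) = indc \<Omega> y *\<^sub>R (f y * eta e (x - y))"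
 proof (cases "y \<in> cball x e")
  case True
  then have "y \<in> S" "y \<in> \<Omega>" using assms by auto
  then show ?thesis by simp
 next
  case False
  then have "eta e (x - y) = 0" using assms by (intro eta_eq_0) (auto simp: dist_norm)
  then show ?thesis by simp
 qed
qed

text \<open>The kernel centred at \<open>x\<close> is itself an admissible test function as long as
  its ball lies in \<open>S\<close>. The sign in the definition of the weak derivative cancels
  against that of the inner derivative of \<open>x - y\<close>. Cutting off to \<open>S\<close>
  makes the mollified functions integrable without changing anything near \<open>x\<close>.\<close>

lemma moll_weak_deriv:
 assumes w: "weak_deriv \<Omega> e f f'" and S: "compact S" "S \<subseteq> \<Omega>"
  and x: "d > 0" "cball x d \<subseteq> S"
 shows "dmoll d (\<lambda>y. indc S y * f y) x \<bullet> e = moll d (\<lambda>y. indc S y * f' y) x"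
proof -
 have f: "locally_integrable \<Omega> f" and f': "locally_integrable \<Omega> f'"
  using w by (auto simp: weak_deriv_def)
 have "dmoll d (\<lambda>y. indc S y * f y) x \<bullet> e = (LBINT y. indc S y * f y * (deta d (x - y) \<bullet> e))"
  by (rule dmoll_inner[OF locally_integrable_cut[OF f S] x(1)])
 also have "\<dots> = (LBINT y. - (indc \<Omega> y *\<^sub>R (f y * frechet_derivative (\<lambda>y. eta d (x - y)) (at y) e)))"
 proof (rule lint_cong[OF refl])
  fix y
  show "indc S y * f y * (deta d (x - y) \<bullet> e) = - (indc \<Omega> y *\<^sub>R (f y * frechet_derivative (\<lambda>y. eta d (x - y)) (at y) e))"
  proof (cases "y \<in> cball x d")
   case True
   then have "y \<in> S" "y \<in> \<Omega>" using x S by auto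
   then show ?thesis by (simp add: frechet_derivative_eta_shift)
  next
   case False
   then have "deta d (x - y) = 0" using x by (intro deta_eq_0) (auto simp: dist_norm)
   then show ?thesis by (simp add: frechet_derivative_eta_shift)
  qed
 qed
 also have "\<dots> = - (LINT y:\<Omega>|lborel. f y * frechet_derivative (\<lambda>y. eta d (x - y)) (at y) e)"
  by (simp add: set_lebesgue_integral_def)
 also have "\<dots> = (LINT y:\<Omega>|lborel. f' y * eta d (x - y))"
  using w test_function_eta[of d x \<Omega>] x S by (auto simp: weak_deriv_def)
 also have "\<dots> = moll d (\<lambda>y. indc S y * f' y) x"
  by (rule moll_cut_eq[OF x S(2), symmetric])
 finally show ?thesis .
qed

text \<open>The fundamental lemma of the calculus of variations, with the kernels as the only tests.
  The cut-off of \<open>f\<close> is the \<open>L1\<close> limit of its mollifications, and these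
  vanish on the smaller set \<open>exh \<Omega> N\<close>.\<close>

lemma AE_eq_0_if_moll_eq_0:
 fixes f :: "'a::euclidean_space \<Rightarrow> real"
 assumes f: "locally_integrable \<Omega> f" and \<Omega>: "open \<Omega>"
  and zero: "\<And>x n. cball x (eps n) \<subseteq> \<Omega> \<Longrightarrow> (LINT y:\<Omega>|lborel. f y * eta (eps n) (x - y)) = 0"
 shows "AE x in lborel. x \<in> \<Omega> \<longrightarrow> f x = 0"
proof -
 have "AE x in lborel. x \<in> exh \<Omega> N \<longrightarrow> f x = 0" for N
 proof -
  \<comment> \<open>With this index, \<open>2 * eps M \<le> eps N\<close> and
    \<open>real M \<ge> real N + 1\<close>. Hence balls of radius \<open>eps n\<close> with
    \<open>n \<ge> M\<close> around points of \<open>exh \<Omega> N\<close> stay inside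
    \<open>exh \<Omega> M\<close>.\<close>
  define M where "M = 2 * N + 2"
  have sub: "cball x (eps n) \<subseteq> exh \<Omega> M" if "x \<in> exh \<Omega> N" "n \<ge> M" for x n
  proof
   fix y assume y: "y \<in> cball x (eps n)"
   have en: "eps n \<le> eps M" by (rule eps_antimono[OF that(2)])
   have e2: "eps M + eps M \<le> eps N" by (simp add: M_def eps_def field_simps)
   have "eps M \<le> 1" by (simp add: eps_def field_simps)
   moreover have "norm y \<le> norm x + dist x y"
    using norm_triangle_ineq4[of x "x - y"] by (simp add: dist_norm)
   ultimately have "norm y \<le> real M" using that(1) y en by (auto simp: exh_def M_def)
   moreover have "ball y (eps M) \<subseteq> ball x (eps N)"
   proof
    fix z assume "z \<in> ball y (eps M)"
    then have "dist x z < eps M + eps M"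
     using dist_triangle[of x z y] y en by auto
    then show "z \<in> ball x (eps N)" using e2 by simp
   qed
   ultimately show "y \<in> exh \<Omega> M" using that(1) by (auto simp: exh_def)
  qed
  let ?F = "\<lambda>y. indc (exh \<Omega> M) y * f y"
  have F: "intble ?F" by (rule locally_integrable_cut[OF f exh_compact exh_subset])
  note lim = moll_tendsto_L1(2)[OF F]
  have [measurable]: "exh \<Omega> N \<in> sets borel" "exh \<Omega> M \<in> sets borel"
   by (auto intro: borel_closed compact_imp_closed exh_compact)
  have le: "(LBINT x. indc (exh \<Omega> N) x * \<bar>?F x\<bar>) \<le> (LBINT x. \<bar>moll (eps n) ?F x - ?F x\<bar>)" if "n \<ge> M" for n
  proof (rule integral_mono)
   show "intble (\<lambda>x. indc (exh \<Omega> N) x * \<bar>?F x\<bar>)"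
    using integrable_mult_indicator[of "exh \<Omega> N" lborel "\<lambda>x. \<bar>?F x\<bar>"] F by simp
   show "intble (\<lambda>x. \<bar>moll (eps n) ?F x - ?F x\<bar>)"
    using F moll_tendsto_L1(1)[OF F] by auto
   fix x
   show "indc (exh \<Omega> N) x * \<bar>?F x\<bar> \<le> \<bar>moll (eps n) ?F x - ?F x\<bar>"
   proof (cases "x \<in> exh \<Omega> N")
    case True
    have "moll (eps n) ?F x = 0"
     using sub[OF True that] exh_subset[of \<Omega> M] zero[of x n]
     by (subst moll_cut_eq[of _ _ _ \<Omega>]) auto
    then show ?thesis by (simp add: indicator_def)
   qed simp
  qed
  have "(LBINT x. indc (exh \<Omega> N) x * \<bar>?F x\<bar>) \<le> 0"
   by (rule LIMSEQ_le_const[OF lim]) (use le in auto)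
  then have "(LBINT x. indc (exh \<Omega> N) x * \<bar>?F x\<bar>) = 0" by (intro antisym) auto
  then have "AE x in lborel. indc (exh \<Omega> N) x * \<bar>?F x\<bar> = 0"
   using integrable_mult_indicator[of "exh \<Omega> N" lborel "\<lambda>x. \<bar>?F x\<bar>"] F
   by (subst (asm) integral_nonneg_eq_0_iff_AE) auto
  then show ?thesis
  proof eventually_elim
   case (elim x)
   have "exh \<Omega> N \<subseteq> exh \<Omega> M" by (rule exh_mono) (simp add: M_def)
   then show ?case using elim by (auto simp: indicator_def)
  qed
 qed
 then have "AE x in lborel. \<forall>N. x \<in> exh \<Omega> N \<longrightarrow> f x = 0"
  unfolding AE_all_countable by blast
 then show ?thesis
  by eventually_elim (use exh_UN[OF \<Omega>] in blast)
qed

lemma locally_integrable_diff: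
 assumes "locally_integrable \<Omega> f" "locally_integrable \<Omega> g"
 shows "locally_integrable \<Omega> (\<lambda>x. f x - g x)"
 using assms unfolding locally_integrable_def by (auto intro: set_integral_diff)

lemma set_integrable_mult_eta:
 assumes f: "locally_integrable \<Omega> f" and c: "e > 0" "cball x e \<subseteq> \<Omega>"
 shows "set_integrable lborel \<Omega> (\<lambda>y. f y * eta e (x - y))"
proof -
 have "intble (\<lambda>y. indc (cball x e) y * f y * eta e (x - y))"
  by (rule moll_integrable(1)[OF locally_integrable_cut[OF f compact_cball c(2)] c(1)])
 also have "(\<lambda>y. indc (cball x e) y * f y * eta e (x - y)) = (\<lambda>y. indc \<Omega> y *\<^sub>R (f y * eta e (x - y)))"
 proof
  fix y
  show "indc (cball x e) y * f y * eta e (x - y) = indc \<Omega> y *\<^sub>R (f y * eta e (x - y))"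
  proof (cases "y \<in> cball x e")
   case True
   then have "y \<in> \<Omega>" using c by auto
   then show ?thesis using True by simp
  next
   case False
   then have "eta e (x - y) = 0" using c by (intro eta_eq_0) (auto simp: dist_norm)
   then show ?thesis by simp
  qed
 qed
 finally show ?thesis by (simp add: set_integrable_def)
qed

lemma weak_deriv_unique:
 assumes "weak_deriv \<Omega> e f f1" "weak_deriv \<Omega> e f f2" "open \<Omega>"
 shows "AE x in lborel. x \<in> \<Omega> \<longrightarrow> f1 x = f2 x"
proof -
 have l: "locally_integrable \<Omega> f1" "locally_integrable \<Omega> f2" using assms by (auto simp: weak_deriv_def)
 have "AE x in lborel. x \<in> \<Omega> \<longrightarrow> f1 x - f2 x = 0"
 proof (rule AE_eq_0_if_moll_eq_0[OF locally_integrable_diff[OF l] assms(3)])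
  fix x n assume c: "cball x (eps n) \<subseteq> \<Omega>"
  have eq: "(LINT y:\<Omega>|lborel. f1 y * eta (eps n) (x - y)) = (LINT y:\<Omega>|lborel. f2 y * eta (eps n) (x - y))"
   using assms(1,2) test_function_eta[OF eps_pos c] by (simp add: weak_deriv_def)
  show "(LINT y:\<Omega>|lborel. (f1 y - f2 y) * eta (eps n) (x - y)) = 0"
   unfolding left_diff_distrib
   by (subst set_integral_diff) (use eq set_integrable_mult_eta[OF l(1) eps_pos c] set_integrable_mult_eta[OF l(2) eps_pos c] in auto)
 qed
 then show ?thesis by simp
qed

section \<open>Integration by parts\<close>

lemma c1_mult:
 assumes "c1 f F" "c1 g G"
 shows "c1 (\<lambda>x. f x * g x) (\<lambda>x. f x *\<^sub>R G x + g x *\<^sub>R F x)"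
 unfolding c1_def
proof (intro conjI allI)
 fix x
 have "((\<lambda>x. f x * g x) has_derivative (\<lambda>h. f x * (G x \<bullet> h) + (F x \<bullet> h) * g x)) (at x)"
  by (rule has_derivative_mult[OF c1_has_derivative[OF assms(1)] c1_has_derivative[OF assms(2)]])
 then show "((\<lambda>x. f x * g x) has_derivative (\<lambda>h. (f x *\<^sub>R G x + g x *\<^sub>R F x) \<bullet> h)) (at x)"
  by (simp add: inner_add_left mult.commute)
 show "continuous_on UNIV (\<lambda>x. f x *\<^sub>R G x + g x *\<^sub>R F x)"
  using assms by (intro continuous_intros c1_continuous c1_gradient_continuous)
qed

lemma c1_cong_continuous_integrable:
 fixes f :: "'a::euclidean_space \<Rightarrow> real"
 assumes "c1 f F" "\<And>x. norm x > R \<Longrightarrow> f x = 0"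
 shows "intble f" "intble (\<lambda>x. F x \<bullet> b)"
proof -
 show "intble f"
  by (rule continuous_compact_support_integrable[OF c1_continuous[OF assms(1)] assms(2)])
 show "intble (\<lambda>x. F x \<bullet> b)"
  by (rule continuous_compact_support_integrable[of _ R])
   (use gradient_eq_0_outside[OF assms] c1_gradient_continuous[OF assms(1)] in \<open>auto intro!: continuous_intros\<close>)
qed

text \<open>Difference quotients of \<open>f\<close> in the direction \<open>b\<close> have integral
  0 by translation invariance. The Lipschitz bound and the compact support provide a dominating
  function for the passage to the derivative.\<close>

lemma integral_gradient_eq_0:
 fixes f :: "'a::euclidean_space \<Rightarrow> real"
 assumes c: "c1 f F" and supp: "\<And>x. norm x > R \<Longrightarrow> f x = 0"
 shows "(LBINT x. F x \<bullet> b) = 0"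
proof -
 have [measurable]: "borel_fun f" "borel_fun (\<lambda>x. F x \<bullet> b)"
  using c1_cong_continuous_integrable[OF assms] by auto
 have "\<exists>C\<ge>0. \<forall>x. norm (F x) \<le> C"
  by (rule bounded_compact_support[OF c1_gradient_continuous[OF c], of R]) (rule gradient_eq_0_outside[OF assms])
 then obtain C where C: "C \<ge> 0" "\<And>x. norm (F x) \<le> C" by blast
 have lip: "\<bar>f (x + h) - f x\<bar> \<le> C * norm h" for x h
 proof -
  have "norm (f (x + h) - f x) \<le> C * norm (x + h - x)"
  proof (rule differentiable_bound[of UNIV f "\<lambda>w v. F w \<bullet> v"])
   fix w
   show "(f has_derivative (\<lambda>v. F w \<bullet> v)) (at w within UNIV)" using c1_has_derivative[OF c] by simp
   have "norm (F w \<bullet> v) \<le> C * norm v" for v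
    using Cauchy_Schwarz_ineq2[of "F w" v] mult_right_mono[OF C(2)[of w], of "norm v"] by simp
   then show "onorm (\<lambda>v. F w \<bullet> v) \<le> C" by (rule onorm_le)
  qed auto
  then show ?thesis by simp
 qed
 define q where "q n x = (f (x + eps n *\<^sub>R b) - f x) / eps n" for n x
 have "(\<lambda>n. (LBINT x. q n x)) \<longlonglongrightarrow> (LBINT x. F x \<bullet> b)"
 proof (rule integral_dominated_convergence[where w="\<lambda>x. (C * norm b) * indc (cball 0 (R + norm b)) x"])
  show "intble (\<lambda>x. (C * norm b) * indc (cball (0::'a) (R + norm b)) x)"
   using emeasure_lborel_cball_finite[of "0::'a" "R + norm b"]
   by (intro integrable_mult_right integrable_real_indicator) auto
  show "AE x in lborel. (\<lambda>n. q n x) \<longlonglongrightarrow> F x \<bullet> b"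
  proof (rule AE_I2)
   fix x
   have "((\<lambda>s. f (x + s *\<^sub>R b)) has_derivative (\<lambda>s. F x \<bullet> (s *\<^sub>R b))) (at 0)"
    by (rule has_derivative_compose[of "\<lambda>s. x + s *\<^sub>R b" "\<lambda>s. s *\<^sub>R b" 0 UNIV f])
     (auto intro!: derivative_eq_intros c1_has_derivative[OF c])
   then have "((\<lambda>s. f (x + s *\<^sub>R b)) has_real_derivative (F x \<bullet> b)) (at 0)"
    by (simp add: has_field_derivative_def mult_commute_abs)
   then have "((\<lambda>h. (f (x + h *\<^sub>R b) - f x) / h) \<longlongrightarrow> F x \<bullet> b) (at 0)"
    by (simp add: DERIV_def)
   moreover have "filterlim eps (at 0) sequentially"
    unfolding filterlim_at using eps_tendsto by (auto simp: less_imp_neq[THEN not_sym])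
   ultimately show "(\<lambda>n. q n x) \<longlonglongrightarrow> F x \<bullet> b"
    unfolding q_def by (rule filterlim_compose)
  qed
  show "AE x in lborel. norm (q n x) \<le> (C * norm b) * indc (cball 0 (R + norm b)) x" for n
  proof (rule AE_I2)
   fix x
   have e1: "eps n \<le> 1" by (simp add: eps_def field_simps)
   show "norm (q n x) \<le> (C * norm b) * indc (cball 0 (R + norm b)) x"
   proof (cases "x \<in> cball 0 (R + norm b)")
    case True
    have "\<bar>f (x + eps n *\<^sub>R b) - f x\<bar> \<le> (C * norm b) * eps n"
     using lip[of x "eps n *\<^sub>R b"] less_imp_le[OF eps_pos[of n]] by (simp add: mult_ac)
    then show ?thesis using True by (simp add: q_def divide_le_eq less_imp_le)
   next
    case False
    have "norm x \<le> norm (x + eps n *\<^sub>R b) + norm (eps n *\<^sub>R b)"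
     using norm_triangle_ineq4[of "x + eps n *\<^sub>R b" "eps n *\<^sub>R b"] by simp
    moreover have "norm (eps n *\<^sub>R b) \<le> norm b"
     using mult_right_mono[OF e1, of "norm b"] less_imp_le[OF eps_pos[of n]] by simp
    moreover have "norm b \<ge> 0" by simp
    ultimately have "norm (x + eps n *\<^sub>R b) > R" "norm x > R" using False unfolding mem_cball_0 by linarith+
    then show ?thesis using False supp by (simp add: q_def)
   qed
  qed
 qed (auto simp: q_def)
 moreover have "(LBINT x. q n x) = 0" for n
 proof -
  have i: "intble f" by (rule c1_cong_continuous_integrable(1)[OF assms])
  then have i2: "intble (\<lambda>x. f (x + eps n *\<^sub>R b))" by (subst integrable_translate_lborel) auto
  have "(LBINT x. f (x + eps n *\<^sub>R b) - f x) = 0"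
   using i i2 integral_translate_lborel[of f "eps n *\<^sub>R b"] by simp
  then show ?thesis by (simp add: q_def)
 qed
 ultimately show ?thesis by (simp add: LIMSEQ_const_iff)
qed

lemma integration_by_parts:
 fixes f :: "'a::euclidean_space \<Rightarrow> real"
 assumes f: "c1 f F" and g: "c1 g G" and supp: "\<And>x. norm x > R \<Longrightarrow> g x = 0"
 shows "(LBINT x. (F x \<bullet> b) * g x) = - (LBINT x. f x * (G x \<bullet> b))"
proof -
 have i1: "intble (\<lambda>x. (F x \<bullet> b) * g x)"
  by (rule continuous_compact_support_integrable[of _ R])
   (use supp in \<open>auto intro!: continuous_intros c1_gradient_continuous[OF f] c1_continuous[OF g]\<close>)
 have i2: "intble (\<lambda>x. f x * (G x \<bullet> b))"
  by (rule continuous_compact_support_integrable[of _ R])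
   (use gradient_eq_0_outside[OF g supp] in \<open>auto intro!: continuous_intros c1_gradient_continuous[OF g] c1_continuous[OF f]\<close>)
 have "(LBINT x. (f x *\<^sub>R G x + g x *\<^sub>R F x) \<bullet> b) = 0"
  by (rule integral_gradient_eq_0[OF c1_mult[OF f g], of R]) (simp add: supp)
 then have "(LBINT x. f x * (G x \<bullet> b) + (F x \<bullet> b) * g x) = 0"
  by (simp add: inner_add_left mult.commute)
 then show ?thesis using i1 i2 by simp
qed

section \<open>Steklov averages\<close>

text \<open>The forward average in time. It occurs because an increment of \<open>v\<close> over a
  time step of length \<open>e\<close> is \<open>e\<close> times the Steklov average of
  \<open>Q\<close>.\<close>

definition steklov :: "real \<Rightarrow> ('a::euclidean_space \<times> real \<Rightarrow> real) \<Rightarrow> 'a \<times> real \<Rightarrow> real" where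
 "steklov e f p = (LBINT d. indc {0..e} d * f (fst p, snd p + d)) / e"

lemma steklov_tendsto_L2:
 fixes f :: "'a::euclidean_space \<times> real \<Rightarrow> real"
 assumes f: "L2 lborel f"
 shows "L2 lborel (steklov (eps n) f)"
  and "(\<lambda>n. (LBINT x. (steklov (eps n) f x - f x)\<^sup>2)) \<longlonglongrightarrow> 0"
proof -
 have [measurable]: "borel_fun f" using f by (simp add: L2_def)
 \<comment> \<open>The uniform distribution on \<open>{0..eps n}\<close>. Its image \<open>d\<close>
   on the time axis of space-time turns the Steklov average into an average of translates.\<close>
 define U where "U n = density lborel (\<lambda>e. ennreal (indc {0..eps n} e / eps n))" for n
 define d where "d n = distr (U n) borel (\<lambda>e. (0::'a, e::real))" for n
 have [measurable]: "(\<lambda>e. (0::'a, e::real)) \<in> borel_measurable (U n)" for n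
  unfolding U_def by measurable
 have pU: "prob_space (U n)" for n
 proof (rule prob_spaceI)
  have "emeasure (U n) (space (U n)) = (\<integral>\<^sup>+e. ennreal (indc {0..eps n} e / eps n) \<partial>lborel)"
   unfolding U_def by (subst emeasure_density) auto
  also have "\<dots> = (\<integral>\<^sup>+e. ennreal (1 / eps n) * indc {0..eps n} e \<partial>lborel)"
   by (intro nn_integral_cong) (auto simp: indicator_def)
  also have "\<dots> = ennreal (1 / eps n) * ennreal (eps n)"
   using less_imp_le[OF eps_pos[of n]] by (subst nn_integral_cmult_indicator) auto
  also have "\<dots> = 1"
   by (subst ennreal_mult[symmetric]) (auto simp: eps_def)
  finally show "emeasure (U n) (space (U n)) = 1" .
 qed
 have pd: "prob_space (d n)" for n
  unfolding d_def by (rule prob_space.prob_space_distr[OF pU]) measurable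
 have conc: "AE k in d n. norm k \<le> eps n" for n
  unfolding d_def
 proof (subst AE_distr_iff)
  show "AE e in U n. norm (0::'a, e) \<le> eps n"
   unfolding U_def by (subst AE_density) (auto simp: norm_Pair indicator_def split: if_splits)
 qed auto
 have eq: "steklov (eps n) f x = (\<integral>k. f (x + k) \<partial>d n)" for n x
 proof -
  have "(\<integral>k. f (x + k) \<partial>d n) = (\<integral>e. f (x + (0, e)) \<partial>U n)"
   unfolding d_def by (rule integral_distr) auto
  also have "\<dots> = (LBINT e. (indc {0..eps n} e / eps n) * f (x + (0, e)))"
   unfolding U_def by (subst integral_density) (auto simp: less_imp_le)
  also have "\<dots> = steklov (eps n) f x"
   unfolding steklov_def by (cases x) (simp add: mult.commute)
  finally show ?thesis by simp
 qed
 have sd: "sets (d n) = sets borel" for n by (simp add: d_def)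
 note * = average_tendsto_L2[of f d eps, OF f pd sd conc eps_tendsto]
 show "L2 lborel (steklov (eps n) f)"
  using *(1)[of n] by (simp add: eq[symmetric])
 show "(\<lambda>n. (LBINT x. (steklov (eps n) f x - f x)\<^sup>2)) \<longlonglongrightarrow> 0"
  using *(2) by (simp add: eq[symmetric])
qed

lemma AE_translate_lborel:
 fixes e :: "'a::euclidean_space"
 assumes "AE s in lborel. Q s"
 shows "AE s in lborel. Q (s + e)"
proof -
 obtain N where N: "{s. \<not> Q s} \<subseteq> N" "N \<in> null_sets (lborel :: 'a measure)"
  using assms by (auto simp: eventually_ae_filter)
 have [measurable]: "N \<in> sets borel" using N(2) by auto
 have "(\<integral>\<^sup>+s. indc N (s + e) \<partial>lborel) = (\<integral>\<^sup>+s. indc N s \<partial>lborel)"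
  by (rule nn_integral_translate_lborel) measurable
 also have "\<dots> = 0" using N(2) by auto
 finally have "AE s in lborel. indc N (s + e) = (0::ennreal)"
  by (subst (asm) nn_integral_0_iff_AE) auto
 then show ?thesis
  by eventually_elim (use N(1) in \<open>auto simp: indicator_def split: if_splits\<close>)
qed

section \<open>The cut-off functions\<close>

definition Phi :: "real \<Rightarrow> 'a::euclidean_space \<Rightarrow> real" where
 "Phi R y = (max 0 (1 - (norm y)\<^sup>2 / R\<^sup>2))\<^sup>2"

definition dPhi :: "real \<Rightarrow> 'a::euclidean_space \<Rightarrow> 'a" where
 "dPhi R y = (- 4 * max 0 (1 - (norm y)\<^sup>2 / R\<^sup>2) / R\<^sup>2) *\<^sub>R y"

lemma max0_square_has_derivative: "((\<lambda>t::real. (max 0 t)\<^sup>2) has_real_derivative 2 * max 0 t) (at t)"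
proof -
 consider "t < 0" | "t = 0" | "t > 0" by linarith
 then show ?thesis
 proof cases
  case 1
  have "((\<lambda>t::real. (max 0 t)\<^sup>2) has_real_derivative 0) (at t)"
   by (rule has_field_derivative_transform_within_open[of "\<lambda>_. 0" _ _ "{..<0}"]) (use 1 in auto)
  then show ?thesis using 1 by simp
 next
  case 2
  have "((\<lambda>h::real. ((max 0 (0 + h))\<^sup>2 - (max 0 0)\<^sup>2) / h) \<longlongrightarrow> max 0 0) (at 0)"
  proof (rule Lim_transform_eventually)
   show "((\<lambda>h::real. max 0 h) \<longlongrightarrow> max 0 0) (at 0)" by (intro tendsto_intros)
   show "\<forall>\<^sub>F h::real in at 0. max 0 h = ((max 0 (0 + h))\<^sup>2 - (max 0 0)\<^sup>2) / h"
    by (auto simp: eventually_at_filter max_def power2_eq_square)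
  qed
  then show ?thesis using 2 by (simp add: DERIV_def)
 next
  case 3
  have "((\<lambda>t::real. t\<^sup>2) has_real_derivative 2 * t) (at t)"
   by (auto intro!: derivative_eq_intros)
  then have "((\<lambda>t::real. (max 0 t)\<^sup>2) has_real_derivative 2 * t) (at t)"
   by (rule has_field_derivative_transform_within_open[of _ _ _ "{0<..}"]) (use 3 in auto)
  then show ?thesis using 3 by simp
 qed
qed

lemma c1_Phi: "c1 (Phi R) (dPhi R :: 'a::euclidean_space \<Rightarrow> 'a)"
 unfolding c1_def
proof (intro conjI allI)
 fix x :: 'a
 have "((\<lambda>y::'a. 1 - (norm y)\<^sup>2 / R\<^sup>2) has_derivative (\<lambda>h. - (2 * (x \<bullet> h)) / R\<^sup>2)) (at x)"
  unfolding power2_norm_eq_inner divide_inverse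
  by (auto intro!: derivative_eq_intros simp: inner_commute algebra_simps)
 from has_derivative_compose[OF this max0_square_has_derivative[unfolded has_field_derivative_def]]
 have "(Phi R has_derivative (\<lambda>h. 2 * max 0 (1 - (norm x)\<^sup>2 / R\<^sup>2) * (- (2 * (x \<bullet> h)) / R\<^sup>2))) (at x)"
  by (simp add: Phi_def[abs_def])
 moreover have "2 * max 0 (1 - (norm x)\<^sup>2 / R\<^sup>2) * (- (2 * (x \<bullet> h)) / R\<^sup>2) = dPhi R x \<bullet> h" for h
  by (simp add: dPhi_def)
 ultimately show "(Phi R has_derivative (\<lambda>h. dPhi R x \<bullet> h)) (at x)" by simp
 show "continuous_on UNIV (dPhi R :: 'a \<Rightarrow> 'a)"
  unfolding dPhi_def divide_inverse by (intro continuous_intros)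
qed

lemma Phi_nonneg: "0 \<le> Phi R y" by (simp add: Phi_def)

lemma Phi_le_1: "Phi R y \<le> 1"
 unfolding Phi_def by (rule power_le_one) auto

lemma Phi_eq_0:
 assumes "R > 0" "norm y \<ge> R"
 shows "Phi R y = 0" "dPhi R y = 0"
proof -
 have "R\<^sup>2 \<le> (norm y)\<^sup>2" using assms by (intro power_mono) auto
 then have "1 - (norm y)\<^sup>2 / R\<^sup>2 \<le> 0" using assms by (simp add: field_simps)
 then show "Phi R y = 0" "dPhi R y = 0" by (simp_all add: Phi_def dPhi_def)
qed

lemma dPhi_bound:
 assumes R: "R > 0"
 shows "norm (dPhi R y) \<le> 4 / R * sqrt (Phi R y)" "norm (dPhi R y) \<le> 4 / R"
proof -
 let ?m = "max 0 (1 - (norm y)\<^sup>2 / R\<^sup>2)"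
 have s: "sqrt (Phi R y) = ?m" by (simp add: Phi_def)
 show 1: "norm (dPhi R y) \<le> 4 / R * sqrt (Phi R y)"
 proof (cases "norm y \<ge> R")
  case True
  then show ?thesis using Phi_eq_0[OF R True] by simp
 next
  case False
  have "norm (dPhi R y) = 4 * ?m / R\<^sup>2 * norm y" by (simp add: dPhi_def abs_mult)
  also have "\<dots> \<le> 4 * ?m / R\<^sup>2 * R"
  proof (rule mult_left_mono)
   show "norm y \<le> R" using False by simp
   show "0 \<le> 4 * ?m / R\<^sup>2" by (intro divide_nonneg_nonneg mult_nonneg_nonneg) auto
  qed
  also have "\<dots> = 4 / R * ?m" using R by (simp add: power2_eq_square)
  finally show ?thesis by (simp add: s)
 qed
 also have "\<dots> \<le> 4 / R * 1" using R Phi_le_1[of R y] by (intro mult_left_mono) (auto simp: real_sqrt_le_1_iff)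
 finally show "norm (dPhi R y) \<le> 4 / R" by simp
qed

lemma Phi_tendsto_1: "(\<lambda>n. Phi (real (Suc n)) y) \<longlonglongrightarrow> 1"
proof -
 have "(\<lambda>n. (max 0 (1 - (norm y)\<^sup>2 * (eps n)\<^sup>2))\<^sup>2) \<longlonglongrightarrow> (max 0 (1 - (norm y)\<^sup>2 * 0\<^sup>2))\<^sup>2"
  by (intro tendsto_intros eps_tendsto)
 then show ?thesis by (simp add: Phi_def eps_def divide_inverse power_inverse)
qed

lemma Phi_continuous: "continuous_on S (Phi R :: 'a::euclidean_space \<Rightarrow> real)"
 by (rule continuous_on_subset[OF c1_continuous[OF c1_Phi] subset_UNIV])

lemma dPhi_continuous: "continuous_on S (dPhi R :: 'a::euclidean_space \<Rightarrow> 'a)"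
 by (rule continuous_on_subset[OF c1_gradient_continuous[OF c1_Phi] subset_UNIV])

lemma Phi_measurable [measurable]: "borel_fun (Phi R :: 'a::euclidean_space \<Rightarrow> real)"
 by (intro borel_measurable_continuous_onI Phi_continuous)

lemma dPhi_measurable [measurable]: "borel_fun (dPhi R :: 'a::euclidean_space \<Rightarrow> 'a)"
 by (intro borel_measurable_continuous_onI dPhi_continuous)

section \<open>Monotonicity of the frequency in similarity variables\<close>

text \<open>The analytic core, detached from the diffeomorphism. \<open>P t\<close> is the gradient
  of \<open>v\<close> on the slice at time \<open>t\<close>; it is meaningful for every
  \<open>t\<close> but not known to be jointly measurable. \<open>Pj\<close> is a jointly measurable
  version that agrees with it on almost every slice. In \<open>equation\<close> the exceptional null
  set of times \<open>s\<close> does not depend on \<open>r\<close>, so the time \<open>r\<close>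
  can be coupled to \<open>s\<close> when integrating over \<open>s\<close>.\<close>

locale frequency =
 fixes v W Q :: "'a::euclidean_space \<times> real \<Rightarrow> real" and Pj :: "'a \<times> real \<Rightarrow> 'a"
  and P :: "real \<Rightarrow> 'a \<Rightarrow> 'a" and T c :: real
 assumes T_pos: "T > 0" and c_nonneg: "c \<ge> 0"
  and v_meas [measurable]: "borel_fun v"
  and W_meas [measurable]: "borel_fun W"
  and Q_meas [measurable]: "borel_fun Q"
  and Pj_meas [measurable]: "borel_fun Pj"
  and P_meas: "\<And>t. 0 < t \<Longrightarrow> t < T \<Longrightarrow> P t \<in> borel_measurable borel"
  and v_cont: "continuous_on (UNIV \<times> {0<..<T}) v"
  and W_cont: "continuous_on (UNIV \<times> {0<..<T}) W"
  and W_pos: "\<And>y t. 0 < t \<Longrightarrow> t < T \<Longrightarrow> W (y, t) > 0"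
  and W_incr: "\<And>y s r. 0 < s \<Longrightarrow> s \<le> r \<Longrightarrow> r < T \<Longrightarrow> s powr c * W (y, s) \<le> r powr c * W (y, r)"
  and W_decr: "\<And>y s r. 0 < s \<Longrightarrow> s \<le> r \<Longrightarrow> r < T \<Longrightarrow> r powr (- c) * W (y, r) \<le> s powr (- c) * W (y, s)"
  and P_int: "\<And>t. 0 < t \<Longrightarrow> t < T \<Longrightarrow> intble (\<lambda>y. (norm (P t y))\<^sup>2 * W (y, t))"
  and v_int: "\<And>t. 0 < t \<Longrightarrow> t < T \<Longrightarrow> intble (\<lambda>y. (v (y, t))\<^sup>2 * W (y, t))"
  and Pj_eq: "AE t in lborel. 0 < t \<and> t < T \<longrightarrow> (AE y in lborel. Pj (y, t) = P t y)"
  and Q_loc: "\<And>a b R. 0 < a \<Longrightarrow> b < T \<Longrightarrow> intble (\<lambda>p. indc (cball 0 R \<times> {a..b}) p * (Q p)\<^sup>2)"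
  and D_loc: "\<And>a b. 0 < a \<Longrightarrow> b < T \<Longrightarrow>
   intble (\<lambda>t. indc {a..b} t * (LBINT y. (norm (P t y))\<^sup>2 * W (y, t)))"
  and H_loc: "\<And>a b. 0 < a \<Longrightarrow> b < T \<Longrightarrow>
   intble (\<lambda>t. indc {a..b} t * (LBINT y. (v (y, t))\<^sup>2 * W (y, t)))"
  and increment: "\<And>s r. 0 < s \<Longrightarrow> s \<le> r \<Longrightarrow> r < T \<Longrightarrow>
   AE y in lborel. v (y, r) - v (y, s) = (LBINT t. indc {s..r} t * Q (y, t))"
  and equation: "AE s in lborel. 0 < s \<and> s < T \<longrightarrow> (\<forall>r R. 0 < r \<and> r < T \<and> R > 0 \<longrightarrow>
   (LBINT y. (P s y \<bullet> P r y) * (Phi R y * W (y, s))) + (LBINT y. (P s y \<bullet> dPhi R y) * (v (y, r) * W (y, s)))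
    = s * (LBINT y. Q (y, s) * (v (y, r) * Phi R y * W (y, s))))"
  and ibp: "\<And>t U dU R b. 0 < t \<Longrightarrow> t < T \<Longrightarrow> c1 U dU \<Longrightarrow> (\<And>y. norm y > R \<Longrightarrow> U y = 0) \<Longrightarrow>
   (LBINT y. (P t y \<bullet> b) * U y) = - (LBINT y. v (y, t) * (dU y \<bullet> b))"
begin

lemma slice_continuous:
 assumes "0 < t" "t < T"
 shows "continuous_on S (\<lambda>y. v (y, t))" "continuous_on S (\<lambda>y. W (y, t))"
proof -
 show "continuous_on S (\<lambda>y. v (y, t))"
  by (rule continuous_on_compose2[OF v_cont]) (use assms in \<open>auto intro!: continuous_intros\<close>)
 show "continuous_on S (\<lambda>y. W (y, t))"
  by (rule continuous_on_compose2[OF W_cont]) (use assms in \<open>auto intro!: continuous_intros\<close>)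
qed

lemma W_bounds:
 assumes "0 < a" "b < T"
 shows "\<exists>m M. 0 < m \<and> 0 < M \<and> (\<forall>y t. norm y \<le> R \<and> a \<le> t \<and> t \<le> b \<longrightarrow> m \<le> W (y, t) \<and> W (y, t) \<le> M)"
proof (cases "R \<ge> 0 \<and> a \<le> b")
 case True
 let ?K = "cball (0::'a) R \<times> {a..b}"
 have K: "compact ?K" "?K \<noteq> {}" using True by (auto intro!: compact_Times)
 have c: "continuous_on ?K W" by (rule continuous_on_subset[OF W_cont]) (use assms in auto)
 obtain p where p: "p \<in> ?K" "\<And>q. q \<in> ?K \<Longrightarrow> W p \<le> W q" using continuous_attains_inf[OF K c] by blast
 obtain p' where p': "p' \<in> ?K" "\<And>q. q \<in> ?K \<Longrightarrow> W q \<le> W p'" using continuous_attains_sup[OF K c] by blast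
 have "W p > 0" "W p' > 0" using p p' W_pos[of "snd p" "fst p"] W_pos[of "snd p'" "fst p'"] assms by auto
 then show ?thesis using p p' by (intro exI[of _ "W p"] exI[of _ "W p'"]) auto
next
 case False
 have "\<not> (norm y \<le> R \<and> a \<le> t \<and> t \<le> b)" for y :: 'a and t using False norm_ge_zero[of y] by linarith
 then show ?thesis by (intro exI[of _ 1]) auto
qed

text \<open>The weight is bounded below on balls by a positive constant, so weighted square
  integrability implies local square integrability.\<close>

lemma L2_cut_bound:
 assumes [measurable]: "borel_fun f"
  and int: "intble (\<lambda>y::'a. (f y)\<^sup>2 * W (y, t))" and t: "0 < t" "t < T"
 shows "L2 lborel (\<lambda>y. indc (cball 0 R) y * f y)"
proof -
 obtain m M where m: "0 < m" "\<And>y. norm y \<le> R \<Longrightarrow> m \<le> W (y, t)"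
  using W_bounds[OF t, of R] by auto
 have [measurable]: "cball (0::'a) R \<in> sets borel" by simp
 show ?thesis
  unfolding L2_def
 proof
  show "intble (\<lambda>y. (indc (cball 0 R) y * f y)\<^sup>2)"
  proof (rule lintable_bound)
   show "intble (\<lambda>y. (1 / m) * ((f y)\<^sup>2 * W (y, t)))" using int by simp
   show "AE y in lborel. norm ((indc (cball 0 R) y * f y)\<^sup>2) \<le> norm ((1 / m) * ((f y)\<^sup>2 * W (y, t)))"
   proof (rule AE_I2)
    fix y :: 'a
    show "norm ((indc (cball 0 R) y * f y)\<^sup>2) \<le> norm ((1 / m) * ((f y)\<^sup>2 * W (y, t)))"
    proof (cases "norm y \<le> R")
     case True
     have "(f y)\<^sup>2 * m \<le> (f y)\<^sup>2 * W (y, t)" by (intro mult_left_mono m True) auto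
     then show ?thesis using True m(1) W_pos[OF t, of y] by (simp add: field_simps abs_mult)
    qed (use m(1) in simp)
   qed
  qed measurable
 qed measurable
qed

lemma P_norm_L2: "0 < t \<Longrightarrow> t < T \<Longrightarrow> L2 lborel (\<lambda>y. indc (cball 0 R) y * norm (P t y))"
 using P_meas P_int by (intro L2_cut_bound) auto

lemma continuous_L2_cut:
 fixes f :: "'a \<Rightarrow> real"
 assumes "continuous_on UNIV f"
 shows "L2 lborel (\<lambda>y. indc (cball 0 R) y * f y)"
proof -
 have [measurable]: "borel_fun f" "cball (0::'a) R \<in> sets borel"
  by (auto intro: borel_measurable_continuous_onI assms)
 have "intble (\<lambda>y. indc (cball 0 R) y *\<^sub>R (f y)\<^sup>2)"
  by (rule borel_integrable_compact) (use assms in \<open>auto intro!: continuous_intros intro: continuous_on_subset\<close>)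
 moreover have "(\<lambda>y. indc (cball 0 R) y *\<^sub>R (f y)\<^sup>2) = (\<lambda>y. (indc (cball 0 R) y * f y)\<^sup>2)"
  by (auto simp: fun_eq_iff indicator_def)
 ultimately show ?thesis by (auto simp: L2_def)
qed

lemma slice_integrable:
 fixes f g X k :: "'a \<Rightarrow> real"
 assumes f: "L2 lborel (\<lambda>y. indc (cball 0 R) y * f y)" and g: "L2 lborel (\<lambda>y. indc (cball 0 R) y * g y)"
  and [measurable]: "borel_fun X"
  and X: "\<And>y. \<bar>X y\<bar> \<le> \<bar>f y\<bar> * \<bar>g y\<bar>"
  and k: "continuous_on UNIV k" and supp: "\<And>y. norm y > R \<Longrightarrow> X y * k y = 0"
 shows "intble (\<lambda>y. X y * k y)"
proof -
 have [measurable]: "borel_fun k" by (rule borel_measurable_continuous_onI[OF k(1)])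
 have "compact (k ` cball 0 R)"
  by (rule compact_continuous_image[OF continuous_on_subset[OF k(1)]]) auto
 then obtain C where C: "C > 0" "\<And>y. y \<in> cball 0 R \<Longrightarrow> norm (k y) \<le> C"
  by (metis bounded_pos compact_imp_bounded imageI)
 show ?thesis
 proof (rule lintable_bound)
  show "intble (\<lambda>y. C * ((indc (cball 0 R) y * f y) * (indc (cball 0 R) y * g y)))"
   using L2_mult_integrable[OF f g] by simp
  show "AE y in lborel. norm (X y * k y) \<le> norm (C * ((indc (cball 0 R) y * f y) * (indc (cball 0 R) y * g y)))"
  proof (rule AE_I2)
   fix y
   show "norm (X y * k y) \<le> norm (C * ((indc (cball 0 R) y * f y) * (indc (cball 0 R) y * g y)))"
   proof (cases "norm y \<le> R")
    case True
    have "\<bar>X y\<bar> * \<bar>k y\<bar> \<le> (\<bar>f y\<bar> * \<bar>g y\<bar>) * C"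
     using C(2)[of y] True by (intro mult_mono X) auto
    then show ?thesis using True C(1) by (simp add: abs_mult mult_ac)
   qed (use supp in simp)
  qed
 qed measurable
qed

end

lemma eps_nonneg [simp]: "0 \<le> eps n" "eps n \<noteq> 0"
 by (simp_all add: eps_def)

section \<open>The discrete energy inequality and its summation over time\<close>

context frequency begin

definition A :: "real \<Rightarrow> real \<Rightarrow> real" where
 "A R t = (LBINT y. (norm (P t y))\<^sup>2 * (Phi R y * W (y, t)))"

text \<open>Twice \<open>s powr c\<close> times the weighted density by which the equation at time
  \<open>s\<close> represents the localised energy form; it will be paired with increments of
  \<open>v\<close> and finally with \<open>Q\<close>.\<close>

definition F :: "real \<Rightarrow> 'a \<times> real \<Rightarrow> real" where
 "F R p = 2 * snd p powr c * (snd p * Q p * Phi R (fst p) - Pj p \<bullet> dPhi R (fst p)) * W p"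

text \<open>Countably many cylinders cover all balls and all times in the open interval. This yields
  one null set of times outside of which every radius is admissible.\<close>

lemma Q_slice_L2:
 "AE s in lborel. 0 < s \<and> s < T \<longrightarrow> (\<forall>R. L2 lborel (\<lambda>y. indc (cball 0 R) y * Q (y, s)))"
proof -
 define a b where "a n = T * eps n / 2" and "b n = T - T * eps n / 2" for n
 have ab: "a n > 0" "b n < T" for n using T_pos by (auto simp: a_def b_def)
 have "AE s in lborel. intble (\<lambda>y. indc (cball 0 (real n) \<times> {a n..b n}) (y, s) * (Q (y, s))\<^sup>2)" for n
  using lborel_AE_integrable_snd[OF Q_loc[OF ab]] by simp
 then have "AE s in lborel. \<forall>n. intble (\<lambda>y. indc (cball 0 (real n) \<times> {a n..b n}) (y, s) * (Q (y, s))\<^sup>2)"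
  unfolding AE_all_countable by blast
 then show ?thesis
 proof eventually_elim
  case (elim s)
  show ?case
  proof (intro impI allI)
   fix R assume s: "0 < s \<and> s < T"
   have [measurable]: "cball (0::'a) R \<in> sets borel" by simp
   define d where "d = min s (T - s) / T"
   have "d > 0" using s T_pos by (simp add: d_def)
   then obtain N where N: "\<And>n. n \<ge> N \<Longrightarrow> eps n < d" using eventually_eps_less by (auto simp: eventually_sequentially)
   obtain N' where N': "real N' \<ge> R" using real_arch_simple by blast
   define n where "n = max N N'"
   have "T * eps n < T * d" using N[of n] T_pos by (simp add: n_def)
   also have "T * d = min s (T - s)" using T_pos by (simp add: d_def)
   finally have "T * eps n < min s (T - s)" .
   moreover have "T * eps n > 0" using T_pos by simp
   ultimately have sn: "a n \<le> s" "s \<le> b n" by (auto simp: a_def b_def)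
   have Rn: "R \<le> real n" using N' by (simp add: n_def)
   show "L2 lborel (\<lambda>y. indc (cball 0 R) y * Q (y, s))"
    unfolding L2_def
   proof
    show "intble (\<lambda>y. (indc (cball 0 R) y * Q (y, s))\<^sup>2)"
    proof (rule lintable_bound[OF elim[rule_format, of n]])
     show "AE y in lborel. norm ((indc (cball 0 R) y * Q (y, s))\<^sup>2)
      \<le> norm (indc (cball 0 (real n) \<times> {a n..b n}) (y, s) * (Q (y, s))\<^sup>2)"
      using sn Rn by (intro AE_I2) (auto simp: indicator_def)
    qed measurable
   qed measurable
  qed
 qed
qed

text \<open>Subtracting the equation with \<open>r = s\<close> from the one for \<open>r\<close>
  tests it with the increment of \<open>v\<close>. The left side thus becomes
  \<open>2 * s powr c\<close> times the integral of
  \<open>(P s \<bullet> P r - P s \<bullet> P s) * Phi R * W\<close> with the weight at time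
  \<open>s\<close>. Convexity in the form \<open>2 * (P s \<bullet> P r) - P s \<bullet> P s \<le> P
  r \<bullet> P r\<close> and the exchange of weights by \<open>W_incr\<close> give the claim. No
  time derivative of \<open>P\<close> occurs.\<close>

lemma key_inequality:
 "AE s in lborel. 0 < s \<and> s < T \<longrightarrow> (\<forall>r R. s \<le> r \<and> r < T \<and> R > 0 \<longrightarrow>
  (LBINT y. F R (y, s) * (v (y, r) - v (y, s))) \<le> r powr c * A R r - s powr c * A R s)"
 using Q_slice_L2 equation Pj_eq
proof eventually_elim
 case (elim s)
 show ?case
 proof (intro impI allI, elim conjE)
  fix r R :: real assume s: "0 < s" "s < T" and r: "s \<le> r" "r < T" and R: "R > 0"
  have r0: "0 < r" using s r by simp
  note [measurable] = P_meas[OF s] P_meas[OF r0 r(2)]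
  have Qs: "L2 lborel (\<lambda>y. indc (cball 0 R) y * Q (y, s))" using elim s by blast
  have [measurable]: "borel_fun (\<lambda>y. Q (y, s))" by measurable
  note Ps = P_norm_L2[OF s, of R] and Pr = P_norm_L2[OF r0 r(2), of R]
  have one: "L2 lborel (\<lambda>y::'a. indc (cball 0 R) y * 1)" by (rule continuous_L2_cut) simp
  let ?k = "\<lambda>y. Phi R y * W (y, s)"
  have kc: "continuous_on UNIV ?k" by (intro continuous_intros Phi_continuous slice_continuous s)
  have ksupp: "?k y = 0" if "norm y > R" for y using Phi_eq_0[OF R, of y] that by simp
  have i1: "intble (\<lambda>y. (P s y \<bullet> P r y) * ?k y)"
   by (rule slice_integrable[OF Ps Pr _ _ kc]) (use ksupp in \<open>auto intro: Cauchy_Schwarz_ineq2\<close>)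
  have i2: "intble (\<lambda>y. (norm (P r y))\<^sup>2 * ?k y)"
   by (rule slice_integrable[OF Pr Pr _ _ kc]) (use ksupp in \<open>auto simp: power2_eq_square\<close>)
  have i3: "intble (\<lambda>y. (norm (P s y))\<^sup>2 * ?k y)"
   by (rule slice_integrable[OF Ps Ps _ _ kc]) (use ksupp in \<open>auto simp: power2_eq_square\<close>)
  have i4: "intble (\<lambda>y. Q (y, s) * (v (y, q) * Phi R y * W (y, s)))" if q: "0 < q" "q < T" for q
   by (rule slice_integrable[OF Qs one])
    (use Phi_eq_0[OF R less_imp_le] in \<open>auto intro!: continuous_intros Phi_continuous slice_continuous s q\<close>)
  have dz: "dPhi R y = 0" if "norm y > R" for y using Phi_eq_0(2)[OF R less_imp_le[OF that]] .
  have dP: "L2 lborel (\<lambda>y::'a. indc (cball 0 R) y * norm (dPhi R y))"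
   by (rule continuous_L2_cut) (intro continuous_intros dPhi_continuous)
  have i5: "intble (\<lambda>y. (P s y \<bullet> dPhi R y) * (v (y, q) * W (y, s)))" if q: "0 < q" "q < T" for q
   by (rule slice_integrable[OF Ps dP])
    (auto simp: dz intro!: continuous_intros slice_continuous s q Cauchy_Schwarz_ineq2)
  define X where "X q = (LBINT y. (P s y \<bullet> dPhi R y) * (v (y, q) * W (y, s)))" for q
  define Y where "Y q = (LBINT y. Q (y, s) * (v (y, q) * Phi R y * W (y, s)))" for q
  define Z where "Z = (LBINT y. (P s y \<bullet> P r y) * ?k y)"
  have eqr: "Z + X r = s * Y r" using elim s r0 r R by (auto simp: X_def Y_def Z_def)
  have eqs: "A R s + X s = s * Y s" using elim s R by (auto simp: X_def Y_def A_def power2_norm_eq_inner)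
  have le1: "s powr c * (2 * Z - A R s) \<le> r powr c * A R r"
  proof -
   have "2 * Z - A R s = (LBINT y. 2 * ((P s y \<bullet> P r y) * ?k y) - (norm (P s y))\<^sup>2 * ?k y)"
    using i1 i3 by (simp add: Z_def A_def)
   also have "\<dots> \<le> (LBINT y. (norm (P r y))\<^sup>2 * ?k y)"
   proof (rule integral_mono)
    fix y
    have k0: "?k y \<ge> 0" using W_pos[OF s, of y] Phi_nonneg[of R y] by simp
    have "0 \<le> (norm (P r y - P s y))\<^sup>2" by simp
    then have "2 * (P s y \<bullet> P r y) - (norm (P s y))\<^sup>2 \<le> (norm (P r y))\<^sup>2"
     by (simp add: power2_norm_eq_inner inner_diff_left inner_diff_right inner_commute)
    from mult_right_mono[OF this k0]
    show "2 * ((P s y \<bullet> P r y) * ?k y) - (norm (P s y))\<^sup>2 * ?k y \<le> (norm (P r y))\<^sup>2 * ?k y"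
     by (simp add: algebra_simps)
   qed (use i1 i2 i3 in auto)
   finally have "s powr c * (2 * Z - A R s) \<le> s powr c * (LBINT y. (norm (P r y))\<^sup>2 * ?k y)"
    by (rule mult_left_mono) simp
   also have "\<dots> = (LBINT y. s powr c * ((norm (P r y))\<^sup>2 * ?k y))" by simp
   also have "\<dots> \<le> (LBINT y. r powr c * ((norm (P r y))\<^sup>2 * (Phi R y * W (y, r))))"
   proof (rule integral_mono)
    show "intble (\<lambda>y. r powr c * ((norm (P r y))\<^sup>2 * (Phi R y * W (y, r))))"
     by (intro integrable_mult_right slice_integrable[OF Pr Pr])
      (use Phi_eq_0[OF R less_imp_le] in \<open>auto simp: power2_eq_square intro!: continuous_intros Phi_continuous slice_continuous r0 r\<close>)
    fix y
    have "(norm (P r y))\<^sup>2 * Phi R y * (s powr c * W (y, s)) \<le> (norm (P r y))\<^sup>2 * Phi R y * (r powr c * W (y, r))"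
     using Phi_nonneg[of R y] by (intro mult_left_mono W_incr s r) auto
    then show "s powr c * ((norm (P r y))\<^sup>2 * ?k y) \<le> r powr c * ((norm (P r y))\<^sup>2 * (Phi R y * W (y, r)))"
     by (simp add: mult_ac)
   qed (use i2 in auto)
   finally show ?thesis by (simp add: A_def)
  qed
  have "(LBINT y. F R (y, s) * (v (y, r) - v (y, s)))
   = (LBINT y. 2 * s powr c * (s * (Q (y, s) * (v (y, r) * Phi R y * W (y, s))) - s * (Q (y, s) * (v (y, s) * Phi R y * W (y, s)))
     - ((P s y \<bullet> dPhi R y) * (v (y, r) * W (y, s)) - (P s y \<bullet> dPhi R y) * (v (y, s) * W (y, s)))))"
  proof (rule integral_cong_AE)
   have "AE y in lborel. Pj (y, s) = P s y" using elim s by blast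
   then show "AE y in lborel. F R (y, s) * (v (y, r) - v (y, s)) =
    2 * s powr c * (s * (Q (y, s) * (v (y, r) * Phi R y * W (y, s))) - s * (Q (y, s) * (v (y, s) * Phi R y * W (y, s)))
     - ((P s y \<bullet> dPhi R y) * (v (y, r) * W (y, s)) - (P s y \<bullet> dPhi R y) * (v (y, s) * W (y, s))))"
    by eventually_elim (simp add: F_def algebra_simps)
  qed (auto simp: F_def)
  also have "\<dots> = 2 * s powr c * (s * (Y r - Y s) - (X r - X s))"
   using i4[OF r0 r(2)] i4[OF s] i5[OF r0 r(2)] i5[OF s] by (simp add: X_def Y_def right_diff_distrib)
  also have "s * (Y r - Y s) - (X r - X s) = Z - A R s" using eqr eqs by (simp add: algebra_simps)
  finally have eq: "(LBINT y. F R (y, s) * (v (y, r) - v (y, s))) = 2 * s powr c * (Z - A R s)" .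
  show "(LBINT y. F R (y, s) * (v (y, r) - v (y, s))) \<le> r powr c * A R r - s powr c * A R s"
   unfolding eq using le1 by (simp add: algebra_simps)
 qed
qed

text \<open>The discrete inequalities are summed up with increments \<open>min (s + k) a2 - s\<close>,
 which telescopes exactly at the right end point.\<close>

lemma telescoping:
 fixes \<phi> \<phi>j :: "real \<Rightarrow> real" and G :: "'a \<times> real \<Rightarrow> real"
 assumes b: "0 < a1" "a1 < a2" "a2 < T"
  and G: "L2 lborel (\<lambda>p. indc (cball 0 R \<times> {a1..a2}) p * G p)"
  and Gsupp: "\<And>y s. norm y > R \<Longrightarrow> G (y, s) = 0"
  and \<phi>j_meas [measurable]: "borel_fun \<phi>j"
  and \<phi>j: "AE s in lborel. s \<in> {a1..a2} \<longrightarrow> \<phi>j s = \<phi> s"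
  and int: "intble (\<lambda>s. indc {a1..a2} s * \<phi>j s)"
  and K: "K \<ge> 0"
  and incr: "AE s in lborel. s \<in> {a1..a2} \<longrightarrow> (\<forall>r\<in>{s..a2}.
   (LBINT y. G (y, s) * (v (y, r) - v (y, s)))
    - K * (LBINT y. indc (cball 0 R) y * (v (y, r) - v (y, s))\<^sup>2) \<le> \<phi> r - \<phi> s)"
  and lsc: "\<And>e. e > 0 \<Longrightarrow> \<exists>d>0. \<forall>s. a1 < s \<and> s < a1 + d \<and> s < a2 \<longrightarrow> \<phi> a1 - e \<le> \<phi> s"
 shows "(LBINT p. indc (cball 0 R \<times> {a1..a2}) p * (G p * Q p)) \<le> \<phi> a2 - \<phi> a1"
proof -
 let ?I = "{a1..a2}" and ?B = "cball (0::'a) R"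
 have [measurable]: "?B \<in> sets borel" "?B \<times> ?I \<in> sets borel"
  by (auto intro!: borel_closed closed_Times)
 \<comment> \<open>Since \<open>q\<close> vanishes beyond \<open>a2\<close>, its Steklov average
   also represents the increments truncated at \<open>a2\<close>.\<close>
 define q where "q p = indc (?B \<times> ?I) p * Q p" for p
 define G' where "G' p = indc (?B \<times> ?I) p * G p" for p
 have G': "L2 lborel G'" using G by (simp add: G'_def[abs_def])
 have [measurable]: "borel_fun q" "borel_fun G'"
  using G' by (auto simp: q_def[abs_def] L2_def)
 have q: "L2 lborel q"
  unfolding L2_def
 proof
  have "(\<lambda>p. (q p)\<^sup>2) = (\<lambda>p. indc (?B \<times> ?I) p * (Q p)\<^sup>2)"
   by (auto simp: fun_eq_iff q_def indicator_def)
  then show "intble (\<lambda>p. (q p)\<^sup>2)" using Q_loc[of a1 a2 R] b by simp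
 qed measurable
 note st = steklov_tendsto_L2[of q, OF q]
 have lim1: "(\<lambda>n. (LBINT p. steklov (eps n) q p * G' p)) \<longlonglongrightarrow> (LBINT p. q p * G' p)"
  by (rule L2_pairing_tendsto[OF st(1) q G' st(2)])
 \<comment> \<open>The quadratic error retains one factor \<open>eps n\<close> after division by the
   time step, while the Steklov averages stay bounded in \<open>L2\<close>.\<close>
 have lim2: "(\<lambda>n. eps n * (LBINT p. (steklov (eps n) q p)\<^sup>2)) \<longlonglongrightarrow> 0"
 proof (rule Lim_null_comparison)
  have "(\<lambda>n. eps n * (2 * (LBINT p. (steklov (eps n) q p - q p)\<^sup>2) + 2 * (LBINT p. (q p)\<^sup>2)))
   \<longlonglongrightarrow> 0 * (2 * 0 + 2 * (LBINT p. (q p)\<^sup>2))"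
   by (intro tendsto_intros eps_tendsto st(2))
  then show "(\<lambda>n. eps n * (2 * (LBINT p. (steklov (eps n) q p - q p)\<^sup>2) + 2 * (LBINT p. (q p)\<^sup>2))) \<longlonglongrightarrow> 0" by simp
  show "\<forall>\<^sub>F n in sequentially. norm (eps n * (LBINT p. (steklov (eps n) q p)\<^sup>2))
   \<le> eps n * (2 * (LBINT p. (steklov (eps n) q p - q p)\<^sup>2) + 2 * (LBINT p. (q p)\<^sup>2))"
  proof (rule always_eventually, rule allI)
   fix n
   have "(LBINT p. (steklov (eps n) q p)\<^sup>2) \<le> (LBINT p. 2 * (steklov (eps n) q p - q p)\<^sup>2 + 2 * (q p)\<^sup>2)"
   proof (rule integral_mono)
    show "intble (\<lambda>p. 2 * (steklov (eps n) q p - q p)\<^sup>2 + 2 * (q p)\<^sup>2)"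
     using L2_diff[OF st(1)[of n] q] q by (simp add: L2_def)
    fix p
    have "0 \<le> (steklov (eps n) q p - 2 * q p)\<^sup>2" by simp
    then show "(steklov (eps n) q p)\<^sup>2 \<le> 2 * (steklov (eps n) q p - q p)\<^sup>2 + 2 * (q p)\<^sup>2"
     by (simp add: power2_eq_square algebra_simps)
   qed (use st(1)[of n] in \<open>simp add: L2_def\<close>)
   also have "\<dots> = 2 * (LBINT p. (steklov (eps n) q p - q p)\<^sup>2) + 2 * (LBINT p. (q p)\<^sup>2)"
    using L2_diff[OF st(1)[of n] q] q by (simp add: L2_def)
   finally show "norm (eps n * (LBINT p. (steklov (eps n) q p)\<^sup>2))
    \<le> eps n * (2 * (LBINT p. (steklov (eps n) q p - q p)\<^sup>2) + 2 * (LBINT p. (q p)\<^sup>2))"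
    by (simp add: abs_mult mult_left_mono less_imp_le)
  qed
 qed
 have diff: "AE y in lborel. y \<in> ?B \<longrightarrow> v (y, min (s + eps n) a2) - v (y, s) = eps n * steklov (eps n) q (y, s)"
  if s: "s \<in> ?I" for s n
 proof -
  let ?r = "min (s + eps n) a2"
  have "AE y in lborel. v (y, ?r) - v (y, s) = (LBINT t. indc {s..?r} t * Q (y, t))"
   using s b less_imp_le[OF eps_pos[of n]] by (intro increment) auto
  then show ?thesis
  proof eventually_elim
   case (elim y)
   show ?case
   proof
    assume y: "y \<in> ?B"
    have "(LBINT t. indc {s..?r} t * Q (y, t)) = (LBINT m. indc {s..?r} (m + s) * Q (y, m + s))"
     by (rule integral_translate_lborel[symmetric, of "\<lambda>t. indc {s..?r} t * Q (y, t)"]) measurable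
    also have "\<dots> = (LBINT m. indc {0..eps n} m * q (y, s + m))"
     by (rule lint_cong) (use y s in \<open>auto simp: q_def indicator_def add.commute\<close>)
    also have "\<dots> = eps n * steklov (eps n) q (y, s)"
     by (simp add: steklov_def less_imp_neq[OF eps_pos, THEN not_sym])
    finally show "v (y, ?r) - v (y, s) = eps n * steklov (eps n) q (y, s)" using elim by simp
   qed
  qed
 qed
 have main: "(LBINT p. steklov (eps n) q p * G' p) - K * (eps n * (LBINT p. (steklov (eps n) q p)\<^sup>2))
   \<le> \<phi> a2 - (\<phi> a1 - e)"
  if e: "e > 0" and d: "\<And>s. a1 < s \<Longrightarrow> s < a1 + d \<Longrightarrow> s < a2 \<Longrightarrow> \<phi> a1 - e \<le> \<phi> s"
   and n: "eps n < d" "eps n < a2 - a1" for e d n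
 proof -
  let ?k = "eps n" and ?S = "steklov (eps n) q"
  have d0: "?k > 0" by simp
  define \<psi> where "\<psi> s = indc ?I s * \<phi>j s" for s
  have [measurable]: "borel_fun \<psi>" by (simp add: \<psi>_def[abs_def])
  have \<psi>: "intble \<psi>" using int by (simp add: \<psi>_def[abs_def])
  define r where "r s = min (s + ?k) a2" for s
  define L where "L s = (LBINT y. ?S (y, s) * G' (y, s)) - K * (?k * (indc ?I s * (LBINT y. (?S (y, s))\<^sup>2)))" for s
  have iSG: "intble (\<lambda>p. ?S p * G' p)" by (rule L2_mult_integrable[OF st(1) G'])
  have iSS: "intble (\<lambda>p. (?S p)\<^sup>2)" using st(1)[of n] by (simp add: L2_def)
  have iSS': "intble (\<lambda>s. indc ?I s * (LBINT y. (?S (y, s))\<^sup>2))"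
   using integrable_mult_indicator[OF _ lborel_integrable_snd[OF iSS], of ?I] by simp
  have iL: "intble L"
   unfolding L_def using lborel_integrable_snd[OF iSG] iSS' by auto
  \<comment> \<open>On the interval, \<open>g s\<close> is almost everywhere
    \<open>\<phi> (r s) - \<phi> s\<close>, in a measurable form: shifted values of \<psi> before
    the last step, the constant \<open>\<phi> a2\<close> during it.\<close>
  define g where "g s = indc {a1..<a2 - ?k} s * \<psi> (s + ?k) + indc {a2 - ?k..a2} s * \<phi> a2 - \<psi> s" for s
  have i1: "intble (\<lambda>s. indc {a1..<a2 - ?k} s * \<psi> (s + ?k))"
   using integrable_mult_indicator[of "{a1..<a2 - ?k}" lborel "\<lambda>s. \<psi> (s + ?k)"] \<psi>
   by (simp add: integrable_translate_lborel)
  have i2: "intble (\<lambda>s. indc {a2 - ?k..a2} s * \<phi> a2)"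
   by (intro integrable_mult_left integrable_real_indicator) (auto simp: emeasure_lborel_Icc_eq)
  have ig: "intble g" unfolding g_def using i1 i2 \<psi> by auto
  have shift: "AE s in lborel. s + ?k \<in> ?I \<longrightarrow> \<phi>j (s + ?k) = \<phi> (s + ?k)"
   by (rule AE_translate_lborel[OF \<phi>j])
  have "AE s in lborel. s \<noteq> a1" by (rule AE_lborel_singleton)
  have Lg: "AE s in lborel. ?k * L s \<le> g s"
   using incr shift \<phi>j lborel_AE_integrable_snd[OF iSS]
  proof eventually_elim
   case (elim s)
   show ?case
   proof (cases "s \<in> ?I")
    case False
    then have "G' (y, s) = 0" for y by (auto simp: G'_def)
    then have "L s = 0" using False by (simp add: L_def)
    moreover have "g s = 0" using False d0 n(2) by (auto simp: g_def \<psi>_def indicator_def simp del: eps_pos)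
    ultimately show ?thesis by simp
   next
    case s: True
    have rs: "r s \<in> {s..a2}" using s d0 by (auto simp: r_def)
    note df = diff[OF s, of n, folded r_def]
    have e1: "(LBINT y. G (y, s) * (v (y, r s) - v (y, s))) = ?k * (LBINT y. ?S (y, s) * G' (y, s))"
    proof -
     have "(LBINT y. G (y, s) * (v (y, r s) - v (y, s))) = (LBINT y. G' (y, s) * (v (y, r s) - v (y, s)))"
      by (rule lint_cong) (use s Gsupp in \<open>auto simp: G'_def indicator_def\<close>)
     also have "\<dots> = (LBINT y. ?k * (?S (y, s) * G' (y, s)))"
     proof (rule integral_cong_AE)
      show "AE y in lborel. G' (y, s) * (v (y, r s) - v (y, s)) = ?k * (?S (y, s) * G' (y, s))"
       using df by eventually_elim (auto simp: G'_def indicator_def)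
      show "(\<lambda>y. ?k * (?S (y, s) * G' (y, s))) \<in> borel_measurable lborel"
       using st(1)[of n] by (auto simp: L2_def)
     qed measurable
     finally show ?thesis by simp
    qed
    have e2: "(LBINT y. indc ?B y * (v (y, r s) - v (y, s))\<^sup>2) \<le> ?k\<^sup>2 * (LBINT y. (?S (y, s))\<^sup>2)"
    proof -
     have [measurable]: "borel_fun ?S" using st(1)[of n] by (simp add: L2_def)
     have iS: "intble (\<lambda>y. (?S (y, s))\<^sup>2)" using elim by blast
     have "(LBINT y. indc ?B y * (v (y, r s) - v (y, s))\<^sup>2) = (LBINT y. indc ?B y * (?k\<^sup>2 * (?S (y, s))\<^sup>2))"
     proof (rule integral_cong_AE)
      show "AE y in lborel. indc ?B y * (v (y, r s) - v (y, s))\<^sup>2 = indc ?B y * (?k\<^sup>2 * (?S (y, s))\<^sup>2)"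
       using df by eventually_elim (auto simp: indicator_def power_mult_distrib)
     qed measurable
     also have "\<dots> \<le> (LBINT y. ?k\<^sup>2 * (?S (y, s))\<^sup>2)"
     proof (rule integral_mono)
      show "intble (\<lambda>y. indc ?B y * (?k\<^sup>2 * (?S (y, s))\<^sup>2))"
       using integrable_mult_indicator[of ?B lborel "\<lambda>y. ?k\<^sup>2 * (?S (y, s))\<^sup>2"] iS by simp
     qed (use iS in \<open>auto simp: indicator_def\<close>)
     finally show ?thesis by simp
    qed
    have "?k * L s = ?k * (LBINT y. ?S (y, s) * G' (y, s)) - K * (?k\<^sup>2 * (LBINT y. (?S (y, s))\<^sup>2))"
     using s by (simp add: L_def algebra_simps power2_eq_square)
    also have "\<dots> \<le> (LBINT y. G (y, s) * (v (y, r s) - v (y, s)))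
      - K * (LBINT y. indc ?B y * (v (y, r s) - v (y, s))\<^sup>2)"
     unfolding e1 using mult_left_mono[OF e2 K] by simp
    also have "\<dots> \<le> \<phi> (r s) - \<phi> s" using elim s rs by blast
    also have "\<dots> = g s"
    proof -
     have \<psi>s: "\<psi> s = \<phi> s" using elim s by (simp add: \<psi>_def)
     show ?thesis
     proof (cases "s < a2 - ?k")
      case True
      then have "s + ?k \<in> ?I" using s by (auto simp: add_increasing2)
      then have "\<psi> (s + ?k) = \<phi> (s + ?k)" using elim by (simp add: \<psi>_def)
      then show ?thesis using True s \<psi>s by (simp add: g_def r_def)
     next
      case False
      then have "r s = a2" unfolding r_def by (intro min_absorb2) linarith
      then show ?thesis using False s \<psi>s by (simp add: g_def)
     qed
    qed
    finally show ?thesis .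
   qed
  qed
  define J where "J = (LBINT s. indc {a1..<a2 - ?k} s * \<psi> (s + ?k))"
  have J: "J = (LBINT t. indc {a1 + ?k..<a2} t * \<psi> t)"
  proof -
   have "J = (LBINT s. indc {a1 + ?k..<a2} (s + ?k) * \<psi> (s + ?k))"
    unfolding J_def by (rule lint_cong) (auto simp: indicator_def)
   also have "\<dots> = (LBINT t. indc {a1 + ?k..<a2} t * \<psi> t)"
    by (rule integral_translate_lborel[of "\<lambda>t. indc {a1 + ?k..<a2} t * \<psi> t"]) measurable
   finally show ?thesis .
  qed
  have iJ: "intble (\<lambda>t. indc {a1 + ?k..<a2} t * \<psi> t)"
   using integrable_mult_indicator[of "{a1 + ?k..<a2}" lborel \<psi>] \<psi> by simp
  have "?k * (LBINT s. L s) = (LBINT s. ?k * L s)" by simp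
  also have "\<dots> \<le> (LBINT s. g s)" by (rule integral_mono_AE) (use iL ig Lg in auto)
  also have "\<dots> = J + ?k * \<phi> a2 - (LBINT s. \<psi> s)"
   unfolding g_def J_def using i1 i2 \<psi> d0 by simp
  finally have le0: "?k * (LBINT s. L s) \<le> J + ?k * \<phi> a2 - (LBINT s. \<psi> s)" .
  \<comment> \<open>After the shift the two integrals cancel up to the first time step, where the
    bound from below by \<open>\<phi> a1 - e\<close> applies. This is the only place where the
    behaviour of \<phi> near \<open>a1\<close> enters.\<close>
  have "J - (LBINT s. \<psi> s) \<le> - ((\<phi> a1 - e) * ?k)"
  proof -
   have "J - (LBINT s. \<psi> s) = (LBINT t. indc {a1 + ?k..<a2} t * \<psi> t - \<psi> t)"
    unfolding J using iJ \<psi> by simp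
   also have "\<dots> \<le> (LBINT t. indc {a1..a1 + ?k} t * - (\<phi> a1 - e))"
   proof (rule integral_mono_AE)
    show "intble (\<lambda>t. indc {a1 + ?k..<a2} t * \<psi> t - \<psi> t)" using iJ \<psi> by auto
    show "intble (\<lambda>t. indc {a1..a1 + ?k} t * - (\<phi> a1 - e))"
     by (intro integrable_mult_left integrable_real_indicator) (auto simp: emeasure_lborel_Icc_eq)
    show "AE t in lborel. indc {a1 + ?k..<a2} t * \<psi> t - \<psi> t \<le> indc {a1..a1 + ?k} t * - (\<phi> a1 - e)"
     using \<phi>j AE_lborel_singleton[of a1] AE_lborel_singleton[of a2] AE_lborel_singleton[of "a1 + ?k"]
    proof eventually_elim
     case (elim t)
     consider "t < a1 \<or> t > a2" | "a1 < t \<and> t < a1 + ?k" | "a1 + ?k < t \<and> t < a2"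
      using elim by linarith
     then show ?case
     proof cases
      case 1
      then show ?thesis using n(2) by (auto simp: \<psi>_def indicator_def)
     next
      case 2
      then have "t < a2" using n(2) by linarith
      have "\<psi> t = \<phi> t" using elim 2 \<open>t < a2\<close> by (simp add: \<psi>_def)
      moreover have "\<phi> a1 - e \<le> \<phi> t" using 2 \<open>t < a2\<close> n(1) by (intro d) auto
      ultimately show ?thesis using 2 by simp
     next
      case 3
      then show ?thesis by simp
     qed
    qed
   qed
   also have "\<dots> = - ((\<phi> a1 - e) * ?k)" by (simp add: algebra_simps)
   finally show ?thesis .
  qed
  with le0 have le: "?k * (LBINT s. L s) \<le> ?k * (\<phi> a2 - (\<phi> a1 - e))"
   by (simp add: algebra_simps)
  have "(LBINT p. ?S p * G' p) - K * (?k * (LBINT p. (?S p)\<^sup>2)) \<le> (LBINT s. L s)"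
  proof -
   have "(LBINT s. L s) = (LBINT p. ?S p * G' p) - K * (?k * (LBINT s. indc ?I s * (LBINT y. (?S (y, s))\<^sup>2)))"
    unfolding L_def using lborel_integrable_snd[OF iSG] iSS'
    by (simp add: lborel_integral_snd[OF iSG])
   moreover have "(LBINT s. indc ?I s * (LBINT y. (?S (y, s))\<^sup>2)) \<le> (LBINT s. (LBINT y. (?S (y, s))\<^sup>2))"
    by (rule integral_mono[OF iSS' lborel_integrable_snd[OF iSS]]) (auto simp: indicator_def)
   then have "K * (?k * (LBINT s. indc ?I s * (LBINT y. (?S (y, s))\<^sup>2))) \<le> K * (?k * (LBINT p. (?S p)\<^sup>2))"
    using K d0 by (intro mult_left_mono) (auto simp: lborel_integral_snd[OF iSS])
   ultimately show ?thesis by linarith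
  qed
  also have "\<dots> \<le> \<phi> a2 - (\<phi> a1 - e)" using le d0 by (simp add: mult_le_cancel_left)
  finally show ?thesis .
 qed
 have "(LBINT p. q p * G' p) \<le> \<phi> a2 - \<phi> a1"
 proof (rule field_le_epsilon)
  fix e :: real assume e: "e > 0"
  from lsc[OF e] obtain d where d: "d > 0" "\<And>s. a1 < s \<Longrightarrow> s < a1 + d \<Longrightarrow> s < a2 \<Longrightarrow> \<phi> a1 - e \<le> \<phi> s" by blast
  have "(\<lambda>n. (LBINT p. steklov (eps n) q p * G' p) - K * (eps n * (LBINT p. (steklov (eps n) q p)\<^sup>2)))
   \<longlonglongrightarrow> (LBINT p. q p * G' p) - K * 0"
   by (intro tendsto_intros lim1 lim2)
  moreover have "eventually (\<lambda>n. (LBINT p. steklov (eps n) q p * G' p) - K * (eps n * (LBINT p. (steklov (eps n) q p)\<^sup>2))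
   \<le> \<phi> a2 - (\<phi> a1 - e)) sequentially"
  proof -
   have "a2 - a1 > 0" using b by simp
   from eventually_eps_less[OF d(1)] eventually_eps_less[OF this] show ?thesis
    by eventually_elim (rule main[OF e d(2)])
  qed
  ultimately have "(LBINT p. q p * G' p) - K * 0 \<le> \<phi> a2 - (\<phi> a1 - e)"
   by (intro tendsto_upperbound[OF _ _ trivial_limit_sequentially])
  then show "(LBINT p. q p * G' p) \<le> \<phi> a2 - \<phi> a1 + e" by simp
 qed
 also have "(LBINT p. q p * G' p) = (LBINT p. indc (?B \<times> ?I) p * (G p * Q p))"
  by (rule lint_cong) (auto simp: q_def G'_def indicator_def)
 finally show ?thesis .
qed

end

lemma Phi_outside: "R > 0 \<Longrightarrow> norm y > R \<Longrightarrow> Phi R y = 0" "R > 0 \<Longrightarrow> norm y > R \<Longrightarrow> dPhi R y = 0"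
 using Phi_eq_0 less_imp_le by blast+

section \<open>Lower semicontinuity of the localised energy in time\<close>

context frequency begin

lemma slice_integral_continuous:
 fixes g :: "'a \<times> real \<Rightarrow> real"
 assumes g: "continuous_on (UNIV \<times> {0<..<T}) g" and supp: "\<And>y s. norm y > R \<Longrightarrow> g (y, s) = 0"
  and r: "0 < r" "r < T" and e: "e > 0"
 shows "\<exists>d>0. \<forall>s. 0 < s \<and> s < T \<and> \<bar>s - r\<bar> < d \<longrightarrow> \<bar>(LBINT y. g (y, s)) - (LBINT y. g (y, r))\<bar> \<le> e"
proof -
 define a b where "a = r / 2" and "b = (r + T) / 2"
 have ab: "0 < a" "a < r" "r < b" "b < T" using r by (auto simp: a_def b_def)
 let ?K = "cball (0::'a) R \<times> {a..b}"
 have "uniformly_continuous_on ?K g"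
  by (rule compact_uniformly_continuous[OF continuous_on_subset[OF g]]) (use ab in \<open>auto intro!: compact_Times\<close>)
 define V where "V = measure lborel (cball (0::'a) R)"
 have V0: "V \<ge> 0" by (simp add: V_def)
 have ev: "e / (V + 1) > 0" by (rule divide_Suc_bounds(1)[OF V0 e])
 obtain d where d: "d > 0" "\<And>p q. p \<in> ?K \<Longrightarrow> q \<in> ?K \<Longrightarrow> dist q p < d \<Longrightarrow> dist (g q) (g p) < e / (V + 1)"
  using \<open>uniformly_continuous_on ?K g\<close>[unfolded uniformly_continuous_on_def] ev by metis
 have slice: "intble (\<lambda>y. g (y, s))" if s: "0 < s" "s < T" for s
 proof (rule continuous_compact_support_integrable[of _ R])
  show "continuous_on UNIV (\<lambda>y. g (y, s))"
   by (rule continuous_on_compose2[OF g]) (use s in \<open>auto intro!: continuous_intros\<close>)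
 qed (rule supp)
 show ?thesis
 proof (intro exI[of _ "min d (min (r - a) (b - r))"] conjI allI impI)
  show "0 < min d (min (r - a) (b - r))" using d(1) ab by simp
  fix s assume s: "0 < s \<and> s < T \<and> \<bar>s - r\<bar> < min d (min (r - a) (b - r))"
  have "\<bar>(LBINT y. g (y, s)) - (LBINT y. g (y, r))\<bar> = \<bar>(LBINT y. g (y, s) - g (y, r))\<bar>"
   using slice s r by simp
  also have "\<dots> \<le> (LBINT y. \<bar>g (y, s) - g (y, r)\<bar>)"
   using integral_norm_bound[of lborel "\<lambda>y. g (y, s) - g (y, r)"] by simp
  also have "\<dots> \<le> (LBINT y. e / (V + 1) * indc (cball (0::'a) R) y)"
  proof (rule integral_mono)
   show "intble (\<lambda>y. \<bar>g (y, s) - g (y, r)\<bar>)" using slice s r by auto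
   show "intble (\<lambda>y. e / (V + 1) * indc (cball (0::'a) R) y)"
    using emeasure_lborel_cball_finite[of "0::'a" R]
    by (intro integrable_mult_right integrable_real_indicator) auto
   fix y :: 'a
   show "\<bar>g (y, s) - g (y, r)\<bar> \<le> e / (V + 1) * indc (cball 0 R) y"
   proof (cases "norm y \<le> R")
    case True
    have "dist (g (y, s)) (g (y, r)) < e / (V + 1)"
     by (rule d(2)) (use True s ab in \<open>auto simp: dist_Pair_Pair dist_real_def\<close>)
    then show ?thesis using True by (simp add: dist_real_def)
   qed (use supp in simp)
  qed
  also have "\<dots> = e / (V + 1) * V" by (simp add: V_def)
  also have "\<dots> \<le> e" using divide_Suc_bounds(2)[OF V0 e] by simp
  finally show "\<bar>(LBINT y. g (y, s)) - (LBINT y. g (y, r))\<bar> \<le> e" .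
 qed
qed

definition D :: "real \<Rightarrow> real" where "D t = (LBINT y. (norm (P t y))\<^sup>2 * W (y, t))"
definition H :: "real \<Rightarrow> real" where "H t = (LBINT y. (v (y, t))\<^sup>2 * W (y, t))"

lemma P_cut_integrable:
 assumes t: "0 < t" "t < T" and R: "R > 0" and k: "continuous_on UNIV k"
 shows "intble (\<lambda>y. (norm (P t y))\<^sup>2 * (Phi R y * k y))"
proof -
 note [measurable] = P_meas[OF t]
 show ?thesis
  by (rule slice_integrable[OF P_norm_L2[OF t, of R] P_norm_L2[OF t, of R]])
   (auto simp: Phi_outside R power2_eq_square intro!: continuous_intros Phi_continuous k)
qed

lemma A_bounds:
 assumes t: "0 < t" "t < T" and R: "R > 0"
 shows "0 \<le> A R t" "A R t \<le> D t"
proof -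
 have W0: "W (y, t) \<ge> 0" for y using W_pos[OF t, of y] by simp
 show "0 \<le> A R t" unfolding A_def using W0 Phi_nonneg[of R] by (intro integral_nonneg_AE AE_I2 mult_nonneg_nonneg) auto
 show "A R t \<le> D t"
  unfolding A_def D_def
 proof (rule integral_mono[OF P_cut_integrable[OF t R slice_continuous(2)[OF t]] P_int[OF t]])
  fix y
  have "Phi R y * W (y, t) \<le> 1 * W (y, t)" by (intro mult_right_mono Phi_le_1 W0)
  then show "(norm (P t y))\<^sup>2 * (Phi R y * W (y, t)) \<le> (norm (P t y))\<^sup>2 * W (y, t)"
   by (intro mult_left_mono) auto
 qed
qed

text \<open>Lower semicontinuity from the right: \<open>P s\<close> converges weakly to \<open>P r\<close>, as \<open>v\<close> is continuous.\<close>

lemma A_lsc: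
 assumes r: "0 < r" "r < T" and R: "R > 0" and e: "e > 0"
 shows "\<exists>d>0. \<forall>s. r < s \<and> s < r + d \<and> s < T \<longrightarrow> r powr c * A R r - e \<le> s powr c * A R s"
proof -
 note [measurable] = P_meas[OF r]
 have [measurable]: "cball (0::'a) R \<in> sets borel" by simp
 define a where "a s = s powr c * A R s" for s
 have a0: "a r \<ge> 0" using A_bounds[OF r R] by (simp add: a_def)
 define w where "w y = r powr c * W (y, r)" for y
 have wc: "continuous_on S w" for S unfolding w_def by (intro continuous_intros slice_continuous r)
 have [measurable]: "borel_fun w" by (rule borel_measurable_continuous_onI[OF wc])
 obtain m M where "0 < m" "\<And>y. norm y \<le> R \<Longrightarrow> m \<le> W (y, r)" "0 < M" "\<And>y. norm y \<le> R \<Longrightarrow> W (y, r) \<le> M"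
  using W_bounds[OF r, of R] by blast
 then obtain m M where m: "0 < m" "\<And>y. norm y \<le> R \<Longrightarrow> m \<le> w y" "0 < M" "\<And>y. norm y \<le> R \<Longrightarrow> w y \<le> M"
  using that[of "r powr c * m" "r powr c * M"] r by (auto simp: w_def)
 have w0: "w y > 0" for y using W_pos[OF r, of y] r by (simp add: w_def)
 \<comment> \<open>The total error at the end is at most ten times \<open>e / 16\<close>: five
   contributions, namely the change of \<open>S\<close>, \<open>j\<close> twice and
   \<open>z * a\<close> at both times, all doubled by the convexity inequality.\<close>
 define z where "z = e / 16 / (a r + 1)"
 have z: "z > 0" "16 * (z * a r) \<le> e"
  using divide_Suc_bounds[OF a0, of "e/16"] e unfolding z_def by linarith+
 \<comment> \<open>The parameter of Young's inequality. With \<open>m\<close> the lower bound of the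
   weight, \<open>t\<close> times the unweighted localised energy at time \<open>s\<close> is at
   most \<open>z * a s\<close>.\<close>
 define t where "t = z * m"
 have t: "t > 0" using z m by (simp add: t_def)
 \<comment> \<open>Components of the weighted gradient at time \<open>r\<close>. They are only
   square integrable; their mollifications \<open>V n b\<close> can be integrated by parts against
   \<open>P s\<close>.\<close>
 define f where "f b y = indc (cball 0 R) y * ((P r y \<bullet> b) * w y)" for b y
 have [measurable]: "f b \<in> borel_measurable borel" for b unfolding f_def by measurable
 have f: "L2 lborel (f b)" if "b \<in> Basis" for b
 proof (rule L2_bound[OF P_norm_L2[OF r, of R], of _ M])
  show "AE y in lborel. \<bar>f b y\<bar> \<le> M * \<bar>indc (cball 0 R) y * norm (P r y)\<bar>"
  proof (rule AE_I2)
   fix y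
   have "\<bar>P r y \<bullet> b\<bar> * w y \<le> norm (P r y) * M" if "norm y \<le> R"
    using Cauchy_Schwarz_ineq2[of "P r y" b] \<open>b \<in> Basis\<close> that m w0[of y]
    by (intro mult_mono) (auto simp: less_imp_le)
   then show "\<bar>f b y\<bar> \<le> M * \<bar>indc (cball 0 R) y * norm (P r y)\<bar>"
    using w0[of y] by (simp add: f_def indicator_def abs_mult mult_ac)
  qed
 qed measurable
 have fi: "intble (f b)" if b: "b \<in> Basis" for b
 proof -
  have "intble (\<lambda>y. f b y * (indc (cball 0 R) y * 1))"
   by (rule L2_mult_integrable[OF f[OF b] continuous_L2_cut]) simp
  moreover have "(\<lambda>y. f b y * (indc (cball 0 R) y * 1)) = f b"
   by (auto simp: f_def indicator_def fun_eq_iff)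
  ultimately show ?thesis by simp
 qed
 define V where "V n b = moll (eps n) (f b)" for n b
 have V2: "L2 lborel (V n b)" "(\<lambda>n. (LBINT y. (V n b y - f b y)\<^sup>2)) \<longlonglongrightarrow> 0" if b: "b \<in> Basis" for n b
  unfolding V_def by (rule moll_tendsto_L2[OF f[OF b]])+
 have "(\<lambda>n. (1 / (4 * t)) * (\<Sum>b\<in>Basis. (LBINT y. (V n b y - f b y)\<^sup>2))) \<longlonglongrightarrow> (1 / (4 * t)) * (\<Sum>b\<in>(Basis::'a set). 0)"
  by (intro tendsto_intros V2)
 then have "eventually (\<lambda>n. (1 / (4 * t)) * (\<Sum>b\<in>Basis. (LBINT y. (V n b y - f b y)\<^sup>2)) < e / 16) sequentially"
  by (rule order_tendstoD(2)) (use e in simp)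
 then obtain n where n: "(1 / (4 * t)) * (\<Sum>b\<in>Basis. (LBINT y. (V n b y - f b y)\<^sup>2)) < e / 16"
  by (auto simp: eventually_sequentially)
 define j where "j = (1 / (4 * t)) * (\<Sum>b\<in>Basis. (LBINT y. (V n b y - f b y)\<^sup>2))"
 have Vc1: "c1 (V n b) (dmoll (eps n) (f b))" if "b \<in> Basis" for b
  unfolding V_def by (rule c1_moll[OF fi[OF that] eps_pos])
 define k where "k b y = (Phi R y *\<^sub>R dmoll (eps n) (f b) y + V n b y *\<^sub>R dPhi R y) \<bullet> b" for b y
 have c1k: "c1 (\<lambda>y. Phi R y * V n b y) (\<lambda>y. Phi R y *\<^sub>R dmoll (eps n) (f b) y + V n b y *\<^sub>R dPhi R y)" if "b \<in> Basis" for b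
  by (rule c1_mult[OF c1_Phi Vc1[OF that]])
 have kc: "continuous_on UNIV (k b)" if "b \<in> Basis" for b
  unfolding k_def by (intro continuous_intros c1_gradient_continuous[OF c1k[OF that]])
 have ksupp: "k b y = 0" if "norm y > R" for b y using Phi_eq_0[OF R less_imp_le[OF that]] by (simp add: k_def)
 define S where "S s = (\<Sum>b\<in>Basis. (LBINT y. (P s y \<bullet> b) * (Phi R y * V n b y)))" for s
 \<comment> \<open>Integration by parts removes the gradient from \<open>v\<close>. What remains
   depends on \<open>s\<close> through the continuous function \<open>v\<close> alone, so it varies
   little near \<open>r\<close>.\<close>
 have S_eq: "S s = - (LBINT y. (\<Sum>b\<in>Basis. v (y, s) * k b y))" if s: "0 < s" "s < T" for s
 proof -
  have "intble (\<lambda>y. v (y, s) * k b y)" if "b \<in> Basis" for b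
   by (rule continuous_compact_support_integrable[of _ R])
    (auto simp: ksupp intro!: continuous_intros slice_continuous s kc that)
  then have "(LBINT y. (\<Sum>b\<in>Basis. v (y, s) * k b y)) = (\<Sum>b\<in>Basis. (LBINT y. v (y, s) * k b y))"
   by (intro lint_sum) auto
  moreover have "(LBINT y. (P s y \<bullet> b) * (Phi R y * V n b y)) = - (LBINT y. v (y, s) * k b y)" if "b \<in> Basis" for b
   unfolding k_def
   by (rule ibp[OF s c1k[OF that], of R]) (simp add: Phi_outside R)
  ultimately show ?thesis by (simp add: S_def sum_negf)
 qed
 have "continuous_on (UNIV \<times> {0<..<T}) (\<lambda>p. \<Sum>b\<in>Basis. v p * k b (fst p))"
  by (intro continuous_on_sum continuous_on_mult v_cont continuous_on_compose2[OF kc] continuous_intros) auto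
 from slice_integral_continuous[OF this _ r, of R "e / 16"] ksupp e
 obtain d where d: "d > 0" "\<And>s. 0 < s \<Longrightarrow> s < T \<Longrightarrow> \<bar>s - r\<bar> < d \<Longrightarrow>
   \<bar>(LBINT y. (\<Sum>b\<in>Basis. v (y, s) * k b y)) - (LBINT y. (\<Sum>b\<in>Basis. v (y, r) * k b y))\<bar> \<le> e / 16"
  by fastforce
 have S_close: "\<bar>S s - S r\<bar> \<le> e / 16" if "0 < s" "s < T" "\<bar>s - r\<bar> < d" for s
  using d(2)[OF that] unfolding S_eq[OF that(1,2)] S_eq[OF r] by linarith
 define Z where "Z s = (LBINT y. (P s y \<bullet> P r y) * (Phi R y * w y))" for s
 have a_ge: "a s \<ge> (LBINT y. (norm (P s y))\<^sup>2 * (Phi R y * w y))" if s: "r \<le> s" "s < T" for s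
 proof -
  have s0: "0 < s" using s r by simp
  have "(LBINT y. (norm (P s y))\<^sup>2 * (Phi R y * w y)) \<le> (LBINT y. (norm (P s y))\<^sup>2 * (Phi R y * (s powr c * W (y, s))))"
  proof (rule integral_mono)
   show "intble (\<lambda>y. (norm (P s y))\<^sup>2 * (Phi R y * w y))" by (rule P_cut_integrable[OF s0 s(2) R wc])
   show "intble (\<lambda>y. (norm (P s y))\<^sup>2 * (Phi R y * (s powr c * W (y, s))))"
    by (rule P_cut_integrable[OF s0 s(2) R]) (intro continuous_intros slice_continuous s0 s)
   fix y
   show "(norm (P s y))\<^sup>2 * (Phi R y * w y) \<le> (norm (P s y))\<^sup>2 * (Phi R y * (s powr c * W (y, s)))"
    unfolding w_def by (intro mult_left_mono W_incr r s Phi_nonneg) auto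
  qed
  also have "\<dots> = (LBINT y. s powr c * ((norm (P s y))\<^sup>2 * (Phi R y * W (y, s))))"
   by (rule lint_cong) (simp_all add: mult_ac)
  also have "\<dots> = a s" by (simp add: a_def A_def)
  finally show ?thesis .
 qed
 have ar: "a r = (LBINT y. (norm (P r y))\<^sup>2 * (Phi R y * w y))"
 proof -
  have "a r = (LBINT y. r powr c * ((norm (P r y))\<^sup>2 * (Phi R y * W (y, r))))" by (simp add: a_def A_def)
  also have "\<dots> = (LBINT y. (norm (P r y))\<^sup>2 * (Phi R y * w y))"
   by (rule lint_cong) (simp_all add: w_def mult_ac)
  finally show ?thesis .
 qed
 \<comment> \<open>Replacing \<open>f b\<close> by its mollification costs a small multiple of the
   energy at time \<open>s\<close> plus a fixed small error. An error bound free of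
   \<open>a s\<close> would presuppose that the energy is bounded near \<open>r\<close>.\<close>
 have ZS: "\<bar>Z s - S s\<bar> \<le> z * a s + j" if s: "r \<le> s" "s < T" for s
 proof -
  have s0: "0 < s" using s r by simp
  note [measurable] = P_meas[OF s0 s(2)]
  note Ps = P_norm_L2[OF s0 s(2), of R]
  have iV: "intble (\<lambda>y. (P s y \<bullet> b) * (Phi R y * V n b y))" if b: "b \<in> Basis" for b
  proof (rule slice_integrable[OF Ps continuous_L2_cut[of "\<lambda>_. 1"]])
   show "continuous_on UNIV (\<lambda>y. Phi R y * V n b y)"
    by (intro continuous_intros Phi_continuous c1_continuous[OF Vc1[OF b]])
   show "\<bar>P s y \<bullet> b\<bar> \<le> \<bar>norm (P s y)\<bar> * \<bar>1\<bar>" for y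
    using Cauchy_Schwarz_ineq2[of "P s y" b] b by simp
  qed (auto simp: Phi_outside R)
  have if': "intble (\<lambda>y. (P s y \<bullet> b) * (Phi R y * f b y))" if b: "b \<in> Basis" for b
  proof -
   have "intble (\<lambda>y. ((P s y \<bullet> b) * (P r y \<bullet> b)) * (Phi R y * w y))"
   proof (rule slice_integrable[OF Ps P_norm_L2[OF r, of R]])
    show "continuous_on UNIV (\<lambda>y. Phi R y * w y)" by (intro continuous_intros Phi_continuous wc)
    show "\<bar>(P s y \<bullet> b) * (P r y \<bullet> b)\<bar> \<le> \<bar>norm (P s y)\<bar> * \<bar>norm (P r y)\<bar>" for y
     unfolding abs_mult using Cauchy_Schwarz_ineq2[of "P s y" b] Cauchy_Schwarz_ineq2[of "P r y" b] b
     by (intro mult_mono) auto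
   qed (auto simp: Phi_outside R)
   also have "(\<lambda>y. ((P s y \<bullet> b) * (P r y \<bullet> b)) * (Phi R y * w y)) = (\<lambda>y. (P s y \<bullet> b) * (Phi R y * f b y))"
    using R by (auto simp: Phi_outside f_def indicator_def fun_eq_iff)
   finally show ?thesis .
  qed
  have iP: "intble (\<lambda>y. (P s y \<bullet> b)\<^sup>2 * Phi R y)" if b: "b \<in> Basis" for b
  proof (rule slice_integrable[OF Ps Ps])
   show "\<bar>(P s y \<bullet> b)\<^sup>2\<bar> \<le> \<bar>norm (P s y)\<bar> * \<bar>norm (P s y)\<bar>" for y
    unfolding power2_eq_square abs_mult using Cauchy_Schwarz_ineq2[of "P s y" b] b by (intro mult_mono) auto
  qed (auto simp: Phi_outside R Phi_continuous)
  have iVf: "intble (\<lambda>y. (V n b y - f b y)\<^sup>2)" if b: "b \<in> Basis" for b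
   using L2_diff[OF V2(1)[OF b, of n] f[OF b]] by (simp add: L2_def)
  have Zsum: "Z s = (\<Sum>b\<in>Basis. (LBINT y. (P s y \<bullet> b) * (Phi R y * f b y)))"
  proof -
   have "Z s = (LBINT y. (\<Sum>b\<in>Basis. (P s y \<bullet> b) * (Phi R y * f b y)))"
    unfolding Z_def
   proof (rule lint_cong[OF refl])
    fix y
    show "(P s y \<bullet> P r y) * (Phi R y * w y) = (\<Sum>b\<in>Basis. (P s y \<bullet> b) * (Phi R y * f b y))"
    proof (cases "norm y \<le> R")
     case True
     have "(P s y \<bullet> P r y) * (Phi R y * w y) = (\<Sum>b\<in>Basis. (P s y \<bullet> b) * (P r y \<bullet> b)) * (Phi R y * w y)"
      by (subst euclidean_inner) simp
     also have "\<dots> = (\<Sum>b\<in>Basis. ((P s y \<bullet> b) * (P r y \<bullet> b)) * (Phi R y * w y))"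
      by (rule sum_distrib_right)
     also have "\<dots> = (\<Sum>b\<in>Basis. (P s y \<bullet> b) * (Phi R y * f b y))"
      by (rule sum.cong) (use True in \<open>simp_all add: f_def mult_ac\<close>)
     finally show ?thesis .
    next
     case False
     then have "Phi R y = 0" using Phi_eq_0(1)[OF R, of y] by simp
     then show ?thesis by simp
    qed
   qed
   also have "\<dots> = (\<Sum>b\<in>Basis. (LBINT y. (P s y \<bullet> b) * (Phi R y * f b y)))"
    by (intro lint_sum if') auto
   finally show ?thesis .
  qed
  let ?g = "\<lambda>b y. (P s y \<bullet> b) * (Phi R y * f b y) - (P s y \<bullet> b) * (Phi R y * V n b y)"
  have "\<bar>Z s - S s\<bar> = \<bar>\<Sum>b\<in>Basis. (LBINT y. ?g b y)\<bar>"
   unfolding Zsum S_def sum_subtractf[symmetric] using iV if' by simp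
  also have "\<dots> \<le> (\<Sum>b\<in>Basis. \<bar>(LBINT y. ?g b y)\<bar>)"
   by (rule sum_abs)
  also have "\<dots> \<le> (\<Sum>b\<in>Basis. t * (LBINT y. (P s y \<bullet> b)\<^sup>2 * Phi R y) + (1 / (4 * t)) * (LBINT y. (V n b y - f b y)\<^sup>2))"
  proof (rule sum_mono)
   fix b :: 'a assume b: "b \<in> Basis"
   have "\<bar>(LBINT y. ?g b y)\<bar>
    \<le> (LBINT y. \<bar>?g b y\<bar>)"
    using integral_norm_bound[of lborel "?g b"] by simp
   also have "\<dots> \<le> (LBINT y. t * ((P s y \<bullet> b)\<^sup>2 * Phi R y) + (1 / (4 * t)) * (V n b y - f b y)\<^sup>2)"
   proof (rule integral_mono)
    fix y
    define p q where "p = \<bar>P s y \<bullet> b\<bar>" and "q = \<bar>V n b y - f b y\<bar>"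
    have ag: "p * q \<le> t * p\<^sup>2 + (1 / (4 * t)) * q\<^sup>2"
    proof -
     have "0 \<le> (2 * t * p - q)\<^sup>2" by simp
     then have "4 * t * (p * q) \<le> 4 * t * (t * p\<^sup>2) + q\<^sup>2" by (simp add: power2_eq_square algebra_simps)
     then have "4 * t * (p * q) \<le> 4 * t * (t * p\<^sup>2 + (1 / (4 * t)) * q\<^sup>2)"
      using t by (simp add: distrib_left)
     then show ?thesis using t by (simp add: mult_le_cancel_left)
    qed
    have "\<bar>?g b y\<bar> = Phi R y * (p * q)"
    proof -
     have "?g b y = Phi R y * ((P s y \<bullet> b) * - (V n b y - f b y))"
      by (simp add: algebra_simps)
     then show ?thesis by (simp only: abs_mult abs_minus_cancel p_def q_def abs_of_nonneg[OF Phi_nonneg])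
    qed
    also have "\<dots> \<le> Phi R y * (t * p\<^sup>2 + (1 / (4 * t)) * q\<^sup>2)" by (intro mult_left_mono ag Phi_nonneg)
    also have "\<dots> = t * (p\<^sup>2 * Phi R y) + Phi R y * ((1 / (4 * t)) * q\<^sup>2)" by (simp add: algebra_simps)
    also have "\<dots> \<le> t * (p\<^sup>2 * Phi R y) + 1 * ((1 / (4 * t)) * q\<^sup>2)"
     using t by (intro add_left_mono mult_right_mono Phi_le_1) auto
    finally show "\<bar>?g b y\<bar>
      \<le> t * ((P s y \<bullet> b)\<^sup>2 * Phi R y) + (1 / (4 * t)) * (V n b y - f b y)\<^sup>2"
     by (simp add: p_def q_def)
   qed (use iV[OF b] if'[OF b] iP[OF b] iVf[OF b] in auto)
   also have "\<dots> = t * (LBINT y. (P s y \<bullet> b)\<^sup>2 * Phi R y) + (1 / (4 * t)) * (LBINT y. (V n b y - f b y)\<^sup>2)"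
    using iP[OF b] iVf[OF b] by simp
   finally show "\<bar>(LBINT y. ?g b y)\<bar>
    \<le> t * (LBINT y. (P s y \<bullet> b)\<^sup>2 * Phi R y) + (1 / (4 * t)) * (LBINT y. (V n b y - f b y)\<^sup>2)" .
  qed
  also have "\<dots> = t * (\<Sum>b\<in>Basis. (LBINT y. (P s y \<bullet> b)\<^sup>2 * Phi R y)) + j"
   by (simp add: j_def sum.distrib sum_distrib_left)
  also have "(\<Sum>b\<in>Basis. (LBINT y. (P s y \<bullet> b)\<^sup>2 * Phi R y)) = (LBINT y. (\<Sum>b\<in>Basis. (P s y \<bullet> b)\<^sup>2 * Phi R y))"
   by (intro lint_sum[symmetric] iP) auto
  also have "\<dots> = (LBINT y. (norm (P s y))\<^sup>2 * (Phi R y * 1))"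
  proof (rule lint_cong[OF refl])
   fix y
   have "(norm (P s y))\<^sup>2 = (\<Sum>b\<in>Basis. (P s y \<bullet> b)\<^sup>2)"
    unfolding power2_norm_eq_inner by (subst euclidean_inner) (simp add: power2_eq_square)
   then show "(\<Sum>b\<in>Basis. (P s y \<bullet> b)\<^sup>2 * Phi R y) = (norm (P s y))\<^sup>2 * (Phi R y * 1)"
    by (simp add: sum_distrib_right)
  qed
  also have "t * (LBINT y. (norm (P s y))\<^sup>2 * (Phi R y * 1)) + j \<le> z * a s + j"
  proof -
   have "m * (LBINT y. (norm (P s y))\<^sup>2 * (Phi R y * 1)) = (LBINT y. m * ((norm (P s y))\<^sup>2 * (Phi R y * 1)))" by simp
   also have "\<dots> \<le> (LBINT y. (norm (P s y))\<^sup>2 * (Phi R y * w y))"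
   proof (rule integral_mono)
    show "intble (\<lambda>y. m * ((norm (P s y))\<^sup>2 * (Phi R y * 1)))"
     by (intro integrable_mult_right P_cut_integrable[OF s0 s(2) R]) simp
    show "intble (\<lambda>y. (norm (P s y))\<^sup>2 * (Phi R y * w y))" by (rule P_cut_integrable[OF s0 s(2) R wc])
    fix y
    show "m * ((norm (P s y))\<^sup>2 * (Phi R y * 1)) \<le> (norm (P s y))\<^sup>2 * (Phi R y * w y)"
    proof (cases "norm y \<le> R")
     case True
     have "(norm (P s y))\<^sup>2 * Phi R y * m \<le> (norm (P s y))\<^sup>2 * Phi R y * w y"
      by (intro mult_left_mono m True mult_nonneg_nonneg Phi_nonneg) auto
     then show ?thesis by (simp add: mult_ac)
    next
     case False
     then show ?thesis using Phi_eq_0(1)[OF R, of y] by simp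
    qed
   qed
   also have "\<dots> \<le> a s" by (rule a_ge[OF s])
   finally have "z * (m * (LBINT y. (norm (P s y))\<^sup>2 * (Phi R y * 1))) \<le> z * a s"
    using z by (intro mult_left_mono) auto
   then show ?thesis by (simp add: t_def mult_ac)
  qed
  finally show ?thesis .
 qed
 show ?thesis
 proof (intro exI[of _ d] conjI allI impI d(1))
  fix s assume s: "r < s \<and> s < r + d \<and> s < T"
  then have s': "r \<le> s" "s < T" "0 < s" using r by auto
  note [measurable] = P_meas[OF s'(3,2)]
  have "2 * Z s - a r \<le> a s"
  proof -
   have iZ: "intble (\<lambda>y. (P s y \<bullet> P r y) * (Phi R y * w y))"
   proof (rule slice_integrable[OF P_norm_L2[OF s'(3,2), of R] P_norm_L2[OF r, of R]])
    show "continuous_on UNIV (\<lambda>y. Phi R y * w y)" by (intro continuous_intros Phi_continuous wc)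
   qed (auto simp: Phi_outside R intro: Cauchy_Schwarz_ineq2)
   have "2 * Z s - a r = (LBINT y. 2 * ((P s y \<bullet> P r y) * (Phi R y * w y)) - (norm (P r y))\<^sup>2 * (Phi R y * w y))"
    unfolding Z_def ar using iZ P_cut_integrable[OF r R wc] by simp
   also have "\<dots> \<le> (LBINT y. (norm (P s y))\<^sup>2 * (Phi R y * w y))"
   proof (rule integral_mono)
    fix y
    have "0 \<le> (norm (P s y - P r y))\<^sup>2" by simp
    then have "2 * (P s y \<bullet> P r y) - (norm (P r y))\<^sup>2 \<le> (norm (P s y))\<^sup>2"
     by (simp add: power2_norm_eq_inner inner_diff_left inner_diff_right inner_commute)
    then have "(2 * (P s y \<bullet> P r y) - (norm (P r y))\<^sup>2) * (Phi R y * w y) \<le> (norm (P s y))\<^sup>2 * (Phi R y * w y)"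
     by (intro mult_right_mono mult_nonneg_nonneg Phi_nonneg less_imp_le[OF w0])
    then show "2 * ((P s y \<bullet> P r y) * (Phi R y * w y)) - (norm (P r y))\<^sup>2 * (Phi R y * w y) \<le> (norm (P s y))\<^sup>2 * (Phi R y * w y)"
     by (simp add: algebra_simps)
   qed (use iZ P_cut_integrable[OF r R wc] P_cut_integrable[OF s'(3,2) R wc] in auto)
   also have "\<dots> \<le> a s" by (rule a_ge[OF s'(1,2)])
   finally show ?thesis .
  qed
  moreover have "Z r = a r" by (simp add: Z_def ar power2_norm_eq_inner)
  moreover have "\<bar>Z s - S s\<bar> \<le> z * a s + j" "\<bar>Z r - S r\<bar> \<le> z * a r + j"
   using ZS s' r by auto
  moreover have "\<bar>S s - S r\<bar> \<le> e / 16" using S_close s s' by auto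
  moreover have "j < e / 16" using n by (simp add: j_def)
  \<comment> \<open>Either the claim is immediate, or the energy at time \<open>s\<close> in the
    error term can be exchanged for that at time \<open>r\<close>.\<close>
  moreover have "a r \<le> a s \<or> z * a s \<le> z * a r" using z(1) by (meson linear mult_left_mono less_imp_le)
  ultimately have "a r - e \<le> a s" using z(2) e by linarith
  then show "r powr c * A R r - e \<le> s powr c * A R s" by (simp add: a_def)
 qed
qed

end

section \<open>Tonelli's theorem and Gronwall's inequality\<close>

lemma integrable_Tonelli_snd:
 fixes f :: "'a::euclidean_space \<times> 'b::euclidean_space \<Rightarrow> real"
 assumes [measurable]: "borel_fun f" and nn: "\<And>p. f p \<ge> 0"
  and sl: "AE t in lborel. intble (\<lambda>y. f (y, t))"
  and int: "intble (\<lambda>t. (LBINT y. f (y, t)))"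
 shows "intble f"
proof (rule integrableI_bounded)
 have "(\<integral>\<^sup>+p. ennreal (norm (f p)) \<partial>lborel) = (\<integral>\<^sup>+p. ennreal (f p) \<partial>(lborel \<Otimes>\<^sub>M lborel))"
  using nn by (simp add: lborel_prod)
 also have "\<dots> = (\<integral>\<^sup>+t. \<integral>\<^sup>+y. ennreal (f (y, t)) \<partial>lborel \<partial>lborel)"
  by (rule lborel_pair.nn_integral_snd[symmetric]) (simp add: lborel_prod)
 also have "\<dots> = (\<integral>\<^sup>+t. ennreal (LBINT y. f (y, t)) \<partial>lborel)"
  by (rule nn_integral_cong_AE) (use sl in eventually_elim, auto intro!: nn_integral_eq_integral nn)
 also have "\<dots> = ennreal (LBINT t. (LBINT y. f (y, t)))"
  by (rule nn_integral_eq_integral[OF int]) (auto intro!: integral_nonneg_AE nn)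
 finally show "(\<integral>\<^sup>+p. ennreal (norm (f p)) \<partial>lborel) < \<infinity>" by simp
qed simp

text \<open>\<open>Y\<close> need not be continuous, so the argument runs on its integral
  \<open>E\<close> in steps of length \<open>h\<close>, chosen with
  \<open>C * h \<le> 1 / 2\<close>. If \<open>E\<close> vanishes at \<open>s0\<close>, then on
  \<open>{s0..s}\<close> the hypothesis bounds \<open>Y\<close> by \<open>C * E s\<close>, whence
  \<open>E s \<le> E s / 2\<close>.\<close>

lemma gronwall_zero:
 fixes Y :: "real \<Rightarrow> real"
 assumes [measurable]: "borel_fun Y"
  and bd: "\<And>s. a \<le> s \<Longrightarrow> s \<le> b \<Longrightarrow> 0 \<le> Y s \<and> Y s \<le> K"
  and C: "C \<ge> 0" and le: "\<And>s. a \<le> s \<Longrightarrow> s \<le> b \<Longrightarrow> Y s \<le> C * (LBINT t. indc {a..s} t * Y t)"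
  and s: "a \<le> s" "s \<le> b"
 shows "Y s = 0"
proof -
 define E where "E s = (LBINT t. indc {a..s} t * Y t)" for s
 have int: "intble (\<lambda>t. indc S t * Y t)" if [measurable]: "S \<in> sets borel" and S: "S \<subseteq> {a..b}" for S
 proof (rule lintable_bound)
  show "intble (\<lambda>t. indc {a..b} t * K)"
   by (intro integrable_mult_left integrable_real_indicator) (auto simp: emeasure_lborel_Icc_eq)
  show "AE t in lborel. norm (indc S t * Y t) \<le> norm (indc {a..b} t * K)"
   using bd S by (intro AE_I2) (force simp: indicator_def)
 qed measurable
 have E0: "E s \<ge> 0" if "s \<le> b" for s
  unfolding E_def using bd that by (intro integral_nonneg_AE AE_I2) (auto simp: indicator_def)
 have mono: "E t \<le> E s" if "t \<le> s" "s \<le> b" for t s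
  unfolding E_def using bd that by (intro integral_mono int) (auto simp: indicator_def)
 define h where "h = 1 / (2 * (C + 1))"
 have h: "h > 0" "C * h \<le> 1 / 2" using C by (auto simp: h_def field_simps)
 have "E s = 0" if "a \<le> s" "s \<le> b" "s \<le> a + real n * h" for n s
  using that
 proof (induction n arbitrary: s)
  case 0
  then have "s = a" by simp
  have "E s = (\<integral>t. 0 \<partial>(lborel :: real measure))"
   unfolding E_def
  proof (intro integral_cong_AE)
   show "AE t in lborel. indc {a..s} t * Y t = 0"
    using AE_lborel_singleton[of a] by eventually_elim (use \<open>s = a\<close> in \<open>auto simp: indicator_def\<close>)
  qed measurable
  then show ?case by simp
 next
  case (Suc n)
  define s0 where "s0 = max a (s - h)"
  have s0: "a \<le> s0" "s0 \<le> s" "s - s0 \<le> h" using Suc.prems h by (auto simp: s0_def)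
  have "E s0 = 0" using Suc.prems s0 h by (intro Suc.IH) (auto simp: s0_def algebra_simps)
  have "E s - E s0 = (LBINT t. indc {a..s} t * Y t - indc {a..s0} t * Y t)"
   unfolding E_def using int[of "{a..s}"] int[of "{a..s0}"] s0 Suc.prems by simp
  also have "\<dots> \<le> (LBINT t. indc {s0..s} t * (C * E s))"
  proof (rule integral_mono)
   show "intble (\<lambda>t. indc {a..s} t * Y t - indc {a..s0} t * Y t)"
    using int[of "{a..s}"] int[of "{a..s0}"] s0 Suc.prems by auto
   show "intble (\<lambda>t. indc {s0..s} t * (C * E s))"
    by (intro integrable_mult_left integrable_real_indicator) (auto simp: emeasure_lborel_Icc_eq)
   fix t
   have Y: "Y t \<le> C * E s" if "a \<le> t" "t \<le> s"
    using le[of t] mono[of t s] that Suc.prems C mult_left_mono[OF mono[of t s] C] by (simp add: E_def)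
   show "indc {a..s} t * Y t - indc {a..s0} t * Y t \<le> indc {s0..s} t * (C * E s)"
    using Y s0 E0[of s] C Suc.prems by (auto simp: indicator_def)
  qed
  also have "\<dots> = (s - s0) * (C * E s)" using s0 by simp
  also have "\<dots> \<le> h * (C * E s)" using s0 C E0[of s] Suc.prems by (intro mult_right_mono) auto
  also have "\<dots> = (C * h) * E s" by simp
  also have "\<dots> \<le> (1 / 2) * E s" using h E0[of s] Suc.prems by (intro mult_right_mono) auto
  finally show ?case using \<open>E s0 = 0\<close> E0[of s] Suc.prems by linarith
 qed
 moreover obtain n where "(s - a) / h < real n" using reals_Archimedean2 by blast
 then have "s \<le> a + real n * h" using h by (simp add: field_simps)
 ultimately have "E s = 0" using s by blast
 then show ?thesis using le[OF s] bd[OF s] by (simp add: E_def)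
qed

section \<open>The energy inequality and global integrability of the time derivative\<close>

context frequency begin

lemma snd_pair_measurable [measurable]:
 "borel_fun (\<lambda>p::'a \<times> real. snd p)" "borel_fun (\<lambda>p::'a \<times> real. snd p powr b)"
proof -
 show *: "borel_fun (\<lambda>p::'a \<times> real. snd p)"
  by (intro borel_measurable_continuous_onI continuous_intros)
 have "borel_fun (\<lambda>t::real. t powr b)" by measurable
 from measurable_compose[OF * this] show "borel_fun (\<lambda>p::'a \<times> real. snd p powr b)" .
qed

lemma fst_pair_measurable [measurable]:
 "borel_fun (\<lambda>p::'a \<times> real. Phi R (fst p))" "borel_fun (\<lambda>p::'a \<times> real. dPhi R (fst p))"
 by (intro borel_measurable_continuous_onI continuous_on_compose2[OF Phi_continuous[of UNIV]] continuous_intros, simp)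
  (intro borel_measurable_continuous_onI continuous_on_compose2[OF dPhi_continuous[of UNIV]] continuous_intros, simp)

lemma slab_measurable [measurable]:
 "UNIV \<times> {a..b} \<in> sets (borel :: ('a \<times> real) measure)" "cball (0::'a) R \<times> {a..b} \<in> sets borel"
 by (auto intro!: borel_closed closed_Times)

text \<open>The bounds are assumed for \<open>P\<close>, but joint integrability can be stated for
  \<open>Pj\<close> only. The two agree on almost every slice, and Tonelli's theorem assembles the
  slices.\<close>

lemma Pj_weighted:
 assumes "0 < a" "b < T"
 shows "intble (\<lambda>p. indc (UNIV \<times> {a..b}) p * ((norm (Pj p))\<^sup>2 * W p))"
proof (rule integrable_Tonelli_snd)
 let ?f = "\<lambda>p. indc (UNIV \<times> {a..b}) p * ((norm (Pj p))\<^sup>2 * W p)"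
 show "?f p \<ge> 0" for p
  using W_pos[of "snd p" "fst p"] assms by (auto simp: indicator_def less_imp_le)
 have eq: "AE t in lborel. (AE y in lborel. ?f (y, t) = indc {a..b} t * ((norm (P t y))\<^sup>2 * W (y, t)))"
  using Pj_eq
 proof eventually_elim
  case (elim t)
  show ?case
  proof (cases "t \<in> {a..b}")
   case True
   then have "AE y in lborel. Pj (y, t) = P t y" using elim assms by auto
   then show ?thesis by eventually_elim (simp add: indicator_def)
  qed (simp add: indicator_def)
 qed
 have meas: "(\<lambda>y. indc {a..b} t * ((norm (P t y))\<^sup>2 * W (y, t))) \<in> borel_measurable lborel" for t
 proof (cases "t \<in> {a..b}")
  case True
  then have [measurable]: "P t \<in> borel_measurable borel" using assms by (intro P_meas) auto
  show ?thesis by measurable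
 qed simp
 show "AE t in lborel. intble (\<lambda>y. ?f (y, t))"
  using eq
 proof eventually_elim
  case (elim t)
  have "intble (\<lambda>y. indc {a..b} t * ((norm (P t y))\<^sup>2 * W (y, t)))"
   using P_int[of t] assms by (cases "t \<in> {a..b}") auto
  then show ?case
   by (rule integrable_cong_AE_imp) (use elim in \<open>auto elim!: eventually_mono\<close>)
 qed
 have eq2: "AE t in lborel. indc {a..b} t * (LBINT y. (norm (P t y))\<^sup>2 * W (y, t)) = (LBINT y. ?f (y, t))"
  using eq
 proof eventually_elim
  case (elim t)
  have "(LBINT y. ?f (y, t)) = (LBINT y. indc {a..b} t * ((norm (P t y))\<^sup>2 * W (y, t)))"
   by (rule integral_cong_AE) (use elim meas[of t] in auto)
  then show ?case by simp
 qed
 show "intble (\<lambda>t. (LBINT y. ?f (y, t)))"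
  by (rule integrable_cong_AE_imp[OF D_loc[OF assms]]) (use eq2 in \<open>auto elim!: eventually_mono\<close>)
qed measurable

lemma v_weighted:
 assumes "0 < a" "b < T"
 shows "intble (\<lambda>p. indc (UNIV \<times> {a..b}) p * ((v p)\<^sup>2 * W p))"
proof (rule integrable_Tonelli_snd)
 let ?f = "\<lambda>p. indc (UNIV \<times> {a..b}) p * ((v p)\<^sup>2 * W p)"
 show "?f p \<ge> 0" for p
  using W_pos[of "snd p" "fst p"] assms by (auto simp: indicator_def less_imp_le)
 have eq: "?f (y, t) = indc {a..b} t * ((v (y, t))\<^sup>2 * W (y, t))" for y t by (simp add: indicator_def)
 show "AE t in lborel. intble (\<lambda>y. ?f (y, t))"
 proof (rule AE_I2)
  fix t
  show "intble (\<lambda>y. ?f (y, t))"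
   unfolding eq using v_int[of t] assms by (cases "t \<in> {a..b}") auto
 qed
 show "intble (\<lambda>t. (LBINT y. ?f (y, t)))"
  unfolding eq using H_loc[OF assms] by simp
qed measurable

lemma Pj_loc:
 assumes "0 < a" "b < T"
 shows "L2 lborel (\<lambda>p. indc (cball 0 R \<times> {a..b}) p * norm (Pj p))"
 unfolding L2_def
proof
 obtain m M where m: "0 < m" "\<And>y t. norm y \<le> R \<Longrightarrow> a \<le> t \<Longrightarrow> t \<le> b \<Longrightarrow> m \<le> W (y, t)"
  using W_bounds[OF assms, of R] by blast
 show "intble (\<lambda>p. (indc (cball 0 R \<times> {a..b}) p * norm (Pj p))\<^sup>2)"
 proof (rule lintable_bound)
  show "intble (\<lambda>p. (1 / m) * (indc (UNIV \<times> {a..b}) p * ((norm (Pj p))\<^sup>2 * W p)))"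
   using Pj_weighted[OF assms] by simp
  show "AE p in lborel. norm ((indc (cball 0 R \<times> {a..b}) p * norm (Pj p))\<^sup>2)
    \<le> norm ((1 / m) * (indc (UNIV \<times> {a..b}) p * ((norm (Pj p))\<^sup>2 * W p)))"
  proof (rule AE_I2)
   fix p :: "'a \<times> real"
   show "norm ((indc (cball 0 R \<times> {a..b}) p * norm (Pj p))\<^sup>2)
    \<le> norm ((1 / m) * (indc (UNIV \<times> {a..b}) p * ((norm (Pj p))\<^sup>2 * W p)))"
   proof (cases "p \<in> cball 0 R \<times> {a..b}")
    case True
    then have "m \<le> W p" using m(2)[of "fst p" "snd p"] by auto
    then have "(norm (Pj p))\<^sup>2 * m \<le> (norm (Pj p))\<^sup>2 * W p" by (intro mult_left_mono) auto
    then show ?thesis using True m(1) \<open>m \<le> W p\<close> by (auto simp: field_simps abs_mult indicator_def)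
   qed simp
  qed
 qed measurable
qed measurable

lemma Q_loc_L2:
 assumes "0 < a" "b < T"
 shows "L2 lborel (\<lambda>p. indc (cball 0 R \<times> {a..b}) p * Q p)"
proof -
 have "(\<lambda>p. (indc (cball 0 R \<times> {a..b}) p * Q p)\<^sup>2) = (\<lambda>p. indc (cball 0 R \<times> {a..b}) p * (Q p)\<^sup>2)"
  by (auto simp: indicator_def fun_eq_iff)
 then show ?thesis using Q_loc[OF assms, of R] by (simp add: L2_def)
qed

lemma F_outside: "R > 0 \<Longrightarrow> norm y > R \<Longrightarrow> F R (y, s) = 0"
 by (simp add: F_def Phi_outside)

lemma F_measurable [measurable]: "F R \<in> borel_measurable borel"
 unfolding F_def[abs_def] by (intro borel_measurable_times borel_measurable_diff borel_measurable_inner borel_measurable_const snd_pair_measurable fst_pair_measurable W_meas Q_meas Pj_meas)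

lemma F_loc_L2:
 assumes ab: "0 < a" "b < T" and R: "R > 0"
 shows "L2 lborel (\<lambda>p. indc (cball 0 R \<times> {a..b}) p * F R p)"
proof -
 obtain m M where M: "0 < M" "\<And>y t. norm y \<le> R \<Longrightarrow> a \<le> t \<Longrightarrow> t \<le> b \<Longrightarrow> W (y, t) \<le> M"
  using W_bounds[OF ab, of R] by blast
 let ?K = "cball (0::'a) R \<times> {a..b}"
 let ?g = "\<lambda>p. \<bar>indc ?K p * Q p\<bar> + indc ?K p * norm (Pj p)"
 have "L2 lborel (\<lambda>p. \<bar>indc ?K p * Q p\<bar>)" using Q_loc_L2[OF ab, of R] by (simp add: L2_def)
 from L2_add[OF this Pj_loc[OF ab, of R]] have g: "L2 lborel ?g" .
 let ?C = "2 * T powr c * (T + 4 / R) * M"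
 have C0: "?C \<ge> 0" using T_pos R M by simp
 show ?thesis
 proof (rule L2_bound[OF g])
  show "AE p in lborel. \<bar>indc ?K p * F R p\<bar> \<le> ?C * \<bar>?g p\<bar>"
  proof (rule AE_I2)
   fix p :: "'a \<times> real"
   show "\<bar>indc ?K p * F R p\<bar> \<le> ?C * \<bar>?g p\<bar>"
   proof (cases "p \<in> ?K")
    case True
    obtain y s where p: "p = (y, s)" by (cases p)
    have ys: "norm y \<le> R" "a \<le> s" "s \<le> b" "0 < s" "s < T" using True p ab by auto
    have W: "0 < W (y, s)" "W (y, s) \<le> M" using W_pos[OF ys(4,5)] M(2)[OF ys(1-3)] by auto
    have "\<bar>F R p\<bar> = 2 * s powr c * \<bar>s * Q p * Phi R y - Pj p \<bullet> dPhi R y\<bar> * W (y, s)"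
     using W ys by (simp add: F_def p abs_mult)
    also have "\<dots> \<le> 2 * T powr c * ((T + 4 / R) * (\<bar>Q p\<bar> + norm (Pj p))) * M"
    proof (rule mult_mono)
     have "\<bar>s * Q p * Phi R y\<bar> \<le> T * \<bar>Q p\<bar> * 1"
      unfolding abs_mult using ys Phi_nonneg[of R y] Phi_le_1[of R y] by (intro mult_mono) auto
     moreover have "\<bar>Pj p \<bullet> dPhi R y\<bar> \<le> 4 / R * norm (Pj p)"
      using Cauchy_Schwarz_ineq2[of "Pj p" "dPhi R y"] mult_left_mono[OF dPhi_bound(2)[OF R, of y], of "norm (Pj p)"]
      by (simp add: mult.commute)
     ultimately have "\<bar>s * Q p * Phi R y - Pj p \<bullet> dPhi R y\<bar> \<le> T * \<bar>Q p\<bar> + 4 / R * norm (Pj p)" by linarith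
     also have "\<dots> \<le> (T + 4 / R) * (\<bar>Q p\<bar> + norm (Pj p))"
      using T_pos R by (simp add: distrib_left distrib_right)
     finally have le: "\<bar>s * Q p * Phi R y - Pj p \<bullet> dPhi R y\<bar> \<le> (T + 4 / R) * (\<bar>Q p\<bar> + norm (Pj p))" .
     have "s powr c \<le> T powr c" using ys c_nonneg by (intro powr_mono2) auto
     then show "2 * s powr c * \<bar>s * Q p * Phi R y - Pj p \<bullet> dPhi R y\<bar> \<le> 2 * T powr c * ((T + 4 / R) * (\<bar>Q p\<bar> + norm (Pj p)))"
      using le by (intro mult_mono) auto
    qed (use W T_pos R in \<open>auto intro!: mult_nonneg_nonneg\<close>)
    also have "\<dots> = ?C * \<bar>?g p\<bar>" using True by (simp add: mult_ac)
    finally show ?thesis using True by simp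
   qed (use C0 in simp)
  qed
 qed measurable
qed

text \<open>Measurable in time by construction, in contrast to \<open>A R\<close>, whose integrand
  need not be jointly measurable. It is the function \<phi>j in the application of
  \<open>telescoping\<close>.\<close>

definition Aj :: "real \<Rightarrow> real \<Rightarrow> real" where
 "Aj R t = (LBINT y. (norm (Pj (y, t)))\<^sup>2 * (Phi R y * W (y, t)))"

lemma Aj_measurable [measurable]: "Aj R \<in> borel_measurable borel"
 unfolding Aj_def[abs_def] by measurable

lemma Aj_eq: "AE t in lborel. 0 < t \<and> t < T \<longrightarrow> Aj R t = A R t"
 using Pj_eq
proof eventually_elim
 case (elim t)
 show ?case
 proof
  assume t: "0 < t \<and> t < T"
  then have [measurable]: "P t \<in> borel_measurable borel" by (intro P_meas) auto
  have "AE y in lborel. Pj (y, t) = P t y" using elim t by blast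
  then show "Aj R t = A R t"
   unfolding Aj_def A_def by (intro integral_cong_AE) (auto elim!: eventually_mono)
 qed
qed

text \<open>Integrated form of the statement that the derivative of \<open>s powr c * A R s\<close>
  is at least the integral of \<open>F R * Q\<close>. By \<open>key_inequality\<close> there is no
  quadratic error, hence \<open>K = 0\<close>.\<close>

lemma energy_cut:
 assumes a: "0 < a1" "a1 < a2" "a2 < T" and R: "R > 0"
 shows "(LBINT p. indc (UNIV \<times> {a1..a2}) p * (F R p * Q p)) \<le> a2 powr c * A R a2 - a1 powr c * A R a1"
  and "intble (\<lambda>p. indc (UNIV \<times> {a1..a2}) p * (F R p * Q p))"
proof -
 let ?I = "{a1..a2}"
 have eq: "(\<lambda>p. indc (UNIV \<times> ?I) p * (F R p * Q p)) = (\<lambda>p. indc (cball 0 R \<times> ?I) p * (F R p * Q p))"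
  using F_outside[OF R] by (auto simp: fun_eq_iff indicator_def)
 show "intble (\<lambda>p. indc (UNIV \<times> ?I) p * (F R p * Q p))"
 proof -
  have "intble (\<lambda>p. (indc (cball 0 R \<times> ?I) p * F R p) * (indc (cball 0 R \<times> ?I) p * Q p))"
   by (rule L2_mult_integrable[OF F_loc_L2 Q_loc_L2]) (use a R in auto)
  also have "(\<lambda>p. (indc (cball 0 R \<times> ?I) p * F R p) * (indc (cball 0 R \<times> ?I) p * Q p))
   = (\<lambda>p. indc (cball 0 R \<times> ?I) p * (F R p * Q p))"
   by (auto simp: fun_eq_iff indicator_def)
  finally show ?thesis unfolding eq .
 qed
 show "(LBINT p. indc (UNIV \<times> {a1..a2}) p * (F R p * Q p)) \<le> a2 powr c * A R a2 - a1 powr c * A R a1"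
  unfolding eq
 proof (rule telescoping[where \<phi>="\<lambda>s. s powr c * A R s" and \<phi>j="\<lambda>s. s powr c * Aj R s" and K=0])
  show "L2 lborel (\<lambda>p. indc (cball 0 R \<times> ?I) p * F R p)" by (rule F_loc_L2) (use a R in auto)
  show "F R (y, s) = 0" if "R < norm y" for y s by (rule F_outside[OF R that])
  show AE: "AE s in lborel. s \<in> ?I \<longrightarrow> s powr c * Aj R s = s powr c * A R s"
   using Aj_eq[of R] by eventually_elim (use a in auto)
  show "intble (\<lambda>s. indc ?I s * (s powr c * Aj R s))"
  proof (rule lintable_bound)
   show "intble (\<lambda>s. T powr c * (indc ?I s * D s))"
    unfolding D_def using D_loc[of a1 a2] a by simp
   show "AE s in lborel. norm (indc ?I s * (s powr c * Aj R s)) \<le> norm (T powr c * (indc ?I s * D s))"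
    using Aj_eq[of R]
   proof eventually_elim
    case (elim s)
    show ?case
    proof (cases "s \<in> ?I")
     case True
     then have s: "0 < s" "s < T" using a by auto
     have "s powr c * A R s \<le> T powr c * D s"
      using A_bounds[OF s R] s c_nonneg by (intro mult_mono powr_mono2) auto
     moreover have "0 \<le> A R s" "0 \<le> D s" using A_bounds[OF s R] by auto
     ultimately show ?thesis using True elim s by (simp add: abs_mult)
    qed simp
   qed
  qed measurable
  show "AE s in lborel. s \<in> ?I \<longrightarrow> (\<forall>r\<in>{s..a2}. (LBINT y. F R (y, s) * (v (y, r) - v (y, s)))
    - 0 * (LBINT y. indc (cball 0 R) y * (v (y, r) - v (y, s))\<^sup>2) \<le> r powr c * A R r - s powr c * A R s)"
   using key_inequality by eventually_elim (use a R in auto)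
  fix e :: real assume "e > 0"
  from A_lsc[OF a(1) _ R this] a
  obtain d where "d > 0" "\<forall>s. a1 < s \<and> s < a1 + d \<and> s < T \<longrightarrow> a1 powr c * A R a1 - e \<le> s powr c * A R s" by auto
  then show "\<exists>d>0. \<forall>s. a1 < s \<and> s < a1 + d \<and> s < a2 \<longrightarrow> a1 powr c * A R a1 - e \<le> s powr c * A R s"
   using a by (intro exI[of _ d]) auto
 qed (use a in auto)
qed

text \<open>So far \<open>Q\<close> is square integrable on bounded sets only. In
  \<open>F R * Q\<close> the term with the square of \<open>Q\<close> dominates the mixed term up to
  a multiple of the energy, because the gradient of the cut-off is at most
  \<open>4 * sqrt (Phi R y)\<close>. By \<open>energy_cut\<close> the integrals are bounded
  uniformly in the radius, and Fatou's lemma removes the cut-off.\<close>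

lemma Q_weighted:
 assumes d: "0 < a1" "a1 < a2" "a2 < T"
 shows "intble (\<lambda>p. indc (UNIV \<times> {a1..a2}) p * ((Q p)\<^sup>2 * W p))"
proof -
 let ?X = "UNIV \<times> {a1..a2} :: ('a \<times> real) set"
 have [measurable]: "?X \<in> sets borel" by measurable
 have X: "p \<in> ?X \<Longrightarrow> 0 < snd p \<and> snd p < T \<and> a1 \<le> snd p \<and> W p > 0" for p
  using W_pos[of "snd p" "fst p"] d by auto
 \<comment> \<open>On the time interval \<open>k0\<close> bounds \<open>s powr c * s\<close> from
   below, and \<open>K\<close> bounds \<open>s powr c * (16 / s)\<close> from above.\<close>
 define k0 where "k0 = a1 powr c * a1"
 define K where "K = 16 * T powr c / a1"
 have k0: "k0 > 0" and K: "K \<ge> 0" using d by (auto simp: k0_def K_def)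
 have Pw: "intble (\<lambda>p. indc ?X p * ((norm (Pj p))\<^sup>2 * W p))" using Pj_weighted d by auto
 define C where "C = a2 powr c * D a2 + K * (LBINT p. indc ?X p * ((norm (Pj p))\<^sup>2 * W p))"
 define G where "G n p = indc ?X p * (k0 * ((Q p)\<^sup>2 * Phi (real (Suc n)) (fst p) * W p))" for n p
 have [measurable]: "G n \<in> borel_measurable borel" for n unfolding G_def[abs_def]
  by (intro borel_measurable_times borel_measurable_indicator borel_measurable_const borel_measurable_power fst_pair_measurable Q_meas W_meas) measurable
 have G0: "G n p \<ge> 0" for n p
  using X[of p] k0 Phi_nonneg[of "real (Suc n)" "fst p"] by (auto simp: G_def indicator_def intro!: mult_nonneg_nonneg)
 have pt: "G n p \<le> indc ?X p * (F (real (Suc n)) p * Q p) + K * (indc ?X p * ((norm (Pj p))\<^sup>2 * W p))" for n p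
 proof (cases "p \<in> ?X")
  case True
  note x = X[OF True]
  obtain y s where p: "p = (y, s)" by (cases p)
  define R where "R = real (Suc n)"
  have R: "R > 0" "R \<ge> 1" by (auto simp: R_def)
  define f where "f = sqrt (Phi R y)"
  have f: "f \<ge> 0" "f\<^sup>2 = Phi R y" using Phi_nonneg[of R y] by (auto simp: f_def)
  have s: "0 < s" "s < T" "a1 \<le> s" and W: "W p > 0" using x p by auto
  have "\<bar>Q p * (Pj p \<bullet> dPhi R y)\<bar> \<le> \<bar>Q p\<bar> * (norm (Pj p) * (4 * f))"
  proof -
   have "norm (dPhi R y) \<le> 4 / R * f" using dPhi_bound(1)[OF R(1), of y] by (simp add: f_def)
   also have "\<dots> \<le> 4 * f" using R f by (intro mult_right_mono) (auto simp: field_simps)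
   finally have "\<bar>Pj p \<bullet> dPhi R y\<bar> \<le> norm (Pj p) * (4 * f)"
    using Cauchy_Schwarz_ineq2[of "Pj p" "dPhi R y"] mult_left_mono[of "norm (dPhi R y)" "4 * f" "norm (Pj p)"] by simp
   then show ?thesis unfolding abs_mult by (rule mult_left_mono) simp
  qed
  \<comment> \<open>Young's inequality, balanced such that exactly half of the quadratic term in
    \<open>F R * Q\<close> is spent.\<close>
  moreover have "2 * (\<bar>Q p\<bar> * (norm (Pj p) * (4 * f))) \<le> s * (Q p)\<^sup>2 * f\<^sup>2 + 16 * (norm (Pj p))\<^sup>2 / s"
  proof -
   have "0 \<le> (s * (\<bar>Q p\<bar> * f) - 4 * norm (Pj p))\<^sup>2" by simp
   then have "s * (2 * (\<bar>Q p\<bar> * (norm (Pj p) * (4 * f)))) \<le> s * (s * (Q p)\<^sup>2 * f\<^sup>2) + 16 * (norm (Pj p))\<^sup>2"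
    by (simp add: power2_diff power_mult_distrib power2_eq_square[of s] mult_ac)
   also have "\<dots> = s * (s * (Q p)\<^sup>2 * f\<^sup>2 + 16 * (norm (Pj p))\<^sup>2 / s)" using s by (simp add: distrib_left)
   finally show ?thesis using s by (simp add: mult_le_cancel_left)
  qed
  ultimately have "s * (Q p)\<^sup>2 * f\<^sup>2 \<le> 2 * (s * (Q p)\<^sup>2 * f\<^sup>2) - 2 * (Q p * (Pj p \<bullet> dPhi R y)) + 16 * (norm (Pj p))\<^sup>2 / s"
   by linarith
  then have "s powr c * (s * (Q p)\<^sup>2 * f\<^sup>2) * W p
   \<le> s powr c * (2 * (s * (Q p)\<^sup>2 * f\<^sup>2) - 2 * (Q p * (Pj p \<bullet> dPhi R y)) + 16 * (norm (Pj p))\<^sup>2 / s) * W p"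
   using W by (intro mult_right_mono mult_left_mono) auto
  also have "\<dots> = F R p * Q p + s powr c * (16 * (norm (Pj p))\<^sup>2 / s) * W p"
   by (simp add: F_def p f(2)[symmetric] power2_eq_square algebra_simps)
  also have "s powr c * (16 * (norm (Pj p))\<^sup>2 / s) * W p \<le> K * ((norm (Pj p))\<^sup>2 * W p)"
  proof -
   have "s powr c * (16 / s) \<le> T powr c * (16 / a1)"
    using s d c_nonneg by (intro mult_mono powr_mono2 divide_left_mono) auto
   then have "s powr c * (16 / s) * ((norm (Pj p))\<^sup>2 * W p) \<le> T powr c * (16 / a1) * ((norm (Pj p))\<^sup>2 * W p)"
    using W by (intro mult_right_mono) auto
   then show ?thesis by (simp add: K_def mult_ac)
  qed
  finally have "s powr c * (s * (Q p)\<^sup>2 * f\<^sup>2) * W p \<le> F R p * Q p + K * ((norm (Pj p))\<^sup>2 * W p)" by simp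
  moreover have "G n p \<le> s powr c * (s * (Q p)\<^sup>2 * f\<^sup>2) * W p"
  proof -
   have "k0 \<le> s powr c * s" unfolding k0_def using s d c_nonneg by (intro mult_mono powr_mono2) auto
   then have "k0 * ((Q p)\<^sup>2 * f\<^sup>2 * W p) \<le> s powr c * s * ((Q p)\<^sup>2 * f\<^sup>2 * W p)"
    using W by (intro mult_right_mono) auto
   then show ?thesis using True by (simp add: G_def f p R_def mult_ac)
  qed
  ultimately show ?thesis using True by (simp add: R_def)
 qed (simp add: G_def)
 have Gle: "(\<integral>\<^sup>+p. ennreal (G n p) \<partial>lborel) \<le> ennreal C" for n
 proof -
  let ?R = "real (Suc n)"
  note e = energy_cut[OF d, of ?R]
  have iG: "intble (G n)"
  proof (rule lintable_bound)
   show "intble (\<lambda>p. indc ?X p * (F ?R p * Q p) + K * (indc ?X p * ((norm (Pj p))\<^sup>2 * W p)))"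
    using e(2) Pw by auto
   show "AE p in lborel. norm (G n p) \<le> norm (indc ?X p * (F ?R p * Q p) + K * (indc ?X p * ((norm (Pj p))\<^sup>2 * W p)))"
   proof (rule AE_I2)
    fix p
    show "norm (G n p) \<le> norm (indc ?X p * (F ?R p * Q p) + K * (indc ?X p * ((norm (Pj p))\<^sup>2 * W p)))"
     using pt[of n p] G0[of n p] unfolding real_norm_def by linarith
   qed
  qed measurable
  have "(LBINT p. G n p) \<le> (LBINT p. indc ?X p * (F ?R p * Q p) + K * (indc ?X p * ((norm (Pj p))\<^sup>2 * W p)))"
   using e(2) Pw by (intro integral_mono iG pt) auto
  also have "\<dots> = (LBINT p. indc ?X p * (F ?R p * Q p)) + K * (LBINT p. indc ?X p * ((norm (Pj p))\<^sup>2 * W p))"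
   using e(2) Pw by simp
  also have "\<dots> \<le> C"
  proof -
   have "a2 powr c * A ?R a2 \<le> a2 powr c * D a2" using A_bounds[of a2 ?R] d by (intro mult_left_mono) auto
   moreover have "0 \<le> a1 powr c * A ?R a1" using A_bounds[of a1 ?R] d by auto
   ultimately show ?thesis using e(1) by (simp add: C_def)
  qed
  finally have "(LBINT p. G n p) \<le> C" .
  then show ?thesis using nn_integral_eq_integral[OF iG] G0 by (simp add: ennreal_leI)
 qed
 have "(\<integral>\<^sup>+p. ennreal (indc ?X p * (k0 * ((Q p)\<^sup>2 * W p))) \<partial>lborel) = (\<integral>\<^sup>+p. liminf (\<lambda>n. ennreal (G n p)) \<partial>lborel)"
 proof (rule nn_integral_cong)
  fix p
  have "(\<lambda>n. G n p) \<longlonglongrightarrow> indc ?X p * (k0 * ((Q p)\<^sup>2 * 1 * W p))"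
   unfolding G_def by (intro tendsto_intros Phi_tendsto_1)
  then have "(\<lambda>n. ennreal (G n p)) \<longlonglongrightarrow> ennreal (indc ?X p * (k0 * ((Q p)\<^sup>2 * W p)))"
   by (intro tendsto_ennrealI) simp
  from lim_imp_Liminf[OF _ this] show "ennreal (indc ?X p * (k0 * ((Q p)\<^sup>2 * W p))) = liminf (\<lambda>n. ennreal (G n p))" by simp
 qed
 also have "\<dots> \<le> liminf (\<lambda>n. \<integral>\<^sup>+p. ennreal (G n p) \<partial>lborel)" by (rule nn_integral_liminf) measurable
 also have "\<dots> \<le> liminf (\<lambda>n. ennreal C)" by (intro Liminf_mono always_eventually allI Gle)
 also have "\<dots> = ennreal C" by (simp add: Liminf_const)
 finally have fin: "(\<integral>\<^sup>+p. ennreal (indc ?X p * (k0 * ((Q p)\<^sup>2 * W p))) \<partial>lborel) < \<infinity>"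
  by (rule le_less_trans) simp
 have "intble (\<lambda>p. indc ?X p * (k0 * ((Q p)\<^sup>2 * W p)))"
 proof (rule integrableI_bounded)
  have "norm (indc ?X p * (k0 * ((Q p)\<^sup>2 * W p))) = indc ?X p * (k0 * ((Q p)\<^sup>2 * W p))" for p
   using X[of p] k0 by (auto simp: indicator_def abs_mult)
  then show "(\<integral>\<^sup>+p. ennreal (norm (indc ?X p * (k0 * ((Q p)\<^sup>2 * W p)))) \<partial>lborel) < \<infinity>" using fin by simp
 qed measurable
 then have "intble (\<lambda>p. (1 / k0) * (indc ?X p * (k0 * ((Q p)\<^sup>2 * W p))))" by (rule integrable_mult_right)
 then show ?thesis using k0 by (simp add: mult_ac)
qed

lemma A_tendsto_D:
 assumes t: "0 < t" "t < T"
 shows "(\<lambda>n. A (real (Suc n)) t) \<longlonglongrightarrow> D t"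
 unfolding A_def D_def
proof (rule integral_dominated_convergence[OF _ _ P_int[OF t]])
 note [measurable] = P_meas[OF t]
 show "AE y in lborel. (\<lambda>n. (norm (P t y))\<^sup>2 * (Phi (real (Suc n)) y * W (y, t))) \<longlonglongrightarrow> (norm (P t y))\<^sup>2 * W (y, t)"
 proof (rule AE_I2)
  fix y
  have "(\<lambda>n. (norm (P t y))\<^sup>2 * (Phi (real (Suc n)) y * W (y, t))) \<longlonglongrightarrow> (norm (P t y))\<^sup>2 * (1 * W (y, t))"
   by (intro tendsto_intros Phi_tendsto_1)
  then show "(\<lambda>n. (norm (P t y))\<^sup>2 * (Phi (real (Suc n)) y * W (y, t))) \<longlonglongrightarrow> (norm (P t y))\<^sup>2 * W (y, t)" by simp
 qed
 show "AE y in lborel. norm ((norm (P t y))\<^sup>2 * (Phi (real (Suc n)) y * W (y, t))) \<le> (norm (P t y))\<^sup>2 * W (y, t)" for n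
 proof (rule AE_I2)
  fix y
  have W: "W (y, t) \<ge> 0" using W_pos[OF t, of y] by simp
  have "(norm (P t y))\<^sup>2 * (Phi (real (Suc n)) y * W (y, t)) \<le> (norm (P t y))\<^sup>2 * (1 * W (y, t))"
   by (intro mult_left_mono mult_right_mono Phi_le_1 W) auto
  then show "norm ((norm (P t y))\<^sup>2 * (Phi (real (Suc n)) y * W (y, t))) \<le> (norm (P t y))\<^sup>2 * W (y, t)"
   using W Phi_nonneg[of "real (Suc n)" y] by (simp add: abs_mult)
 qed
 show "(\<lambda>y. (norm (P t y))\<^sup>2 * W (y, t)) \<in> borel_measurable lborel" by measurable
 show "(\<lambda>y. (norm (P t y))\<^sup>2 * (Phi (real (Suc n)) y * W (y, t))) \<in> borel_measurable lborel" for n by measurable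
qed

text \<open>The square norm of \<open>Q\<close> and its pairing \<open>M\<close> with
  \<open>v\<close>: formally, the equation gives \<open>D = t * M\<close>, and Cauchy-Schwarz
  compares \<open>M\<close> with \<open>B\<close> and \<open>H\<close>.\<close>

definition B :: "real \<Rightarrow> real" where "B t = (LBINT y. (Q (y, t))\<^sup>2 * W (y, t))"
definition M :: "real \<Rightarrow> real" where "M t = (LBINT y. v (y, t) * Q (y, t) * W (y, t))"

lemma dPhi_tendsto_0: "(\<lambda>n. dPhi (real (Suc n)) (y::'a)) \<longlonglongrightarrow> 0"
proof (rule Lim_null_comparison)
 show "\<forall>\<^sub>F n in sequentially. norm (dPhi (real (Suc n)) y) \<le> 4 * eps n"
  using dPhi_bound(2)[of "real (Suc n)" y for n] by (intro always_eventually allI) (simp add: eps_def divide_inverse)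
 have "(\<lambda>n. 4 * eps n) \<longlonglongrightarrow> 4 * 0" by (intro tendsto_intros eps_tendsto)
 then show "(\<lambda>n. 4 * eps n) \<longlonglongrightarrow> 0" by simp
qed

text \<open>The limit of \<open>energy_cut\<close> for growing radius. Global integrability of
  \<open>Q\<close> gives a dominating function independent of the radius, and the contribution of
  the gradient of the cut-off tends to 0.\<close>

lemma energy:
 assumes e: "0 < a1" "a1 < a2" "a2 < T"
 shows "(LBINT t. indc {a1..a2} t * (2 * t powr c * t * B t)) \<le> a2 powr c * D a2 - a1 powr c * D a1"
  and "intble (\<lambda>t. indc {a1..a2} t * (2 * t powr c * t * B t))"
proof -
 let ?X = "UNIV \<times> {a1..a2} :: ('a \<times> real) set"
 have [measurable]: "?X \<in> sets borel" by measurable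
 have X: "p \<in> ?X \<Longrightarrow> 0 < snd p \<and> snd p < T \<and> a1 \<le> snd p \<and> W p > 0" for p
  using W_pos[of "snd p" "fst p"] e by auto
 let ?w = "\<lambda>p. 2 * T powr c * ((T + 4) * (indc ?X p * ((Q p)\<^sup>2 * W p)) + 4 * (indc ?X p * ((norm (Pj p))\<^sup>2 * W p)))"
 let ?f = "\<lambda>p. indc ?X p * (2 * snd p powr c * snd p * ((Q p)\<^sup>2 * W p))"
 have w: "intble ?w" using Q_weighted[OF e] Pj_weighted[of a1 a2] e by simp
 have dom: "norm (indc ?X p * (F R p * Q p)) \<le> ?w p" if R: "R \<ge> 1" for R p
 proof (cases "p \<in> ?X")
  case True
  note x = X[OF True]
  obtain y s where p: "p = (y, s)" by (cases p)
  have s: "0 < s" "s < T" "a1 \<le> s" and W: "W p > 0" using x p by auto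
  have "4 / R \<le> 4" using R by (simp add: divide_le_eq)
  then have d4: "norm (dPhi R y) \<le> 4" using dPhi_bound(2)[of R y] R by simp
  have "\<bar>s * Q p * Phi R y\<bar> \<le> T * \<bar>Q p\<bar> * 1"
   unfolding abs_mult using s Phi_nonneg[of R y] Phi_le_1[of R y] by (intro mult_mono) auto
  moreover have "\<bar>Pj p \<bullet> dPhi R y\<bar> \<le> norm (Pj p) * 4"
   using Cauchy_Schwarz_ineq2[of "Pj p" "dPhi R y"] mult_left_mono[OF d4, of "norm (Pj p)"] by simp
  ultimately have "\<bar>s * Q p * Phi R y - Pj p \<bullet> dPhi R y\<bar> \<le> T * \<bar>Q p\<bar> + 4 * norm (Pj p)" by linarith
  then have "\<bar>s * Q p * Phi R y - Pj p \<bullet> dPhi R y\<bar> * \<bar>Q p\<bar> \<le> (T * \<bar>Q p\<bar> + 4 * norm (Pj p)) * \<bar>Q p\<bar>"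
   by (rule mult_right_mono) simp
  also have "\<dots> \<le> (T + 4) * (Q p)\<^sup>2 + 4 * (norm (Pj p))\<^sup>2"
  proof -
   have "0 \<le> (\<bar>Q p\<bar> - norm (Pj p))\<^sup>2" by simp
   then have "2 * (norm (Pj p) * \<bar>Q p\<bar>) \<le> (Q p)\<^sup>2 + (norm (Pj p))\<^sup>2"
    by (simp add: power2_diff mult_ac)
   moreover have "0 \<le> norm (Pj p) * \<bar>Q p\<bar>" by simp
   ultimately have "norm (Pj p) * \<bar>Q p\<bar> \<le> (Q p)\<^sup>2 + (norm (Pj p))\<^sup>2" by linarith
   moreover have "(T * \<bar>Q p\<bar> + 4 * norm (Pj p)) * \<bar>Q p\<bar> = T * (Q p)\<^sup>2 + 4 * (norm (Pj p) * \<bar>Q p\<bar>)"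
   proof -
    have "\<bar>Q p\<bar> * \<bar>Q p\<bar> = (Q p)\<^sup>2" by (simp add: power2_eq_square)
    then show ?thesis by (simp only: distrib_right mult.assoc)
   qed
   ultimately show ?thesis by (simp only: distrib_right)
  qed
  finally have le: "\<bar>s * Q p * Phi R y - Pj p \<bullet> dPhi R y\<bar> * \<bar>Q p\<bar> \<le> (T + 4) * (Q p)\<^sup>2 + 4 * (norm (Pj p))\<^sup>2" .
  have "norm (indc ?X p * (F R p * Q p)) = 2 * s powr c * (\<bar>s * Q p * Phi R y - Pj p \<bullet> dPhi R y\<bar> * \<bar>Q p\<bar>) * W p"
   using True W by (simp add: F_def p abs_mult)
  also have "\<dots> \<le> 2 * T powr c * ((T + 4) * (Q p)\<^sup>2 + 4 * (norm (Pj p))\<^sup>2) * W p"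
   using le W s c_nonneg by (intro mult_right_mono mult_mono powr_mono2) auto
  also have "\<dots> = ?w p" using True by (simp add: algebra_simps)
  finally show ?thesis .
 qed simp
 have lim: "(\<lambda>n. (LBINT p. indc ?X p * (F (real (Suc n)) p * Q p))) \<longlonglongrightarrow> (LBINT p. ?f p)"
 proof (rule integral_dominated_convergence[OF _ _ w])
  show "AE p in lborel. (\<lambda>n. indc ?X p * (F (real (Suc n)) p * Q p)) \<longlonglongrightarrow> ?f p"
  proof (rule AE_I2)
   fix p :: "'a \<times> real"
   have "(\<lambda>n. indc ?X p * (F (real (Suc n)) p * Q p)) \<longlonglongrightarrow>
     indc ?X p * ((2 * snd p powr c * (snd p * Q p * 1 - Pj p \<bullet> 0) * W p) * Q p)"
    unfolding F_def by (intro tendsto_intros Phi_tendsto_1 dPhi_tendsto_0)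
   then show "(\<lambda>n. indc ?X p * (F (real (Suc n)) p * Q p)) \<longlonglongrightarrow> ?f p"
    by (simp add: power2_eq_square mult_ac)
  qed
  show "AE p in lborel. norm (indc ?X p * (F (real (Suc n)) p * Q p)) \<le> ?w p" for n
   by (rule AE_I2, rule dom) simp
  show "?f \<in> borel_measurable lborel" by measurable
  show "(\<lambda>p. indc ?X p * (F (real (Suc n)) p * Q p)) \<in> borel_measurable lborel" for n by measurable
 qed
 have i: "intble ?f"
 proof (rule lintable_bound)
  show "intble (\<lambda>p. 2 * T powr c * T * (indc ?X p * ((Q p)\<^sup>2 * W p)))" using Q_weighted[OF e] by simp
  show "AE p in lborel. norm (?f p) \<le> norm (2 * T powr c * T * (indc ?X p * ((Q p)\<^sup>2 * W p)))"
  proof (rule AE_I2)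
   fix p :: "'a \<times> real"
   show "norm (?f p) \<le> norm (2 * T powr c * T * (indc ?X p * ((Q p)\<^sup>2 * W p)))"
   proof (cases "p \<in> ?X")
    case True
    note x = X[OF True]
    have "2 * snd p powr c * snd p * ((Q p)\<^sup>2 * W p) \<le> 2 * T powr c * T * ((Q p)\<^sup>2 * W p)"
     using x c_nonneg by (intro mult_right_mono mult_mono powr_mono2) auto
    then show ?thesis using True x T_pos by (simp add: abs_mult)
   qed simp
  qed
 qed measurable
 have eq: "(LBINT y. ?f (y, t)) = indc {a1..a2} t * (2 * t powr c * t * B t)" for t
  by (simp add: B_def indicator_def)
 show "intble (\<lambda>t. indc {a1..a2} t * (2 * t powr c * t * B t))"
  using lborel_integrable_snd[OF i] unfolding eq .
 have "(LBINT p. ?f p) \<le> a2 powr c * D a2 - a1 powr c * D a1"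
 proof (rule LIMSEQ_le[OF lim])
  show "(\<lambda>n. a2 powr c * A (real (Suc n)) a2 - a1 powr c * A (real (Suc n)) a1) \<longlonglongrightarrow> a2 powr c * D a2 - a1 powr c * D a1"
   using e by (intro tendsto_intros A_tendsto_D) auto
  show "\<exists>N. \<forall>n\<ge>N. (LBINT p. indc ?X p * (F (real (Suc n)) p * Q p))
    \<le> a2 powr c * A (real (Suc n)) a2 - a1 powr c * A (real (Suc n)) a1"
   using energy_cut(1)[OF e] by auto
 qed
 then show "(LBINT t. indc {a1..a2} t * (2 * t powr c * t * B t)) \<le> a2 powr c * D a2 - a1 powr c * D a1"
  using lborel_integral_snd[OF i] unfolding eq by simp
qed

end

section \<open>Growth of the weighted norm and monotonicity of the frequency\<close>

context frequency begin

definition h :: "real \<Rightarrow> real \<Rightarrow> real" where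
 "h R t = (LBINT y. (v (y, t))\<^sup>2 * (Phi R y * W (y, t)))"

text \<open>The derivative with respect to \<open>v\<close> of the density of
  \<open>t powr e * h R t\<close>; the exponent \<open>e\<close> will be \<open>c\<close> or
  \<open>- c\<close>.\<close>

definition G :: "real \<Rightarrow> real \<Rightarrow> 'a \<times> real \<Rightarrow> real" where
 "G e R p = 2 * snd p powr e * v p * (Phi R (fst p) * W p)"

lemma h_measurable [measurable]: "h R \<in> borel_measurable borel"
 unfolding h_def[abs_def] by measurable

lemma G_measurable [measurable]: "G e R \<in> borel_measurable borel"
 unfolding G_def[abs_def]
 by (intro borel_measurable_times borel_measurable_const snd_pair_measurable fst_pair_measurable W_meas v_meas)

lemma h_integrable:
 assumes "0 < t" "t < T" "R > 0"
 shows "intble (\<lambda>y. (v (y, t))\<^sup>2 * (Phi R y * W (y, t)))"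
 by (rule continuous_compact_support_integrable[of _ R])
  (auto simp: Phi_outside assms intro!: continuous_intros Phi_continuous slice_continuous assms)

lemma h_bounds:
 assumes t: "0 < t" "t < T" and R: "R > 0"
 shows "0 \<le> h R t" "h R t \<le> H t"
proof -
 have W0: "W (y, t) \<ge> 0" for y using W_pos[OF t, of y] by simp
 show "0 \<le> h R t"
  unfolding h_def using W0 Phi_nonneg[of R] by (intro integral_nonneg_AE AE_I2 mult_nonneg_nonneg) auto
 show "h R t \<le> H t"
  unfolding h_def H_def
 proof (rule integral_mono[OF h_integrable[OF t R] v_int[OF t]])
  fix y
  have "Phi R y * W (y, t) \<le> 1 * W (y, t)" by (intro mult_right_mono Phi_le_1 W0)
  then show "(v (y, t))\<^sup>2 * (Phi R y * W (y, t)) \<le> (v (y, t))\<^sup>2 * W (y, t)"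
   by (intro mult_left_mono) auto
 qed
qed

lemma h_tendsto_H:
 assumes t: "0 < t" "t < T"
 shows "(\<lambda>n. h (real (Suc n)) t) \<longlonglongrightarrow> H t"
 unfolding h_def H_def
proof (rule integral_dominated_convergence[OF _ _ v_int[OF t]])
 show "AE y in lborel. (\<lambda>n. (v (y, t))\<^sup>2 * (Phi (real (Suc n)) y * W (y, t))) \<longlonglongrightarrow> (v (y, t))\<^sup>2 * W (y, t)"
 proof (rule AE_I2)
  fix y
  have "(\<lambda>n. (v (y, t))\<^sup>2 * (Phi (real (Suc n)) y * W (y, t))) \<longlonglongrightarrow> (v (y, t))\<^sup>2 * (1 * W (y, t))"
   by (intro tendsto_intros Phi_tendsto_1)
  then show "(\<lambda>n. (v (y, t))\<^sup>2 * (Phi (real (Suc n)) y * W (y, t))) \<longlonglongrightarrow> (v (y, t))\<^sup>2 * W (y, t)" by simp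
 qed
 show "AE y in lborel. norm ((v (y, t))\<^sup>2 * (Phi (real (Suc n)) y * W (y, t))) \<le> (v (y, t))\<^sup>2 * W (y, t)" for n
 proof (rule AE_I2)
  fix y
  have W: "W (y, t) \<ge> 0" using W_pos[OF t, of y] by simp
  have "(v (y, t))\<^sup>2 * (Phi (real (Suc n)) y * W (y, t)) \<le> (v (y, t))\<^sup>2 * (1 * W (y, t))"
   by (intro mult_left_mono mult_right_mono Phi_le_1 W) auto
  then show "norm ((v (y, t))\<^sup>2 * (Phi (real (Suc n)) y * W (y, t))) \<le> (v (y, t))\<^sup>2 * W (y, t)"
   using W Phi_nonneg[of "real (Suc n)" y] by (simp add: abs_mult)
 qed
 show "(\<lambda>y. (v (y, t))\<^sup>2 * W (y, t)) \<in> borel_measurable lborel" by measurable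
 show "(\<lambda>y. (v (y, t))\<^sup>2 * (Phi (real (Suc n)) y * W (y, t))) \<in> borel_measurable lborel" for n by measurable
qed

lemma G_loc_L2:
 assumes ab: "0 < a" "b < T"
 shows "L2 lborel (\<lambda>p. indc (cball 0 R \<times> {a..b}) p * G e R p)"
proof -
 have "continuous_on (cball 0 R \<times> {a..b}) (G e R)"
  unfolding G_def[abs_def]
  by (intro continuous_intros continuous_on_compose2[OF Phi_continuous[of UNIV]]
    continuous_on_subset[OF v_cont] continuous_on_subset[OF W_cont]) (use ab in auto)
 then have "intble (\<lambda>p. indc (cball 0 R \<times> {a..b}) p *\<^sub>R (G e R p)\<^sup>2)"
  by (intro borel_integrable_compact compact_Times continuous_intros) auto
 moreover have "(\<lambda>p. indc (cball 0 R \<times> {a..b}) p *\<^sub>R (G e R p)\<^sup>2) = (\<lambda>p. (indc (cball 0 R \<times> {a..b}) p * G e R p)\<^sup>2)"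
  by (auto simp: indicator_def fun_eq_iff)
 ultimately show ?thesis by (simp add: L2_def)
qed

lemma powr_h_continuous:
 assumes a: "0 < a" "a < T" and R: "R > 0" and r: "r > 0"
 shows "\<exists>d>0. \<forall>s. 0 < s \<and> s < T \<and> \<bar>s - a\<bar> < d \<longrightarrow> \<bar>s powr e * h R s - a powr e * h R a\<bar> \<le> r"
proof -
 let ?g = "\<lambda>p. snd p powr e * ((v p)\<^sup>2 * (Phi R (fst p) * W p))"
 have cont: "continuous_on (UNIV \<times> {0<..<T}) ?g"
  by (intro continuous_intros continuous_on_compose2[OF Phi_continuous[of UNIV]] v_cont W_cont) auto
 have eq: "(LBINT y. ?g (y, s)) = s powr e * h R s" for s by (simp add: h_def)
 have "\<exists>d>0. \<forall>s. 0 < s \<and> s < T \<and> \<bar>s - a\<bar> < d \<longrightarrow> \<bar>(LBINT y. ?g (y, s)) - (LBINT y. ?g (y, a))\<bar> \<le> r"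
  by (rule slice_integral_continuous[OF cont _ a r, of R]) (simp add: Phi_outside R)
 then show ?thesis unfolding eq .
qed

lemma powr_h_integrable:
 assumes d: "0 < a1" "a1 < a2" "a2 < T" and R: "R > 0"
 shows "intble (\<lambda>s. indc {a1..a2} s * (s powr e * h R s))"
proof (rule lintable_bound)
 define E where "E = a1 powr e + a2 powr e"
 have E: "s powr e \<le> E" if "s \<in> {a1..a2}" for s
 proof (cases "e \<ge> 0")
  case True
  then have "s powr e \<le> a2 powr e" using that d by (intro powr_mono2) auto
  then show ?thesis by (simp add: E_def add_increasing)
 next
  case False
  then have "s powr e \<le> a1 powr e" using that d by (intro powr_mono2') auto
  then show ?thesis by (simp add: E_def add_increasing2)
 qed
 show "intble (\<lambda>s. E * (indc {a1..a2} s * H s))"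
  unfolding H_def using H_loc[of a1 a2] d by simp
 show "AE s in lborel. norm (indc {a1..a2} s * (s powr e * h R s)) \<le> norm (E * (indc {a1..a2} s * H s))"
 proof (rule AE_I2)
  fix s
  show "norm (indc {a1..a2} s * (s powr e * h R s)) \<le> norm (E * (indc {a1..a2} s * H s))"
  proof (cases "s \<in> {a1..a2}")
   case True
   then have s: "0 < s" "s < T" using d by auto
   note hb = h_bounds[OF s R]
   have "s powr e * h R s \<le> E * H s"
    using E[OF True] hb by (intro mult_mono) (auto intro: order_trans[OF powr_ge_zero])
   moreover have "E \<ge> 0" "H s \<ge> 0" using hb by (auto simp: E_def)
   ultimately show ?thesis using True hb by (simp add: abs_mult)
  qed simp
 qed
qed measurable

text \<open>With \<open>a\<close> and \<open>b\<close> the values of \<open>v\<close> at the later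
  and the earlier time, convexity gives \<open>2 * b * (a - b) \<le> a\<^sup>2 - b\<^sup>2\<close>,
  and \<open>W_incr\<close> exchanges the weight in front of \<open>a\<^sup>2\<close>.\<close>

lemma mass_plus_cut:
 assumes t: "0 < a1" "a1 < a2" "a2 < T" and R: "R > 0"
 shows "(LBINT p. indc (cball 0 R \<times> {a1..a2}) p * (G c R p * Q p)) \<le> a2 powr c * h R a2 - a1 powr c * h R a1"
proof (rule telescoping[where \<phi>="\<lambda>s. s powr c * h R s" and \<phi>j="\<lambda>s. s powr c * h R s" and K=0])
 show "L2 lborel (\<lambda>p. indc (cball 0 R \<times> {a1..a2}) p * G c R p)" using t by (intro G_loc_L2) auto
 show "G c R (y, s) = 0" if "R < norm y" for y s using that R by (simp add: G_def Phi_outside)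
 show "intble (\<lambda>s. indc {a1..a2} s * (s powr c * h R s))" by (rule powr_h_integrable[OF t R])
 show "AE s in lborel. s \<in> {a1..a2} \<longrightarrow> (\<forall>r\<in>{s..a2}. (LBINT y. G c R (y, s) * (v (y, r) - v (y, s)))
   - 0 * (LBINT y. indc (cball 0 R) y * (v (y, r) - v (y, s))\<^sup>2) \<le> r powr c * h R r - s powr c * h R s)"
 proof (intro AE_I2 impI ballI)
  fix s r assume "s \<in> {a1..a2}" "r \<in> {s..a2}"
  then have s: "0 < s" "s < T" and r: "0 < r" "r < T" "s \<le> r" using t by auto
  have i: "intble (\<lambda>y. G c R (y, s) * (v (y, r) - v (y, s)))"
   unfolding G_def
   by (rule continuous_compact_support_integrable[of _ R])
    (auto simp: Phi_outside R intro!: continuous_intros Phi_continuous slice_continuous s r)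
  have "(LBINT y. G c R (y, s) * (v (y, r) - v (y, s)))
   \<le> (LBINT y. r powr c * ((v (y, r))\<^sup>2 * (Phi R y * W (y, r))) - s powr c * ((v (y, s))\<^sup>2 * (Phi R y * W (y, s))))"
  proof (rule integral_mono[OF i])
   show "intble (\<lambda>y. r powr c * ((v (y, r))\<^sup>2 * (Phi R y * W (y, r))) - s powr c * ((v (y, s))\<^sup>2 * (Phi R y * W (y, s))))"
    using h_integrable s r R by simp
   fix y
   define a b k where "a = v (y, r)" and "b = v (y, s)" and "k = Phi R y * (s powr c * W (y, s))"
   have k: "k \<ge> 0" using W_pos[OF s, of y] Phi_nonneg[of R y] by (simp add: k_def)
   have "0 \<le> (a - b)\<^sup>2" by simp
   then have "2 * b * (a - b) \<le> a\<^sup>2 - b\<^sup>2" by (simp add: power2_eq_square algebra_simps)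
   then have "2 * b * (a - b) * k \<le> (a\<^sup>2 - b\<^sup>2) * k" using k by (rule mult_right_mono)
   also have "\<dots> = a\<^sup>2 * k - b\<^sup>2 * k" by (simp add: left_diff_distrib)
   also have "a\<^sup>2 * k \<le> a\<^sup>2 * (Phi R y * (r powr c * W (y, r)))"
    unfolding k_def by (intro mult_left_mono W_incr s r Phi_nonneg) auto
   finally have "2 * b * (a - b) * k \<le> a\<^sup>2 * (Phi R y * (r powr c * W (y, r))) - b\<^sup>2 * k" by simp
   then show "G c R (y, s) * (v (y, r) - v (y, s)) \<le>
    r powr c * ((v (y, r))\<^sup>2 * (Phi R y * W (y, r))) - s powr c * ((v (y, s))\<^sup>2 * (Phi R y * W (y, s)))"
    by (simp add: G_def a_def b_def k_def mult_ac)
  qed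
  also have "\<dots> = r powr c * h R r - s powr c * h R s"
   using h_integrable s r R by (simp add: h_def)
  finally show "(LBINT y. G c R (y, s) * (v (y, r) - v (y, s)))
   - 0 * (LBINT y. indc (cball 0 R) y * (v (y, r) - v (y, s))\<^sup>2) \<le> r powr c * h R r - s powr c * h R s" by simp
 qed
 fix e :: real assume "e > 0"
 from powr_h_continuous[OF t(1) _ R this, of c] t obtain d where d: "d > 0"
  "\<And>s. 0 < s \<Longrightarrow> s < T \<Longrightarrow> \<bar>s - a1\<bar> < d \<Longrightarrow> \<bar>s powr c * h R s - a1 powr c * h R a1\<bar> \<le> e" by auto
 show "\<exists>d>0. \<forall>s. a1 < s \<and> s < a1 + d \<and> s < a2 \<longrightarrow> a1 powr c * h R a1 - e \<le> s powr c * h R s"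
 proof (intro exI[of _ d] conjI allI impI d(1))
  fix s assume "a1 < s \<and> s < a1 + d \<and> s < a2"
  then show "a1 powr c * h R a1 - e \<le> s powr c * h R s" using d(2)[of s] t by auto
 qed
qed (use t in auto)

text \<open>The upper bound goes against convexity: \<open>a\<^sup>2 - b\<^sup>2\<close> exceeds
  \<open>2 * b * (a - b)\<close> by \<open>(a - b)\<^sup>2\<close>. This excess is the reason for
  the constant \<open>K\<close> in \<open>telescoping\<close>; being quadratic in the increment, it
  disappears in the limit.\<close>

lemma mass_minus_cut:
 assumes n: "0 < a1" "a1 < a2" "a2 < T" and R: "R > 0"
 shows "a2 powr (- c) * h R a2 - a1 powr (- c) * h R a1 \<le> (LBINT p. indc (cball 0 R \<times> {a1..a2}) p * (G (- c) R p * Q p))"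
proof -
 obtain m Mx where Mx: "0 < Mx" "\<And>y t. norm y \<le> R \<Longrightarrow> a1 \<le> t \<Longrightarrow> t \<le> a2 \<Longrightarrow> W (y, t) \<le> Mx"
  using W_bounds[OF n(1,3), of R] by blast
 have "(LBINT p. indc (cball 0 R \<times> {a1..a2}) p * (- G (- c) R p * Q p))
   \<le> - (a2 powr (- c) * h R a2) - - (a1 powr (- c) * h R a1)"
 proof (rule telescoping[where \<phi>="\<lambda>s. - (s powr (- c) * h R s)" and \<phi>j="\<lambda>s. - (s powr (- c) * h R s)" and K="a1 powr (- c) * Mx"])
  show "L2 lborel (\<lambda>p. indc (cball 0 R \<times> {a1..a2}) p * - G (- c) R p)"
   using G_loc_L2[OF n(1,3), of R "- c"] by (simp add: L2_def)
  show "- G (- c) R (y, s) = 0" if "R < norm y" for y s using that R by (simp add: G_def Phi_outside)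
  show "intble (\<lambda>s. indc {a1..a2} s * - (s powr (- c) * h R s))"
   using powr_h_integrable[OF n R, of "- c"] by simp
  show "AE s in lborel. s \<in> {a1..a2} \<longrightarrow> (\<forall>r\<in>{s..a2}. (LBINT y. - G (- c) R (y, s) * (v (y, r) - v (y, s)))
    - a1 powr (- c) * Mx * (LBINT y. indc (cball 0 R) y * (v (y, r) - v (y, s))\<^sup>2)
    \<le> - (r powr (- c) * h R r) - - (s powr (- c) * h R s))"
  proof (intro AE_I2 impI ballI)
   fix s r assume sr: "s \<in> {a1..a2}" "r \<in> {s..a2}"
   then have s: "0 < s" "s < T" and r: "0 < r" "r < T" "s \<le> r" using n by auto
   let ?K = "a1 powr (- c) * Mx"
   have i: "intble (\<lambda>y. - G (- c) R (y, s) * (v (y, r) - v (y, s)))"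
    unfolding G_def
    by (rule continuous_compact_support_integrable[of _ R])
     (auto simp: Phi_outside R intro!: continuous_intros Phi_continuous slice_continuous s r)
   have i2: "intble (\<lambda>y. indc (cball 0 R) y * (v (y, r) - v (y, s))\<^sup>2)"
   proof -
    have "continuous_on (cball 0 R) (\<lambda>y. (v (y, r) - v (y, s))\<^sup>2)"
     by (intro continuous_intros slice_continuous s r)
    from borel_integrable_compact[OF compact_cball this] show ?thesis by simp
   qed
   have "(LBINT y. - G (- c) R (y, s) * (v (y, r) - v (y, s))) - ?K * (LBINT y. indc (cball 0 R) y * (v (y, r) - v (y, s))\<^sup>2)
    = (LBINT y. - G (- c) R (y, s) * (v (y, r) - v (y, s)) - ?K * (indc (cball 0 R) y * (v (y, r) - v (y, s))\<^sup>2))"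
    using i i2 by simp
   also have "\<dots> \<le> (LBINT y. s powr (- c) * ((v (y, s))\<^sup>2 * (Phi R y * W (y, s))) - r powr (- c) * ((v (y, r))\<^sup>2 * (Phi R y * W (y, r))))"
   proof (rule integral_mono)
    show "intble (\<lambda>y. - G (- c) R (y, s) * (v (y, r) - v (y, s)) - ?K * (indc (cball 0 R) y * (v (y, r) - v (y, s))\<^sup>2))"
     using i i2 by auto
    show "intble (\<lambda>y. s powr (- c) * ((v (y, s))\<^sup>2 * (Phi R y * W (y, s))) - r powr (- c) * ((v (y, r))\<^sup>2 * (Phi R y * W (y, r))))"
     using h_integrable s r R by simp
    fix y
    define a b k where "a = v (y, r)" and "b = v (y, s)" and "k = Phi R y * (s powr (- c) * W (y, s))"
    have k: "k \<ge> 0" using W_pos[OF s, of y] Phi_nonneg[of R y] by (simp add: k_def)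
    have kK: "k * (a - b)\<^sup>2 \<le> ?K * (indc (cball 0 R) y * (a - b)\<^sup>2)"
    proof (cases "norm y \<le> R")
     case True
     have "s powr (- c) \<le> a1 powr (- c)" using sr n c_nonneg by (intro powr_mono2') auto
     then have "s powr (- c) * W (y, s) \<le> ?K"
      using Mx(2)[OF True] sr W_pos[OF s, of y] by (intro mult_mono) auto
     moreover have "k \<le> 1 * (s powr (- c) * W (y, s))"
      unfolding k_def using W_pos[OF s, of y] by (intro mult_right_mono Phi_le_1) auto
     ultimately have "k \<le> ?K" by simp
     then show ?thesis using True by (simp add: mult_right_mono)
    next
     case False
     then show ?thesis using R by (simp add: k_def Phi_outside)
    qed
    have "a\<^sup>2 * (Phi R y * (r powr (- c) * W (y, r))) \<le> a\<^sup>2 * k"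
     unfolding k_def by (intro mult_left_mono W_decr s r Phi_nonneg) auto
    moreover have "- (2 * b * (a - b) * k) - k * (a - b)\<^sup>2 = b\<^sup>2 * k - a\<^sup>2 * k"
     by (simp add: power2_eq_square algebra_simps)
    ultimately have "- (2 * b * (a - b) * k) - ?K * (indc (cball 0 R) y * (a - b)\<^sup>2)
     \<le> b\<^sup>2 * k - a\<^sup>2 * (Phi R y * (r powr (- c) * W (y, r)))" using kK by linarith
    then show "- G (- c) R (y, s) * (v (y, r) - v (y, s)) - ?K * (indc (cball 0 R) y * (v (y, r) - v (y, s))\<^sup>2)
     \<le> s powr (- c) * ((v (y, s))\<^sup>2 * (Phi R y * W (y, s))) - r powr (- c) * ((v (y, r))\<^sup>2 * (Phi R y * W (y, r)))"
     by (simp add: G_def a_def b_def k_def mult_ac)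
   qed
   also have "\<dots> = - (r powr (- c) * h R r) - - (s powr (- c) * h R s)"
    using h_integrable s r R by (simp add: h_def)
   finally show "(LBINT y. - G (- c) R (y, s) * (v (y, r) - v (y, s)))
    - ?K * (LBINT y. indc (cball 0 R) y * (v (y, r) - v (y, s))\<^sup>2)
    \<le> - (r powr (- c) * h R r) - - (s powr (- c) * h R s)" .
  qed
  fix e :: real assume "e > 0"
  from powr_h_continuous[OF n(1) _ R this, of "- c"] n obtain d where d: "d > 0"
   "\<And>s. 0 < s \<Longrightarrow> s < T \<Longrightarrow> \<bar>s - a1\<bar> < d \<Longrightarrow> \<bar>s powr (- c) * h R s - a1 powr (- c) * h R a1\<bar> \<le> e" by auto
  show "\<exists>d>0. \<forall>s. a1 < s \<and> s < a1 + d \<and> s < a2 \<longrightarrow> - (a1 powr (- c) * h R a1) - e \<le> - (s powr (- c) * h R s)"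
  proof (intro exI[of _ d] conjI allI impI d(1))
   fix s assume "a1 < s \<and> s < a1 + d \<and> s < a2"
   then show "- (a1 powr (- c) * h R a1) - e \<le> - (s powr (- c) * h R s)" using d(2)[of s] n by auto
  qed
 qed (use n Mx in auto)
 then show ?thesis by simp
qed

lemma mass_limit:
 assumes d: "0 < a1" "a1 < a2" "a2 < T"
 shows "intble (\<lambda>t. indc {a1..a2} t * (2 * t powr e * M t))"
  and "(\<lambda>n. (LBINT p. indc (cball 0 (real (Suc n)) \<times> {a1..a2}) p * (G e (real (Suc n)) p * Q p)))
   \<longlonglongrightarrow> (LBINT t. indc {a1..a2} t * (2 * t powr e * M t))"
proof -
 let ?X = "UNIV \<times> {a1..a2} :: ('a \<times> real) set"
 have [measurable]: "?X \<in> sets borel" by measurable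
 have X: "p \<in> ?X \<Longrightarrow> 0 < snd p \<and> snd p < T \<and> a1 \<le> snd p \<and> W p > 0" for p
  using W_pos[of "snd p" "fst p"] d by auto
 define E where "E = a1 powr e + a2 powr e"
 have E0: "E \<ge> 0" by (simp add: E_def)
 have E: "s powr e \<le> E" if "s \<in> {a1..a2}" for s
 proof (cases "e \<ge> 0")
  case True
  then have "s powr e \<le> a2 powr e" using that d by (intro powr_mono2) auto
  then show ?thesis by (simp add: E_def add_increasing)
 next
  case False
  then have "s powr e \<le> a1 powr e" using that d by (intro powr_mono2') auto
  then show ?thesis by (simp add: E_def add_increasing2)
 qed
 let ?w = "\<lambda>p. 2 * E * (indc ?X p * ((v p)\<^sup>2 * W p) + indc ?X p * ((Q p)\<^sup>2 * W p))"
 let ?f = "\<lambda>p. indc ?X p * (2 * snd p powr e * (v p * Q p * W p))"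
 have w: "intble ?w" using Q_weighted[OF d] v_weighted[of a1 a2] d by simp
 have dom: "norm (indc ?X p * (2 * snd p powr e * (v p * Q p * (k * W p)))) \<le> ?w p" if k: "0 \<le> k" "k \<le> 1" for k p
 proof (cases "p \<in> ?X")
  case True
  note x = X[OF True]
  have "\<bar>v p * Q p\<bar> * k \<le> ((v p)\<^sup>2 + (Q p)\<^sup>2) * 1"
  proof (rule mult_mono[OF _ k(2)])
   have "0 \<le> (\<bar>v p\<bar> - \<bar>Q p\<bar>)\<^sup>2" by simp
   then have "2 * (\<bar>v p\<bar> * \<bar>Q p\<bar>) \<le> (v p)\<^sup>2 + (Q p)\<^sup>2" by (simp add: power2_diff mult_ac)
   moreover have "0 \<le> \<bar>v p\<bar> * \<bar>Q p\<bar>" by simp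
   ultimately show "\<bar>v p * Q p\<bar> \<le> (v p)\<^sup>2 + (Q p)\<^sup>2" unfolding abs_mult by linarith
  qed (use k in auto)
  then have "\<bar>v p * Q p\<bar> * k * W p \<le> ((v p)\<^sup>2 + (Q p)\<^sup>2) * 1 * W p"
   using x by (intro mult_right_mono) auto
  moreover have "2 * snd p powr e \<le> 2 * E" using True E[of "snd p"] by auto
  ultimately have "2 * snd p powr e * (\<bar>v p * Q p\<bar> * k * W p) \<le> 2 * E * (((v p)\<^sup>2 + (Q p)\<^sup>2) * 1 * W p)"
   by (intro mult_mono[of "2 * snd p powr e" "2 * E"]) (use x k E0 in auto)
  then show ?thesis using True x k by (simp add: abs_mult algebra_simps)
 qed simp
 have i: "intble ?f"
 proof (rule lintable_bound[OF w])
  show "AE p in lborel. norm (?f p) \<le> norm (?w p)"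
  proof (rule AE_I2)
   fix p
   have "norm (?f p) \<le> ?w p" using dom[of 1 p] by simp
   then show "norm (?f p) \<le> norm (?w p)" by simp
  qed
 qed measurable
 have eq: "(LBINT y. ?f (y, t)) = indc {a1..a2} t * (2 * t powr e * M t)" for t
  by (simp add: M_def indicator_def)
 show "intble (\<lambda>t. indc {a1..a2} t * (2 * t powr e * M t))"
  using lborel_integrable_snd[OF i] unfolding eq .
 have fint: "(LBINT p. ?f p) = (LBINT t. indc {a1..a2} t * (2 * t powr e * M t))"
  using lborel_integral_snd[OF i] unfolding eq by simp
 have cut: "indc (cball 0 (real (Suc n)) \<times> {a1..a2}) p * (G e (real (Suc n)) p * Q p)
  = indc ?X p * (2 * snd p powr e * (v p * Q p * (Phi (real (Suc n)) (fst p) * W p)))" for n and p :: "'a \<times> real"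
  using Phi_outside(1)[of "real (Suc n)" "fst p"] by (cases p) (auto simp: G_def indicator_def)
 show "(\<lambda>n. (LBINT p. indc (cball 0 (real (Suc n)) \<times> {a1..a2}) p * (G e (real (Suc n)) p * Q p)))
   \<longlonglongrightarrow> (LBINT t. indc {a1..a2} t * (2 * t powr e * M t))"
  unfolding fint[symmetric] cut
 proof (rule integral_dominated_convergence[OF _ _ w])
  show "AE p in lborel. (\<lambda>n. indc ?X p * (2 * snd p powr e * (v p * Q p * (Phi (real (Suc n)) (fst p) * W p)))) \<longlonglongrightarrow> ?f p"
  proof (rule AE_I2)
   fix p :: "'a \<times> real"
   have "(\<lambda>n. indc ?X p * (2 * snd p powr e * (v p * Q p * (Phi (real (Suc n)) (fst p) * W p)))) \<longlonglongrightarrow>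
     indc ?X p * (2 * snd p powr e * (v p * Q p * (1 * W p)))"
    by (intro tendsto_intros Phi_tendsto_1)
   then show "(\<lambda>n. indc ?X p * (2 * snd p powr e * (v p * Q p * (Phi (real (Suc n)) (fst p) * W p)))) \<longlonglongrightarrow> ?f p"
    by simp
  qed
  show "AE p in lborel. norm (indc ?X p * (2 * snd p powr e * (v p * Q p * (Phi (real (Suc n)) (fst p) * W p)))) \<le> ?w p" for n
   by (rule AE_I2, rule dom) (rule Phi_nonneg, rule Phi_le_1)
  show "?f \<in> borel_measurable lborel" by measurable
  show "(\<lambda>p. indc ?X p * (2 * snd p powr e * (v p * Q p * (Phi (real (Suc n)) (fst p) * W p)))) \<in> borel_measurable lborel" for n
   by (simp only: measurable_lborel2) (intro borel_measurable_times borel_measurable_indicator borel_measurable_const snd_pair_measurable fst_pair_measurable v_meas Q_meas W_meas slab_measurable)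
 qed
qed

lemma mass_plus:
 assumes e: "0 < a1" "a1 < a2" "a2 < T"
 shows "(LBINT t. indc {a1..a2} t * (2 * t powr c * M t)) \<le> a2 powr c * H a2 - a1 powr c * H a1"
proof (rule LIMSEQ_le[OF mass_limit(2)[OF e]])
 show "(\<lambda>n. a2 powr c * h (real (Suc n)) a2 - a1 powr c * h (real (Suc n)) a1) \<longlonglongrightarrow> a2 powr c * H a2 - a1 powr c * H a1"
  using e by (intro tendsto_intros h_tendsto_H) auto
qed (use mass_plus_cut[OF e] in auto)

lemma mass_minus:
 assumes e: "0 < a1" "a1 < a2" "a2 < T"
 shows "a2 powr (- c) * H a2 - a1 powr (- c) * H a1 \<le> (LBINT t. indc {a1..a2} t * (2 * t powr (- c) * M t))"
proof (rule LIMSEQ_le[OF _ mass_limit(2)[OF e]])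
 show "(\<lambda>n. a2 powr (- c) * h (real (Suc n)) a2 - a1 powr (- c) * h (real (Suc n)) a1)
   \<longlonglongrightarrow> a2 powr (- c) * H a2 - a1 powr (- c) * H a1"
  using e by (intro tendsto_intros h_tendsto_H) auto
qed (use mass_minus_cut[OF e] in auto)

text \<open>The first relation is the equation at time \<open>s\<close> tested with \<open>v\<close>
  at the same time, after the cut-off has been removed. The second is Cauchy-Schwarz for
  \<open>v\<close> and \<open>Q\<close>, which needs \<open>Q\<close> to be globally integrable on
  the slice, hence \<open>Q_weighted\<close>.\<close>

lemma slice_relations:
 "AE s in lborel. 0 < s \<and> s < T \<longrightarrow> D s = s * M s \<and> (M s)\<^sup>2 \<le> B s * H s"
proof -
 \<comment> \<open>The divisor 4 ensures \<open>a n < b n\<close> also for \<open>n = 0\<close>,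
   where \<open>eps n = 1\<close>.\<close>
 define a b where "a n = T * eps n / 4" and "b n = T - T * eps n / 4" for n
 have ab: "0 < a n" "a n < b n" "b n < T" for n
 proof -
  have "eps n \<le> 1" by (simp add: eps_def field_simps)
  then have "T * eps n \<le> T * 1" using T_pos by (intro mult_left_mono) auto
  then show "0 < a n" "a n < b n" "b n < T" using T_pos unfolding a_def b_def by auto
 qed
 have "AE s in lborel. intble (\<lambda>y. indc (UNIV \<times> {a n..b n}) (y, s) * ((Q (y, s))\<^sup>2 * W (y, s)))" for n
  by (rule lborel_AE_integrable_snd[OF Q_weighted[OF ab]])
 then have "AE s in lborel. \<forall>n. intble (\<lambda>y. indc (UNIV \<times> {a n..b n}) (y, s) * ((Q (y, s))\<^sup>2 * W (y, s)))"
  unfolding AE_all_countable by blast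
 then show ?thesis
  using equation
 proof eventually_elim
  case (elim s)
  show ?case
  proof
   assume s: "0 < s \<and> s < T"
   then have s': "0 < s" "s < T" by auto
   note [measurable] = P_meas[OF s']
   define d where "d = min s (T - s) / T"
   have "d > 0" using s T_pos by (simp add: d_def)
   then obtain n where n: "eps n < d" using eventually_eps_less[of d] by (auto simp: eventually_sequentially)
   have "T * eps n < T * d" using n T_pos by simp
   also have "T * d = min s (T - s)" using T_pos by (simp add: d_def)
   finally have "T * eps n < min s (T - s)" .
   moreover have "T * eps n > 0" using T_pos by simp
   ultimately have sn: "a n \<le> s" "s \<le> b n" by (auto simp: a_def b_def)
   have QW: "intble (\<lambda>y. (Q (y, s))\<^sup>2 * W (y, s))"
    using elim(1)[rule_format, of n] sn by (simp add: indicator_def)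
   have W0: "W (y, s) \<ge> 0" for y using W_pos[OF s', of y] by simp
   have L1: "L2 lborel (\<lambda>y. v (y, s) * sqrt (W (y, s)))"
    using v_int[OF s'] W0 by (auto simp: L2_def power_mult_distrib)
   have L2: "L2 lborel (\<lambda>y. Q (y, s) * sqrt (W (y, s)))"
    using QW W0 by (auto simp: L2_def power_mult_distrib)
   have L3: "L2 lborel (\<lambda>y. norm (P s y) * sqrt (W (y, s)))"
    using P_int[OF s'] W0 by (auto simp: L2_def power_mult_distrib)
   have e12: "(v (y, s) * sqrt (W (y, s))) * (Q (y, s) * sqrt (W (y, s))) = v (y, s) * Q (y, s) * W (y, s)" for y
    using W0[of y] by (simp add: mult_ac)
   have e13: "(v (y, s) * sqrt (W (y, s))) * (norm (P s y) * sqrt (W (y, s))) = v (y, s) * norm (P s y) * W (y, s)" for y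
    using W0[of y] by (simp add: mult_ac)
   have CS: "(M s)\<^sup>2 \<le> B s * H s"
   proof -
    have sq: "(x * sqrt (W (y, s)))\<^sup>2 = x\<^sup>2 * W (y, s)" for x y using W0[of y] by (simp add: power_mult_distrib)
    show ?thesis
     using L2_Cauchy_Schwarz[OF L1 L2] unfolding e12 sq by (simp add: M_def B_def H_def mult.commute)
   qed
   have ivQ: "intble (\<lambda>y. v (y, s) * Q (y, s) * W (y, s))"
    using L2_mult_integrable[OF L1 L2] unfolding e12 .
   have ivP: "intble (\<lambda>y. v (y, s) * norm (P s y) * W (y, s))"
    using L2_mult_integrable[OF L1 L3] unfolding e13 .
   have eqn: "A (real (Suc n)) s + (LBINT y. (P s y \<bullet> dPhi (real (Suc n)) y) * (v (y, s) * W (y, s)))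
     = s * (LBINT y. Q (y, s) * (v (y, s) * Phi (real (Suc n)) y * W (y, s)))" for n
    using elim(2) s by (auto simp: A_def power2_norm_eq_inner)
   have lim1: "(\<lambda>n. (LBINT y. (P s y \<bullet> dPhi (real (Suc n)) y) * (v (y, s) * W (y, s)))) \<longlonglongrightarrow> (\<integral>y. 0 \<partial>(lborel :: 'a measure))"
   proof (rule integral_dominated_convergence[where w="\<lambda>y. 4 * \<bar>v (y, s) * norm (P s y) * W (y, s)\<bar>"])
    show "intble (\<lambda>y. 4 * \<bar>v (y, s) * norm (P s y) * W (y, s)\<bar>)" using ivP by simp
    show "AE y in lborel. (\<lambda>n. (P s y \<bullet> dPhi (real (Suc n)) y) * (v (y, s) * W (y, s))) \<longlonglongrightarrow> 0"
    proof (rule AE_I2)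
     fix y
     have "(\<lambda>n. (P s y \<bullet> dPhi (real (Suc n)) y) * (v (y, s) * W (y, s))) \<longlonglongrightarrow> (P s y \<bullet> 0) * (v (y, s) * W (y, s))"
      by (intro tendsto_intros dPhi_tendsto_0)
     then show "(\<lambda>n. (P s y \<bullet> dPhi (real (Suc n)) y) * (v (y, s) * W (y, s))) \<longlonglongrightarrow> 0" by simp
    qed
    show "AE y in lborel. norm ((P s y \<bullet> dPhi (real (Suc n)) y) * (v (y, s) * W (y, s))) \<le> 4 * \<bar>v (y, s) * norm (P s y) * W (y, s)\<bar>" for n
    proof (rule AE_I2)
     fix y :: 'a
     have "4 / real (Suc n) \<le> 4" by (simp add: divide_le_eq)
     then have "norm (dPhi (real (Suc n)) y) \<le> 4" using dPhi_bound(2)[of "real (Suc n)" y] by simp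
     from mult_left_mono[OF this, of "norm (P s y)"]
     have "\<bar>P s y \<bullet> dPhi (real (Suc n)) y\<bar> \<le> norm (P s y) * 4"
      using Cauchy_Schwarz_ineq2[of "P s y" "dPhi (real (Suc n)) y"] by simp
     then have "\<bar>P s y \<bullet> dPhi (real (Suc n)) y\<bar> * \<bar>v (y, s) * W (y, s)\<bar> \<le> norm (P s y) * 4 * \<bar>v (y, s) * W (y, s)\<bar>"
      by (rule mult_right_mono) simp
     then show "norm ((P s y \<bullet> dPhi (real (Suc n)) y) * (v (y, s) * W (y, s))) \<le> 4 * \<bar>v (y, s) * norm (P s y) * W (y, s)\<bar>"
      by (simp add: abs_mult mult_ac)
    qed
   qed auto
   have lim2: "(\<lambda>n. (LBINT y. Q (y, s) * (v (y, s) * Phi (real (Suc n)) y * W (y, s)))) \<longlonglongrightarrow> M s"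
    unfolding M_def
   proof (rule integral_dominated_convergence[where w="\<lambda>y. \<bar>v (y, s) * Q (y, s) * W (y, s)\<bar>"])
    show "AE y in lborel. (\<lambda>n. Q (y, s) * (v (y, s) * Phi (real (Suc n)) y * W (y, s))) \<longlonglongrightarrow> v (y, s) * Q (y, s) * W (y, s)"
    proof (rule AE_I2)
     fix y
     have "(\<lambda>n. Q (y, s) * (v (y, s) * Phi (real (Suc n)) y * W (y, s))) \<longlonglongrightarrow> Q (y, s) * (v (y, s) * 1 * W (y, s))"
      by (intro tendsto_intros Phi_tendsto_1)
     then show "(\<lambda>n. Q (y, s) * (v (y, s) * Phi (real (Suc n)) y * W (y, s))) \<longlonglongrightarrow> v (y, s) * Q (y, s) * W (y, s)"
      by (simp add: mult_ac)
    qed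
    show "AE y in lborel. norm (Q (y, s) * (v (y, s) * Phi (real (Suc n)) y * W (y, s))) \<le> \<bar>v (y, s) * Q (y, s) * W (y, s)\<bar>" for n
    proof (rule AE_I2)
     fix y
     have "\<bar>v (y, s) * Q (y, s) * W (y, s)\<bar> * Phi (real (Suc n)) y \<le> \<bar>v (y, s) * Q (y, s) * W (y, s)\<bar> * 1"
      by (intro mult_left_mono Phi_le_1) simp
     then show "norm (Q (y, s) * (v (y, s) * Phi (real (Suc n)) y * W (y, s))) \<le> \<bar>v (y, s) * Q (y, s) * W (y, s)\<bar>"
      using Phi_nonneg[of "real (Suc n)" y] by (simp add: abs_mult mult_ac)
    qed
   qed (use ivQ in auto)
   have "(\<lambda>n. s * (LBINT y. Q (y, s) * (v (y, s) * Phi (real (Suc n)) y * W (y, s)))) \<longlonglongrightarrow> s * M s"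
    by (intro tendsto_intros lim2)
   moreover have "(\<lambda>n. A (real (Suc n)) s + (LBINT y. (P s y \<bullet> dPhi (real (Suc n)) y) * (v (y, s) * W (y, s)))) \<longlonglongrightarrow> D s + (\<integral>y. 0 \<partial>(lborel :: 'a measure))"
    by (intro tendsto_intros A_tendsto_D s' lim1)
   ultimately have "D s = s * M s" unfolding eqn using LIMSEQ_unique by fastforce
   with CS show "D s = s * M s \<and> (M s)\<^sup>2 \<le> B s * H s" by simp
  qed
 qed
qed

lemma D_nonneg: "0 < t \<Longrightarrow> t < T \<Longrightarrow> D t \<ge> 0"
 unfolding D_def using W_pos[of t] by (intro integral_nonneg_AE AE_I2 mult_nonneg_nonneg) (auto simp: less_imp_le)

lemma H_nonneg: "0 < t \<Longrightarrow> t < T \<Longrightarrow> H t \<ge> 0"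
 unfolding H_def using W_pos[of t] by (intro integral_nonneg_AE AE_I2 mult_nonneg_nonneg) (auto simp: less_imp_le)

text \<open>\<open>M\<close> is nonnegative since \<open>D t = t * M t\<close>, and
  \<open>mass_plus\<close> applies. In particular \<open>H\<close> stays positive once it is
  positive, which keeps the denominators below under control.\<close>

lemma H_increasing:
 assumes "0 < a" "a \<le> b" "b < T"
 shows "a powr c * H a \<le> b powr c * H b"
proof (cases "a = b")
 case False
 then have ab: "0 < a" "a < b" "b < T" using assms by auto
 have "0 \<le> (LBINT t. indc {a..b} t * (2 * t powr c * M t))"
 proof (rule integral_nonneg_AE)
  show "AE t in lborel. 0 \<le> indc {a..b} t * (2 * t powr c * M t)"
   using slice_relations
  proof eventually_elim
   case (elim t)
   show ?case
   proof (cases "t \<in> {a..b}")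
    case True
    then have t: "0 < t" "t < T" using ab by auto
    have "t * M t \<ge> 0" using elim t D_nonneg[OF t] by simp
    then have "M t \<ge> 0" using t by (simp add: zero_le_mult_iff)
    then show ?thesis by simp
   qed simp
  qed
 qed
 also have "\<dots> \<le> b powr c * H b - a powr c * H a" by (rule mass_plus[OF ab])
 finally show ?thesis by simp
qed simp

text \<open>\<open>X\<close> may jump, so the quotient of \<open>X\<close> and \<open>Y\<close> is
  not differentiated. With \<open>N\<close> the quotient at \<open>s1\<close>, the function
  \<open>Z = X - N * Y\<close> satisfies \<open>Z' \<ge> k * Z\<close> in integrated form, where
  \<open>k = 2 * M / H\<close>. Its negative part then obeys Gronwall's inequality with value 0 at
  \<open>s1\<close>, so it vanishes at \<open>s2\<close>.\<close>

theorem frequency_mono: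
 assumes s12: "0 < s1" "s1 \<le> s2" "s2 < T"
 shows "s1 powr (2 * c) * (D s1 / H s1) \<le> s2 powr (2 * c) * (D s2 / H s2)"
proof (cases "s1 = s2 \<or> H s1 = 0")
 \<comment> \<open>If \<open>H s1 = 0\<close>, the quotient at \<open>s1\<close> is 0 because
   division by 0 yields 0.\<close>
 case True
 then show ?thesis using D_nonneg[of s2] H_nonneg[of s2] assms by auto
next
 case False
 then have s: "s1 < s2" and H1: "H s1 > 0" using s12 H_nonneg[of s1] by auto
 define X where "X t = t powr c * D t" for t
 define Y where "Y t = t powr (- c) * H t" for t
 \<comment> \<open>Bounds of \<open>Y\<close> on the interval, from writing it as the decreasing
   factor \<open>t powr (- 2 * c)\<close> times the increasing
   \<open>t powr c * H t\<close>.\<close>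
 define hm where "hm = s2 powr (- 2 * c) * (s1 powr c * H s1)"
 define hM where "hM = s1 powr (- 2 * c) * (s2 powr c * H s2)"
 have hm: "hm > 0" using H1 s12 s by (simp add: hm_def)
 have Yb: "hm \<le> Y t" "Y t \<le> hM" if t: "t \<in> {s1..s2}" for t
 proof -
  have t0: "0 < t" "t < T" using t s12 by auto
  have eq: "Y t = t powr (- 2 * c) * (t powr c * H t)"
   by (simp add: Y_def powr_add[symmetric] mult.assoc[symmetric])
  have "s2 powr (- 2 * c) \<le> t powr (- 2 * c)" "t powr (- 2 * c) \<le> s1 powr (- 2 * c)"
   using t s12 c_nonneg by (auto intro!: powr_mono2')
  moreover have "s1 powr c * H s1 \<le> t powr c * H t" "t powr c * H t \<le> s2 powr c * H s2"
   using H_increasing[of s1 t] H_increasing[of t s2] t s12 by auto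
  ultimately show "hm \<le> Y t" "Y t \<le> hM"
   unfolding eq hm_def hM_def using H1 H_nonneg[OF t0] by (auto intro!: mult_mono)
 qed
 have Xincr: "X s \<le> X t" if "s1 \<le> s" "s \<le> t" "t \<le> s2" for s t
 proof (cases "s = t")
  case False
  then have st: "0 < s" "s < t" "t < T" using that s12 by auto
  have "0 \<le> (LBINT r. indc {s..t} r * (2 * r powr c * r * B r))"
  proof (rule integral_nonneg_AE, rule AE_I2)
   fix r
   have "B r \<ge> 0" if "r \<in> {s..t}"
    unfolding B_def using W_pos[of r] that st
    by (intro integral_nonneg_AE AE_I2 mult_nonneg_nonneg) (auto simp: less_imp_le)
   then show "0 \<le> indc {s..t} r * (2 * r powr c * r * B r)" using st by (auto simp: indicator_def)
  qed
  also have "\<dots> \<le> X t - X s" unfolding X_def by (rule energy(1)[OF st])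
  finally show ?thesis by simp
 qed simp
 define N where "N = X s1 / Y s1"
 have Y1: "Y s1 > 0" using Yb(1)[of s1] hm s12 by auto
 have X0: "X t \<ge> 0" if "t \<in> {s1..s2}" for t using D_nonneg[of t] that s12 by (auto simp: X_def)
 have N0: "N \<ge> 0" using X0[of s1] Y1 s12 by (simp add: N_def)
 define Z where "Z t = X t - N * Y t" for t
 have Z1: "Z s1 = 0" using Y1 by (simp add: Z_def N_def)
 \<comment> \<open>An upper bound of the rate \<open>k\<close> below: \<open>k\<close> is
   \<open>2 * (r powr (- 2 * c) * (1 / r) * X r) / Y r\<close>, and each factor is estimated at an
   end point of the interval.\<close>
 define C where "C = 2 * (s1 powr (- 2 * c) * (1 / s1) * X s2) / hm"
 have C0: "C \<ge> 0" using X0[of s2] hm s12 by (simp add: C_def)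
 define U where "U t = indc {s1..s2} t * max 0 (- Z t)" for t
 have mD: "borel_fun (\<lambda>t. indc {s1..s2} t * D t)"
  unfolding D_def using D_loc[of s1 s2] s12 by auto
 have mH: "borel_fun (\<lambda>t. indc {s1..s2} t * H t)"
  unfolding H_def by measurable
 have Umeas [measurable]: "borel_fun U"
 proof -
  have "borel_fun (\<lambda>t. max 0 (- (t powr c * (indc {s1..s2} t * D t) - N * (t powr (- c) * (indc {s1..s2} t * H t)))))"
   using mD mH by measurable
  also have "(\<lambda>t. max 0 (- (t powr c * (indc {s1..s2} t * D t) - N * (t powr (- c) * (indc {s1..s2} t * H t))))) = U"
   by (auto simp: fun_eq_iff U_def Z_def X_def Y_def indicator_def)
  finally show ?thesis .
 qed
 have Ub: "0 \<le> U t \<and> U t \<le> N * hM" if "s1 \<le> t" "t \<le> s2" for t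
 proof -
  have "- Z t \<le> N * Y t" using X0[of t] that by (simp add: Z_def)
  also have "\<dots> \<le> N * hM" using Yb(2)[of t] that N0 by (intro mult_left_mono) auto
  finally have "- Z t \<le> N * hM" .
  moreover have "0 \<le> N * hM" using N0 Yb[of t] hm that by (intro mult_nonneg_nonneg) auto
  ultimately show ?thesis by (simp add: U_def indicator_def)
 qed
 have Uint: "intble (\<lambda>t. indc {s1..s} t * (C * U t))" for s
 proof (rule lintable_bound)
  show "intble (\<lambda>t. indc {s1..s2} t * (C * (N * hM)))"
   by (intro integrable_mult_left integrable_real_indicator) (auto simp: emeasure_lborel_Icc_eq)
  show "AE t in lborel. norm (indc {s1..s} t * (C * U t)) \<le> norm (indc {s1..s2} t * (C * (N * hM)))"
  proof (rule AE_I2)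
   fix t
   show "norm (indc {s1..s} t * (C * U t)) \<le> norm (indc {s1..s2} t * (C * (N * hM)))"
   proof (cases "t \<in> {s1..s2}")
    case True
    then have "0 \<le> U t" "U t \<le> N * hM" using Ub by auto
    then have "C * U t \<le> C * (N * hM)" "0 \<le> C * U t"
     using C0 by (auto intro: mult_left_mono)
    then have "norm (indc {s1..s} t * (C * U t)) \<le> C * (N * hM)" by (simp add: indicator_def)
    also have "\<dots> \<le> norm (indc {s1..s2} t * (C * (N * hM)))" using True by simp
    finally show ?thesis .
   qed (simp add: U_def)
  qed
 qed measurable
 have gron: "U t \<le> C * (LBINT r. indc {s1..t} r * U r)" if t: "s1 \<le> t" "t \<le> s2" for t
 proof (cases "t = s1")
  case True
  then have "U t = 0" using Z1 by (simp add: U_def)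
  moreover have "0 \<le> (LBINT r. indc {s1..t} r * U r)"
   by (rule integral_nonneg_AE, rule AE_I2) (auto simp: U_def indicator_def)
  ultimately show ?thesis using C0 by simp
 next
  case False
  then have st: "0 < s1" "s1 < t" "t < T" using t s12 by auto
  have "X t - X s1 \<ge> (LBINT r. indc {s1..t} r * (2 * r powr c * r * B r))"
   unfolding X_def by (rule energy(1)[OF st])
  moreover have "N * (Y t - Y s1) \<le> N * (LBINT r. indc {s1..t} r * (2 * r powr (- c) * M r))"
   unfolding Y_def by (rule mult_left_mono[OF mass_minus[OF st] N0])
  ultimately have "Z t - Z s1 \<ge> (LBINT r. indc {s1..t} r * (2 * r powr c * r * B r))
   - N * (LBINT r. indc {s1..t} r * (2 * r powr (- c) * M r))"
   by (simp add: Z_def right_diff_distrib)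
  also have "(LBINT r. indc {s1..t} r * (2 * r powr c * r * B r)) - N * (LBINT r. indc {s1..t} r * (2 * r powr (- c) * M r))
   = (LBINT r. indc {s1..t} r * (2 * r powr c * r * B r) - N * (indc {s1..t} r * (2 * r powr (- c) * M r)))"
   using energy(2)[OF st] mass_limit(1)[OF st, of "- c"] by simp
  also have "\<dots> \<ge> (LBINT r. - (indc {s1..t} r * (C * U r)))"
  proof (rule integral_mono_AE)
   show "intble (\<lambda>r. - (indc {s1..t} r * (C * U r)))" using Uint by simp
   show "intble (\<lambda>r. indc {s1..t} r * (2 * r powr c * r * B r) - N * (indc {s1..t} r * (2 * r powr (- c) * M r)))"
    using energy(2)[OF st] mass_limit(1)[OF st, of "- c"] by simp
   show "AE r in lborel. - (indc {s1..t} r * (C * U r))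
    \<le> indc {s1..t} r * (2 * r powr c * r * B r) - N * (indc {s1..t} r * (2 * r powr (- c) * M r))"
    using slice_relations
   proof eventually_elim
    case (elim r)
    show ?case
    proof (cases "r \<in> {s1..t}")
     case True
     then have r: "0 < r" "r < T" "r \<in> {s1..s2}" using st t by auto
     have rel: "D r = r * M r" "(M r)\<^sup>2 \<le> B r * H r" using elim r by auto
     have Yr: "Y r > 0" using Yb(1)[OF r(3)] hm by simp
     have Hr: "H r > 0" using Yr r by (simp add: Y_def zero_less_mult_iff)
     have M0: "M r \<ge> 0" using D_nonneg[OF r(1,2)] rel r by (simp add: zero_le_mult_iff)
     define k where "k = 2 * r powr (- c) * M r / Y r"
     have k0: "k \<ge> 0" using M0 Yr by (simp add: k_def)
     have kC: "k \<le> C"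
     proof -
      have "r powr (- 2 * c) * (1 / r) * X r = r powr (- c) * M r"
       using r by (simp add: X_def rel(1) powr_add[symmetric] mult.assoc[symmetric])
      then have "k = 2 * (r powr (- 2 * c) * (1 / r) * X r) / Y r" by (simp add: k_def)
      also have "\<dots> \<le> C"
       unfolding C_def
      proof (rule frac_le)
       have "r powr (- 2 * c) \<le> s1 powr (- 2 * c)" using r s12 c_nonneg by (intro powr_mono2') auto
       moreover have "1 / r \<le> 1 / s1" using r s12 by (intro divide_left_mono) auto
       moreover have "X r \<le> X s2" "X r \<ge> 0" using Xincr[of r s2] X0[of r] r by auto
       ultimately show "2 * (r powr (- 2 * c) * (1 / r) * X r) \<le> 2 * (s1 powr (- 2 * c) * (1 / s1) * X s2)"
        using s12 r by (intro mult_left_mono mult_mono) auto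
       show "0 \<le> 2 * (s1 powr (- 2 * c) * (1 / s1) * X s2)" using X0[of s2] s12 by simp
       show "0 < hm" "hm \<le> Y r" using hm Yb r by auto
      qed
      finally show ?thesis .
     qed
     \<comment> \<open>By Cauchy-Schwarz the first term is at least \<open>k * X r\<close>; the
       second equals \<open>k * (N * Y r)\<close>.\<close>
     have "2 * r powr c * r * B r - N * (2 * r powr (- c) * M r) \<ge> k * Z r"
     proof -
      have "k * X r \<le> 2 * r powr c * r * B r"
      proof -
       have "k * X r = 2 * r powr c * r * ((M r)\<^sup>2 / H r)"
        using r Hr by (simp add: k_def X_def Y_def rel(1) power2_eq_square field_simps)
       also have "\<dots> \<le> 2 * r powr c * r * B r"
        using rel(2) Hr r by (intro mult_left_mono) (auto simp: divide_le_eq)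
       finally show ?thesis .
      qed
      moreover have "k * (N * Y r) = N * (2 * r powr (- c) * M r)" using Yr by (simp add: k_def)
      ultimately show ?thesis unfolding Z_def right_diff_distrib by linarith
     qed
     moreover have "- (C * U r) \<le> k * Z r"
     proof -
      have "- U r \<le> Z r" "U r \<ge> 0" using r by (auto simp: U_def)
      have "k * (- U r) \<le> k * Z r" using k0 \<open>- U r \<le> Z r\<close> by (rule mult_left_mono[rotated])
      moreover have "k * U r \<le> C * U r" using kC \<open>U r \<ge> 0\<close> by (rule mult_right_mono)
      ultimately show ?thesis by simp
     qed
     ultimately show ?thesis using True by simp
    qed simp
   qed
  qed
  finally have "Z t - Z s1 \<ge> - (C * (LBINT r. indc {s1..t} r * U r))"
   by (simp add: mult.left_commute)
  moreover have "0 \<le> C * (LBINT r. indc {s1..t} r * U r)"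
   using C0 by (intro mult_nonneg_nonneg integral_nonneg_AE AE_I2) (auto simp: U_def indicator_def)
  ultimately show ?thesis using Z1 t by (simp add: U_def)
 qed
 have "U s2 = 0"
  by (rule gronwall_zero[OF Umeas Ub C0 gron]) (use s in auto)
 then have "Z s2 \<ge> 0" using s by (simp add: U_def max_def split: if_splits)
 then have "N \<le> X s2 / Y s2"
  using Yb(1)[of s2] hm s by (simp add: Z_def pos_le_divide_eq)
 moreover have "X t / Y t = t powr (2 * c) * (D t / H t)" if "0 < t" for t
 proof -
  have "t powr (2 * c) = t powr c * t powr c" by (simp add: powr_add[symmetric])
  moreover have "t powr (- c) = 1 / t powr c" by (simp add: powr_minus_divide)
  ultimately show ?thesis by (simp add: X_def Y_def)
 qed
 ultimately show ?thesis using s12 s by (simp add: N_def)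
qed

end

section \<open>Change of variables\<close>

text \<open>A measure with the right values on boxes is \<open>lborel\<close>. The preimage of a box
  is mapped injectively onto the box, so the change of variables formula for measures of images
  evaluates the density on it.\<close>

lemma lborel_diffeo_wellorder:
 fixes \<phi> :: "real^'n::{finite,wellorder} \<Rightarrow> real^'n::_"
 assumes der: "\<And>x. (\<phi> has_derivative \<phi>' x) (at x)" and bij: "bij \<phi>"
  and meas [measurable]: "borel_fun (\<lambda>x. \<bar>det (matrix (\<phi>' x))\<bar>)"
 shows "lborel = distr (density lborel (\<lambda>x. ennreal \<bar>det (matrix (\<phi>' x))\<bar>)) borel \<phi>"
proof (rule lborel_eqI)
 have "continuous_on UNIV \<phi>"
  by (rule continuous_at_imp_continuous_on) (blast intro: has_derivative_continuous der)
 then have [measurable]: "borel_fun \<phi>" by (rule borel_measurable_continuous_onI)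
 fix l u :: "real^'n::_" assume lu: "\<And>b. b \<in> Basis \<Longrightarrow> l \<bullet> b \<le> u \<bullet> b"
 define S where "S = \<phi> -` box l u"
 have Sm [measurable]: "S \<in> sets borel"
  using measurable_sets_borel[of \<phi> borel "box l u"] unfolding S_def by simp
 have img: "\<phi> ` S = box l u" using bij unfolding S_def bij_def by (auto simp: surj_image_vimage_eq)
 have "((\<lambda>x. \<bar>det (matrix (\<phi>' x))\<bar>) has_integral measure lebesgue (box l u)) S"
 proof (rule has_measure_differentiable_image[THEN iffD1])
  show "S \<in> sets lebesgue" using Sm by simp
  show "(\<phi> has_derivative \<phi>' x) (at x within S)" for x by (rule has_derivative_at_withinI[OF der])
  show "inj_on \<phi> S" using bij by (auto simp: bij_def intro: inj_on_subset)
  show "\<phi> ` S \<in> lmeasurable \<and> measure lebesgue (\<phi> ` S) = measure lebesgue (box l u)"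
   unfolding img by simp
 qed
 from nn_integral_has_integral_lebesgue[OF _ this]
 have "(\<integral>\<^sup>+x. ennreal (indc S x * \<bar>det (matrix (\<phi>' x))\<bar>) \<partial>lborel) = ennreal (measure lebesgue (box l u))" by simp
 also have "ennreal (measure lebesgue (box l u)) = (\<Prod>b\<in>Basis. (u - l) \<bullet> b)"
  using lu by (simp add: measure_lborel_box_eq)
 finally have I: "(\<integral>\<^sup>+x. ennreal (indc S x * \<bar>det (matrix (\<phi>' x))\<bar>) \<partial>lborel) = (\<Prod>b\<in>Basis. (u - l) \<bullet> b)" .
 have "emeasure (distr (density lborel (\<lambda>x. ennreal \<bar>det (matrix (\<phi>' x))\<bar>)) borel \<phi>) (box l u)
  = emeasure (density lborel (\<lambda>x. ennreal \<bar>det (matrix (\<phi>' x))\<bar>)) S"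
  by (subst emeasure_distr) (auto simp: S_def)
 also have "\<dots> = (\<integral>\<^sup>+x. ennreal \<bar>det (matrix (\<phi>' x))\<bar> * indc S x \<partial>lborel)"
  by (subst emeasure_density) auto
 also have "\<dots> = (\<integral>\<^sup>+x. ennreal (indc S x * \<bar>det (matrix (\<phi>' x))\<bar>) \<partial>lborel)"
  by (intro nn_integral_cong) (auto simp: indicator_def)
 finally show "emeasure (distr (density lborel (\<lambda>x. ennreal \<bar>det (matrix (\<phi>' x))\<bar>)) borel \<phi>) (box l u) = (\<Prod>b\<in>Basis. (u - l) \<bullet> b)"
  using I by simp
qed simp

text \<open>The change of variables theorem of the library asks for a well-ordered index type. A finite index
 type is therefore replaced by a copy of itself that is well-ordered along an enumeration.\<close>

typedef 'a wo = "UNIV :: 'a set" morphisms un_wo Wo by simp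

lemma un_wo_bij: "bij (un_wo :: 'a wo \<Rightarrow> 'a)" "bij (Wo :: 'a \<Rightarrow> 'a wo)"
 by (auto simp: bij_def inj_def surj_def un_wo_inject Wo_inject) (metis Wo_inverse UNIV_I, metis un_wo_inverse)

instance wo :: (finite) finite
proof
 have "(UNIV :: 'a wo set) = range Wo" using un_wo_bij(2)[where 'a='a] by (simp add: bij_def)
 then show "finite (UNIV :: 'a wo set)" by (metis finite finite_imageI)
qed

definition enum_wo :: "'a::finite wo \<Rightarrow> nat" where
 "enum_wo = (SOME f. inj f)"

lemma inj_enum_wo: "inj (enum_wo :: 'a::finite wo \<Rightarrow> nat)"
proof -
 have "\<exists>f :: 'a wo \<Rightarrow> nat. inj f"
  using finite_imp_inj_to_nat_seg[of "UNIV :: 'a wo set"] by auto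
 then show ?thesis unfolding enum_wo_def by (rule someI_ex)
qed

instantiation wo :: (finite) wellorder
begin

definition less_eq_wo :: "'a wo \<Rightarrow> 'a wo \<Rightarrow> bool" where "less_eq_wo x y \<longleftrightarrow> enum_wo x \<le> enum_wo y"
definition less_wo :: "'a wo \<Rightarrow> 'a wo \<Rightarrow> bool" where "less_wo x y \<longleftrightarrow> enum_wo x < enum_wo y"

instance
proof
 fix P :: "'a wo \<Rightarrow> bool" and a
 assume step: "\<And>x. (\<And>y. y < x \<Longrightarrow> P y) \<Longrightarrow> P x"
 show "P a"
  by (induction "enum_wo a" arbitrary: a rule: less_induct) (auto intro: step simp: less_wo_def)
qed (auto simp: less_eq_wo_def less_wo_def dest: injD[OF inj_enum_wo])

end

definition to_wo :: "real^'n \<Rightarrow> real^('n wo)" where "to_wo x = (\<chi> i. x $ un_wo i)"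
definition of_wo :: "real^('n wo) \<Rightarrow> real^'n" where "of_wo x = (\<chi> i. x $ Wo i)"

lemma to_of_wo [simp]: "to_wo (of_wo x) = x" "of_wo (to_wo y) = y"
 by (simp_all add: to_wo_def of_wo_def vec_eq_iff un_wo_inverse Wo_inverse)

lemma linear_wo: "linear (to_wo :: real^'n \<Rightarrow> _)" "linear (of_wo :: _ \<Rightarrow> real^'n)"
 by (auto intro!: linearI simp: to_wo_def of_wo_def vec_eq_iff)

lemma prod_Basis_cart: "(\<Prod>b\<in>Basis. (x :: real^'n) \<bullet> b) = (\<Prod>i\<in>UNIV. x $ i)"
proof -
 have B: "Basis = range (\<lambda>i::'n. axis i (1::real))" by (auto simp: Basis_vec_def)
 have inj: "inj (\<lambda>i::'n. axis i (1::real))" by (auto simp: inj_def axis_eq_axis)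
 show ?thesis unfolding B by (subst prod.reindex[OF inj]) (simp add: inner_axis)
qed

lemma lborel_to_wo: "lborel = distr lborel borel (to_wo :: real^'n \<Rightarrow> _)"
proof (rule lborel_eqI)
 have [measurable]: "borel_fun (to_wo :: real^'n \<Rightarrow> _)"
  by (intro borel_measurable_continuous_onI linear_continuous_on linear_wo(1)[unfolded linear_conv_bounded_linear])
 fix l u :: "real^('n wo)" assume lu: "\<And>b. b \<in> Basis \<Longrightarrow> l \<bullet> b \<le> u \<bullet> b"
 have "to_wo -` box l u = box (of_wo l) (of_wo u)"
 proof (intro set_eqI)
  fix x :: "real^'n"
  have "(\<forall>i. l $ i < x $ un_wo i \<and> x $ un_wo i < u $ i) \<longleftrightarrow> (\<forall>j. l $ Wo j < x $ j \<and> x $ j < u $ Wo j)"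
   by (metis Wo_inverse un_wo_inverse UNIV_I)
  then show "x \<in> to_wo -` box l u \<longleftrightarrow> x \<in> box (of_wo l) (of_wo u)"
   by (simp add: mem_box_cart to_wo_def of_wo_def)
 qed
 then have "emeasure (distr lborel borel (to_wo :: real^'n \<Rightarrow> _)) (box l u) = emeasure lborel (box (of_wo l) (of_wo u))"
  by (subst emeasure_distr) auto
 also have "\<dots> = (\<Prod>b\<in>Basis. (of_wo u - of_wo l) \<bullet> b)"
 proof (rule emeasure_lborel_box)
  fix b :: "real^'n" assume "b \<in> Basis"
  then obtain i where b: "b = axis i 1" by (auto simp: Basis_vec_def)
  have "axis (Wo i) (1::real) \<in> Basis" by (auto simp: Basis_vec_def)
  from lu[OF this] show "of_wo l \<bullet> b \<le> of_wo u \<bullet> b" by (simp add: b inner_axis of_wo_def)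
 qed
 also have "\<dots> = (\<Prod>b\<in>Basis. (u - l) \<bullet> b)"
 proof -
  have "(\<Prod>i\<in>UNIV. (of_wo u - of_wo l) $ i) = (\<Prod>i\<in>UNIV. (u - l) $ i)"
   by (rule prod.reindex_bij_betw[OF un_wo_bij(2), of "\<lambda>i. (u - l) $ i", THEN trans[rotated]]) (simp add: of_wo_def)
  then show ?thesis by (simp only: prod_Basis_cart)
 qed
 finally show "emeasure (distr lborel borel (to_wo :: real^'n \<Rightarrow> _)) (box l u) = (\<Prod>b\<in>Basis. (u - l) \<bullet> b)" .
qed simp

text \<open>Relabelling the indices conjugates each permutation in the Leibniz formula by a
  bijection, which changes neither the sign nor the product of entries.\<close>

lemma det_wo:
 fixes A :: "real^'n^'n"
 shows "det (\<chi> i j. A $ un_wo i $ un_wo j) = det A"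
proof -
 let ?f = "map_permutation UNIV (un_wo :: 'n wo \<Rightarrow> 'n)"
 have inj: "inj (un_wo :: 'n wo \<Rightarrow> 'n)" using un_wo_bij(1)[where 'a='n] by (simp add: bij_def)
 have inv: "inv (un_wo :: 'n wo \<Rightarrow> 'n) = Wo"
  by (rule inv_unique_comp) (auto simp: fun_eq_iff un_wo_inverse Wo_inverse)
 have f: "?f p = un_wo \<circ> p \<circ> Wo" if "p permutes UNIV" for p
  using un_wo_bij(1)[where 'a='n] by (simp add: map_permutation_def restrict_id_def inv bij_def fun_eq_iff)
 have bij: "bij_betw ?f {p. p permutes UNIV} {p. p permutes UNIV}"
 proof (rule bij_betw_byWitness[where f'="map_permutation UNIV (Wo :: 'n \<Rightarrow> 'n wo)"])
  have g: "map_permutation UNIV (Wo :: 'n \<Rightarrow> 'n wo) p = Wo \<circ> p \<circ> un_wo" if "p permutes UNIV" for p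
  proof -
   have "inv (Wo :: 'n \<Rightarrow> 'n wo) = un_wo"
    by (rule inv_unique_comp) (auto simp: fun_eq_iff un_wo_inverse Wo_inverse)
   then show ?thesis using un_wo_bij(2)[where 'a='n] by (simp add: map_permutation_def restrict_id_def bij_def fun_eq_iff)
  qed
  have p1: "?f p permutes UNIV" if "p permutes UNIV" for p
   by (rule map_permutation_permutes[OF un_wo_bij(1) that])
  have p2: "map_permutation UNIV (Wo :: 'n \<Rightarrow> 'n wo) p permutes UNIV" if "p permutes UNIV" for p
   by (rule map_permutation_permutes[OF un_wo_bij(2) that])
  show "\<forall>p\<in>{p. p permutes UNIV}. map_permutation UNIV (Wo :: 'n \<Rightarrow> 'n wo) (?f p) = p"
   using p1 by (auto simp: g f fun_eq_iff un_wo_inverse)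
  show "\<forall>p\<in>{p. p permutes UNIV}. ?f (map_permutation UNIV (Wo :: 'n \<Rightarrow> 'n wo) p) = p"
   using p2 by (auto simp: g f fun_eq_iff Wo_inverse)
 qed (use map_permutation_permutes un_wo_bij in auto)
 have "det A = (\<Sum>p | p permutes (UNIV :: 'n wo set). of_int (sign (?f p)) * (\<Prod>i\<in>UNIV. A $ i $ (?f p) i))"
  unfolding det_def by (rule sum.reindex_bij_betw[OF bij, symmetric])
 also have "\<dots> = (\<Sum>p | p permutes (UNIV :: 'n wo set). of_int (sign p) * (\<Prod>i\<in>UNIV. A $ un_wo i $ un_wo (p i)))"
 proof (rule sum.cong[OF refl])
  fix p :: "'n wo \<Rightarrow> 'n wo" assume "p \<in> {p. p permutes UNIV}"
  then have p: "p permutes UNIV" by simp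
  have "sign (?f p) = sign p" by (rule sign_map_permutation) (use inj p in auto)
  moreover have "(\<Prod>i\<in>UNIV. A $ i $ (?f p) i) = (\<Prod>i\<in>UNIV. A $ un_wo i $ un_wo (p i))"
   by (rule prod.reindex_bij_betw[OF un_wo_bij(1), of "\<lambda>i. A $ i $ (?f p) i", THEN trans[OF sym]])
    (simp add: f[OF p] un_wo_inverse)
  ultimately show "of_int (sign (?f p)) * (\<Prod>i\<in>UNIV. A $ i $ (?f p) i)
   = of_int (sign p) * (\<Prod>i\<in>UNIV. A $ un_wo i $ un_wo (p i))" by simp
 qed
 also have "\<dots> = det (\<chi> i j. A $ un_wo i $ un_wo j)" by (simp add: det_def)
 finally show ?thesis by simp
qed

text \<open>Conjugation with \<open>to_wo\<close> transfers the well-ordered case: this linear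
  bijection preserves Lebesgue measure by \<open>lborel_to_wo\<close>, and the determinant of the
  derivative is unchanged by \<open>det_wo\<close>.\<close>

theorem lborel_diffeo:
 fixes \<phi> :: "real^'n \<Rightarrow> real^'n"
 assumes der: "\<And>x. (\<phi> has_derivative (\<lambda>k. J x *v k)) (at x)" and bij: "bij \<phi>"
  and meas [measurable]: "borel_fun (\<lambda>x. \<bar>det (J x)\<bar>)"
 shows "lborel = distr (density lborel (\<lambda>x. ennreal \<bar>det (J x)\<bar>)) borel \<phi>"
proof -
 have tom [measurable]: "borel_fun (to_wo :: real^'n \<Rightarrow> _)"
  by (intro borel_measurable_continuous_onI linear_continuous_on linear_wo(1)[unfolded linear_conv_bounded_linear])
 have ofm [measurable]: "borel_fun (of_wo :: _ \<Rightarrow> real^'n)"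
  by (intro borel_measurable_continuous_onI linear_continuous_on linear_wo(2)[unfolded linear_conv_bounded_linear])
 have "continuous_on UNIV \<phi>"
  by (rule continuous_at_imp_continuous_on) (blast intro: has_derivative_continuous der)
 then have [measurable]: "borel_fun \<phi>" by (rule borel_measurable_continuous_onI)
 define \<psi> where "\<psi> x = to_wo (\<phi> (of_wo x))" for x :: "real^('n wo)"
 define \<psi>' where "\<psi>' x k = to_wo (J (of_wo x) *v of_wo k)" for x k :: "real^('n wo)"
 have der': "(\<psi> has_derivative \<psi>' x) (at x)" for x
 proof -
  have "((\<lambda>x. \<phi> (of_wo x)) has_derivative (\<lambda>k. J (of_wo x) *v of_wo k)) (at x)"
   by (rule has_derivative_compose[OF linear_imp_has_derivative[OF linear_wo(2)] der])
  from has_derivative_compose[OF this linear_imp_has_derivative[OF linear_wo(1)]]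
  show ?thesis unfolding \<psi>_def[abs_def] \<psi>'_def[abs_def] by simp
 qed
 have "matrix (\<psi>' x) = (\<chi> i j. J (of_wo x) $ un_wo i $ un_wo j)" for x
 proof -
  have "\<psi>' x (axis j 1) $ i = J (of_wo x) $ un_wo i $ un_wo j" for i j
  proof -
   have "of_wo (axis j 1) = (axis (un_wo j) 1 :: real^'n)"
    by (auto simp: of_wo_def axis_def vec_eq_iff un_wo_inverse Wo_inverse)
   then show ?thesis by (simp add: \<psi>'_def to_wo_def matrix_vector_mult_basis column_def)
  qed
  then show ?thesis by (simp add: matrix_def vec_eq_iff)
 qed
 then have det: "det (matrix (\<psi>' x)) = det (J (of_wo x))" for x by (simp add: det_wo)
 have bij': "bij \<psi>"
 proof -
  have "bij (to_wo :: real^'n \<Rightarrow> _)" "bij (of_wo :: _ \<Rightarrow> real^'n)"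
   by (auto intro!: o_bij[of "of_wo"] o_bij[of "to_wo"] simp: fun_eq_iff comp_def)
  then have "bij (to_wo \<circ> (\<phi> \<circ> of_wo))" using bij by (intro bij_comp) auto
  then show ?thesis by (simp add: \<psi>_def[abs_def] comp_def)
 qed
 have L: "lborel = distr (density lborel (\<lambda>x. ennreal \<bar>det (J (of_wo x))\<bar>)) borel \<psi>"
  using lborel_diffeo_wellorder[OF der' bij'] unfolding det by measurable
 have \<psi>m [measurable]: "borel_fun \<psi>" unfolding \<psi>_def[abs_def] by measurable
 show ?thesis
 proof (rule measure_eqI)
  fix A :: "(real^'n) set" assume "A \<in> sets lborel"
  then have A [measurable]: "A \<in> sets borel" by simp
  have emb: "emeasure lborel A = emeasure lborel (of_wo -` A)" if "A \<in> sets borel" for A :: "(real^'n) set"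
  proof -
   have "of_wo -` A \<in> sets borel" using measurable_sets_borel[OF ofm that] by simp
   then have "emeasure lborel (of_wo -` A) = emeasure lborel (to_wo -` (of_wo -` A))"
    by (subst lborel_to_wo) (subst emeasure_distr, auto)
   also have "to_wo -` (of_wo -` A) = A" by auto
   finally show ?thesis by simp
  qed
  have nn: "(\<integral>\<^sup>+x. f (of_wo x) \<partial>lborel) = (\<integral>\<^sup>+y. f y \<partial>lborel)" if [measurable]: "borel_fun f" for f :: "real^'n \<Rightarrow> ennreal"
   by (subst lborel_to_wo) (subst nn_integral_distr, auto)
  have mA: "of_wo -` A \<in> sets borel" using measurable_sets_borel[OF ofm A] by simp
  have "emeasure lborel A = emeasure (distr (density lborel (\<lambda>x. ennreal \<bar>det (J (of_wo x))\<bar>)) borel \<psi>) (of_wo -` A)"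
   unfolding emb[OF A] by (subst L) simp
  also have "\<dots> = emeasure (density lborel (\<lambda>x. ennreal \<bar>det (J (of_wo x))\<bar>)) (\<psi> -` (of_wo -` A))"
   by (subst emeasure_distr) (use mA in auto)
  also have "\<dots> = (\<integral>\<^sup>+x. ennreal \<bar>det (J (of_wo x))\<bar> * indc (\<psi> -` (of_wo -` A)) x \<partial>lborel)"
   by (subst emeasure_density) (use measurable_sets_borel[OF \<psi>m mA] in auto)
  also have "\<dots> = (\<integral>\<^sup>+x. ennreal \<bar>det (J (of_wo x))\<bar> * indc (\<phi> -` A) (of_wo x) \<partial>lborel)"
   by (intro nn_integral_cong) (auto simp: indicator_def \<psi>_def)
  also have "\<dots> = (\<integral>\<^sup>+y. ennreal \<bar>det (J y)\<bar> * indc (\<phi> -` A) y \<partial>lborel)"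
   by (rule nn[of "\<lambda>y. ennreal \<bar>det (J y)\<bar> * indc (\<phi> -` A) y"]) measurable
  also have "\<dots> = emeasure (distr (density lborel (\<lambda>x. ennreal \<bar>det (J x)\<bar>)) borel \<phi>) A"
   using measurable_sets_borel[of \<phi> borel A] by (subst emeasure_distr) (auto simp: emeasure_density)
  finally show "emeasure lborel A = emeasure (distr (density lborel (\<lambda>x. ennreal \<bar>det (J x)\<bar>)) borel \<phi>) A" .
 qed simp
qed

section \<open>Jacobi's formula\<close>

text \<open>A permutation other than the identity moves at least two indices. Differentiating a
  single factor of its product therefore leaves an off-diagonal entry of the identity matrix, and
  only the identity permutation contributes.\<close>

lemma det_has_derivative_at_id:
 fixes M :: "real \<Rightarrow> real^'n^'n"
 assumes M: "\<And>i j. ((\<lambda>e. M e $ i $ j) has_real_derivative M' $ i $ j) (at e0)" and id: "M e0 = mat 1"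
 shows "((\<lambda>e. det (M e)) has_real_derivative trace M') (at e0)"
proof -
 have "((\<lambda>e. det (M e)) has_real_derivative
   (\<Sum>p | p permutes (UNIV :: 'n set). of_int (sign p) * (\<Sum>i\<in>UNIV. M' $ i $ p i * (\<Prod>j\<in>UNIV - {i}. M e0 $ j $ p j)))) (at e0)"
  unfolding det_def
 proof (intro DERIV_sum DERIV_cmult)
  fix p
  show "((\<lambda>e. \<Prod>i\<in>UNIV. M e $ i $ p i) has_real_derivative
    (\<Sum>i\<in>UNIV. M' $ i $ p i * (\<Prod>j\<in>UNIV - {i}. M e0 $ j $ p j))) (at e0)"
   by (rule has_field_derivative_prod) (rule M)
 qed
 also have "(\<Sum>p | p permutes (UNIV :: 'n set). of_int (sign p) * (\<Sum>i\<in>UNIV. M' $ i $ p i * (\<Prod>j\<in>UNIV - {i}. M e0 $ j $ p j)))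
  = (\<Sum>p\<in>{id}. of_int (sign p) * (\<Sum>i\<in>UNIV. M' $ i $ p i * (\<Prod>j\<in>UNIV - {i}. M e0 $ j $ p j)))"
 proof (rule sum.mono_neutral_right)
  show "\<forall>p\<in>{p. p permutes UNIV} - {id}. of_int (sign p) * (\<Sum>i\<in>UNIV. M' $ i $ p i * (\<Prod>j\<in>UNIV - {i}. M e0 $ j $ p j)) = 0"
  proof
   fix p :: "'n \<Rightarrow> 'n" assume p: "p \<in> {p. p permutes UNIV} - {id}"
   then have inj: "inj p" by (auto intro: permutes_inj)
   from p obtain a where a: "p a \<noteq> a" by (auto simp: fun_eq_iff)
   then have pa: "p (p a) \<noteq> p a" using inj by (auto simp: inj_def)
   have z: "(\<Prod>j\<in>UNIV - {i}. M e0 $ j $ p j) = 0" for i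
   proof -
    obtain b where "b \<noteq> i" "p b \<noteq> b" using a pa by (cases "a = i") auto
    then show ?thesis by (intro prod_zero) (auto simp: id mat_def intro!: bexI[of _ b])
   qed
   then show "of_int (sign p) * (\<Sum>i\<in>UNIV. M' $ i $ p i * (\<Prod>j\<in>UNIV - {i}. M e0 $ j $ p j)) = 0"
    by (simp only: z mult_zero_right sum.neutral_const)
  qed
 qed (auto simp: permutes_id finite_permutations)
 also have "\<dots> = trace M'" by (simp add: id mat_def trace_def)
 finally show ?thesis .
qed

text \<open>Multiplication by the constant matrix \<open>N\<close> moves the curve through the
  identity at \<open>e0\<close>; the determinant is multiplicative, so \<open>det N\<close>
  cancels.\<close>

lemma det_has_derivative:
 fixes M :: "real \<Rightarrow> real^'n^'n"
 assumes M: "\<And>i j. ((\<lambda>e. M e $ i $ j) has_real_derivative M' $ i $ j) (at e0)" and inv: "N ** M e0 = mat 1"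
 shows "((\<lambda>e. det (M e)) has_real_derivative det (M e0) * trace (N ** M')) (at e0)"
proof -
 have d1: "det N * det (M e0) = 1" using inv by (metis det_I det_mul)
 have "((\<lambda>e. det (N ** M e)) has_real_derivative trace (N ** M')) (at e0)"
 proof (rule det_has_derivative_at_id[of "\<lambda>e. N ** M e", OF _ inv])
  fix i j
  show "((\<lambda>e. (N ** M e) $ i $ j) has_real_derivative (N ** M') $ i $ j) (at e0)"
   unfolding matrix_matrix_mult_def by (simp, intro DERIV_sum DERIV_cmult M)
 qed
 from DERIV_cmult[OF this, of "det (M e0)"]
 have "((\<lambda>e. det (M e0) * (det N * det (M e))) has_real_derivative det (M e0) * trace (N ** M')) (at e0)"
  by (simp add: det_mul)
 moreover have "det (M e0) * (det N * x) = x" for x using d1 by (metis mult.assoc mult.commute mult_1)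
 ultimately show ?thesis by simp
qed

section \<open>The geometry of the diffeomorphism\<close>

lemma Ck_mono: "Ck (Suc k) f \<Longrightarrow> Ck k f"
proof (induction k arbitrary: f)
 case 0
 then show ?case by (auto intro!: continuous_at_imp_continuous_on differentiable_imp_continuous_within)
qed auto

lemma Ck_has_derivative:
 fixes f :: "real^'n \<Rightarrow> real^'n"
 assumes "Ck (Suc k) f"
 shows "(f has_derivative (\<lambda>v. Jac f x *v v)) (at x)"
 using assms jacobian_works[of f "at x"] by (simp add: Jac_def)

lemma Jac_eq:
 fixes f :: "real^'n \<Rightarrow> real^'n"
 shows "Jac f x $ i $ j = frechet_derivative f (at x) (axis j 1) $ i"
 by (simp add: Jac_def jacobian_def matrix_def)

lemma Ck_Jac_has_derivative:
 fixes f :: "real^'n \<Rightarrow> real^'n"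
 assumes "Ck 2 f"
 shows "(Jac f has_derivative
  (\<lambda>v. \<chi> i j. frechet_derivative (\<lambda>x. frechet_derivative f (at x) (axis j 1)) (at x) v $ i)) (at x)"
 unfolding has_derivative_componentwise_within[of "Jac f"]
proof
 fix b :: "real^'n^'n" assume "b \<in> Basis"
 then obtain i j where b: "b = axis i (axis j 1)" by (auto simp: Basis_vec_def)
 define F where "F x = frechet_derivative f (at x) (axis j 1)" for x
 have "axis j 1 \<in> (Basis :: (real^'n) set)" by (auto simp: Basis_vec_def)
 then have "F differentiable at x" using assms by (simp add: numeral_2_eq_2 F_def[abs_def])
 then have "(F has_derivative frechet_derivative F (at x)) (at x)" by (simp add: frechet_derivative_works)
 from bounded_linear.has_derivative[OF bounded_linear_vec_nth[of i] this]
 show "((\<lambda>x. Jac f x \<bullet> b) has_derivative (\<lambda>v. (\<chi> i j. frechet_derivative (\<lambda>x. frechet_derivative f (at x) (axis j 1)) (at x) v $ i) \<bullet> b)) (at x)"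
  by (simp add: b inner_axis Jac_eq F_def[abs_def])
qed

locale diffeo =
 fixes g h :: "real^'d \<Rightarrow> real^'d" and \<Upsilon> :: real
 assumes diffeo: "C2_diffeo g h" and det_pos: "det (Jac g z) > 0"
  and trHG_Linf: "in_Linf lborel (trHG g h)" and trHG_le: "Linf_norm lborel (trHG g h) \<le> ereal \<Upsilon>"
begin

lemma hg [simp]: "h (g z) = z" and gh [simp]: "g (h x) = x"
 using diffeo by (auto simp: C2_diffeo_def)

lemma Ck2: "Ck 2 g" "Ck 2 h" and Ck1: "Ck (Suc 0) g" "Ck (Suc 0) h"
 using diffeo Ck_mono[of 1 g] Ck_mono[of 1 h] by (auto simp: C2_diffeo_def numeral_2_eq_2)

lemmas g_has_derivative = Ck_has_derivative[OF Ck1(1)] and h_has_derivative = Ck_has_derivative[OF Ck1(2)]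
lemmas Jac_g_has_derivative = Ck_Jac_has_derivative[OF Ck2(1)]

lemma g_continuous: "continuous_on S g" and h_continuous: "continuous_on S h"
 and Jac_g_continuous: "continuous_on S (Jac g)"
 by (auto intro!: continuous_at_imp_continuous_on intro: has_derivative_continuous g_has_derivative h_has_derivative Jac_g_has_derivative)

lemma Jac_inverse: "Jac h (g z) ** Jac g z = mat 1" "Jac g z ** Jac h (g z) = mat 1"
proof -
 have "((\<lambda>x. h (g x)) has_derivative (\<lambda>v. Jac h (g z) *v (Jac g z *v v))) (at z)"
  by (rule has_derivative_compose[OF g_has_derivative h_has_derivative])
 then have d: "((\<lambda>x. x) has_derivative (\<lambda>v. Jac h (g z) *v (Jac g z *v v))) (at z)" by simp
 have "(\<lambda>v. Jac h (g z) *v (Jac g z *v v)) = (\<lambda>v. v)"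
  by (rule has_derivative_unique[OF d has_derivative_ident])
 then have "(Jac h (g z) ** Jac g z) *v v = mat 1 *v v" for v
  by (simp add: matrix_vector_mul_assoc fun_eq_iff)
 then show 1: "Jac h (g z) ** Jac g z = mat 1" by (simp add: matrix_eq)
 then show "Jac g z ** Jac h (g z) = mat 1" by (simp add: matrix_left_right_inverse)
qed

lemma matrix_inv_Jac_h: "matrix_inv (Jac h (g z)) = Jac g z"
proof -
 have "invertible (Jac h (g z))" using Jac_inverse unfolding invertible_def by blast
 then have i: "Jac h (g z) ** matrix_inv (Jac h (g z)) = mat 1"
  using someI_ex[of "\<lambda>B. Jac h (g z) ** B = mat 1 \<and> B ** Jac h (g z) = mat 1"]
  unfolding invertible_def matrix_inv_def by blast
 have "matrix_inv (Jac h (g z)) = (Jac g z ** Jac h (g z)) ** matrix_inv (Jac h (g z))"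
  by (simp add: Jac_inverse)
 also have "\<dots> = Jac g z" by (simp only: matrix_mul_assoc[symmetric] i matrix_mul_rid)
 finally show ?thesis .
qed

lemma coeffA_eq: "coeffA h (g z) = Jac g z ** transpose (Jac g z)"
 by (simp add: coeffA_def matrix_inv_Jac_h)

lemma coeffA_inner: "(coeffA h (g z) *v p) \<bullet> q = (transpose (Jac g z) *v p) \<bullet> (transpose (Jac g z) *v q)"
 unfolding coeffA_eq matrix_vector_mul_assoc[symmetric]
 by (subst (1 2) inner_commute) (simp only: transpose_matrix_vector[of "Jac g z" q] dot_lmul_matrix)

lemma coeffA_continuous: "continuous_on S (coeffA h)"
proof -
 have "coeffA h = (\<lambda>x. Jac g (h x) ** transpose (Jac g (h x)))"
 proof
  fix x show "coeffA h x = Jac g (h x) ** transpose (Jac g (h x))" using coeffA_eq[of "h x"] by simp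
 qed
 moreover have c: "continuous_on S (\<lambda>x. Jac g (h x) $ i $ j)" for i j
  by (intro continuous_intros continuous_on_compose2[OF Jac_g_continuous[of UNIV] h_continuous]) auto
 ultimately show ?thesis
  by (simp add: matrix_matrix_mult_def transpose_def) (intro continuous_on_vec_lambda continuous_intros c)
qed

definition gam :: "real^'d \<Rightarrow> real" where "gam z = det (Jac g z)"

lemma gam_pos: "gam z > 0" by (simp add: gam_def det_pos)

lemma gam_continuous: "continuous_on S gam"
 unfolding gam_def[abs_def] det_def by (intro continuous_intros Jac_g_continuous)

text \<open>Since \<open>h (g z) = z\<close>, the sum with coefficients \<open>h x $ i\<close> is,
  by linearity, the derivative of the Jacobian in the radial direction \<open>z\<close>.\<close>

lemma trHG_eq: "trHG g h (g z) = trace (Jac h (g z) ** frechet_derivative (Jac g) (at z) z)"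
proof -
 let ?F = "frechet_derivative (Jac g) (at z)"
 have lin: "linear ?F"
  by (rule linear_frechet_derivative) (use Jac_g_has_derivative in \<open>auto simp: differentiable_def\<close>)
 have F: "?F z = (\<Sum>i\<in>UNIV. z $ i *\<^sub>R ?F (axis i 1))"
 proof -
  have "?F z = ?F (\<Sum>i\<in>UNIV. z $ i *\<^sub>R axis i 1)"
   using basis_expansion[of z] by (simp add: scalar_mult_eq_scaleR)
  then show ?thesis by (simp only: linear_sum[OF lin] linear_scale[OF lin])
 qed
 have "trace (Jac h (g z) ** ?F z) = (\<Sum>i\<in>UNIV. \<Sum>a\<in>UNIV. \<Sum>b\<in>UNIV. Jac h (g z) $ a $ b * (z $ i * ?F (axis i 1) $ b $ a))"
  unfolding F trace_def matrix_matrix_mult_def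
  by (simp add: sum_distrib_left sum_component, subst sum.swap[of _ UNIV UNIV, symmetric], rule sum.cong[OF refl], rule sum.swap)
 also have "\<dots> = trHG g h (g z)"
  by (simp add: trHG_def trace_def matrix_matrix_mult_def sum_distrib_left mult_ac)
 finally show ?thesis by simp
qed

text \<open>Jacobi's formula along a ray. The derivative of the Jacobian in direction
  \<open>y\<close> is \<open>1 / r\<close> times the one in the radial direction
  \<open>r *\<^sub>R y\<close>, whose trace \<open>trHG_eq\<close> identifies.\<close>

lemma gam_has_derivative:
 assumes "r > 0"
 shows "((\<lambda>r. gam (r *\<^sub>R y)) has_real_derivative gam (r *\<^sub>R y) * trHG g h (g (r *\<^sub>R y)) / r) (at r)"
proof -
 let ?z = "r *\<^sub>R y"
 let ?F = "frechet_derivative (Jac g) (at ?z)"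
 have d: "(Jac g has_derivative ?F) (at ?z)"
  by (subst frechet_derivative_at[OF Jac_g_has_derivative, symmetric]) (rule Jac_g_has_derivative)
 have lin: "linear ?F" by (rule has_derivative_linear[OF d])
 have dJ: "((\<lambda>r. Jac g (r *\<^sub>R y)) has_derivative (\<lambda>s. ?F (s *\<^sub>R y))) (at r)"
  using has_derivative_compose[of "\<lambda>r. r *\<^sub>R y" "\<lambda>s. s *\<^sub>R y" r UNIV "Jac g" ?F] d
  by (simp add: bounded_linear_imp_has_derivative bounded_linear_scaleR_left)
 have e: "((\<lambda>r. Jac g (r *\<^sub>R y) $ i $ j) has_real_derivative ?F y $ i $ j) (at r)" for i j
 proof -
  from bounded_linear.has_derivative[OF bounded_linear_vec_nth[of j] bounded_linear.has_derivative[OF bounded_linear_vec_nth[of i] dJ]]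
  have d: "((\<lambda>r. Jac g (r *\<^sub>R y) $ i $ j) has_derivative (\<lambda>s. ?F (s *\<^sub>R y) $ i $ j)) (at r)" .
  have "(\<lambda>s. ?F (s *\<^sub>R y) $ i $ j) = (*) (?F y $ i $ j)" by (simp add: fun_eq_iff linear_scale[OF lin])
  with d show ?thesis by (simp add: has_field_derivative_def)
 qed
 have "?F ?z = r *\<^sub>R ?F y" by (simp add: linear_scale[OF lin])
 then have "trHG g h (g ?z) = r * trace (Jac h (g ?z) ** ?F y)"
  unfolding trHG_eq by (simp add: trace_def matrix_matrix_mult_def sum_distrib_left mult_ac)
 then show ?thesis
  using det_has_derivative[of "\<lambda>r. Jac g (r *\<^sub>R y)", OF e Jac_inverse(1)[of ?z]] assms by (simp add: gam_def)
qed

lemma trHG_continuous: "continuous_on UNIV (trHG g h)"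
proof -
 define F where "F j x = frechet_derivative g (at x) (axis j 1)" for j x
 have ax: "axis j 1 \<in> (Basis :: (real^'d) set)" for j by (auto simp: Basis_vec_def)
 have cF: "continuous_on UNIV (\<lambda>x. frechet_derivative (F j) (at x) (axis i 1))" for i j
  using Ck2(1) ax by (simp add: numeral_2_eq_2 F_def[abs_def])
 have fr: "frechet_derivative (Jac g) (at x) v = (\<chi> i j. frechet_derivative (F j) (at x) v $ i)" for x v
  using frechet_derivative_at[OF Jac_g_has_derivative[of x]] by (simp add: F_def[abs_def] fun_eq_iff)
 have h1: "continuous_on UNIV (\<lambda>x. Jac h x $ i $ j)" for i j
 proof -
  have "continuous_on UNIV (Jac h)"
   by (auto intro!: continuous_at_imp_continuous_on intro: has_derivative_continuous Ck_Jac_has_derivative[OF Ck2(2)])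
  then show ?thesis by (intro continuous_intros)
 qed
 have c2: "continuous_on UNIV (\<lambda>x. frechet_derivative (F j) (at (h x)) (axis i 1))" for i j
  by (rule continuous_on_compose2[OF cF h_continuous]) auto
 show ?thesis
  unfolding trHG_def trace_def matrix_matrix_mult_def fr
  by (simp, intro continuous_intros h1 c2 h_continuous)
qed

text \<open>The set where the essential bound fails is open by continuity and null, hence empty. A
  bound at every point is needed, as the monotonicity below is claimed along every single
  ray.\<close>

lemma trHG_bound: "\<bar>trHG g h x\<bar> \<le> \<Upsilon>"
proof -
 have m: "(\<lambda>x. ereal \<bar>trHG g h x\<bar>) \<in> borel_measurable lborel"
  using borel_measurable_continuous_onI[OF trHG_continuous] by simp
 have "AE x in lborel. ereal \<bar>trHG g h x\<bar> \<le> esssup lborel (\<lambda>x. ereal \<bar>trHG g h x\<bar>)" by (rule esssup_AE)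
 then have ae: "AE x in lborel. \<bar>trHG g h x\<bar> \<le> \<Upsilon>"
  using trHG_le unfolding Linf_norm_def by (auto elim!: eventually_mono dest: order_trans)
 have op: "open {x. \<Upsilon> < \<bar>trHG g h x\<bar>}"
  by (rule open_Collect_less) (intro continuous_intros trHG_continuous)+
 obtain N where N: "N \<in> null_sets lborel" "{x. \<not> \<bar>trHG g h x\<bar> \<le> \<Upsilon>} \<subseteq> N"
  using ae unfolding eventually_ae_filter by auto
 have "negligible N" using N(1) by (simp add: negligible_iff_null_sets null_sets_completionI)
 then have "negligible {x. \<Upsilon> < \<bar>trHG g h x\<bar>}" using N(2) by (auto intro: negligible_subset simp: not_le)
 then have "{x. \<Upsilon> < \<bar>trHG g h x\<bar>} = {}" using open_not_negligible[OF op] by blast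
 then show ?thesis by (auto simp: not_less)
qed

text \<open>The last factor of the derivative is nonnegative for \<open>p = \<Upsilon>\<close> and
  nonpositive for \<open>p = - \<Upsilon>\<close>, which gives the two monotone quantities
  below.\<close>

lemma powr_gam_derivative:
 assumes "e > 0"
 shows "((\<lambda>e. e powr p * gam (e *\<^sub>R y)) has_real_derivative e powr (p - 1) * gam (e *\<^sub>R y) * (p + trHG g h (g (e *\<^sub>R y)))) (at e)"
proof -
 have "e powr p = e powr (p - 1) * e" using assms by (simp add: powr_diff)
 then show ?thesis
  using DERIV_mult[OF has_real_derivative_powr[OF assms, of p] gam_has_derivative[OF assms, of y]] assms
  by (simp add: field_simps)
qed

lemma gam_incr:
 assumes "0 < a" "a \<le> b"
 shows "a powr \<Upsilon> * gam (a *\<^sub>R y) \<le> b powr \<Upsilon> * gam (b *\<^sub>R y)"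
proof (rule DERIV_nonneg_imp_nondecreasing[OF assms(2)])
 fix e assume "a \<le> e" "e \<le> b"
 then show "\<exists>D. ((\<lambda>e. e powr \<Upsilon> * gam (e *\<^sub>R y)) has_real_derivative D) (at e) \<and> 0 \<le> D"
  using assms trHG_bound[of "g (e *\<^sub>R y)"] gam_pos[of "e *\<^sub>R y"]
  by (intro exI[of _ "e powr (\<Upsilon> - 1) * gam (e *\<^sub>R y) * (\<Upsilon> + trHG g h (g (e *\<^sub>R y)))"] conjI powr_gam_derivative mult_nonneg_nonneg) auto
qed

lemma gam_decr:
 assumes "0 < a" "a \<le> b"
 shows "b powr (- \<Upsilon>) * gam (b *\<^sub>R y) \<le> a powr (- \<Upsilon>) * gam (a *\<^sub>R y)"
proof (rule DERIV_nonpos_imp_nonincreasing[OF assms(2)])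
 fix e assume "a \<le> e" "e \<le> b"
 then show "\<exists>D. ((\<lambda>e. e powr (- \<Upsilon>) * gam (e *\<^sub>R y)) has_real_derivative D) (at e) \<and> D \<le> 0"
  using assms trHG_bound[of "g (e *\<^sub>R y)"] gam_pos[of "e *\<^sub>R y"]
  by (intro exI[of _ "e powr (- \<Upsilon> - 1) * gam (e *\<^sub>R y) * (- \<Upsilon> + trHG g h (g (e *\<^sub>R y)))"] conjI powr_gam_derivative mult_nonneg_nonpos) auto
qed

section \<open>Similarity variables on a time slice\<close>

definition gsc :: "real \<Rightarrow> real^'d \<Rightarrow> real^'d" where "gsc t y = g (sqrt t *\<^sub>R y)"
text \<open>The Jacobian determinant of \<open>gsc t\<close>. Its power of \<open>sqrt t\<close>
  later cancels against the density \<open>t powr (- d / 2)\<close> of the time measure and in the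
  quotient \<open>L_fun\<close>.\<close>

definition gdet :: "real \<Rightarrow> real^'d \<Rightarrow> real" where "gdet t y = sqrt t ^ CARD('d) * gam (sqrt t *\<^sub>R y)"

lemma gdet_pos: "t > 0 \<Longrightarrow> gdet t y > 0" by (simp add: gdet_def gam_pos)

lemma gsc_continuous: "continuous_on S (\<lambda>(y, t). gsc t y)"
 unfolding gsc_def case_prod_beta by (intro continuous_on_compose2[OF g_continuous[of UNIV]] continuous_intros) auto

lemma gdet_continuous: "continuous_on S (\<lambda>(y, t). gdet t y)"
 unfolding gdet_def case_prod_beta by (intro continuous_intros continuous_on_compose2[OF gam_continuous[of UNIV]]) auto

lemma gsc_measurable [measurable]: "gsc t \<in> borel_measurable borel"
 unfolding gsc_def[abs_def] by (intro borel_measurable_continuous_onI continuous_on_compose2[OF g_continuous[of UNIV]] continuous_intros) auto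

lemma gdet_measurable [measurable]: "gdet t \<in> borel_measurable borel"
 unfolding gdet_def[abs_def] by (intro borel_measurable_continuous_onI continuous_intros continuous_on_compose2[OF gam_continuous[of UNIV]]) auto

lemma gsc_has_derivative: "(gsc t has_derivative (\<lambda>k. (sqrt t *\<^sub>R Jac g (sqrt t *\<^sub>R y)) *v k)) (at y)"
proof -
 have "((\<lambda>y. sqrt t *\<^sub>R y) has_derivative (\<lambda>k. sqrt t *\<^sub>R k)) (at y)"
  by (auto intro!: derivative_eq_intros)
 from has_derivative_compose[OF this g_has_derivative]
 show ?thesis by (simp add: gsc_def[abs_def] matrix_vector_mult_scaleR scaleR_matrix_vector_assoc)
qed

lemma det_scaleR: "det (c *\<^sub>R (A :: real^'d^'d)) = c ^ CARD('d) * det A"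
 by (simp add: det_def prod.distrib sum_distrib_left mult_ac)

lemma lborel_gsc:
 assumes "t > 0"
 shows "lborel = distr (density lborel (\<lambda>y. ennreal (gdet t y))) borel (gsc t)"
proof -
 have d: "\<bar>det (sqrt t *\<^sub>R Jac g (sqrt t *\<^sub>R y))\<bar> = gdet t y" for y
  using gdet_pos[OF assms, of y] by (simp add: det_scaleR gdet_def gam_def)
 have "bij (gsc t)"
 proof (rule o_bij[of "\<lambda>x. h x /\<^sub>R sqrt t"])
  show "(\<lambda>x. h x /\<^sub>R sqrt t) \<circ> gsc t = id" "gsc t \<circ> (\<lambda>x. h x /\<^sub>R sqrt t) = id"
   using assms by (auto simp: fun_eq_iff gsc_def)
 qed
 from lborel_diffeo[OF gsc_has_derivative this] show ?thesis by (simp add: d)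
qed

lemma integral_gsc:
 fixes f :: "real^'d \<Rightarrow> real"
 assumes "t > 0" and [measurable]: "borel_fun f"
 shows "(LBINT x. f x) = (LBINT y. f (gsc t y) * gdet t y)"
proof -
 have "(LBINT x. f x) = (\<integral>x. f x \<partial>(distr (density lborel (\<lambda>y. ennreal (gdet t y))) borel (gsc t)))"
  using lborel_gsc[OF assms(1)] by (rule arg_cong)
 also have "\<dots> = (\<integral>y. f (gsc t y) \<partial>(density lborel (\<lambda>y. ennreal (gdet t y))))"
  by (subst integral_distr) auto
 also have "\<dots> = (LBINT y. gdet t y *\<^sub>R f (gsc t y))"
  using gdet_pos[OF assms(1)] by (subst integral_density) (auto intro: less_imp_le)
 finally show ?thesis by (simp add: mult.commute)
qed

lemma integrable_gsc:
 fixes f :: "real^'d \<Rightarrow> real"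
 assumes "t > 0" and [measurable]: "borel_fun f"
 shows "intble f \<longleftrightarrow> intble (\<lambda>y. f (gsc t y) * gdet t y)"
proof -
 have "intble f = integrable (distr (density lborel (\<lambda>y. ennreal (gdet t y))) borel (gsc t)) f"
  using lborel_gsc[OF assms(1)] by (rule arg_cong)
 also have "\<dots> = integrable (density lborel (\<lambda>y. ennreal (gdet t y))) (\<lambda>y. f (gsc t y))"
  by (subst integrable_distr_eq) auto
 also have "\<dots> = intble (\<lambda>y. gdet t y *\<^sub>R f (gsc t y))"
  using gdet_pos[OF assms(1)] by (subst integrable_density) (auto intro: less_imp_le)
 finally show ?thesis by (simp add: mult.commute)
qed

lemma AE_gsc:
 assumes "t > 0" and "AE x in lborel. R x"
 shows "AE y in lborel. R (gsc t y)"
proof -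
 have "AE x in distr (density lborel (\<lambda>y. ennreal (gdet t y))) borel (gsc t). R x"
  using assms(2) by (subst (asm) lborel_gsc[OF assms(1)])
 then have "AE y in density lborel (\<lambda>y. ennreal (gdet t y)). R (gsc t y)" by (rule AE_distrD[rotated]) simp
 then show ?thesis using gdet_pos[OF assms(1)] by (simp add: AE_density)
qed

lemma nn_integral_gsc:
 fixes f :: "real^'d \<Rightarrow> ennreal"
 assumes "t > 0" and [measurable]: "borel_fun f"
 shows "(\<integral>\<^sup>+x. f x \<partial>lborel) = (\<integral>\<^sup>+y. ennreal (gdet t y) * f (gsc t y) \<partial>lborel)"
proof -
 have "(\<integral>\<^sup>+x. f x \<partial>lborel) = (\<integral>\<^sup>+x. f x \<partial>(distr (density lborel (\<lambda>y. ennreal (gdet t y))) borel (gsc t)))"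
  using lborel_gsc[OF assms(1)] by (rule arg_cong)
 also have "\<dots> = (\<integral>\<^sup>+y. f (gsc t y) \<partial>(density lborel (\<lambda>y. ennreal (gdet t y))))" by (subst nn_integral_distr) auto
 also have "\<dots> = (\<integral>\<^sup>+y. ennreal (gdet t y) * f (gsc t y) \<partial>lborel)" by (subst nn_integral_density) auto
 finally show ?thesis .
qed

end

section \<open>Slices of space-time functions\<close>

lemma locally_integrable_cut_mult:
 fixes w :: "'a::euclidean_space \<Rightarrow> real"
 assumes f: "locally_integrable \<Omega> f" and K: "compact K" "K \<subseteq> \<Omega>" and w: "continuous_on K w"
 shows "intble (\<lambda>x. indc K x * f x * w x)"
proof -
 have "compact (w ` K)" by (rule compact_continuous_image[OF w K(1)])
 then obtain C where C: "\<And>x. x \<in> K \<Longrightarrow> norm (w x) \<le> C"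
  by (meson bounded_iff compact_imp_bounded imageI)
 have "norm (indc K x *\<^sub>R w x) \<le> max 0 C" for x using C[of x] by (auto simp: indicator_def)
 from integrable_bounded_mult[OF locally_integrable_cut[OF f K] _ this]
 have "intble (\<lambda>x. (indc K x * f x) *\<^sub>R (indc K x *\<^sub>R w x))"
  using borel_measurable_continuous_on_indicator[OF _ w] K(1) by (simp add: compact_imp_closed)
 then show ?thesis by (rule lintable_cong[OF refl, THEN iffD1, rotated]) (simp add: indicator_def)
qed

lemma locally_integrable_mult:
 assumes "locally_integrable \<Omega> f" "continuous_on \<Omega> w"
 shows "locally_integrable \<Omega> (\<lambda>x. f x * w x)"
 unfolding locally_integrable_def set_integrable_def
 using locally_integrable_cut_mult[OF assms(1) _ _ continuous_on_subset[OF assms(2)]]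
 by (auto simp: mult.assoc)

lemma locally_integrable_sum:
 assumes "\<And>i. i \<in> I \<Longrightarrow> locally_integrable \<Omega> (f i)"
 shows "locally_integrable \<Omega> (\<lambda>x. \<Sum>i\<in>I. f i x)"
 using assms unfolding locally_integrable_def set_integrable_def by (auto simp: scaleR_sum_right sum_distrib_left intro!: lintable_sum)

abbreviation slab :: "real \<Rightarrow> ('a::euclidean_space \<times> real) set" where
 "slab T \<equiv> UNIV \<times> {0<..<T}"

lemma open_slab: "open (slab T)" by (intro open_Times) auto

text \<open>Countably many cylinders capture all compact subsets of the slices, so a single null set
  of times suffices.\<close>

lemma slice_locally_integrable:
 fixes f :: "'a::euclidean_space \<times> real \<Rightarrow> real"
 assumes f: "locally_integrable (slab T) f"
 shows "AE t in lborel. 0 < t \<and> t < T \<longrightarrow> locally_integrable UNIV (\<lambda>x. f (x, t))"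
proof -
 let ?K = "\<lambda>N. cball (0::'a) (real N) \<times> {eps N..T - eps N}"
 have "intble (\<lambda>p. indc (?K N) p * f p)" for N
  using eps_pos[of N] by (intro locally_integrable_cut[OF f] compact_Times) (auto simp del: eps_pos)
 then have "AE t in lborel. intble (\<lambda>x. indc (?K N) (x, t) * f (x, t))" for N
  by (rule lborel_AE_integrable_snd)
 then have "AE t in lborel. \<forall>N. intble (\<lambda>x. indc (?K N) (x, t) * f (x, t))"
  by (simp add: AE_all_countable)
 then show ?thesis
 proof eventually_elim
  case (elim t)
  show ?case
  proof
   assume t: "0 < t \<and> t < T"
   show "locally_integrable UNIV (\<lambda>x. f (x, t))"
    unfolding locally_integrable_def set_integrable_def
   proof (intro allI impI)
    fix K :: "'a set" assume K: "compact K \<and> K \<subseteq> UNIV"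
    then obtain R where R: "\<And>x. x \<in> K \<Longrightarrow> norm x \<le> R"
     by (meson bounded_iff compact_imp_bounded)
    have "eventually (\<lambda>N. R \<le> real N \<and> eps N < t \<and> eps N < T - t) sequentially"
     using t filterlim_real_sequentially by (intro eventually_conj eventually_eps_less) (auto simp: filterlim_at_top)
    then obtain N where N: "R \<le> real N" "eps N < t" "eps N < T - t"
     by (auto simp: eventually_sequentially)
    have [measurable]: "K \<in> sets borel" using K by (simp add: borel_compact)
    have "intble (\<lambda>x. (indc (?K N) (x, t) * f (x, t)) *\<^sub>R (indc K x :: real))"
     using elim by (intro integrable_bounded_mult[where C=1]) (auto simp: indicator_def)
    then show "intble (\<lambda>x. indc K x *\<^sub>R f (x, t))"
     by (rule lintable_cong[OF refl, THEN iffD1, rotated])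
      (use N R in \<open>force simp: indicator_def\<close>)
   qed
  qed
 qed
qed

text \<open>Passes from tests in space-time that are products of two kernels to almost every time
  slice. For a fixed kernel in \<open>x\<close>, the fundamental lemma in time yields a null set
  that depends on the centre and the radius. The radii are countably many; the centres are first
  taken from a countable dense set, and continuity in the centre recovers the others.\<close>

lemma AE_eq_0_if_mollifications_eq_0:
 fixes k0 :: "'a::euclidean_space \<times> real \<Rightarrow> real" and k1 :: "'a \<times> real \<Rightarrow> 'a"
 assumes k0: "locally_integrable (slab T) k0" and k1: "\<And>b. b \<in> Basis \<Longrightarrow> locally_integrable (slab T) (\<lambda>p. k1 p \<bullet> b)"
  and zero: "\<And>c n e m. cball e (eps m) \<subseteq> {0<..<T} \<Longrightarrow>
   (LINT p:slab T|lborel. (k0 p * eta (eps n) (c - fst p) + k1 p \<bullet> deta (eps n) (c - fst p)) * eta (eps m) (e - snd p)) = 0"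
 shows "AE t in lborel. 0 < t \<and> t < T \<longrightarrow>
  (\<forall>c n. (LBINT x. k0 (x, t) * eta (eps n) (c - x) + k1 (x, t) \<bullet> deta (eps n) (c - x)) = 0)"
proof -
 define k where "k c n p = k0 p * eta (eps n) (c - fst p) + k1 p \<bullet> deta (eps n) (c - fst p)" for c n p
 have k_eq: "k c n p = k0 p * eta (eps n) (c - fst p) + (\<Sum>b\<in>Basis. (k1 p \<bullet> b) * (deta (eps n) (c - fst p) \<bullet> b))" for c n p
  unfolding k_def by (subst euclidean_inner[of "k1 p"]) simp
 have k_out: "k c n p = 0" if "fst p \<notin> cball c (eps n)" for c n p
  using that by (auto simp: k_def dist_norm eta_eq_0 deta_eq_0)
 have k_int: "intble (\<lambda>p. indc (cball c (eps n) \<times> L) p * k c n p * w (snd p))"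
  if L: "compact L" "L \<subseteq> {0<..<T}" and w: "continuous_on L w" for c n L and w :: "real \<Rightarrow> real"
 proof -
  let ?K = "cball c (eps n) \<times> L"
  have K: "compact ?K" "?K \<subseteq> slab T" using L by (auto intro: compact_Times)
  have c1: "continuous_on ?K (\<lambda>p. eta (eps n) (c - fst p) * w (snd p))"
   by (intro continuous_intros continuous_on_compose2[OF eta_continuous[of UNIV]] continuous_on_compose2[OF w]) auto
  have c2: "continuous_on ?K (\<lambda>p. (deta (eps n) (c - fst p) \<bullet> b) * w (snd p))" for b
   by (intro continuous_intros continuous_on_compose2[OF deta_continuous[of UNIV]] continuous_on_compose2[OF w]) auto
  have "intble (\<lambda>p. indc ?K p * k0 p * (eta (eps n) (c - fst p) * w (snd p))
    + (\<Sum>b\<in>Basis. indc ?K p * (k1 p \<bullet> b) * ((deta (eps n) (c - fst p) \<bullet> b) * w (snd p))))"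
   by (intro lintable_add lintable_sum
     locally_integrable_cut_mult[OF k0 K c1] locally_integrable_cut_mult[OF k1 K c2])
  then show ?thesis by (simp add: k_eq algebra_simps sum_distrib_left sum_distrib_right)
 qed
 define F where "F c n t = (LBINT x. k c n (x, t))" for c n t
 have ind: "indc (cball c (eps n) \<times> L) (x, t) * k c n (x, t) = indc L t * k c n (x, t)" for c n L x t
  using k_out[of "(x, t)"] by (auto simp: indicator_def)
 have AE1: "AE t in lborel. t \<in> {0<..<T} \<longrightarrow> F c n t = 0" for c n
 proof (rule AE_eq_0_if_moll_eq_0)
  show "locally_integrable {0<..<T} (F c n)"
   unfolding locally_integrable_def set_integrable_def
  proof (intro allI impI)
   fix L :: "real set" assume L: "compact L \<and> L \<subseteq> {0<..<T}"
   from lborel_integrable_snd[OF k_int[of L "\<lambda>_. 1" c n]] L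
   show "intble (\<lambda>t. indc L t *\<^sub>R F c n t)" by (simp add: ind F_def)
  qed
  fix e m assume L: "cball e (eps m) \<subseteq> {0<..<T}"
  have ce: "continuous_on (cball e (eps m)) (\<lambda>t. eta (eps m) (e - t))"
   by (intro continuous_intros continuous_on_compose2[OF eta_continuous[of UNIV]]) auto
  have e0: "t \<in> cball e (eps m) \<and> t \<in> {0<..<T} \<or> eta (eps m) (e - t) = 0" for t
   using L eta_eq_0[of "eps m" "e - t"] by (cases "t \<in> cball e (eps m)") (auto simp: dist_norm)
  have "(LINT t:{0<..<T}|lborel. F c n t * eta (eps m) (e - t))
   = (LBINT t. (LBINT x. indc (cball c (eps n) \<times> cball e (eps m)) (x, t) * k c n (x, t) * eta (eps m) (e - snd (x, t))))"
   unfolding set_lebesgue_integral_def ind F_def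
  proof (rule lint_cong[OF refl])
   fix t
   show "indc {0<..<T} t *\<^sub>R ((LBINT x. k c n (x, t)) * eta (eps m) (e - t))
    = (LBINT x. indc (cball e (eps m)) t * k c n (x, t) * eta (eps m) (e - snd (x, t)))"
    using e0[of t] by auto
  qed
  also have "\<dots> = (LBINT p. indc (cball c (eps n) \<times> cball e (eps m)) p * k c n p * eta (eps m) (e - snd p))"
   by (rule lborel_integral_snd[OF k_int[OF compact_cball L ce]])
  also have "\<dots> = (LINT p:slab T|lborel. k c n p * eta (eps m) (e - snd p))"
   unfolding set_lebesgue_integral_def
  proof (rule lint_cong[OF refl])
   fix p
   show "indc (cball c (eps n) \<times> cball e (eps m)) p * k c n p * eta (eps m) (e - snd p) = indc (slab T) p *\<^sub>R (k c n p * eta (eps m) (e - snd p))"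
    using ind[of c n "cball e (eps m)" "fst p" "snd p"] e0[of "snd p"] by (cases p) auto
  qed
  also have "\<dots> = 0" using zero[OF L] by (simp add: k_def)
  finally show "(LINT t:{0<..<T}|lborel. F c n t * eta (eps m) (e - t)) = 0" .
 qed simp
 obtain D :: "'a set" where D: "countable D" "\<And>X. open X \<Longrightarrow> X \<noteq> {} \<Longrightarrow> \<exists>d\<in>D. d \<in> X"
  using countable_dense_setE by blast
 have "AE t in lborel. \<forall>c\<in>D. \<forall>n. t \<in> {0<..<T} \<longrightarrow> F c n t = 0"
  by (intro AE_ball_countable'[OF _ D(1)] AE_all_countable[THEN iffD2] allI AE1)
 moreover have "AE t in lborel. \<forall>b\<in>Basis. 0 < t \<and> t < T \<longrightarrow> locally_integrable UNIV (\<lambda>x. k1 (x, t) \<bullet> b)"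
  by (intro AE_ball_countable' slice_locally_integrable k1 countable_finite) auto
 moreover note slice_locally_integrable[OF k0]
 ultimately show ?thesis
 proof eventually_elim
  case (elim t)
  show ?case
  proof (intro impI allI)
   fix c n assume t: "0 < t \<and> t < T"
   have l0: "locally_integrable UNIV (\<lambda>x. k0 (x, t))" and l1: "\<And>b. b \<in> Basis \<Longrightarrow> locally_integrable UNIV (\<lambda>x. k1 (x, t) \<bullet> b)"
    using elim t by auto
   \<comment> \<open>For centres in a ball, the integral is a mollification plus a divergence of
     mollifications of integrable functions, hence continuous in the centre.\<close>
   have F_cont: "continuous_on (ball 0 R) (\<lambda>c. F c n t)" for R
   proof -
    let ?S = "cball (0::'a) (R + 1)"
    let ?f0 = "\<lambda>x. indc ?S x * k0 (x, t)" and ?f1 = "\<lambda>b x. indc ?S x * (k1 (x, t) \<bullet> b)"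
    have i0: "intble ?f0" and i1: "\<And>b. b \<in> Basis \<Longrightarrow> intble (?f1 b)"
     using locally_integrable_cut[OF l0] locally_integrable_cut[OF l1] by auto
    have eq: "F c n t = moll (eps n) ?f0 c + (\<Sum>b\<in>Basis. dmoll (eps n) (?f1 b) c \<bullet> b)" if c: "c \<in> ball 0 R" for c
    proof -
     have "moll (eps n) ?f0 c + (\<Sum>b\<in>Basis. dmoll (eps n) (?f1 b) c \<bullet> b)
      = (LBINT x. ?f0 x * eta (eps n) (c - x) + (\<Sum>b\<in>Basis. ?f1 b x * (deta (eps n) (c - x) \<bullet> b)))"
     proof -
      have j: "intble (\<lambda>x. ?f1 b x * (deta (eps n) (c - x) \<bullet> b))" if "b \<in> Basis" for b
      proof -
       have "intble (\<lambda>x. ?f1 b x *\<^sub>R deta (eps n) (c - x))"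
        by (rule moll_integrable(2)[OF i1[OF that] eps_pos])
       from integrable_inner_left[OF this, of b] show ?thesis by simp
      qed
      show ?thesis
       by (simp add: moll_def dmoll_inner[OF i1] lint_add[OF moll_integrable(1)[OF i0 eps_pos] lintable_sum[OF j]]
         lint_sum[OF j])
     qed
     also have "\<dots> = F c n t" unfolding F_def
     proof (rule lint_cong[OF refl])
      fix x
      show "?f0 x * eta (eps n) (c - x) + (\<Sum>b\<in>Basis. ?f1 b x * (deta (eps n) (c - x) \<bullet> b)) = k c n (x, t)"
      proof (cases "x \<in> ?S")
       case True then show ?thesis by (simp add: k_eq)
      next
       case False
       have "eps n \<le> 1" by (simp add: eps_def field_simps)
       then have "x \<notin> cball c (eps n)"
        using False c norm_triangle_sub[of x c] by (auto simp: dist_norm norm_minus_commute)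
       then show ?thesis using False k_out[of "(x, t)"] by simp
      qed
     qed
     finally show ?thesis by simp
    qed
    have "continuous_on (ball 0 R) (\<lambda>c. moll (eps n) ?f0 c + (\<Sum>b\<in>Basis. dmoll (eps n) (?f1 b) c \<bullet> b))"
     by (intro continuous_intros continuous_on_subset[OF c1_continuous[OF c1_moll[OF i0 eps_pos]]]
       continuous_on_subset[OF c1_gradient_continuous[OF c1_moll[OF i1 eps_pos]]]) auto
    then show ?thesis by (rule continuous_on_eq) (simp add: eq)
   qed
   have "F c n t = 0"
   proof (rule ccontr)
    assume "F c n t \<noteq> 0"
    let ?X = "ball 0 (norm c + 1) \<inter> (\<lambda>c. F c n t) -` (- {0})"
    have "open ?X" by (rule continuous_open_preimage[OF F_cont]) auto
    moreover have "c \<in> ?X" using \<open>F c n t \<noteq> 0\<close> by simp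
    ultimately obtain d where "d \<in> D" "d \<in> ?X" using D(2) by blast
    then show False using elim t by auto
   qed
   then show "(LBINT x. k0 (x, t) * eta (eps n) (c - x) + k1 (x, t) \<bullet> deta (eps n) (c - x)) = 0"
    by (simp add: F_def k_def)
  qed
 qed
qed

lemma test_function_tensor:
 fixes c :: "'a::euclidean_space"
 assumes "cball e (eps m) \<subseteq> {0<..<T}"
 shows "test_function (slab T) (\<lambda>p. eta (eps n) (c - fst p) * eta (eps m) (e - snd p))"
proof (rule test_function_smooth_alg[where K="cball c (eps n) \<times> cball e (eps m)"])
 have i: "x \<bullet> (b, 0) = fst x \<bullet> b" "x \<bullet> (0, s) = snd x \<bullet> s" for x :: "'a \<times> real" and b s by (auto simp: inner_prod_def)
 have "smooth_alg (\<lambda>p :: 'a \<times> real. (c - fst p) \<bullet> b)" "smooth_alg (\<lambda>p :: 'a \<times> real. (e - snd p) \<bullet> s)" for b s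
  unfolding inner_diff_left i[symmetric] by (intro smooth_alg_diff smooth_alg.intros)+
 then show "smooth_alg (\<lambda>p. eta (eps n) (c - fst p) * eta (eps m) (e - snd p))"
  by (intro smooth_alg.mult smooth_alg_compose[OF smooth_alg_eta])
 show "cball c (eps n) \<times> cball e (eps m) \<subseteq> slab T" using assms by auto
 fix p assume "p \<notin> cball c (eps n) \<times> cball e (eps m)"
 then show "eta (eps n) (c - fst p) * eta (eps m) (e - snd p) = 0"
  by (cases p) (auto simp: dist_norm intro!: eta_eq_0)
qed (auto intro: compact_Times)

lemma frechet_derivative_tensor:
 "frechet_derivative (\<lambda>p. eta d (c - fst p) * eta r (a - snd p)) (at p) (e, 0) = - (deta d (c - fst p) \<bullet> e) * eta r (a - snd p)"
proof -
 have 1: "((\<lambda>p. eta d (c - fst p)) has_derivative (\<lambda>v. deta d (c - fst p) \<bullet> (- fst v))) (at p)"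
  by (rule has_derivative_compose[OF _ c1_has_derivative[OF c1_eta]]) (auto intro!: derivative_eq_intros)
 have 2: "((\<lambda>p. eta r (a - snd p)) has_derivative (\<lambda>v. deta r (a - snd p) \<bullet> (- snd v))) (at p)"
  by (rule has_derivative_compose[OF _ c1_has_derivative[OF c1_eta]]) (auto intro!: derivative_eq_intros)
 show ?thesis
  using arg_cong[OF frechet_derivative_at[OF has_derivative_mult[OF 1 2]], of "\<lambda>f. f (e, 0)"] by simp
qed

lemma L1_pairing_tendsto:
 fixes f :: "nat \<Rightarrow> 'a \<Rightarrow> real"
 assumes f: "\<And>n. integrable M (f n)" "integrable M f'" and w [measurable]: "w \<in> borel_measurable M"
  and C: "\<And>x. \<bar>w x\<bar> \<le> C" and lim: "(\<lambda>n. \<integral>x. \<bar>f n x - f' x\<bar> \<partial>M) \<longlonglongrightarrow> 0"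
 shows "integrable M (\<lambda>x. f n x * w x)" "integrable M (\<lambda>x. f' x * w x)"
  "(\<lambda>n. \<integral>x. f n x * w x \<partial>M) \<longlonglongrightarrow> (\<integral>x. f' x * w x \<partial>M)"
proof -
 have i: "integrable M (\<lambda>x. k x * w x)" if "integrable M k" for k
  using integrable_bounded_mult[OF that w, of C] C by simp
 show "integrable M (\<lambda>x. f n x * w x)" "integrable M (\<lambda>x. f' x * w x)" using i f by auto
 have "\<bar>(\<integral>x. f n x * w x \<partial>M) - (\<integral>x. f' x * w x \<partial>M)\<bar> \<le> C * (\<integral>x. \<bar>f n x - f' x\<bar> \<partial>M)" for n
 proof -
  have "(\<integral>x. f n x * w x \<partial>M) - (\<integral>x. f' x * w x \<partial>M) = (\<integral>x. (f n x - f' x) * w x \<partial>M)"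
   using i f by (simp add: left_diff_distrib)
  also have "\<bar>\<dots>\<bar> \<le> (\<integral>x. \<bar>(f n x - f' x) * w x\<bar> \<partial>M)" by (rule integral_abs_bound)
  also have "\<dots> \<le> (\<integral>x. \<bar>f n x - f' x\<bar> * C \<partial>M)"
   using C f by (intro integral_mono integrable_abs i integrable_mult_left) (auto simp: abs_mult intro: mult_left_mono)
  finally show ?thesis by (simp add: mult.commute)
 qed
 then have "\<forall>\<^sub>F n in sequentially. \<bar>(\<integral>x. f n x * w x \<partial>M) - (\<integral>x. f' x * w x \<partial>M)\<bar> \<le> C * (\<integral>x. \<bar>f n x - f' x\<bar> \<partial>M)"
  by simp
 from Lim_null_comparison[of "\<lambda>n. (\<integral>x. f n x * w x \<partial>M) - (\<integral>x. f' x * w x \<partial>M)", OF _ tendsto_mult_right_zero[OF lim, of C]] this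
 show "(\<lambda>n. \<integral>x. f n x * w x \<partial>M) \<longlonglongrightarrow> (\<integral>x. f' x * w x \<partial>M)" by (simp add: LIM_zero_iff)
qed

lemma set_integrable_compact_support:
 fixes w :: "'a::euclidean_space \<Rightarrow> real"
 assumes f: "locally_integrable \<Omega> f" and K: "compact K" "K \<subseteq> \<Omega>" and w: "continuous_on K w" "\<And>x. x \<notin> K \<Longrightarrow> w x = 0"
 shows "set_integrable lborel \<Omega> (\<lambda>x. f x * w x)"
 unfolding set_integrable_def using locally_integrable_cut_mult[OF f K w(1)]
 by (rule lintable_cong[OF refl, THEN iffD1, rotated]) (use K w(2) in \<open>auto simp: indicator_def\<close>)

text \<open>Extends an identity from kernels to all compactly supported tests of class
  \<open>c1\<close>. The hypothesis says that the mollification of \<open>f0\<close> plus the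
  divergence of that of \<open>f1\<close> vanishes pointwise. Integrating by parts against
  \<open>e\<close> and passing to the \<open>L1\<close> limit gives the claim.\<close>

lemma integral_gradient_if_mollifications_eq_0:
 fixes f0 :: "'a::euclidean_space \<Rightarrow> real" and f1 :: "'a \<Rightarrow> 'a"
 assumes f0: "locally_integrable UNIV f0" and f1: "\<And>b. b \<in> Basis \<Longrightarrow> locally_integrable UNIV (\<lambda>x. f1 x \<bullet> b)"
  and zero: "\<And>c n. (LBINT x. f0 x * eta (eps n) (c - x) + f1 x \<bullet> deta (eps n) (c - x)) = 0"
  and e: "c1 e de" "\<And>x. norm x > R \<Longrightarrow> e x = 0"
 shows "(LBINT x. f1 x \<bullet> de x) = (LBINT x. f0 x * e x)"
proof -
 \<comment> \<open>The margin 1 contains the support of every kernel centred in the ball of radius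
   \<open>R\<close>, as \<open>eps n \<le> 1\<close>.\<close>
 let ?S = "cball (0::'a) (R + 1)"
 define k0 where "k0 x = indc ?S x * f0 x" for x
 define k1 where "k1 b x = indc ?S x * (f1 x \<bullet> b)" for b x
 have i0: "intble k0" and i1: "\<And>b. b \<in> Basis \<Longrightarrow> intble (k1 b)"
  using locally_integrable_cut[OF f0] locally_integrable_cut[OF f1] by (auto simp: k0_def[abs_def] k1_def[abs_def])
 have de0: "de x = 0" if "norm x > R" for x by (rule gradient_eq_0_outside[OF e that])
 obtain C where C: "\<And>x. norm (e x) \<le> C"
  using bounded_compact_support[OF c1_continuous[OF e(1)] e(2)] by blast
 obtain C' where C': "\<And>x. norm (de x) \<le> C'"
  using bounded_compact_support[OF c1_gradient_continuous[OF e(1)] de0] by blast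
 have bnd: "\<bar>e x\<bar> \<le> C" "b \<in> Basis \<Longrightarrow> \<bar>de x \<bullet> b\<bar> \<le> C'" for x b
  using C[of x] Basis_le_norm[of b "de x"] C'[of x] by auto
 have [measurable]: "borel_fun e" "borel_fun de"
  using c1_continuous[OF e(1)] c1_gradient_continuous[OF e(1)] by (auto intro: borel_measurable_continuous_onI)
 have L0: "(\<lambda>n. (LBINT x. moll (eps n) k0 x * e x)) \<longlonglongrightarrow> (LBINT x. k0 x * e x)"
  by (rule L1_pairing_tendsto[OF moll_tendsto_L1(1)[OF i0] i0 _ bnd(1) moll_tendsto_L1(2)[OF i0]]) auto
 have L1: "(\<lambda>n. (LBINT x. moll (eps n) (k1 b) x * (de x \<bullet> b))) \<longlonglongrightarrow> (LBINT x. k1 b x * (de x \<bullet> b))"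
  and I1: "intble (\<lambda>x. k1 b x * (de x \<bullet> b))" if b: "b \<in> Basis" for b
  by (rule L1_pairing_tendsto[OF moll_tendsto_L1(1)[OF i1[OF b]] i1[OF b] _ bnd(2)[OF b] moll_tendsto_L1(2)[OF i1[OF b]]]; simp)+
 have div: "moll (eps n) k0 c + (\<Sum>b\<in>Basis. dmoll (eps n) (k1 b) c \<bullet> b) = 0" if c: "norm c \<le> R" for c n
 proof -
  have j: "intble (\<lambda>x. k1 b x * (deta (eps n) (c - x) \<bullet> b))" if "b \<in> Basis" for b
  proof -
   have "intble (\<lambda>x. k1 b x *\<^sub>R deta (eps n) (c - x))"
    by (rule moll_integrable(2)[OF i1[OF that] eps_pos])
   from integrable_inner_left[OF this, of b] show ?thesis by simp
  qed
  have "moll (eps n) k0 c + (\<Sum>b\<in>Basis. dmoll (eps n) (k1 b) c \<bullet> b)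
   = (LBINT x. k0 x * eta (eps n) (c - x) + (\<Sum>b\<in>Basis. k1 b x * (deta (eps n) (c - x) \<bullet> b)))"
   by (simp add: moll_def dmoll_inner[OF i1] lint_add[OF moll_integrable(1)[OF i0 eps_pos] lintable_sum[OF j]]
     lint_sum[OF j])
  also have "\<dots> = (LBINT x. f0 x * eta (eps n) (c - x) + f1 x \<bullet> deta (eps n) (c - x))"
  proof (rule lint_cong[OF refl])
   fix x
   show "k0 x * eta (eps n) (c - x) + (\<Sum>b\<in>Basis. k1 b x * (deta (eps n) (c - x) \<bullet> b)) = f0 x * eta (eps n) (c - x) + f1 x \<bullet> deta (eps n) (c - x)"
   proof (cases "x \<in> ?S")
    case True
    then show ?thesis unfolding k0_def k1_def by (subst euclidean_inner[of "f1 x"]) simp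
   next
    case False
    have "eps n \<le> 1" by (simp add: eps_def field_simps)
    then have "norm (c - x) > eps n" using False c norm_triangle_sub[of x c] by (auto simp: norm_minus_commute)
    then show ?thesis using False by (simp add: k0_def k1_def eta_eq_0 deta_eq_0)
   qed
  qed
  finally show ?thesis using zero by simp
 qed
 have key: "(\<Sum>b\<in>Basis. (LBINT x. moll (eps n) (k1 b) x * (de x \<bullet> b))) = (LBINT x. moll (eps n) k0 x * e x)" for n
 proof -
  have c1m: "c1 (moll (eps n) (k1 b)) (dmoll (eps n) (k1 b))" if "b \<in> Basis" for b
   by (rule c1_moll[OF i1[OF that] eps_pos])
  have j: "intble (\<lambda>x. (dmoll (eps n) (k1 b) x \<bullet> b) * e x)" if "b \<in> Basis" for b
   by (rule continuous_compact_support_integrable[where R=R])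
    (use e c1_gradient_continuous[OF c1m[OF that]] c1_continuous[OF e(1)] in \<open>auto intro!: continuous_intros\<close>)
  have "(LBINT x. moll (eps n) (k1 b) x * (de x \<bullet> b)) = - (LBINT x. (dmoll (eps n) (k1 b) x \<bullet> b) * e x)" if "b \<in> Basis" for b
   using integration_by_parts[OF c1m[OF that] e(1), of R b] e(2) by simp
  then have "(\<Sum>b\<in>Basis. (LBINT x. moll (eps n) (k1 b) x * (de x \<bullet> b)))
   = - (LBINT x. (\<Sum>b\<in>Basis. (dmoll (eps n) (k1 b) x \<bullet> b) * e x))"
   by (simp add: lint_sum[OF j] sum_negf)
  also have "\<dots> = - (LBINT x. - (moll (eps n) k0 x * e x))"
  proof (intro arg_cong[where f=uminus] lint_cong[OF refl])
   fix x
   show "(\<Sum>b\<in>Basis. (dmoll (eps n) (k1 b) x \<bullet> b) * e x) = - (moll (eps n) k0 x * e x)"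
   proof (cases "norm x \<le> R")
    case True
    then have "(\<Sum>b\<in>Basis. dmoll (eps n) (k1 b) x \<bullet> b) = - moll (eps n) k0 x" using div[of x n] by linarith
    then show ?thesis by (simp add: sum_distrib_right[symmetric])
   qed (simp add: e)
  qed
  finally show ?thesis by simp
 qed
 have "(\<lambda>n. \<Sum>b\<in>Basis. (LBINT x. moll (eps n) (k1 b) x * (de x \<bullet> b))) \<longlonglongrightarrow> (\<Sum>b\<in>Basis. (LBINT x. k1 b x * (de x \<bullet> b)))"
  by (intro tendsto_sum L1)
 then have "(\<Sum>b\<in>Basis. (LBINT x. k1 b x * (de x \<bullet> b))) = (LBINT x. k0 x * e x)"
  unfolding key using L0 by (rule LIMSEQ_unique)
 moreover have "(\<Sum>b\<in>Basis. (LBINT x. k1 b x * (de x \<bullet> b))) = (LBINT x. f1 x \<bullet> de x)"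
 proof -
  have "(\<Sum>b\<in>Basis. k1 b x * (de x \<bullet> b)) = f1 x \<bullet> de x" for x
   unfolding k1_def by (cases "norm x \<le> R + 1") (auto simp: de0 intro: euclidean_inner[symmetric])
  then show ?thesis using lint_sum[where I=Basis and M=lborel and f="\<lambda>b x. k1 b x * (de x \<bullet> b)"] I1 by simp
 qed
 moreover have "(LBINT x. k0 x * e x) = (LBINT x. f0 x * e x)"
 proof (rule lint_cong[OF refl])
  show "k0 x * e x = f0 x * e x" for x using e(2)[of x] by (cases "norm x \<le> R + 1") (auto simp: k0_def)
 qed
 ultimately show ?thesis by simp
qed

lemma borel_measurable_vec_nth_compose:
 assumes "f \<in> borel_measurable M"
 shows "(\<lambda>x. (f x :: real^'n) $ i) \<in> borel_measurable M"
 by (rule measurable_compose[OF assms borel_measurable_continuous_onI]) (intro continuous_intros)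

lemma eta_eq_0_cball: "x \<notin> cball c e \<Longrightarrow> e > 0 \<Longrightarrow> eta e (c - x) = 0" "x \<notin> cball c e \<Longrightarrow> e > 0 \<Longrightarrow> deta e (c - x) = 0"
 by (auto simp: dist_norm intro: eta_eq_0 deta_eq_0)

lemma slice_measurable:
 fixes f :: "'a::euclidean_space \<times> real \<Rightarrow> real"
 assumes "locally_integrable (slab T) f" "0 < t" "t < T"
 shows "borel_fun (\<lambda>x. f (x, t))"
proof -
 have "borel_fun (\<lambda>x::'a. (x, t))" by (intro borel_measurable_continuous_onI continuous_intros)
 from measurable_compose[OF this locally_integrable_measurable[OF assms(1) open_slab]]
 show ?thesis using assms by simp
qed

section \<open>Slices of the solution\<close>

text \<open>The same \<open>ut\<close> occurs in the weak equation and in \<open>T_ig\<close>,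
  although the function class and the equation each provide their own time derivative; the two are
  identified when the locale is interpreted.\<close>

locale solution = diffeo g h \<Upsilon> for g h :: "real^'d \<Rightarrow> real^'d" and \<Upsilon> :: real +
 fixes T :: real and u ut :: "(real^'d) \<times> real \<Rightarrow> real" and Du :: "(real^'d) \<times> real \<Rightarrow> real^'d"
 assumes T_pos: "T > 0" and u_continuous: "continuous_on (slab T) u"
  and Du: "is_weak_xgradient T u Du" and ut: "is_weak_tderiv T u ut"
  and xgrad: "0 < t \<Longrightarrow> t < T \<Longrightarrow> is_weak_gradient (\<lambda>x. u (x, t)) (\<lambda>x. xgrad u x t)"
  and weak_equation: "test_function (slab T) \<phi> \<Longrightarrow>
   (LINT p:slab T|lborel. - ((coeffA h (fst p) *v Du p) \<bullet> (\<chi> i. frechet_derivative \<phi> (at p) (axis i 1, 0))) + ut p * \<phi> p) = 0"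
  and functionals_integrable: "0 < t \<Longrightarrow> t < T \<Longrightarrow> intble (H_ig h u t)"
   "0 < t \<Longrightarrow> t < T \<Longrightarrow> intble (D_ig h u t)" "0 < t \<Longrightarrow> t < T \<Longrightarrow> intble (T_ig h ut t)"
  and functionals_Lp: "in_Lp 1 (time_measure CARD('d) {0<..<T}) (H_fun h u)"
   "in_Lp 1 (time_measure CARD('d) {0<..<T}) (D_fun h u)" "in_Lp 1 (time_measure CARD('d) {0<..<T}) (T_fun h ut)"
begin

lemma cylinder_eq: "cylinder T = slab T" by (simp add: cylinder_def)

lemma Du_weak: "weak_deriv (slab T) (axis i 1, 0) u (\<lambda>p. Du p $ i)"
 and ut_weak: "weak_deriv (slab T) (0, 1) u ut"
 using Du ut by (simp_all add: is_weak_xgradient_def is_weak_tderiv_def cylinder_eq)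

lemma locally_integrable_u: "locally_integrable (slab T) u" and locally_integrable_ut: "locally_integrable (slab T) ut"
 and locally_integrable_Du: "locally_integrable (slab T) (\<lambda>p. Du p $ i)"
 using Du_weak ut_weak by (simp_all add: weak_deriv_def)

lemma xgrad_weak: "0 < t \<Longrightarrow> t < T \<Longrightarrow> weak_deriv UNIV (axis i 1) (\<lambda>x. u (x, t)) (\<lambda>x. xgrad u x t $ i)"
 using xgrad by (simp add: is_weak_gradient_def)

lemma locally_integrable_xgrad: "0 < t \<Longrightarrow> t < T \<Longrightarrow> locally_integrable UNIV (\<lambda>x. xgrad u x t $ i)"
 using xgrad_weak by (simp add: weak_deriv_def)

lemma slice_u_continuous: "0 < t \<Longrightarrow> t < T \<Longrightarrow> continuous_on S (\<lambda>x. u (x, t))"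
 by (rule continuous_on_compose2[OF u_continuous]) (auto intro!: continuous_intros)

lemma xgrad_measurable: "0 < t \<Longrightarrow> t < T \<Longrightarrow> (\<lambda>x. xgrad u x t) \<in> borel_measurable borel"
 by (subst borel_measurable_euclidean_space)
  (use locally_integrable_measurable[OF locally_integrable_xgrad, of t] in \<open>auto simp: Basis_vec_def inner_axis\<close>)

text \<open>Both are weak gradients, \<open>Du\<close> in space-time and \<open>xgrad\<close> on
  each slice, of the same function \<open>u\<close>. On almost every slice they have equal integrals
  against every kernel, and the fundamental lemma makes them equal almost everywhere there.\<close>

lemma Du_eq_xgrad: "AE t in lborel. 0 < t \<and> t < T \<longrightarrow> (AE x in lborel. Du (x, t) = xgrad u x t)"
proof -
 have "AE t in lborel. 0 < t \<and> t < T \<longrightarrow> (AE x in lborel. Du (x, t) $ i = xgrad u x t $ i)" for i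
 proof -
  let ?e = "axis i (1::real) :: real^'d"
  have "AE t in lborel. 0 < t \<and> t < T \<longrightarrow> (\<forall>c n. (LBINT x. Du (x, t) $ i * eta (eps n) (c - x) + (- u (x, t) *\<^sub>R ?e) \<bullet> deta (eps n) (c - x)) = 0)"
  proof (rule AE_eq_0_if_mollifications_eq_0[where ?k1.0="\<lambda>p. - u p *\<^sub>R ?e"])
   show "locally_integrable (slab T) (\<lambda>p. (- u p *\<^sub>R ?e) \<bullet> b)" for b
    using locally_integrable_mult[OF locally_integrable_u, of "\<lambda>_. - (?e \<bullet> b)"] by simp
   fix c :: "real^'d" and n r m assume r: "cball r (eps m) \<subseteq> {0<..<T}"
   let ?\<phi> = "\<lambda>p. eta (eps n) (c - fst p) * eta (eps m) (r - snd p)"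
   let ?d = "\<lambda>p. frechet_derivative ?\<phi> (at p) (?e, 0)"
   have K: "compact (cball c (eps n) \<times> cball r (eps m))" "cball c (eps n) \<times> cball r (eps m) \<subseteq> slab T"
    using r by (auto intro: compact_Times)
   have out: "?\<phi> p = 0" "?d p = 0" if "p \<notin> cball c (eps n) \<times> cball r (eps m)" for p
    unfolding frechet_derivative_tensor
    using that eta_eq_0_cball[of "fst p" c "eps n"] eta_eq_0_cball(1)[of "snd p" r "eps m"] by (auto simp del: mem_cball simp: mem_Times_iff)
   have 1: "set_integrable lborel (slab T) (\<lambda>p. Du p $ i * ?\<phi> p)"
    by (rule set_integrable_compact_support[OF locally_integrable_Du K _ out(1)])
     (auto intro!: continuous_intros continuous_on_compose2[OF eta_continuous[of UNIV]])
   have 2: "set_integrable lborel (slab T) (\<lambda>p. u p * ?d p)"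
   proof (rule set_integrable_compact_support[OF locally_integrable_u K _ out(2)])
    show "continuous_on (cball c (eps n) \<times> cball r (eps m)) ?d" unfolding frechet_derivative_tensor
     by (intro continuous_intros continuous_on_compose2[OF eta_continuous[of UNIV]] continuous_on_compose2[OF deta_continuous[of UNIV]]) auto
   qed
   have "(LINT p:slab T|lborel. (Du p $ i * eta (eps n) (c - fst p) + (- u p *\<^sub>R ?e) \<bullet> deta (eps n) (c - fst p)) * eta (eps m) (r - snd p))
    = (LINT p:slab T|lborel. Du p $ i * ?\<phi> p + u p * ?d p)"
    unfolding frechet_derivative_tensor by (simp add: algebra_simps inner_commute)
   also have "\<dots> = (LINT p:slab T|lborel. Du p $ i * ?\<phi> p) + (LINT p:slab T|lborel. u p * ?d p)"
    by (rule set_integral_add(2)[OF 1 2])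
   also have "\<dots> = 0" using Du_weak[of i] test_function_tensor[OF r, of n c] by (auto simp: weak_deriv_def)
   finally show "(LINT p:slab T|lborel. (Du p $ i * eta (eps n) (c - fst p) + (- u p *\<^sub>R ?e) \<bullet> deta (eps n) (c - fst p)) * eta (eps m) (r - snd p)) = 0" .
  qed (rule locally_integrable_Du)
  with slice_locally_integrable[OF locally_integrable_Du[of i]]
  show ?thesis
  proof eventually_elim
   case (elim t)
   show ?case
   proof
    assume t: "0 < t \<and> t < T"
    have l: "locally_integrable UNIV (\<lambda>x. Du (x, t) $ i)" using elim t by simp
    have lx: "locally_integrable UNIV (\<lambda>x. xgrad u x t $ i)" using locally_integrable_xgrad t by simp
    have lu: "locally_integrable UNIV (\<lambda>x. u (x, t))" using slice_u_continuous t by (intro continuous_imp_locally_integrable) auto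
    have "AE x in lborel. x \<in> UNIV \<longrightarrow> Du (x, t) $ i - xgrad u x t $ i = 0"
    proof (rule AE_eq_0_if_moll_eq_0[OF locally_integrable_diff[OF l lx] open_UNIV])
     fix c :: "real^'d" and n
     note K = compact_cball[of c "eps n"] subset_UNIV
     have e: "\<And>x. x \<notin> cball c (eps n) \<Longrightarrow> eta (eps n) (c - x) = 0" "\<And>x. x \<notin> cball c (eps n) \<Longrightarrow> deta (eps n) (c - x) \<bullet> ?e = 0"
      by (simp_all add: eta_eq_0_cball del: mem_cball)
     have ce: "continuous_on (cball c (eps n)) (\<lambda>x. eta (eps n) (c - x))" "continuous_on (cball c (eps n)) (\<lambda>x. deta (eps n) (c - x) \<bullet> ?e)"
      by (intro continuous_intros continuous_on_compose2[OF eta_continuous[of UNIV]] continuous_on_compose2[OF deta_continuous[of UNIV]]; simp)+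
     note I = set_integrable_compact_support[OF l K ce(1) e(1)] set_integrable_compact_support[OF lx K ce(1) e(1)]
      set_integrable_compact_support[OF lu K ce(2) e(2)]
     have w: "(LBINT x. u (x, t) * (deta (eps n) (c - x) \<bullet> ?e)) = (LBINT x. xgrad u x t $ i * eta (eps n) (c - x))"
      using xgrad_weak[of t i] t test_function_eta[of "eps n" c UNIV]
      by (auto simp: weak_deriv_def set_lebesgue_integral_def frechet_derivative_eta_shift)
     have "(LBINT x. Du (x, t) $ i * eta (eps n) (c - x) - u (x, t) * (deta (eps n) (c - x) \<bullet> ?e)) = 0"
      using elim t by (simp add: inner_commute)
     then show "(LINT x:UNIV|lborel. (Du (x, t) $ i - xgrad u x t $ i) * eta (eps n) (c - x)) = 0"
      using I w by (simp add: set_lebesgue_integral_def set_integrable_def left_diff_distrib)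
    qed
    then show "AE x in lborel. Du (x, t) $ i = xgrad u x t $ i" by simp
   qed
  qed
 qed
 then have "AE t in lborel. \<forall>i\<in>UNIV. 0 < t \<and> t < T \<longrightarrow> (AE x in lborel. Du (x, t) $ i = xgrad u x t $ i)"
  by (intro AE_ball_countable') auto
 then show ?thesis
  by eventually_elim (auto simp: vec_eq_iff AE_all_countable)
qed

lemma locally_integrable_flux: "locally_integrable (slab T) (\<lambda>p. (coeffA h (fst p) *v Du p) \<bullet> b)"
proof -
 have "(coeffA h (fst p) *v Du p) \<bullet> b = (\<Sum>i\<in>UNIV. Du p $ i * (column i (coeffA h (fst p)) \<bullet> b))" for p
  by (simp add: matrix_mult_sum inner_sum_left scalar_mult_eq_scaleR)
 moreover have "continuous_on (slab T) (\<lambda>p. column i (coeffA h (fst p)) \<bullet> b)" for i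
  unfolding column_def by (intro continuous_intros continuous_on_vec_lambda continuous_on_compose2[OF coeffA_continuous[of UNIV]]) auto
 ultimately show ?thesis
  by (auto intro!: locally_integrable_sum locally_integrable_mult locally_integrable_Du)
qed

text \<open>Product tests give the equation for all kernels on almost every slice, and the extension
  to \<open>c1\<close> tests happens on the slice itself. The null set of times is therefore
  independent of the test function, and the solution at another time may later serve as a
  test.\<close>

lemma slice_equation:
 "AE t in lborel. 0 < t \<and> t < T \<longrightarrow> (\<forall>e de R. c1 e de \<and> (\<forall>x. norm x > R \<longrightarrow> e x = 0) \<longrightarrow>
  (LBINT x. (coeffA h x *v xgrad u x t) \<bullet> de x) = (LBINT x. ut (x, t) * e x))"
proof -
 have "AE t in lborel. 0 < t \<and> t < T \<longrightarrow> (\<forall>c n. (LBINT x. ut (x, t) * eta (eps n) (c - x) + (coeffA h (fst (x, t)) *v Du (x, t)) \<bullet> deta (eps n) (c - x)) = 0)"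
 proof (rule AE_eq_0_if_mollifications_eq_0[where ?k1.0="\<lambda>p. coeffA h (fst p) *v Du p"])
  fix c :: "real^'d" and n r m assume r: "cball r (eps m) \<subseteq> {0<..<T}"
  have ch: "(\<chi> i. - (deta (eps n) (c - fst p) \<bullet> axis i 1) * s) = - s *\<^sub>R deta (eps n) (c - fst p)" for p :: "(real^'d) \<times> real" and s
   by (simp add: vec_eq_iff inner_axis)
  show "(LINT p:slab T|lborel. (ut p * eta (eps n) (c - fst p) + (coeffA h (fst p) *v Du p) \<bullet> deta (eps n) (c - fst p)) * eta (eps m) (r - snd p)) = 0"
   using weak_equation[OF test_function_tensor[OF r, of n c]] unfolding frechet_derivative_tensor ch
   by (simp add: algebra_simps)
 qed (rule locally_integrable_ut locally_integrable_flux)+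
 moreover have "AE t in lborel. \<forall>b\<in>Basis. 0 < t \<and> t < T \<longrightarrow> locally_integrable UNIV (\<lambda>x. (coeffA h (fst (x, t)) *v Du (x, t)) \<bullet> b)"
  by (intro AE_ball_countable' slice_locally_integrable locally_integrable_flux) (auto intro: countable_finite)
 moreover note slice_locally_integrable[OF locally_integrable_ut] Du_eq_xgrad
 ultimately show ?thesis
 proof eventually_elim
  case (elim t)
  show ?case
  proof (intro impI allI)
   fix e and de :: "real^'d \<Rightarrow> real^'d" and R :: real assume t: "0 < t \<and> t < T" and e: "c1 e de \<and> (\<forall>x. norm x > R \<longrightarrow> e x = 0)"
   have "(LBINT x. (coeffA h x *v Du (x, t)) \<bullet> de x) = (LBINT x. ut (x, t) * e x)"
    using elim t e by (intro integral_gradient_if_mollifications_eq_0[where R=R]) auto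
   moreover have "(LBINT x. (coeffA h x *v Du (x, t)) \<bullet> de x) = (LBINT x. (coeffA h x *v xgrad u x t) \<bullet> de x)"
   proof (rule integral_cong_AE)
    have "borel_fun (\<lambda>x. Du (x, t))"
     by (subst borel_measurable_euclidean_space)
      (use slice_measurable[OF locally_integrable_Du, of t] t in \<open>auto simp: Basis_vec_def inner_axis\<close>)
    moreover have "borel_fun (\<lambda>x. xgrad u x t)" using xgrad_measurable t by simp
    moreover have "borel_fun de" using e c1_gradient_continuous borel_measurable_continuous_onI by blast
    moreover have "borel_fun (\<lambda>x. (coeffA h x *v F x) \<bullet> de x)"
     if [measurable]: "borel_fun F" "borel_fun de" for F
    proof -
     have [measurable]: "borel_fun (\<lambda>x. coeffA h x $ i $ j)" for i j
      by (intro borel_measurable_continuous_onI continuous_intros coeffA_continuous)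
     have [measurable]: "borel_fun (\<lambda>x. F x $ j)" "borel_fun (\<lambda>x. de x $ j)" for j
      using that by (auto intro: borel_measurable_vec_nth_compose)
     show ?thesis unfolding inner_vec_def matrix_vector_mult_def by simp
    qed
    ultimately show "(\<lambda>x. (coeffA h x *v Du (x, t)) \<bullet> de x) \<in> borel_measurable lborel"
     "(\<lambda>x. (coeffA h x *v xgrad u x t) \<bullet> de x) \<in> borel_measurable lborel" by auto
    show "AE x in lborel. (coeffA h x *v Du (x, t)) \<bullet> de x = (coeffA h x *v xgrad u x t) \<bullet> de x"
     using elim t by auto
   qed
   ultimately show "(LBINT x. (coeffA h x *v xgrad u x t) \<bullet> de x) = (LBINT x. ut (x, t) * e x)" by simp
  qed
 qed
qed

end

section \<open>Bounds on compact sets, matrices and limits of pairings\<close>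

lemma continuous_compact_bound:
 fixes f :: "'a::topological_space \<Rightarrow> real"
 assumes "compact K" "continuous_on K f"
 shows "\<exists>C>0. \<forall>x\<in>K. \<bar>f x\<bar> \<le> C"
proof -
 have "bounded (f ` K)" by (rule compact_imp_bounded[OF compact_continuous_image[OF assms(2,1)]])
 then obtain C where "C > 0" "\<And>x. x \<in> f ` K \<Longrightarrow> norm x \<le> C" by (auto simp: bounded_pos)
 then show ?thesis by (intro exI[of _ C]) auto
qed

lemma norm_matrix_vector_le: "norm (M *v (w :: real^'n)) \<le> (\<Sum>i\<in>UNIV. norm (M $ i)) * norm w"
proof -
 have "norm (M *v w) \<le> (\<Sum>i\<in>UNIV. \<bar>(M *v w) $ i\<bar>)" by (rule norm_le_l1_cart)
 also have "\<dots> \<le> (\<Sum>i\<in>UNIV. norm (M $ i) * norm w)"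
  by (intro sum_mono) (simp add: matrix_vector_mul_component Cauchy_Schwarz_ineq2)
 finally show ?thesis by (simp add: sum_distrib_right)
qed

lemma continuous_on_matrix_vector_mult:
 fixes M :: "'a::topological_space \<Rightarrow> real^'n^'m"
 assumes "continuous_on S M" "continuous_on S w"
 shows "continuous_on S (\<lambda>x. M x *v w x)"
 unfolding matrix_vector_mult_def by (intro continuous_on_vec_lambda continuous_intros assms)

lemma continuous_on_transpose:
 fixes M :: "'a::topological_space \<Rightarrow> real^'n^'m"
 assumes "continuous_on S M"
 shows "continuous_on S (\<lambda>x. transpose (M x))"
 unfolding transpose_def by (intro continuous_on_vec_lambda continuous_intros assms)

lemma transpose_inner: "(transpose M *v w) \<bullet> k = w \<bullet> (M *v (k :: real^'n))"
 by (simp only: transpose_matrix_vector dot_lmul_matrix)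

lemma c1_compose_matrix:
 fixes f :: "real^'n \<Rightarrow> real" and \<phi> :: "real^'n \<Rightarrow> real^'n"
 assumes f: "c1 f F" and \<phi>: "\<And>x. (\<phi> has_derivative (\<lambda>k. M x *v k)) (at x)" and M: "continuous_on UNIV M"
 shows "c1 (\<lambda>x. f (\<phi> x)) (\<lambda>x. transpose (M x) *v F (\<phi> x))"
 unfolding c1_def
proof (intro conjI allI)
 fix x
 show "((\<lambda>x. f (\<phi> x)) has_derivative (\<lambda>k. (transpose (M x) *v F (\<phi> x)) \<bullet> k)) (at x)"
  unfolding transpose_inner by (rule has_derivative_compose[OF \<phi> c1_has_derivative[OF f]])
 have "continuous_on UNIV \<phi>" by (auto intro!: continuous_at_imp_continuous_on intro: has_derivative_continuous \<phi>)
 then show "continuous_on UNIV (\<lambda>x. transpose (M x) *v F (\<phi> x))"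
  by (intro continuous_on_matrix_vector_mult continuous_on_transpose M continuous_on_compose2[OF c1_gradient_continuous[OF f]]) auto
qed

text \<open>Counterpart of \<open>L2_pairing_tendsto\<close> for terms without a derivative of the
  approximation: there one factor converges uniformly, and the other has only to be integrable with
  support in \<open>K\<close>.\<close>

lemma uniform_pairing_tendsto:
 fixes F :: "'a::euclidean_space \<Rightarrow> real"
 assumes F: "intble F" "\<And>y. y \<notin> K \<Longrightarrow> F y = 0" and V: "\<And>n. V n \<in> borel_measurable borel" "borel_fun w"
  and wb: "\<And>y. y \<in> K \<Longrightarrow> \<bar>w y\<bar> \<le> C"
  and lim: "\<And>e. e > 0 \<Longrightarrow> eventually (\<lambda>n. \<forall>y\<in>K. \<bar>V n y - w y\<bar> \<le> e) sequentially"
 shows "(\<lambda>n. (LBINT y. V n y * F y)) \<longlonglongrightarrow> (LBINT y. w y * F y)"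
proof (rule LIMSEQ_I)
 note [measurable] = V borel_measurable_integrable[OF F(1)]
 have wF: "intble (\<lambda>y. w y * F y)"
 proof (rule lintable_bound)
  show "intble (\<lambda>y. C * \<bar>F y\<bar>)" using F by auto
  show "AE y in lborel. norm (w y * F y) \<le> norm (C * \<bar>F y\<bar>)"
  proof (rule AE_I2)
   fix y show "norm (w y * F y) \<le> norm (C * \<bar>F y\<bar>)"
    using wb[of y] F(2)[of y] by (cases "y \<in> K") (auto simp: abs_mult intro!: mult_right_mono)
  qed
 qed measurable
 fix e :: real assume e: "e > 0"
 define I where "I = (LBINT y. \<bar>F y\<bar>)"
 have I: "I \<ge> 0" by (simp add: I_def)
 define d where "d = e / (I + 1)"
 have d: "d > 0" using e I by (simp add: d_def)
 from lim[OF d] obtain N where N: "\<And>n. n \<ge> N \<Longrightarrow> \<forall>y\<in>K. \<bar>V n y - w y\<bar> \<le> d" by (auto simp: eventually_sequentially)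
 have "norm ((LBINT y. V n y * F y) - (LBINT y. w y * F y)) < e" if n: "n \<ge> N" for n
 proof -
  have pt: "\<bar>(V n y - w y) * F y\<bar> \<le> d * \<bar>F y\<bar>" for y
   using N[OF n] F(2)[of y] by (cases "y \<in> K") (auto simp: abs_mult intro!: mult_right_mono)
  have i: "intble (\<lambda>y. (V n y - w y) * F y)"
   by (rule lintable_bound[of _ "\<lambda>y. d * \<bar>F y\<bar>"])
    (use F pt d in \<open>auto intro!: AE_I2 simp: abs_mult\<close>)
  have "intble (\<lambda>y. V n y * F y)"
   using lintable_add[OF i wF] by (simp add: algebra_simps)
  then have "(LBINT y. V n y * F y) - (LBINT y. w y * F y) = (LBINT y. (V n y - w y) * F y)"
   using wF by (simp add: left_diff_distrib)
  also have "norm \<dots> \<le> (LBINT y. norm ((V n y - w y) * F y))" by (rule integral_norm_bound)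
  also have "\<dots> \<le> (LBINT y. d * \<bar>F y\<bar>)"
   by (intro integral_mono) (use i pt F in auto)
  also have "\<dots> = d * I" by (simp add: I_def)
  also have "\<dots> < e" using e I by (simp add: d_def field_simps)
  finally show ?thesis .
 qed
 then show "\<exists>N. \<forall>n\<ge>N. norm ((LBINT y. V n y * F y) - (LBINT y. w y * F y)) < e" by blast
qed

lemma matrix_measurable:
 fixes M :: "'a \<Rightarrow> real^'n^'n"
 assumes "\<And>i j. (\<lambda>x. M x $ i $ j) \<in> borel_measurable N" "w \<in> borel_measurable N"
 shows "(\<lambda>x. M x *v w x) \<in> borel_measurable N"
proof -
 have [measurable]: "(\<lambda>x. w x $ j) \<in> borel_measurable N" for j by (rule borel_measurable_vec_nth_compose[OF assms(2)])
 show ?thesis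
  by (subst borel_measurable_euclidean_space) (use assms(1) in \<open>auto simp: Basis_vec_def inner_axis matrix_vector_mult_def\<close>)
qed

section \<open>The slices of the solution in similarity variables\<close>

context solution begin

lemma Jac_h_continuous: "continuous_on S (Jac h)"
 by (auto intro!: continuous_at_imp_continuous_on intro: has_derivative_continuous Ck_Jac_has_derivative[OF Ck2(2)])

text \<open>By the chain rule, the gradient in \<open>y\<close> of \<open>u (gsc t y, t)\<close>. It
  uses the gradient of the slice, so it has a meaning at every single time.\<close>

definition P :: "real \<Rightarrow> real^'d \<Rightarrow> real^'d" where
 "P t y = sqrt t *\<^sub>R (transpose (Jac g (sqrt t *\<^sub>R y)) *v xgrad u (gsc t y) t)"

definition ex :: "real^'d \<Rightarrow> real" where "ex y = exp (- ((norm y)\<^sup>2 / 4))"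
definition W :: "(real^'d) \<times> real \<Rightarrow> real" where "W p = ex (fst p) * gam (sqrt (snd p) *\<^sub>R fst p)"

text \<open>\<open>h (gsc t y)\<close> is \<open>sqrt t *\<^sub>R y\<close>, which cancels the
  \<open>t\<close> in the exponent: the Gaussian becomes independent of time.\<close>

lemma gauss_gsc: "t > 0 \<Longrightarrow> gauss h t (gsc t y) = ex y"
 by (simp add: gauss_def gsc_def ex_def power_mult_distrib field_simps)

lemma gdet_W: "ex y * gdet t y = sqrt t ^ CARD('d) * W (y, t)" by (simp add: gdet_def W_def)

lemma W_pos: "W p > 0" by (simp add: W_def ex_def gam_pos)

lemma ex_continuous: "continuous_on S ex" unfolding ex_def by (intro continuous_intros) simp

lemma W_continuous: "continuous_on S W"
 unfolding W_def by (intro continuous_intros continuous_on_compose2[OF ex_continuous[of UNIV]] continuous_on_compose2[OF gam_continuous[of UNIV]]) auto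

lemma norm_P: "t > 0 \<Longrightarrow> (norm (P t y))\<^sup>2 = t * ((coeffA h (gsc t y) *v xgrad u (gsc t y) t) \<bullet> xgrad u (gsc t y) t)"
 unfolding gsc_def coeffA_inner P_def by (simp add: power_mult_distrib dot_square_norm)

lemma D_ig_gsc: "t > 0 \<Longrightarrow> D_ig h u t (gsc t y) * gdet t y = sqrt t ^ CARD('d) / t * ((norm (P t y))\<^sup>2 * W (y, t))"
 using gdet_W[of y t] norm_P[of t y] by (simp add: D_ig_def gauss_gsc)

lemma H_ig_gsc: "t > 0 \<Longrightarrow> H_ig h u t (gsc t y) * gdet t y = sqrt t ^ CARD('d) * ((u (gsc t y, t))\<^sup>2 * W (y, t))"
 using gdet_W[of y t] by (simp add: H_ig_def gauss_gsc)

lemma T_ig_gsc: "t > 0 \<Longrightarrow> T_ig h ut t (gsc t y) * gdet t y = sqrt t ^ CARD('d) * ((ut (gsc t y, t))\<^sup>2 * W (y, t))"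
 using gdet_W[of y t] by (simp add: T_ig_def gauss_gsc)

lemma slice_integrals:
 assumes t: "0 < t" "t < T"
 shows "intble (\<lambda>y. (norm (P t y))\<^sup>2 * W (y, t))" "intble (\<lambda>y. (u (gsc t y, t))\<^sup>2 * W (y, t))"
  "intble (\<lambda>y. (ut (gsc t y, t))\<^sup>2 * W (y, t))"
  "D_fun h u t = sqrt t ^ CARD('d) / t * (LBINT y. (norm (P t y))\<^sup>2 * W (y, t))"
  "H_fun h u t = sqrt t ^ CARD('d) * (LBINT y. (u (gsc t y, t))\<^sup>2 * W (y, t))"
  "T_fun h ut t = sqrt t ^ CARD('d) * (LBINT y. (ut (gsc t y, t))\<^sup>2 * W (y, t))"
proof -
 have c: "sqrt t ^ CARD('d) \<noteq> 0" "sqrt t ^ CARD('d) / t \<noteq> 0" using t by auto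
 note f = functionals_integrable[OF t]
 have m: "D_ig h u t \<in> borel_measurable borel" "H_ig h u t \<in> borel_measurable borel" "T_ig h ut t \<in> borel_measurable borel"
  using f by auto
 show "intble (\<lambda>y. (norm (P t y))\<^sup>2 * W (y, t))" "intble (\<lambda>y. (u (gsc t y, t))\<^sup>2 * W (y, t))"
  "intble (\<lambda>y. (ut (gsc t y, t))\<^sup>2 * W (y, t))"
  using f integrable_gsc[OF t(1) m(1)] integrable_gsc[OF t(1) m(2)] integrable_gsc[OF t(1) m(3)] c
  by (simp_all only: D_ig_gsc[OF t(1)] H_ig_gsc[OF t(1)] T_ig_gsc[OF t(1)] integrable_mult_left_iff integrable_mult_right_iff simp_thms)
 show "D_fun h u t = sqrt t ^ CARD('d) / t * (LBINT y. (norm (P t y))\<^sup>2 * W (y, t))"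
  unfolding D_fun_def integral_gsc[OF t(1) m(1)] D_ig_gsc[OF t(1)] by simp
 show "H_fun h u t = sqrt t ^ CARD('d) * (LBINT y. (u (gsc t y, t))\<^sup>2 * W (y, t))"
  unfolding H_fun_def integral_gsc[OF t(1) m(2)] H_ig_gsc[OF t(1)] by simp
 show "T_fun h ut t = sqrt t ^ CARD('d) * (LBINT y. (ut (gsc t y, t))\<^sup>2 * W (y, t))"
  unfolding T_fun_def integral_gsc[OF t(1) m(3)] T_ig_gsc[OF t(1)] by simp
qed

lemma P_measurable:
 assumes "0 < t" "t < T"
 shows "P t \<in> borel_measurable borel"
 unfolding P_def[abs_def]
proof (intro borel_measurable_scaleR matrix_measurable borel_measurable_const)
 show "borel_fun (\<lambda>y. xgrad u (gsc t y) t)"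
  by (rule measurable_compose[OF gsc_measurable xgrad_measurable[OF assms]])
 show "borel_fun (\<lambda>y. transpose (Jac g (sqrt t *\<^sub>R y)) $ i $ j)" for i j
  by (intro borel_measurable_continuous_onI continuous_intros continuous_on_transpose continuous_on_compose2[OF Jac_g_continuous[of UNIV]]) auto
qed

text \<open>\<open>D_ig\<close> contains the gradient multiplied by the transposed Jacobian of
  \<open>g\<close>. The transposed Jacobian of \<open>h\<close> inverts it, and on a ball that
  matrix and the reciprocal of the Gaussian are bounded.\<close>

lemma xgrad_L2:
 assumes t: "0 < t" "t < T"
 shows "L2 lborel (\<lambda>x. indc (cball 0 R) x * xgrad u x t $ i)"
proof -
 define m where "m x = (\<Sum>i\<in>UNIV. norm (transpose (Jac h x) $ i))" for x
 have "continuous_on (cball 0 R) (\<lambda>x. (m x)\<^sup>2 / gauss h t x)"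
  unfolding m_def gauss_def
  by (intro continuous_intros continuous_on_transpose Jac_h_continuous h_continuous) (use t in auto)
 from continuous_compact_bound[OF compact_cball this]
 obtain C where "C > 0" "\<forall>x\<in>cball 0 R. \<bar>(m x)\<^sup>2 / gauss h t x\<bar> \<le> C" by blast
 then have C: "C > 0" "\<And>x. x \<in> cball 0 R \<Longrightarrow> (m x)\<^sup>2 / gauss h t x \<le> C" by (auto simp: abs_le_iff simp del: abs_divide)
 have g0: "gauss h t x > 0" for x by (simp add: gauss_def)
 have pt: "(indc (cball 0 R) x * xgrad u x t $ i)\<^sup>2 \<le> C * D_ig h u t x" for x
 proof -
  let ?p = "xgrad u x t"
  let ?w = "transpose (Jac g (h x)) *v ?p"
  have Aw: "(coeffA h x *v ?p) \<bullet> ?p = (norm ?w)\<^sup>2" using coeffA_inner[of "h x" ?p ?p] by (simp add: dot_square_norm)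
  have D0: "D_ig h u t x \<ge> 0" using g0[of x] by (simp add: D_ig_def Aw)
  show ?thesis
  proof (cases "x \<in> cball 0 R")
   case True
   have "Jac g (h x) ** Jac h x = mat 1" using Jac_inverse(2)[of "h x"] by simp
   then have "transpose (Jac h x) ** transpose (Jac g (h x)) = mat 1"
    by (metis matrix_transpose_mul transpose_mat)
   then have "?p = transpose (Jac h x) *v ?w" by (simp only: matrix_vector_mul_assoc matrix_vector_mul_lid)
   then have "norm ?p \<le> m x * norm ?w" using norm_matrix_vector_le[of "transpose (Jac h x)" ?w] by (simp add: m_def)
   then have "\<bar>?p $ i\<bar> \<le> m x * norm ?w" using component_le_norm_cart[of ?p i] by linarith
   then have "(?p $ i)\<^sup>2 \<le> (m x * norm ?w)\<^sup>2" by (metis abs_ge_zero power2_abs power_mono)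
   also have "\<dots> = (m x)\<^sup>2 / gauss h t x * D_ig h u t x"
    using g0[of x] by (simp add: D_ig_def Aw power_mult_distrib)
   also have "\<dots> \<le> C * D_ig h u t x" by (rule mult_right_mono[OF C(2)[OF True] D0])
   finally show ?thesis using True by simp
  qed (use C D0 in simp)
 qed
 have mm: "(\<lambda>x. indc (cball 0 R) x * xgrad u x t $ i) \<in> borel_measurable lborel"
  using borel_measurable_vec_nth_compose[OF xgrad_measurable[OF t]] by (intro borel_measurable_times borel_measurable_indicator) auto
 show ?thesis unfolding L2_def
 proof (rule conjI[OF mm])
  show "intble (\<lambda>x. (indc (cball 0 R) x * xgrad u x t $ i)\<^sup>2)"
   by (rule lintable_bound[OF integrable_mult_right[OF functionals_integrable(2)[OF t], of C]])
    (use pt borel_measurable_power[OF mm, of 2] in \<open>auto intro!: AE_I2 order_trans[OF _ abs_ge_self]\<close>)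
 qed
qed

lemma gsc_ball: "\<exists>R'\<ge>0. gsc t ` cball 0 R \<subseteq> cball 0 R'"
proof -
 have "continuous_on (cball 0 R) (\<lambda>y. norm (gsc t y))"
  unfolding gsc_def by (intro continuous_intros continuous_on_compose2[OF g_continuous[of UNIV]]) auto
 from continuous_compact_bound[OF compact_cball this] obtain C where "C > 0" "\<forall>y\<in>cball 0 R. \<bar>norm (gsc t y)\<bar> \<le> C" by blast
 then show ?thesis by (intro exI[of _ C]) auto
qed

text \<open>Gives access to the chain rule and to integration by parts for \<open>P t\<close>, which
  comes from a weak gradient. The slice is mollified in the original variable \<open>x\<close>,
  where weak derivatives and kernels match, and then composed with the diffeomorphism
  \<open>gsc t\<close>.\<close>

lemma slice_approximation:
 assumes t: "0 < t" "t < T" and R: "R \<ge> 0"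
 shows "\<exists>V dV. (\<forall>n. c1 (V n) (dV n)) \<and> (\<forall>e>0. \<forall>\<^sub>F n in sequentially. \<forall>y\<in>cball 0 R. \<bar>V n y - u (gsc t y, t)\<bar> \<le> e) \<and>
  (\<forall>b. L2 lborel (\<lambda>y. indc (cball 0 R) y * (P t y \<bullet> b)) \<and> (\<forall>n. L2 lborel (\<lambda>y. indc (cball 0 R) y * (dV n y \<bullet> b))) \<and>
   (\<lambda>n. LBINT y. (indc (cball 0 R) y * (dV n y \<bullet> b) - indc (cball 0 R) y * (P t y \<bullet> b))\<^sup>2) \<longlonglongrightarrow> 0)"
proof -
 obtain R' where R': "R' \<ge> 0" "gsc t ` cball 0 R \<subseteq> cball 0 R'" using gsc_ball by blast
 let ?S = "cball (0::real^'d) (R' + 1)" and ?B = "cball (0::real^'d) R"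
 define f where "f x = indc ?S x * u (x, t)" for x
 define p where "p i x = indc ?S x * xgrad u x t $ i" for i x
 define M where "M y = sqrt t *\<^sub>R Jac g (sqrt t *\<^sub>R y)" for y
 have M: "continuous_on S M" for S
  unfolding M_def by (intro continuous_intros continuous_on_compose2[OF Jac_g_continuous[of UNIV]]) auto
 have fi: "intble f" unfolding f_def
  by (rule locally_integrable_cut[OF continuous_imp_locally_integrable[OF slice_u_continuous[OF t, of UNIV]]]) auto
 have pL: "L2 lborel (p i)" for i unfolding p_def by (rule xgrad_L2[OF t])
 define V where "V n y = moll (eps n) f (gsc t y)" for n y
 define dV where "dV n y = transpose (M y) *v dmoll (eps n) f (gsc t y)" for n y
 have c1V: "c1 (V n) (dV n)" for n
  unfolding V_def[abs_def] dV_def[abs_def]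
  by (rule c1_compose_matrix[OF c1_moll[OF fi eps_pos] _ M]) (unfold M_def, rule gsc_has_derivative)
 have in_S: "y \<in> ?S" if "x \<in> cball 0 R'" "norm (y - x) \<le> eps n" for x y n
 proof -
  have "eps n \<le> 1" by (simp add: eps_def field_simps)
  then show ?thesis using that norm_triangle_sub[of y x] by simp
 qed
 have unif: "\<forall>\<^sub>F n in sequentially. \<forall>y\<in>?B. \<bar>V n y - u (gsc t y, t)\<bar> \<le> e" if e: "e > 0" for e
 proof -
  have "uniformly_continuous_on ?S (\<lambda>x. u (x, t))"
   by (rule compact_uniformly_continuous[OF slice_u_continuous[OF t] compact_cball])
  then obtain d where d: "d > 0" "\<And>x y. x \<in> ?S \<Longrightarrow> y \<in> ?S \<Longrightarrow> dist y x < d \<Longrightarrow> dist (u (y, t)) (u (x, t)) < e"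
   using e unfolding uniformly_continuous_on_def by metis
  from eventually_eps_less[OF d(1)] show ?thesis
  proof eventually_elim
   case (elim n)
   show ?case
   proof
    fix y assume "y \<in> ?B"
    then have x: "gsc t y \<in> cball 0 R'" using R' by blast
    show "\<bar>V n y - u (gsc t y, t)\<bar> \<le> e" unfolding V_def
    proof (rule moll_close[OF fi eps_pos])
     fix z assume z: "norm (z - gsc t y) < eps n"
     then have "z \<in> ?S" "gsc t y \<in> ?S" using in_S[OF x, of z n] x by auto
     with d(2)[of "gsc t y" z] z elim show "\<bar>f z - u (gsc t y, t)\<bar> \<le> e" by (simp add: f_def dist_norm)
    qed
   qed
  qed
 qed
 have dmoll_eq: "dmoll (eps n) f x $ i = moll (eps n) (p i) x" if x: "x \<in> cball 0 R'" for x n i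
 proof -
  have "cball x (eps n) \<subseteq> ?S" using in_S[OF x] by (auto simp: dist_norm norm_minus_commute)
  from moll_weak_deriv[OF xgrad_weak[OF t] compact_cball subset_UNIV eps_pos this]
  show ?thesis by (simp add: f_def[abs_def] p_def[abs_def] inner_axis)
 qed
 have "L2 lborel (\<lambda>y. indc ?B y * (P t y \<bullet> b)) \<and> (\<forall>n. L2 lborel (\<lambda>y. indc ?B y * (dV n y \<bullet> b))) \<and>
   (\<lambda>n. LBINT y. (indc ?B y * (dV n y \<bullet> b) - indc ?B y * (P t y \<bullet> b))\<^sup>2) \<longlonglongrightarrow> 0" for b
 proof -
  let ?E = "\<lambda>n y. indc ?B y * (dV n y \<bullet> b) - indc ?B y * (P t y \<bullet> b)"
  define q where "q n i x = (moll (eps n) (p i) x - p i x)\<^sup>2" for n i x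
  have qi: "intble (q n i)" for n i
   unfolding q_def by (rule L2_square_integrable[OF L2_diff[OF moll_tendsto_L2(1)[OF pL] pL]])
  \<comment> \<open>Division by \<open>gdet\<close> prepares the change of variables: the squared
    error in \<open>y\<close> is at most \<open>C\<close> times the squared error in
    \<open>x\<close> multiplied by the Jacobian.\<close>
  have "continuous_on ?B (\<lambda>y. (norm (M y *v b))\<^sup>2 / gdet t y)"
   by (intro continuous_intros continuous_on_matrix_vector_mult M continuous_on_compose2[OF gdet_continuous[of UNIV, unfolded case_prod_beta], of _ "\<lambda>y. (y, t)", simplified])
    (use gdet_pos[OF t(1)] in \<open>auto simp: less_imp_neq[symmetric]\<close>)
  from continuous_compact_bound[OF compact_cball this] obtain C where
   "C > 0" "\<forall>y\<in>?B. \<bar>(norm (M y *v b))\<^sup>2 / gdet t y\<bar> \<le> C" by blast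
  then have C: "C > 0" "\<And>y. y \<in> ?B \<Longrightarrow> (norm (M y *v b))\<^sup>2 \<le> C * gdet t y"
   using gdet_pos[OF t(1)] by (auto simp: divide_le_eq abs_of_pos)
  have pt: "(?E n y)\<^sup>2 \<le> C * ((\<Sum>i\<in>UNIV. q n i (gsc t y)) * gdet t y)" for n y
  proof (cases "y \<in> ?B")
   case True
   then have x: "gsc t y \<in> cball 0 R'" using R' by blast
   then have xS: "gsc t y \<in> ?S" by auto
   define r where "r = dmoll (eps n) f (gsc t y) - xgrad u (gsc t y) t"
   have "P t y = transpose (M y) *v xgrad u (gsc t y) t"
    by (simp add: P_def M_def transpose_def matrix_vector_mult_def vec_eq_iff sum_distrib_left mult_ac)
   then have "?E n y = (transpose (M y) *v r) \<bullet> b"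
    using True by (simp add: dV_def r_def matrix_vector_mult_diff_distrib inner_diff_left)
   then have "(?E n y)\<^sup>2 = (r \<bullet> (M y *v b))\<^sup>2" by (simp only: transpose_inner)
   also have "\<dots> \<le> (norm r)\<^sup>2 * (norm (M y *v b))\<^sup>2"
    using Cauchy_Schwarz_ineq[of r "M y *v b"] by (simp only: power2_norm_eq_inner)
   also have "\<dots> \<le> (norm r)\<^sup>2 * (C * gdet t y)" by (intro mult_left_mono C True) auto
   also have "(norm r)\<^sup>2 = (\<Sum>i\<in>UNIV. q n i (gsc t y))"
    unfolding power2_norm_eq_inner inner_vec_def using x xS by (simp add: r_def q_def p_def dmoll_eq power2_eq_square)
   finally show ?thesis by (simp add: mult_ac)
  next
   case False
   then show ?thesis using C(1) gdet_pos[OF t(1), of y] by (simp add: q_def sum_nonneg)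
  qed
  have qm: "borel_fun (\<lambda>x. \<Sum>i\<in>UNIV. q n i x)" for n
   using qi borel_measurable_integrable by (intro borel_measurable_sum) auto
  have Qi: "intble (\<lambda>x. \<Sum>i\<in>UNIV. q n i x)" for n by (intro lintable_sum qi)
  have dom: "intble (\<lambda>y. C * ((\<Sum>i\<in>UNIV. q n i (gsc t y)) * gdet t y))" for n
   using Qi integrable_gsc[OF t(1) qm[of n]] by simp
  have LV: "L2 lborel (\<lambda>y. indc ?B y * (dV n y \<bullet> b))" for n
  proof -
   have c: "continuous_on ?B (\<lambda>y. dV n y \<bullet> b)"
    by (intro continuous_intros continuous_on_subset[OF c1_gradient_continuous[OF c1V]]) auto
   then have "continuous_on ?B (\<lambda>y. (dV n y \<bullet> b)\<^sup>2)" by (rule continuous_on_power)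
   then have "intble (\<lambda>y. indc ?B y *\<^sub>R (dV n y \<bullet> b)\<^sup>2)" by (intro borel_integrable_compact) auto
   moreover have "(\<lambda>y. indc ?B y *\<^sub>R (dV n y \<bullet> b)\<^sup>2) = (\<lambda>y. (indc ?B y * (dV n y \<bullet> b))\<^sup>2)"
    by (auto simp: indicator_def)
   ultimately show ?thesis using borel_integrable_compact[OF compact_cball c] by (auto simp: L2_def)
  qed
  have EL: "L2 lborel (?E n)" for n unfolding L2_def
  proof
   show "?E n \<in> borel_measurable lborel"
    by (rule borel_measurable_diff[OF L2_measurable[OF LV]])
     (use P_measurable[OF t] in \<open>auto intro!: borel_measurable_times borel_measurable_indicator borel_measurable_inner\<close>)
   then show "intble (\<lambda>y. (?E n y)\<^sup>2)"
    by (intro lintable_bound[OF dom[of n]]) (use pt in \<open>auto intro!: AE_I2 order_trans[OF _ abs_ge_self]\<close>)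
  qed
  have LP: "L2 lborel (\<lambda>y. indc ?B y * (P t y \<bullet> b))"
   using L2_diff[OF LV[of 0] EL[of 0]] by simp
  have "(\<lambda>n. LBINT y. (?E n y)\<^sup>2) \<longlonglongrightarrow> 0"
  proof (rule tendsto_sandwich[OF _ _ tendsto_const])
   have "(\<lambda>n. C * (\<Sum>i\<in>UNIV. LBINT x. q n i x)) \<longlonglongrightarrow> C * (\<Sum>i\<in>(UNIV::'d set). 0)"
    unfolding q_def by (intro tendsto_intros moll_tendsto_L2(2)[OF pL])
   then show "(\<lambda>n. C * (\<Sum>i\<in>UNIV. LBINT x. q n i x)) \<longlonglongrightarrow> 0" by simp
   have "(LBINT y. (?E n y)\<^sup>2) \<le> C * (\<Sum>i\<in>UNIV. LBINT x. q n i x)" for n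
   proof -
    have "(LBINT y. (?E n y)\<^sup>2) \<le> (LBINT y. C * ((\<Sum>i\<in>UNIV. q n i (gsc t y)) * gdet t y))"
     by (rule integral_mono[OF L2_square_integrable[OF EL] dom pt])
    also have "\<dots> = C * (LBINT x. \<Sum>i\<in>UNIV. q n i x)" by (simp add: integral_gsc[OF t(1) qm[of n]])
    finally show ?thesis by (simp add: lint_sum qi)
   qed
   then show "\<forall>\<^sub>F n in sequentially. (LBINT y. (?E n y)\<^sup>2) \<le> C * (\<Sum>i\<in>UNIV. LBINT x. q n i x)" by simp
  qed simp
  then show ?thesis using LP LV by blast
 qed
 then show ?thesis using c1V unif by (intro exI[of _ V] exI[of _ dV]) blast
qed

lemma slice_u_gsc_continuous: "0 < t \<Longrightarrow> t < T \<Longrightarrow> continuous_on S (\<lambda>y. u (gsc t y, t))"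
 unfolding gsc_def
 by (intro continuous_on_compose2[OF slice_u_continuous[of t UNIV]] continuous_on_compose2[OF g_continuous[of UNIV]] continuous_intros) auto

text \<open>For the approximations this is the classical formula. The left side passes to the limit
  by \<open>L2\<close> convergence of the gradients, the right side by uniform convergence of the
  functions.\<close>

lemma slice_ibp:
 assumes t: "0 < t" "t < T" and U: "c1 U dU" "\<And>y. norm y > R \<Longrightarrow> U y = 0"
 shows "(LBINT y. (P t y \<bullet> b) * U y) = - (LBINT y. u (gsc t y, t) * (dU y \<bullet> b))"
proof -
 let ?B = "cball (0::real^'d) (max 0 R)"
 obtain V dV where c: "\<And>n. c1 (V n) (dV n)"
  and unif: "\<And>e. e > 0 \<Longrightarrow> \<forall>\<^sub>F n in sequentially. \<forall>y\<in>?B. \<bar>V n y - u (gsc t y, t)\<bar> \<le> e"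
  and LP: "L2 lborel (\<lambda>y. indc ?B y * (P t y \<bullet> b))" and LV: "\<And>n. L2 lborel (\<lambda>y. indc ?B y * (dV n y \<bullet> b))"
  and lim: "(\<lambda>n. LBINT y. (indc ?B y * (dV n y \<bullet> b) - indc ?B y * (P t y \<bullet> b))\<^sup>2) \<longlonglongrightarrow> 0"
  using slice_approximation[OF t, of "max 0 R"] by auto blast
 have dU0: "dU y = 0" if "norm y > R" for y by (rule gradient_eq_0_outside[OF U that])
 have U0: "U y = 0" "dU y = 0" if "y \<notin> ?B" for y using that U(2)[of y] dU0[of y] by (auto simp: not_le)
 have U2: "L2 lborel U" unfolding L2_def
  using c1_continuous[OF U(1)] U(2)
  by (auto intro!: borel_measurable_continuous_onI continuous_compact_support_integrable[of _ R] continuous_intros)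
 have "(\<lambda>n. LBINT y. indc ?B y * (dV n y \<bullet> b) * U y) \<longlonglongrightarrow> (LBINT y. indc ?B y * (P t y \<bullet> b) * U y)"
  by (rule L2_pairing_tendsto[OF LV LP U2 lim])
 moreover have "indc ?B y * k * U y = k * U y" for y and k :: real using U0(1)[of y] by (auto simp: indicator_def)
 ultimately have 1: "(\<lambda>n. LBINT y. (dV n y \<bullet> b) * U y) \<longlonglongrightarrow> (LBINT y. (P t y \<bullet> b) * U y)" by simp
 have cu: "continuous_on ?B (\<lambda>y. u (gsc t y, t))" by (rule slice_u_gsc_continuous[OF t])
 from continuous_compact_bound[OF compact_cball cu] obtain C where C: "\<And>y. y \<in> ?B \<Longrightarrow> \<bar>u (gsc t y, t)\<bar> \<le> C" by blast
 have "(\<lambda>n. LBINT y. V n y * (dU y \<bullet> b)) \<longlonglongrightarrow> (LBINT y. u (gsc t y, t) * (dU y \<bullet> b))"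
 proof (rule uniform_pairing_tendsto[OF _ _ _ _ C unif])
  show "intble (\<lambda>y. dU y \<bullet> b)"
   by (rule continuous_compact_support_integrable[of _ R])
    (use c1_gradient_continuous[OF U(1)] gradient_eq_0_outside[OF U] in \<open>auto intro!: continuous_intros\<close>)
  show "V n \<in> borel_measurable borel" for n by (rule borel_measurable_continuous_onI[OF c1_continuous[OF c]])
  show "borel_fun (\<lambda>y. u (gsc t y, t))" by (rule borel_measurable_continuous_onI[OF slice_u_gsc_continuous[OF t]])
 qed (use U0 in auto)
 then have "(\<lambda>n. - (LBINT y. V n y * (dU y \<bullet> b))) \<longlonglongrightarrow> - (LBINT y. u (gsc t y, t) * (dU y \<bullet> b))" by (rule tendsto_minus)
 moreover have "(LBINT y. (dV n y \<bullet> b) * U y) = - (LBINT y. V n y * (dU y \<bullet> b))" for n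
  using integration_by_parts[OF c[of n] U(1), of R b] U(2) by simp
 ultimately show ?thesis using 1 LIMSEQ_unique by auto
qed

text \<open>The test function is transported by the inverse of \<open>gsc t\<close>. Because
  \<open>coeffA\<close> is the Jacobian of \<open>g\<close> times its transpose, the Jacobians
  cancel in the flux and the Euclidean product with \<open>P t\<close> is left; the two square roots
  of \<open>t\<close> produce the factor \<open>t\<close> on the right.\<close>

lemma slice_equation_gsc:
 "AE t in lborel. 0 < t \<and> t < T \<longrightarrow> (\<forall>Z dZ R. c1 Z dZ \<and> (\<forall>y. norm y > R \<longrightarrow> Z y = 0) \<longrightarrow>
  (LBINT y. (P t y \<bullet> dZ y) * gam (sqrt t *\<^sub>R y)) = t * (LBINT y. ut (gsc t y, t) * (Z y * gam (sqrt t *\<^sub>R y))))"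
 using slice_equation
proof eventually_elim
 case (elim t)
 show ?case
 proof (intro allI impI)
  fix Z and dZ :: "real^'d \<Rightarrow> real^'d" and R :: real assume t: "0 < t \<and> t < T" and Z: "c1 Z dZ \<and> (\<forall>y. norm y > R \<longrightarrow> Z y = 0)"
  define r where "r x = h x /\<^sub>R sqrt t" for x
  define M where "M x = Jac h x /\<^sub>R sqrt t" for x
  define e where "e x = Z (r x)" for x
  define de where "de x = transpose (M x) *v dZ (r x)" for x
  have st: "sqrt t > 0" using t by simp
  have gsc_chi: "r (gsc t y) = y" for y using st by (simp add: r_def gsc_def)
  have c: "c1 e de" unfolding e_def[abs_def] de_def[abs_def]
  proof (rule c1_compose_matrix)
   show "c1 Z dZ" using Z by simp
   show "continuous_on UNIV M" unfolding M_def by (intro continuous_intros Jac_h_continuous)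
   have "((\<lambda>x. h x /\<^sub>R sqrt t) has_derivative (\<lambda>k. (Jac h x *v k) /\<^sub>R sqrt t)) (at x)" for x
    by (rule has_derivative_scaleR_right[OF h_has_derivative])
   then show "(r has_derivative (\<lambda>k. M x *v k)) (at x)" for x
    by (simp add: r_def[abs_def] M_def scaleR_matrix_vector_assoc)
  qed
  obtain R' where R': "gsc t ` cball 0 R \<subseteq> cball 0 R'" using gsc_ball by blast
  have "e x = 0" if x: "norm x > R'" for x
  proof (rule ccontr)
   assume "e x \<noteq> 0"
   then have "r x \<in> cball 0 R" using Z by (auto simp: e_def not_less[symmetric])
   moreover have "gsc t (r x) = x" using st by (simp add: r_def gsc_def)
   ultimately show False using R' x by (metis imageI subsetD mem_cball_0 not_less)
  qed
  then have eq: "(LBINT x. (coeffA h x *v xgrad u x t) \<bullet> de x) = (LBINT x. ut (x, t) * e x)"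
   using elim t c by blast
  have [measurable]: "borel_fun e" "borel_fun de" "borel_fun (\<lambda>x. xgrad u x t)"
   "borel_fun (\<lambda>x. ut (x, t))" "borel_fun (\<lambda>x. coeffA h x *v xgrad u x t)"
  proof -
   show "borel_fun e" "borel_fun de"
    using c1_continuous[OF c] c1_gradient_continuous[OF c] by (auto intro: borel_measurable_continuous_onI)
   show x: "borel_fun (\<lambda>x. xgrad u x t)" using t xgrad_measurable by simp
   show "borel_fun (\<lambda>x. ut (x, t))" using slice_measurable[OF locally_integrable_ut] t by simp
   show "borel_fun (\<lambda>x. coeffA h x *v xgrad u x t)"
    by (intro matrix_measurable x borel_measurable_continuous_onI continuous_intros coeffA_continuous)
  qed
  have flux: "(coeffA h (gsc t y) *v xgrad u (gsc t y) t) \<bullet> de (gsc t y) = (P t y \<bullet> dZ y) / t" for y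
  proof -
   let ?z = "sqrt t *\<^sub>R y"
   have "transpose (Jac g ?z) *v (transpose (Jac h (g ?z)) *v dZ y) = dZ y"
    by (metis Jac_inverse(1) matrix_transpose_mul transpose_mat matrix_vector_mul_assoc matrix_vector_mul_lid)
   moreover have "de (gsc t y) = (transpose (Jac h (g ?z)) *v dZ y) /\<^sub>R sqrt t"
    unfolding de_def gsc_chi by (simp add: M_def gsc_def transpose_def matrix_vector_mult_def vec_eq_iff sum_distrib_left mult_ac)
   ultimately show ?thesis
    using t by (simp add: gsc_def coeffA_inner P_def matrix_vector_mult_scaleR field_simps)
  qed
  have k: "sqrt t ^ CARD('d) \<noteq> 0" using st by simp
  have m: "borel_fun (\<lambda>x. (coeffA h x *v xgrad u x t) \<bullet> de x)" "borel_fun (\<lambda>x. ut (x, t) * e x)"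
   by measurable
  have "sqrt t ^ CARD('d) / t * (LBINT y. (P t y \<bullet> dZ y) * gam (sqrt t *\<^sub>R y)) = (LBINT x. (coeffA h x *v xgrad u x t) \<bullet> de x)"
   using t by (subst integral_gsc[OF _ m(1)]) (auto simp: flux gdet_def mult_ac integral_mult_right_zero[symmetric] simp del: integral_mult_right_zero)
  moreover have "(LBINT x. ut (x, t) * e x) = sqrt t ^ CARD('d) * (LBINT y. ut (gsc t y, t) * (Z y * gam (sqrt t *\<^sub>R y)))"
   using t by (subst integral_gsc[OF _ m(2)]) (auto simp: e_def gsc_chi gdet_def mult_ac integral_mult_right_zero[symmetric] simp del: integral_mult_right_zero)
  ultimately show "(LBINT y. (P t y \<bullet> dZ y) * gam (sqrt t *\<^sub>R y)) = t * (LBINT y. ut (gsc t y, t) * (Z y * gam (sqrt t *\<^sub>R y)))"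
   using eq k t by (simp add: field_simps)
 qed
qed

lemma P_L2: "0 < t \<Longrightarrow> t < T \<Longrightarrow> R \<ge> 0 \<Longrightarrow> L2 lborel (\<lambda>y. indc (cball 0 R) y * (P t y \<bullet> b))"
 using slice_approximation[of t R] by auto

lemma ex_has_derivative: "(ex has_derivative (\<lambda>k. (- (ex y / 2) *\<^sub>R y) \<bullet> k)) (at y)"
proof -
 have "((\<lambda>y. exp (- ((y \<bullet> y) / 4))) has_derivative (\<lambda>k. exp (- ((y \<bullet> y) / 4)) * - ((y \<bullet> k + k \<bullet> y) / 4))) (at y)"
  by (auto intro!: derivative_eq_intros)
 then show ?thesis by (simp add: ex_def[abs_def] dot_square_norm inner_commute)
qed

lemma c1_ex: "c1 ex (\<lambda>y. - (ex y / 2) *\<^sub>R y)"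
 using ex_has_derivative by (auto simp: c1_def intro!: continuous_intros ex_continuous)

text \<open>The test function of the slice equation at time \<open>s\<close> is the solution at time \<open>r\<close>, localised
 by \<open>Phi R\<close> and weighted by the Gaussian. The term produced by the gradient of the Gaussian
 turns the time derivative into one along the flow of the similarity variables.\<close>

lemma cross_equation:
 "AE s in lborel. 0 < s \<and> s < T \<longrightarrow> (\<forall>r R. 0 < r \<and> r < T \<and> R > 0 \<longrightarrow>
  (LBINT y. (P s y \<bullet> P r y) * (Phi R y * W (y, s))) + (LBINT y. (P s y \<bullet> dPhi R y) * (u (gsc r y, r) * W (y, s)))
   = (LBINT y. (s * ut (gsc s y, s) + (P s y \<bullet> y) / 2) * (u (gsc r y, r) * Phi R y * W (y, s))))"
 using slice_equation_gsc
proof eventually_elim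
 case (elim s)
 show ?case
 proof (intro allI impI)
  fix r R :: real assume s: "0 < s \<and> s < T" and rR: "0 < r \<and> r < T \<and> R > 0"
  let ?w = "\<lambda>y. Phi R y * W (y, s)"
  let ?B = "cball (0::real^'d) R" and ?v = "\<lambda>y. u (gsc r y, r)" and ?\<gamma> = "\<lambda>y. gam (sqrt s *\<^sub>R y)"
  obtain V dV where c: "\<And>n. c1 (V n) (dV n)"
   and unif: "\<And>e. e > 0 \<Longrightarrow> \<forall>\<^sub>F n in sequentially. \<forall>y\<in>?B. \<bar>V n y - ?v y\<bar> \<le> e"
   and LV: "\<And>n b. L2 lborel (\<lambda>y. indc ?B y * (dV n y \<bullet> b))"
   and lim: "\<And>b. (\<lambda>n. LBINT y. (indc ?B y * (dV n y \<bullet> b) - indc ?B y * (P r y \<bullet> b))\<^sup>2) \<longlonglongrightarrow> 0"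
   using slice_approximation[of r R] rR by auto blast
  have LP: "L2 lborel (\<lambda>y. indc ?B y * (P r y \<bullet> b))" and Ls: "L2 lborel (\<lambda>y. indc ?B y * (P s y \<bullet> b))" for b
   using P_L2[of _ R b] s rR by auto
  have Phi0: "Phi R y = 0" "dPhi R y = 0" if "y \<notin> ?B" for y using that Phi_eq_0[of R y] rR by auto
  have W_eq: "W (y, s) = ex y * ?\<gamma> y" for y by (simp add: W_def)
  have Wc: "continuous_on S (\<lambda>y. W (y, s))" for S by (rule continuous_on_compose2[OF W_continuous[of UNIV]]) (auto intro!: continuous_intros)
  have \<gamma>c: "continuous_on S ?\<gamma>" for S by (rule continuous_on_compose2[OF gam_continuous[of UNIV]]) (auto intro!: continuous_intros)
  have vc: "continuous_on S ?v" for S using slice_u_gsc_continuous[of r S] rR by simp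
  have [measurable]: "borel_fun ?v" "V n \<in> borel_measurable borel" for n
   using vc[of UNIV] c1_continuous[OF c[of n]] by (auto intro: borel_measurable_continuous_onI)
  have bm: "L2 lborel (\<lambda>y. f y * w y)" if "L2 lborel f" "\<And>y. y \<notin> ?B \<Longrightarrow> f y = 0" "continuous_on ?B w" for f w :: "real^'d \<Rightarrow> real"
  proof -
   from continuous_compact_bound[OF compact_cball that(3)] obtain C where C: "C > 0" "\<forall>y\<in>?B. \<bar>w y\<bar> \<le> C" by blast
   have f: "f y * w y = f y * (indc ?B y *\<^sub>R w y)" for y using that(2)[of y] by (auto simp: indicator_def)
   have m: "(\<lambda>y. indc ?B y *\<^sub>R w y) \<in> borel_measurable lborel"
    using borel_measurable_continuous_on_indicator[OF _ that(3)] by simp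
   have "(\<lambda>y. f y * w y) \<in> borel_measurable lborel" unfolding f by (rule borel_measurable_times[OF L2_measurable[OF that(1)] m])
   moreover have "\<bar>f y * w y\<bar> \<le> C * \<bar>f y\<bar>" for y
    using C that(2)[of y] mult_left_mono[of "\<bar>w y\<bar>" C "\<bar>f y\<bar>"] by (cases "y \<in> ?B") (auto simp: abs_mult mult.commute)
   ultimately show ?thesis using L2_bound[OF that(1), of _ C] by simp
  qed
  have B1: "L2 lborel (indc ?B :: real^'d \<Rightarrow> real)"
  proof -
   have "(\<lambda>y. (indc ?B y :: real)\<^sup>2) = indc ?B" by (auto simp: indicator_def fun_eq_iff)
   moreover have "intble (indc ?B :: real^'d \<Rightarrow> real)"
    by (rule integrable_real_indicator) (use emeasure_lborel_cball_finite[of "0::real^'d" R] in auto)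
   ultimately show ?thesis by (auto simp: L2_def dest: borel_measurable_integrable)
  qed
  have bi: "intble (\<lambda>y. f y * w y)" if f: "L2 lborel f" "\<And>y. y \<notin> ?B \<Longrightarrow> f y = 0" and w: "continuous_on ?B w" for f w :: "real^'d \<Rightarrow> real"
  proof -
   have e: "f y * w y * indc ?B y = f y * w y" for y using f(2)[of y] by (auto simp: indicator_def)
   have "L2 lborel (\<lambda>y. f y * w y)" by (rule bm[OF f(1) _ w]) (rule f(2))
   from L2_mult_integrable[OF this B1] show ?thesis by (simp only: e)
  qed
  have Lsum: "L2 lborel (\<lambda>y. indc ?B y * (P s y \<bullet> X y))" if X: "continuous_on ?B X" for X
  proof -
   have "L2 lborel (\<lambda>y. \<Sum>b\<in>Basis. (indc ?B y * (P s y \<bullet> b)) * (X y \<bullet> b))"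
    by (intro L2_sum bm Ls continuous_intros X) auto
   also have "(\<lambda>y. \<Sum>b\<in>Basis. (indc ?B y * (P s y \<bullet> b)) * (X y \<bullet> b)) = (\<lambda>y. indc ?B y * (P s y \<bullet> X y))"
    by (subst euclidean_inner) (simp add: sum_distrib_left mult_ac)
   finally show ?thesis .
  qed
  define Z where "Z n y = V n y * (Phi R y * ex y)" for n y
  define dF where "dF y = Phi R y *\<^sub>R (- (ex y / 2) *\<^sub>R y) + ex y *\<^sub>R dPhi R y" for y :: "real^'d"
  define dZ where "dZ n y = V n y *\<^sub>R dF y + (Phi R y * ex y) *\<^sub>R dV n y" for n y
  have cZ: "c1 (Z n) (dZ n)" for n
   unfolding Z_def[abs_def] dZ_def[abs_def] dF_def by (intro c1_mult c c1_Phi c1_ex)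
  have "norm y > R \<Longrightarrow> Z n y = 0" for n y using Phi0(1)[of y] by (simp add: Z_def)
  then have eq: "(LBINT y. (P s y \<bullet> dZ n y) * ?\<gamma> y) = s * (LBINT y. ut (gsc s y, s) * (Z n y * ?\<gamma> y))" for n
   using elim s cZ by blast
  \<comment> \<open>Collects the terms in which \<open>V n\<close> is not differentiated. They
    converge by \<open>uniform_pairing_tendsto\<close>, the term with \<open>dV n\<close> by
    \<open>L2_pairing_tendsto\<close>.\<close>
  let ?G = "\<lambda>y. (P s y \<bullet> dF y) * ?\<gamma> y - s * ut (gsc s y, s) * ?w y"
  have dFc: "continuous_on S dF" for S
   unfolding dF_def by (intro continuous_intros Phi_continuous dPhi_continuous ex_continuous) auto
  have dF0: "dF y = 0" if "y \<notin> ?B" for y using Phi0[OF that] by (simp add: dF_def)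
  have iF: "intble (\<lambda>y. (P s y \<bullet> dF y) * ?\<gamma> y)"
  proof -
   have "indc ?B y * (P s y \<bullet> dF y) = P s y \<bullet> dF y" for y using dF0[of y] by (auto simp: indicator_def)
   with bi[OF Lsum[OF dFc] _ \<gamma>c] show ?thesis by simp
  qed
  have iU: "intble (\<lambda>y. s * ut (gsc s y, s) * ?w y)"
  proof -
   have "continuous_on ?B (\<lambda>y. 1 / W (y, s))"
    using W_pos by (intro continuous_intros Wc) (auto simp: less_imp_neq[symmetric])
   from continuous_compact_bound[OF compact_cball this] obtain C where "C > 0" "\<forall>y\<in>?B. \<bar>1 / W (y, s)\<bar> \<le> C" by blast
   then have C: "C > 0" "\<And>y. y \<in> ?B \<Longrightarrow> 1 \<le> C * W (y, s)"
    using W_pos by (auto simp: divide_le_eq abs_of_pos)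
   have utm: "borel_fun (\<lambda>y. ut (gsc s y, s))"
    by (rule measurable_compose[OF gsc_measurable slice_measurable[OF locally_integrable_ut]]) (use s in auto)
   have "L2 lborel (\<lambda>y. indc ?B y * ut (gsc s y, s))" unfolding L2_def
   proof
    show m: "(\<lambda>y. indc ?B y * ut (gsc s y, s)) \<in> borel_measurable lborel"
     using utm by (auto intro!: borel_measurable_times borel_measurable_indicator)
    have "(indc ?B y * ut (gsc s y, s))\<^sup>2 \<le> C * ((ut (gsc s y, s))\<^sup>2 * W (y, s))" for y
     using mult_right_mono[OF C(2)[of y], of "(ut (gsc s y, s))\<^sup>2"] C(1) W_pos[of "(y, s)"] by (cases "y \<in> ?B") (auto simp: mult_ac)
    then show "intble (\<lambda>y. (indc ?B y * ut (gsc s y, s))\<^sup>2)"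
     by (intro lintable_bound[OF integrable_mult_right[OF slice_integrals(3)[OF conjunct1[OF s] conjunct2[OF s]], of C]])
      (use s borel_measurable_power[OF m, of 2] in \<open>auto intro!: AE_I2 order_trans[OF _ abs_ge_self]\<close>)
   qed
   then have "intble (\<lambda>y. indc ?B y * ut (gsc s y, s) * (s * ?w y))"
    by (rule bi) (auto intro!: continuous_intros Phi_continuous Wc)
   moreover have "indc ?B y * ut (gsc s y, s) * (s * ?w y) = s * ut (gsc s y, s) * ?w y" for y
    using Phi0[of y] by (cases "y \<in> ?B") auto
   ultimately show ?thesis by simp
  qed
  from continuous_compact_bound[OF compact_cball vc] obtain C where C: "\<And>y. y \<in> ?B \<Longrightarrow> \<bar>?v y\<bar> \<le> C" by blast
  have G: "(\<lambda>n. LBINT y. V n y * ?G y) \<longlonglongrightarrow> (LBINT y. ?v y * ?G y)"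
   by (rule uniform_pairing_tendsto[OF lintable_diff[OF iF iU] _ _ _ C unif]) (auto simp: dF0 Phi0)
  have Pl: "(\<lambda>n. LBINT y. indc ?B y * (dV n y \<bullet> b) * ((indc ?B y * (P s y \<bullet> b)) * ?w y))
   \<longlonglongrightarrow> (LBINT y. indc ?B y * (P r y \<bullet> b) * ((indc ?B y * (P s y \<bullet> b)) * ?w y))" for b
   by (rule L2_pairing_tendsto[OF LV LP _ lim]) (intro bm Ls continuous_intros Phi_continuous Wc, auto)
  have Li: "L2 lborel (\<lambda>y. (indc ?B y * (P s y \<bullet> b)) * ?w y)" for b
   by (intro bm Ls continuous_intros Phi_continuous Wc) auto
  have Bas: "(\<Sum>b\<in>Basis. indc ?B y * (X \<bullet> b) * ((indc ?B y * (P s y \<bullet> b)) * ?w y)) = (P s y \<bullet> X) * ?w y" for X y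
  proof (cases "y \<in> ?B")
   case True
   then show ?thesis by (simp add: euclidean_inner[of "P s y" X] sum_distrib_left sum_distrib_right mult_ac)
  qed (use Phi0 in simp)
  have Ps: "(\<Sum>b\<in>Basis. LBINT y. indc ?B y * (X y \<bullet> b) * ((indc ?B y * (P s y \<bullet> b)) * ?w y)) = (LBINT y. (P s y \<bullet> X y) * ?w y)"
   "intble (\<lambda>y. (P s y \<bullet> X y) * ?w y)" if "\<And>b. L2 lborel (\<lambda>y. indc ?B y * (X y \<bullet> b))" for X
  proof -
   have i: "intble (\<lambda>y. indc ?B y * (X y \<bullet> b) * ((indc ?B y * (P s y \<bullet> b)) * ?w y))" for b
    by (rule L2_mult_integrable[OF that Li])
   then have "intble (\<lambda>y. \<Sum>b\<in>Basis. indc ?B y * (X y \<bullet> b) * ((indc ?B y * (P s y \<bullet> b)) * ?w y))"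
    by (rule lintable_sum)
   then show "intble (\<lambda>y. (P s y \<bullet> X y) * ?w y)" by (simp only: Bas)
   show "(\<Sum>b\<in>Basis. LBINT y. indc ?B y * (X y \<bullet> b) * ((indc ?B y * (P s y \<bullet> b)) * ?w y)) = (LBINT y. (P s y \<bullet> X y) * ?w y)"
    unfolding Bas[symmetric] by (rule lint_sum[symmetric]) (rule i)
  qed
  have "(\<lambda>n. (LBINT y. (P s y \<bullet> dV n y) * ?w y)) \<longlonglongrightarrow> (LBINT y. (P s y \<bullet> P r y) * ?w y)"
   unfolding Ps(1)[OF LV, symmetric] Ps(1)[OF LP, symmetric] by (intro tendsto_sum Pl)
  from tendsto_add[OF this G]
  have "(\<lambda>n. (LBINT y. (P s y \<bullet> dV n y) * ?w y) + (LBINT y. V n y * ?G y)) \<longlonglongrightarrow>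
   (LBINT y. (P s y \<bullet> P r y) * ?w y) + (LBINT y. ?v y * ?G y)" .
  moreover have Vi: "intble (\<lambda>y. k y * F y)" if k: "continuous_on ?B k" and F: "intble F" "\<And>y. y \<notin> ?B \<Longrightarrow> F y = 0" for k F :: "real^'d \<Rightarrow> real"
  proof -
   from continuous_compact_bound[OF compact_cball k] obtain C where C: "C > 0" "\<forall>y\<in>?B. \<bar>k y\<bar> \<le> C" by blast
   have "intble (\<lambda>y. F y *\<^sub>R (indc ?B y *\<^sub>R k y))"
    by (rule integrable_bounded_mult[OF F(1), of _ C])
     (use C borel_measurable_continuous_on_indicator[OF _ k] in \<open>auto simp: indicator_def\<close>)
   moreover have e: "F y *\<^sub>R (indc ?B y *\<^sub>R k y) = k y * F y" for y using F(2)[of y] by (cases "y \<in> ?B") auto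
   ultimately show ?thesis by (simp only: e)
  qed
  have "(LBINT y. (P s y \<bullet> dV n y) * ?w y) + (LBINT y. V n y * ?G y) = 0" for n
  proof -
   have i1: "intble (\<lambda>y. V n y * ((P s y \<bullet> dF y) * ?\<gamma> y))" and i2: "intble (\<lambda>y. V n y * (s * ut (gsc s y, s) * ?w y))"
    by (intro Vi iF iU continuous_on_subset[OF c1_continuous[OF c]]; simp add: dF0 Phi0)+
   have "(LBINT y. (P s y \<bullet> dZ n y) * ?\<gamma> y) = (LBINT y. (P s y \<bullet> dV n y) * ?w y + V n y * ((P s y \<bullet> dF y) * ?\<gamma> y))"
    by (intro lint_cong[OF refl]) (simp add: dZ_def W_eq inner_add_right algebra_simps)
   also have "\<dots> = (LBINT y. (P s y \<bullet> dV n y) * ?w y) + (LBINT y. V n y * ((P s y \<bullet> dF y) * ?\<gamma> y))"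
    by (rule lint_add[OF Ps(2)[OF LV] i1])
   moreover have "s * (LBINT y. ut (gsc s y, s) * (Z n y * ?\<gamma> y)) = (LBINT y. V n y * (s * ut (gsc s y, s) * ?w y))"
    unfolding integral_mult_right_zero[symmetric] by (intro lint_cong[OF refl]) (simp add: Z_def W_eq mult_ac)
   moreover have "(LBINT y. V n y * ?G y) = (LBINT y. V n y * ((P s y \<bullet> dF y) * ?\<gamma> y)) - (LBINT y. V n y * (s * ut (gsc s y, s) * ?w y))"
    by (simp only: right_diff_distrib lint_diff[OF i1 i2])
   ultimately show ?thesis using eq[of n] by linarith
  qed
  ultimately have "(LBINT y. (P s y \<bullet> P r y) * ?w y) + (LBINT y. ?v y * ?G y) = 0"
   by (simp add: LIMSEQ_const_iff)
  moreover have "(LBINT y. ?v y * ?G y) = (LBINT y. (P s y \<bullet> dPhi R y) * (?v y * W (y, s))) - (LBINT y. (s * ut (gsc s y, s) + (P s y \<bullet> y) / 2) * (?v y * Phi R y * W (y, s)))"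
  proof -
   have "intble (\<lambda>y. (indc ?B y * (P s y \<bullet> dPhi R y)) * (?v y * W (y, s)))"
    by (intro bi Lsum dPhi_continuous continuous_intros vc Wc) auto
   moreover have "indc ?B y * (P s y \<bullet> dPhi R y) = P s y \<bullet> dPhi R y" for y using Phi0[of y] by (auto simp: indicator_def)
   ultimately have j1: "intble (\<lambda>y. (P s y \<bullet> dPhi R y) * (?v y * W (y, s)))" by simp
   have GG: "?v y * ?G y = (P s y \<bullet> dPhi R y) * (?v y * W (y, s)) - (s * ut (gsc s y, s) + (P s y \<bullet> y) / 2) * (?v y * Phi R y * W (y, s))" for y
    by (simp add: dF_def W_eq inner_add_right algebra_simps)
   have "intble (\<lambda>y. ?v y * ?G y)"
    by (intro Vi vc lintable_diff iF iU) (auto simp: dF0 Phi0)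
   from lintable_diff[OF j1 this]
   have j2: "intble (\<lambda>y. (s * ut (gsc s y, s) + (P s y \<bullet> y) / 2) * (?v y * Phi R y * W (y, s)))" unfolding GG by simp
   show ?thesis unfolding GG by (rule lint_diff[OF j1 j2])
  qed
  ultimately show "(LBINT y. (P s y \<bullet> P r y) * ?w y) + (LBINT y. (P s y \<bullet> dPhi R y) * (?v y * W (y, s)))
   = (LBINT y. (s * ut (gsc s y, s) + (P s y \<bullet> y) / 2) * (?v y * Phi R y * W (y, s)))" by linarith
 qed
qed

end

lemma time_measure_integrable:
 assumes "in_Lp 1 (time_measure d {0<..<T}) f"
 shows "intble (\<lambda>t. indc {0<..<T} t * (t powr (- (real d / 2)) * f t))"
proof -
 let ?M = "restrict_space lborel {0<..<T}"
 have f: "f \<in> borel_measurable ?M" and i: "integrable (density ?M (\<lambda>t. ennreal (t powr (- (real d / 2))))) (\<lambda>t. \<bar>f t\<bar>)"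
  using assms by (auto simp: in_Lp_def time_measure_def)
 have p: "(\<lambda>t. t powr (- (real d / 2))) \<in> borel_measurable ?M" by (rule measurable_restrict_space1) simp
 have "integrable ?M (\<lambda>t. t powr (- (real d / 2)) *\<^sub>R \<bar>f t\<bar>)"
  using i by (subst (asm) integrable_density) (use f p in auto)
 then have "integrable ?M (\<lambda>t. t powr (- (real d / 2)) * f t)"
  by (rule lintable_bound) (use f p in \<open>auto simp: abs_mult intro!: borel_measurable_times\<close>)
 then show ?thesis by (subst (asm) integrable_restrict_space) auto
qed

section \<open>Joint measurability and the increment along the flow\<close>

context solution begin

definition flow_map :: "(real^'d) \<times> real \<Rightarrow> (real^'d) \<times> real" where "flow_map p = (gsc (snd p) (fst p), snd p)"
text \<open>The data are controlled in the slab only; cutting off makes this function and the next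
  ones Borel measurable on all of space-time.\<close>

definition vs where "vs p = indc (slab T) p * u (flow_map p)"
definition uts where "uts p = indc (slab T) p * ut (flow_map p)"
definition Dus :: "(real^'d) \<times> real \<Rightarrow> real^'d" where "Dus p = indc (slab T) p *\<^sub>R Du (flow_map p)"
text \<open>The jointly measurable version of \<open>P\<close>, made from the space-time gradient
  \<open>Du\<close> in place of the gradients of the slices.\<close>

definition Ps :: "(real^'d) \<times> real \<Rightarrow> real^'d" where
 "Ps p = sqrt (snd p) *\<^sub>R (transpose (Jac g (sqrt (snd p) *\<^sub>R fst p)) *v Dus p)"
text \<open>Formally the time derivative of \<open>vs\<close> at fixed \<open>y\<close>: the second
  term is the space gradient of \<open>u\<close> paired with the velocity of \<open>gsc t y\<close>,
  see \<open>Qs_eq\<close>.\<close>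

definition Qs where "Qs p = uts p + (fst p \<bullet> Ps p) / (2 * snd p)"

lemma flow_map_continuous: "continuous_on S flow_map"
 unfolding flow_map_def by (intro continuous_intros continuous_on_compose2[OF gsc_continuous[of UNIV, unfolded case_prod_beta], of _ "\<lambda>p. p", simplified])

lemma flow_map_measurable: "borel_fun flow_map"
 by (rule borel_measurable_continuous_onI[OF flow_map_continuous])

lemma flow_map_slab: "indc (slab T) (flow_map p) = (indc (slab T) p :: real)"
 by (cases p) (auto simp: flow_map_def indicator_def)

lemma cut_flow_measurable:
 assumes "locally_integrable (slab T) f"
 shows "borel_fun (\<lambda>p. indc (slab T) p * f (flow_map p))"
 using measurable_compose[OF flow_map_measurable locally_integrable_measurable[OF assms open_slab]]
 by (simp add: flow_map_slab)

lemma vs_measurable: "borel_fun vs" and uts_measurable: "borel_fun uts"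
 unfolding vs_def[abs_def] uts_def[abs_def] by (intro cut_flow_measurable locally_integrable_u locally_integrable_ut)+

lemma Dus_measurable: "borel_fun Dus"
 by (subst borel_measurable_euclidean_space)
  (use cut_flow_measurable[OF locally_integrable_Du] in \<open>auto simp: Dus_def[abs_def] Basis_vec_def inner_axis\<close>)

lemma snd_measurable: "snd \<in> borel_measurable (borel :: ((real^'d) \<times> real) measure)"
 and fst_measurable: "fst \<in> borel_measurable (borel :: ((real^'d) \<times> real) measure)"
 by (intro borel_measurable_continuous_onI continuous_intros)+

lemma Ps_measurable: "borel_fun Ps"
 unfolding Ps_def[abs_def]
proof (intro borel_measurable_scaleR matrix_measurable Dus_measurable)
 show "borel_fun (\<lambda>p :: (real^'d) \<times> real. sqrt (snd p))"
  by (intro borel_measurable_continuous_onI continuous_intros)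
 show "borel_fun (\<lambda>p. transpose (Jac g (sqrt (snd p) *\<^sub>R fst p)) $ i $ j)" for i j
  by (intro borel_measurable_continuous_onI continuous_intros continuous_on_transpose continuous_on_compose2[OF Jac_g_continuous[of UNIV]]) auto
qed

lemma Qs_measurable: "borel_fun Qs"
 unfolding Qs_def[abs_def]
 by (intro borel_measurable_add borel_measurable_divide borel_measurable_times borel_measurable_const borel_measurable_inner
   uts_measurable Ps_measurable snd_measurable fst_measurable)

lemma W_measurable: "borel_fun W"
 by (rule borel_measurable_continuous_onI[OF W_continuous])

lemma slab_slices: "0 < t \<Longrightarrow> t < T \<Longrightarrow> vs (y, t) = u (gsc t y, t)" "0 < t \<Longrightarrow> t < T \<Longrightarrow> uts (y, t) = ut (gsc t y, t)"
 by (simp_all add: vs_def uts_def flow_map_def)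

lemma vs_continuous: "continuous_on (slab T) vs"
proof -
 have "continuous_on (slab T) (\<lambda>p. u (flow_map p))"
  by (rule continuous_on_compose2[OF u_continuous flow_map_continuous]) (auto simp: flow_map_def)
 then show ?thesis by (rule continuous_on_eq) (simp add: vs_def)
qed

lemma Ps_eq: "AE t in lborel. 0 < t \<and> t < T \<longrightarrow> (AE y in lborel. Ps (y, t) = P t y)"
 using Du_eq_xgrad
proof eventually_elim
 case (elim t)
 show ?case
 proof
  assume t: "0 < t \<and> t < T"
  with elim AE_gsc[of t "\<lambda>x. Du (x, t) = xgrad u x t"] have "AE y in lborel. Du (gsc t y, t) = xgrad u (gsc t y) t" by auto
  then show "AE y in lborel. Ps (y, t) = P t y"
   by eventually_elim (use t in \<open>simp add: Ps_def P_def Dus_def flow_map_def\<close>)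
 qed
qed

lemma sqrt_powr: "t > 0 \<Longrightarrow> sqrt t ^ n = t powr (real n / 2)"
 by (simp add: powr_half_sqrt[symmetric] powr_realpow[symmetric] powr_powr)

text \<open>The density of the time measure cancels the power of \<open>sqrt t\<close> from the
  change of variables; on a compact interval the other factor \<open>k\<close> is bounded.\<close>

lemma functional_integrable:
 assumes F: "in_Lp 1 (time_measure CARD('d) {0<..<T}) F" and ab: "0 < a" "b < T" and k: "continuous_on {a..b} k"
  and eq: "\<And>t. 0 < t \<Longrightarrow> t < T \<Longrightarrow> k t * F t = sqrt t ^ CARD('d) * I t"
 shows "intble (\<lambda>t. indc {a..b} t * I t)"
proof -
 let ?f = "\<lambda>t. indc {0<..<T} t * (t powr (- (real CARD('d) / 2)) * F t)"
 from continuous_compact_bound[OF compact_Icc k] obtain C where C: "C > 0" "\<forall>t\<in>{a..b}. \<bar>k t\<bar> \<le> C" by blast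
 have "intble (\<lambda>t. ?f t *\<^sub>R (indc {a..b} t *\<^sub>R k t))"
  by (rule integrable_bounded_mult[OF time_measure_integrable[OF F], of _ C])
   (use C borel_measurable_continuous_on_indicator[OF _ k] in \<open>auto simp: indicator_def\<close>)
 moreover have "?f t *\<^sub>R (indc {a..b} t *\<^sub>R k t) = indc {a..b} t * I t" for t
 proof (cases "t \<in> {a..b}")
  case True
  then have t: "0 < t" "t < T" using ab by auto
  have "?f t * k t = t powr (- (real CARD('d) / 2)) * (k t * F t)" using t by simp
  also have "\<dots> = I t" using t by (simp add: eq sqrt_powr mult.assoc[symmetric] powr_add[symmetric])
  finally show ?thesis using True by simp
 qed simp
 ultimately show ?thesis by (simp only:)
qed

lemma slice_functionals_integrable:
 assumes "0 < a" "b < T"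
 shows "intble (\<lambda>t. indc {a..b} t * (LBINT y. (norm (P t y))\<^sup>2 * W (y, t)))"
  "intble (\<lambda>t. indc {a..b} t * (LBINT y. (u (gsc t y, t))\<^sup>2 * W (y, t)))"
  "intble (\<lambda>t. indc {a..b} t * (LBINT y. (ut (gsc t y, t))\<^sup>2 * W (y, t)))"
 by (rule functional_integrable[OF functionals_Lp(2) assms, of "\<lambda>t. t"] functional_integrable[OF functionals_Lp(1) assms, of "\<lambda>t. 1"]
   functional_integrable[OF functionals_Lp(3) assms, of "\<lambda>t. 1"]; simp add: slice_integrals)+

text \<open>\<open>Qs\<close> consists of \<open>uts\<close>, controlled by the functional of
  \<open>T_ig\<close>, and of a term of size \<open>norm y * norm (Ps p)\<close>, controlled by that
  of \<open>D_ig\<close> as long as \<open>y\<close> is bounded. The unbounded factor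
  \<open>y\<close> is the reason why this argument is local in space.\<close>

lemma Qs_L2:
 assumes ab: "0 < a" "b < T"
 shows "intble (\<lambda>p. indc (cball 0 R \<times> {a..b}) p * (Qs p)\<^sup>2)"
proof -
 let ?I = "\<lambda>p :: (real^'d) \<times> real. indc {a..b} (snd p) :: real"
 have I: "borel_fun ?I" using measurable_compose[OF snd_measurable, of "indc {a..b}" borel] by simp
 have 1: "intble (\<lambda>p. ?I p * ((uts p)\<^sup>2 * W p))"
 proof (rule integrable_Tonelli_snd)
  show "borel_fun (\<lambda>p. ?I p * ((uts p)\<^sup>2 * W p))"
   by (intro borel_measurable_times borel_measurable_power I uts_measurable W_measurable)
  show "0 \<le> ?I p * ((uts p)\<^sup>2 * W p)" for p using W_pos[of p] by simp
  show "AE t in lborel. intble (\<lambda>y. ?I (y, t) * ((uts (y, t))\<^sup>2 * W (y, t)))"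
  proof (rule AE_I2)
   fix t show "intble (\<lambda>y. ?I (y, t) * ((uts (y, t))\<^sup>2 * W (y, t)))"
    using slice_integrals(3)[of t] ab by (cases "t \<in> {a..b}") (auto simp: slab_slices)
  qed
  have e: "(LBINT y. ?I (y, t) * ((uts (y, t))\<^sup>2 * W (y, t))) = indc {a..b} t * (LBINT y. (ut (gsc t y, t))\<^sup>2 * W (y, t))" for t
   using ab by (cases "t \<in> {a..b}") (auto simp: slab_slices)
  show "intble (\<lambda>t. LBINT y. ?I (y, t) * ((uts (y, t))\<^sup>2 * W (y, t)))"
   unfolding e by (rule slice_functionals_integrable(3)[OF ab])
 qed
 have ae: "AE t in lborel. t \<in> {a..b} \<longrightarrow> (AE y in lborel. (norm (Ps (y, t)))\<^sup>2 * W (y, t) = (norm (P t y))\<^sup>2 * W (y, t))"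
  using Ps_eq by eventually_elim (use ab in auto)
 have Psm: "(\<lambda>y. (norm (Ps (y, t)))\<^sup>2 * W (y, t)) \<in> borel_measurable lborel" "(\<lambda>y. (norm (P t y))\<^sup>2 * W (y, t)) \<in> borel_measurable lborel"
  if "t \<in> {a..b}" for t
 proof -
  have c: "borel_fun (\<lambda>y::real^'d. (y, t))" by (intro borel_measurable_continuous_onI continuous_intros)
  have "P t \<in> borel_measurable borel" using P_measurable that ab by auto
  then show "(\<lambda>y. (norm (Ps (y, t)))\<^sup>2 * W (y, t)) \<in> borel_measurable lborel" "(\<lambda>y. (norm (P t y))\<^sup>2 * W (y, t)) \<in> borel_measurable lborel"
   using measurable_compose[OF c Ps_measurable] measurable_compose[OF c W_measurable]
   by (auto intro!: borel_measurable_times borel_measurable_power borel_measurable_norm)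
 qed
 have 2: "intble (\<lambda>p. ?I p * ((norm (Ps p))\<^sup>2 * W p))"
 proof (rule integrable_Tonelli_snd)
  show "borel_fun (\<lambda>p. ?I p * ((norm (Ps p))\<^sup>2 * W p))"
   by (intro borel_measurable_times borel_measurable_power I measurable_compose[OF Ps_measurable borel_measurable_norm] W_measurable)
  show "0 \<le> ?I p * ((norm (Ps p))\<^sup>2 * W p)" for p using W_pos[of p] by simp
  show "AE t in lborel. intble (\<lambda>y. ?I (y, t) * ((norm (Ps (y, t)))\<^sup>2 * W (y, t)))"
   using ae
  proof eventually_elim
   case (elim t)
   show ?case
   proof (cases "t \<in> {a..b}")
    case True
    then have "intble (\<lambda>y. (norm (Ps (y, t)))\<^sup>2 * W (y, t))"
     using integrable_cong_AE[OF Psm[OF True]] elim slice_integrals(1)[of t] ab by auto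
    then show ?thesis using True by simp
   qed simp
  qed
  have "AE t in lborel. indc {a..b} t * (LBINT y. (norm (P t y))\<^sup>2 * W (y, t)) = (LBINT y. ?I (y, t) * ((norm (Ps (y, t)))\<^sup>2 * W (y, t)))"
   using ae
  proof eventually_elim
   case (elim t)
   then show ?case using integral_cong_AE[OF Psm] by (cases "t \<in> {a..b}") auto
  qed
  moreover have "(\<lambda>t. LBINT y. ?I (y, t) * ((norm (Ps (y, t)))\<^sup>2 * W (y, t))) \<in> borel_measurable lborel"
  proof (rule lborel.borel_measurable_lebesgue_integral)
   have "(\<lambda>q :: real \<times> (real^'d). (snd q, fst q)) \<in> borel_measurable (lborel \<Otimes>\<^sub>M lborel)"
    unfolding lborel_prod by (simp, intro borel_measurable_continuous_onI continuous_intros)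
   from measurable_compose[OF this \<open>(\<lambda>p. ?I p * ((norm (Ps p))\<^sup>2 * W p)) \<in> borel_measurable borel\<close>]
   show "(\<lambda>(t, y). ?I (y, t) * ((norm (Ps (y, t)))\<^sup>2 * W (y, t))) \<in> borel_measurable (lborel \<Otimes>\<^sub>M lborel)"
    by (simp add: case_prod_beta)
  qed
  ultimately show "intble (\<lambda>t. LBINT y. ?I (y, t) * ((norm (Ps (y, t)))\<^sup>2 * W (y, t)))"
   using slice_functionals_integrable(1)[OF ab] integrable_cong_AE_imp by blast
 qed
 let ?K = "cball (0::real^'d) R \<times> {a..b}"
 have K: "compact ?K" by (intro compact_Times compact_cball compact_Icc)
 have "continuous_on ?K (\<lambda>p. 1 / W p)" using W_pos by (intro continuous_intros W_continuous) (auto simp: less_imp_neq[symmetric])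
 from continuous_compact_bound[OF K this] obtain C where "C > 0" "\<forall>p\<in>?K. \<bar>1 / W p\<bar> \<le> C" by blast
 then have C: "C > 0" "\<And>p. p \<in> ?K \<Longrightarrow> 1 \<le> C * W p" using W_pos by (auto simp: divide_le_eq abs_of_pos)
 have pt: "indc ?K p * (Qs p)\<^sup>2 \<le> (2 * C) * (?I p * ((uts p)\<^sup>2 * W p)) + (C * R\<^sup>2 / a\<^sup>2) * (?I p * ((norm (Ps p))\<^sup>2 * W p))" for p
 proof (cases "p \<in> ?K")
  case True
  then have p: "norm (fst p) \<le> R" "a \<le> snd p" "snd p \<in> {a..b}" by auto
  have "\<bar>(fst p \<bullet> Ps p) / (2 * snd p)\<bar> \<le> R * norm (Ps p) / (2 * a)"
  proof -
   have "\<bar>fst p \<bullet> Ps p\<bar> \<le> R * norm (Ps p)"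
    using Cauchy_Schwarz_ineq2[of "fst p" "Ps p"] mult_right_mono[OF p(1), of "norm (Ps p)"] by simp
   then show ?thesis using p ab by (auto simp: abs_divide intro!: frac_le)
  qed
  then have q: "((fst p \<bullet> Ps p) / (2 * snd p))\<^sup>2 \<le> (R * norm (Ps p) / (2 * a))\<^sup>2"
   by (metis abs_ge_zero power2_abs power_mono)
  have "(Qs p)\<^sup>2 \<le> 2 * (uts p)\<^sup>2 + 2 * ((fst p \<bullet> Ps p) / (2 * snd p))\<^sup>2"
   using sum_squares_bound[of "uts p" "(fst p \<bullet> Ps p) / (2 * snd p)"] by (simp add: Qs_def power2_sum)
  also have "\<dots> \<le> 2 * (uts p)\<^sup>2 + R\<^sup>2 / a\<^sup>2 * (norm (Ps p))\<^sup>2"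
  proof -
   have "2 * (R * norm (Ps p) / (2 * a))\<^sup>2 \<le> R\<^sup>2 / a\<^sup>2 * (norm (Ps p))\<^sup>2"
    using ab by (simp add: power_mult_distrib power_divide field_simps)
   with q show ?thesis by linarith
  qed
  also have "\<dots> = (2 * (uts p)\<^sup>2 + R\<^sup>2 / a\<^sup>2 * (norm (Ps p))\<^sup>2) * 1" by simp
  also have "\<dots> \<le> (2 * (uts p)\<^sup>2 + R\<^sup>2 / a\<^sup>2 * (norm (Ps p))\<^sup>2) * (C * W p)"
   by (intro mult_left_mono C(2)[OF True]) simp
  finally show ?thesis using True p by (simp add: algebra_simps)
 qed (use W_pos[of p] C in simp)
 show ?thesis
 proof (rule lintable_bound)
  show "intble (\<lambda>p. (2 * C) * (?I p * ((uts p)\<^sup>2 * W p)) + (C * R\<^sup>2 / a\<^sup>2) * (?I p * ((norm (Ps p))\<^sup>2 * W p)))"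
   by (intro lintable_add integrable_mult_right 1 2)
  have "?K \<in> sets borel" using K by (rule borel_compact)
  then show "(\<lambda>p. indc ?K p * (Qs p)\<^sup>2) \<in> borel_measurable lborel"
   using borel_measurable_power[OF Qs_measurable, of 2] by (auto intro!: borel_measurable_times borel_measurable_indicator)
  show "AE p in lborel. norm (indc ?K p * (Qs p)\<^sup>2) \<le> norm ((2 * C) * (?I p * ((uts p)\<^sup>2 * W p)) + (C * R\<^sup>2 / a\<^sup>2) * (?I p * ((norm (Ps p))\<^sup>2 * W p)))"
  proof (rule AE_I2)
   fix p
   have nn: "0 \<le> indc ?K p * (Qs p)\<^sup>2" by simp
   show "norm (indc ?K p * (Qs p)\<^sup>2) \<le> norm ((2 * C) * (?I p * ((uts p)\<^sup>2 * W p)) + (C * R\<^sup>2 / a\<^sup>2) * (?I p * ((norm (Ps p))\<^sup>2 * W p)))"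
    unfolding real_norm_def abs_of_nonneg[OF nn] by (rule order_trans[OF pt abs_ge_self])
  qed
 qed
qed

text \<open>On each slice \<open>flow_map\<close> is the diffeomorphism \<open>gsc t\<close>, whose
  determinant is at least \<open>m\<close> on the ball. The constant does not depend on
  \<open>k\<close>, so \<open>L1\<close> convergence survives composition with the flow.\<close>

lemma flow_map_L1:
 assumes s: "0 < s" and k: "intble k" "\<And>p. k p \<ge> (0::real)"
  and m: "m > 0" "\<And>y t. y \<in> cball 0 R \<Longrightarrow> t \<in> {s..r} \<Longrightarrow> m \<le> gdet t y"
 shows "intble (\<lambda>p. indc (cball 0 R \<times> {s..r}) p * k (flow_map p))"
  "(LBINT p. indc (cball 0 R \<times> {s..r}) p * k (flow_map p)) \<le> (LBINT p. k p) / m"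
proof -
 let ?K = "cball (0::real^'d) R \<times> {s..r}"
 have km: "borel_fun k" using k by auto
 have "?K \<in> sets borel" by (intro borel_compact compact_Times compact_cball compact_Icc)
 then have fm: "borel_fun (\<lambda>p. indc ?K p * k (flow_map p))"
  using measurable_compose[OF flow_map_measurable km] by (auto intro!: borel_measurable_times borel_measurable_indicator)
 have prod: "(\<integral>\<^sup>+p. ennreal (f p) \<partial>lborel) = (\<integral>\<^sup>+t. \<integral>\<^sup>+y. ennreal (f (y, t)) \<partial>lborel \<partial>lborel)"
  if "borel_fun f" for f :: "(real^'d) \<times> real \<Rightarrow> real"
  using lborel_pair.nn_integral_snd[of "\<lambda>p. ennreal (f p)"] that by (simp add: lborel_prod)
 have "(\<integral>\<^sup>+p. ennreal (indc ?K p * k (flow_map p)) \<partial>lborel) \<le> (\<integral>\<^sup>+t. \<integral>\<^sup>+x. ennreal (k (x, t) / m) \<partial>lborel \<partial>lborel)"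
  unfolding prod[OF fm]
 proof (rule nn_integral_mono)
  fix t
  show "(\<integral>\<^sup>+y. ennreal (indc ?K (y, t) * k (flow_map (y, t))) \<partial>lborel) \<le> (\<integral>\<^sup>+x. ennreal (k (x, t) / m) \<partial>lborel)"
  proof (cases "t \<in> {s..r}")
   case True
   then have t: "t > 0" using s by auto
   have c: "borel_fun (\<lambda>y::real^'d. (y, t))" by (intro borel_measurable_continuous_onI continuous_intros)
   have kt: "borel_fun (\<lambda>x. ennreal (k (x, t) / m))" using measurable_compose[OF c km] by simp
   show ?thesis unfolding nn_integral_gsc[OF t kt]
   proof (rule nn_integral_mono)
    fix y
    have "indc ?K (y, t) * k (flow_map (y, t)) \<le> gdet t y * (k (gsc t y, t) / m)"
     using m(2)[of y t] True m(1) k(2)[of "(gsc t y, t)"] gdet_pos[OF t, of y]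
     by (cases "y \<in> cball 0 R") (auto simp: flow_map_def field_simps intro: mult_right_mono)
    then show "ennreal (indc ?K (y, t) * k (flow_map (y, t))) \<le> ennreal (gdet t y) * ennreal (k (gsc t y, t) / m)"
     using m(1) k(2)[of "(gsc t y, t)"] gdet_pos[OF t, of y] by (simp add: ennreal_mult[symmetric] ennreal_leI)
   qed
  qed simp
 qed
 also have "\<dots> = (\<integral>\<^sup>+p. ennreal (k p / m) \<partial>lborel)"
  by (rule prod[symmetric]) (use km in simp)
 also have "\<dots> = ennreal ((LBINT p. k p) / m)"
  using nn_integral_eq_integral[of lborel "\<lambda>p. k p / m"] k m(1) by simp
 finally have le: "(\<integral>\<^sup>+p. ennreal (indc ?K p * k (flow_map p)) \<partial>lborel) \<le> ennreal ((LBINT p. k p) / m)" .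
 have nn: "0 \<le> indc ?K p * k (flow_map p)" for p using k(2) by simp
 show i: "intble (\<lambda>p. indc ?K p * k (flow_map p))"
  by (rule integrableI_bounded) (use fm le nn in \<open>auto intro: le_less_trans\<close>)
 have "0 \<le> (LBINT p. k p) / m" using k m by simp
 then show "(LBINT p. indc ?K p * k (flow_map p)) \<le> (LBINT p. k p) / m"
  using le nn_integral_eq_integral[OF i] nn by simp
qed

lemma gsc_time_derivative:
 assumes t: "t > 0"
 shows "((\<lambda>t. gsc t y) has_derivative (\<lambda>k. k *\<^sub>R ((Jac g (sqrt t *\<^sub>R y) *v y) /\<^sub>R (2 * sqrt t)))) (at t)"
proof -
 have "(sqrt has_derivative (\<lambda>k. k * (inverse (sqrt t) / 2))) (at t)"
  using DERIV_real_sqrt[OF t] unfolding has_field_derivative_def by (simp only: mult_commute_abs)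
 from has_derivative_scaleR_left[OF this, of y]
 have "((\<lambda>t. sqrt t *\<^sub>R y) has_derivative (\<lambda>k. (k * (inverse (sqrt t) / 2)) *\<^sub>R y)) (at t)" .
 from has_derivative_compose[OF this g_has_derivative]
 show ?thesis by (simp add: gsc_def[abs_def] matrix_vector_mult_scaleR mult_ac)
qed

lemma Qs_eq: "t > 0 \<Longrightarrow> Qs (y, t) = uts (y, t) + ((Jac g (sqrt t *\<^sub>R y) *v y) /\<^sub>R (2 * sqrt t)) \<bullet> Dus (y, t)"
proof -
 assume t: "t > 0"
 have "y \<bullet> Ps (y, t) = sqrt t * ((Jac g (sqrt t *\<^sub>R y) *v y) \<bullet> Dus (y, t))"
  using transpose_inner[of "Jac g (sqrt t *\<^sub>R y)" "Dus (y, t)" y] by (simp add: Ps_def inner_commute)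
 moreover have "sqrt t / (2 * t) = inverse (2 * sqrt t)" using t by (simp add: field_simps real_sqrt_mult_self flip: power2_eq_square)
 ultimately show ?thesis by (simp add: Qs_def) (metis (no_types) mult.commute mult.left_commute times_divide_eq_left)
qed

text \<open>Mollifying \<open>u\<close> in space-time reduces the increment along the flow to the fundamental
 theorem of calculus.\<close>

lemma flow_increment:
 assumes sr: "0 < s" "s \<le> r" "r < T"
 shows "AE y in lborel. vs (y, r) - vs (y, s) = (LBINT t. indc {s..r} t * Qs (y, t))"
proof -
 define E where "E y = vs (y, r) - vs (y, s) - (LBINT t. indc {s..r} t * Qs (y, t))" for y
 have ball: "AE y in lborel. y \<in> cball 0 R \<longrightarrow> E y = 0" for R
 proof -
  let ?B = "cball (0::real^'d) R" and ?X = "cball (0::real^'d) R \<times> {s..r}"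
  have X: "compact ?X" by (intro compact_Times compact_cball compact_Icc)
  have Xm: "?X \<in> sets borel" by (rule borel_compact[OF X])
  \<comment> \<open>Kernels of radius below \<open>a\<close> around points of the flow between the
    times \<open>s\<close> and \<open>r\<close> stay inside the slab.\<close>
  define a where "a = min 1 (min s (T - r) / 2)"
  have a: "a > 0" "a \<le> 1" "a < s" "a < T - r" using sr by (auto simp: a_def min_def)
  have "continuous_on ?X (\<lambda>p. norm (flow_map p))" by (intro continuous_intros flow_map_continuous)
  from continuous_compact_bound[OF X this] obtain R' where R': "R' > 0" "\<And>p. p \<in> ?X \<Longrightarrow> norm (flow_map p) \<le> R'" by auto
  let ?S = "cball (0::real^'d) (R' + 1) \<times> {s - a..r + a}"
  have S: "compact ?S" "?S \<subseteq> slab T" using a by (auto intro!: compact_Times)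
  have in_S: "cball (flow_map p) (eps n) \<subseteq> ?S" if p: "p \<in> ?X" and n: "eps n < a" for p n
  proof
   fix q assume q: "q \<in> cball (flow_map p) (eps n)"
   have d: "norm (fst q - fst (flow_map p)) \<le> eps n" "\<bar>snd q - snd (flow_map p)\<bar> \<le> eps n"
    using q dist_fst_le[of q "flow_map p"] dist_snd_le[of q "flow_map p"] by (auto simp: dist_commute dist_norm[symmetric] dist_real_def[symmetric])
   have "norm (fst (flow_map p)) \<le> R'" using R'(2)[OF p] norm_fst_le[of "fst (flow_map p)" "snd (flow_map p)"] by simp
   then have "norm (fst q) \<le> R' + 1" using d(1) n a(2) norm_triangle_sub[of "fst q" "fst (flow_map p)"] by linarith
   moreover have "s - a \<le> snd q" "snd q \<le> r + a" using d(2) n p by (auto simp: flow_map_def)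
   ultimately show "q \<in> ?S" by (cases q) auto
  qed
  have in_S0: "flow_map p \<in> ?S" if "p \<in> ?X" for p
  proof -
   obtain n where "eps n < a" using eventually_eps_less[OF a(1)] by (auto simp: eventually_sequentially)
   then have "cball (flow_map p) (eps n) \<subseteq> ?S" by (rule in_S[OF that])
   then show ?thesis by (rule subsetD) simp
  qed
  have inT: "0 < t \<and> t < T" if "t \<in> {s..r}" for t using that sr by auto
  define f where "f p = indc ?S p * u p" for p
  \<comment> \<open>\<open>None\<close> stands for the time derivative and \<open>Some j\<close> for
    the space derivatives, so that one sum collects all mollification errors.\<close>
  define G where "G i p = (case i of None \<Rightarrow> indc ?S p * ut p | Some j \<Rightarrow> indc ?S p * Du p $ j)" for i p
  have fi: "intble f" unfolding f_def by (rule locally_integrable_cut[OF locally_integrable_u S])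
  have Gi: "intble (G i)" for i
   unfolding G_def using locally_integrable_cut[OF locally_integrable_ut S] locally_integrable_cut[OF locally_integrable_Du S]
   by (cases i) auto
  define D where "D n = dmoll (eps n) f" for n
  define k where "k n p = (\<Sum>i\<in>UNIV. \<bar>moll (eps n) (G i) p - G i p\<bar>)" for n p
  have ki: "intble (k n)" for n
   unfolding k_def using moll_tendsto_L1(1)[OF Gi] Gi by auto
  have klim: "(\<lambda>n. LBINT p. k n p) \<longlonglongrightarrow> 0"
  proof -
   have "(\<lambda>n. \<Sum>i\<in>UNIV. LBINT p. \<bar>moll (eps n) (G i) p - G i p\<bar>) \<longlonglongrightarrow> (\<Sum>i\<in>(UNIV :: 'd option set). 0)"
    by (intro tendsto_sum moll_tendsto_L1(2)[OF Gi])
   then show ?thesis unfolding k_def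
    by (subst lint_sum) (use moll_tendsto_L1(1)[OF Gi] Gi in auto)
  qed
  define c where "c p = (Jac g (sqrt (snd p) *\<^sub>R fst p) *v fst p) /\<^sub>R (2 * sqrt (snd p))" for p :: "(real^'d) \<times> real"
  have cc: "continuous_on (UNIV \<times> {0<..}) c" unfolding c_def
   by (intro continuous_intros continuous_on_matrix_vector_mult continuous_on_compose2[OF Jac_g_continuous[of UNIV]]) auto
  have "continuous_on ?X (\<lambda>p. norm (c p))" by (intro continuous_intros continuous_on_subset[OF cc]) (use sr in auto)
  from continuous_compact_bound[OF X this] obtain C where C: "C > 0" "\<And>p. p \<in> ?X \<Longrightarrow> norm (c p) \<le> C" by auto
  have "continuous_on ?X (\<lambda>p. 1 / gdet (snd p) (fst p))"
   using gdet_pos inT by (intro continuous_intros continuous_on_subset[OF gdet_continuous[of UNIV, unfolded case_prod_beta]])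
    (auto simp: less_imp_neq[symmetric])
  from continuous_compact_bound[OF X this] obtain M where M: "M > 0" "\<And>p. p \<in> ?X \<Longrightarrow> \<bar>1 / gdet (snd p) (fst p)\<bar> \<le> M" by auto
  have m: "1 / M > 0" "\<And>y t. y \<in> ?B \<Longrightarrow> t \<in> {s..r} \<Longrightarrow> 1 / M \<le> gdet t y"
   using M(1) M(2)[of "(_, _)"] gdet_pos inT by (auto simp: divide_le_eq mult.commute abs_of_pos)
  define Qn where "Qn n p = D n (flow_map p) \<bullet> (c p, 1)" for n p
  have Dc: "continuous_on A (D n)" for A n
   unfolding D_def by (rule continuous_on_subset[OF c1_gradient_continuous[OF c1_moll[OF fi eps_pos]]]) simp
  have Qnc: "continuous_on (UNIV \<times> {0<..}) (Qn n)" for n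
   unfolding Qn_def by (intro continuous_intros cc continuous_on_compose2[OF Dc[of UNIV] flow_map_continuous]) auto
  \<comment> \<open>The derivative along the flow of the mollified \<open>u\<close> differs from
    \<open>Qs\<close> by mollification errors of the weak derivatives at the flow point, weighted
    with the velocity \<open>(c p, 1)\<close>.\<close>
  have Qdiff: "\<bar>Qn n p - Qs p\<bar> \<le> (1 + C) * k n (flow_map p)" if p: "p \<in> ?X" and n: "eps n < a" for n p
  proof -
   obtain y t where pe: "p = (y, t)" by (cases p)
   have t: "0 < t" "t < T" using p inT pe by auto
   let ?q = "flow_map p"
   have mw: "D n ?q \<bullet> e = moll (eps n) (\<lambda>q. indc ?S q * f' q) ?q" if "weak_deriv (slab T) e u f'" for e f'
    unfolding D_def f_def[abs_def] by (rule moll_weak_deriv[OF that S eps_pos in_S[OF p n]])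
   have e0: "snd (D n ?q) - ut ?q = moll (eps n) (G None) ?q - G None ?q"
    using mw[OF ut_weak] in_S0[OF p] by (simp add: G_def[abs_def] inner_prod_def)
   have ei: "fst (D n ?q) $ i - Du ?q $ i = moll (eps n) (G (Some i)) ?q - G (Some i) ?q" for i
    using mw[OF Du_weak[of i]] in_S0[OF p] by (simp add: G_def[abs_def] inner_prod_def inner_axis)
   have "\<bar>snd (D n ?q) - ut ?q\<bar> \<le> k n ?q" unfolding e0 k_def by (rule member_le_sum) auto
   moreover have "norm (fst (D n ?q) - Du ?q) \<le> k n ?q"
   proof -
    have "norm (fst (D n ?q) - Du ?q) \<le> (\<Sum>i\<in>UNIV. \<bar>moll (eps n) (G (Some i)) ?q - G (Some i) ?q\<bar>)"
     using norm_le_l1_cart[of "fst (D n ?q) - Du ?q"] by (simp add: ei)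
    also have "\<dots> \<le> k n ?q" unfolding k_def UNIV_option_conv by (simp add: sum.reindex)
    finally show ?thesis .
   qed
   moreover have "Qn n p - Qs p = (snd (D n ?q) - ut ?q) + (fst (D n ?q) - Du ?q) \<bullet> c p"
    using t Qs_eq[OF t(1), of y] by (simp add: pe Qn_def inner_prod_def uts_def Dus_def c_def inner_diff_left inner_diff_right inner_commute algebra_simps)
   moreover have "\<bar>(fst (D n ?q) - Du ?q) \<bullet> c p\<bar> \<le> norm (fst (D n ?q) - Du ?q) * C"
    using Cauchy_Schwarz_ineq2[of "fst (D n ?q) - Du ?q" "c p"] mult_left_mono[OF C(2)[OF p] norm_ge_zero[of "fst (D n ?q) - Du ?q"]] by linarith
   moreover have "norm (fst (D n ?q) - Du ?q) * C \<le> k n ?q * C" using C(1) calculation(2) by (intro mult_right_mono) auto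
   ultimately show ?thesis by (simp add: algebra_simps)
  qed
  have QX: "intble (\<lambda>p. indc ?X p * Qs p)"
  proof -
   have L: "L2 lborel (\<lambda>p. indc ?X p * Qs p)" unfolding L2_def
   proof
    show "(\<lambda>p. indc ?X p * Qs p) \<in> borel_measurable lborel"
     using Xm Qs_measurable by (auto intro!: borel_measurable_times borel_measurable_indicator)
    have "(indc ?X p * Qs p)\<^sup>2 = indc ?X p * (Qs p)\<^sup>2" for p by (simp add: indicator_def)
    then show "intble (\<lambda>p. (indc ?X p * Qs p)\<^sup>2)" using Qs_L2[OF sr(1,3), of R] by simp
   qed
   have iX: "intble (indc ?X :: _ \<Rightarrow> real)"
    using Xm emeasure_bounded_finite[OF compact_imp_bounded[OF X]] by (intro integrable_real_indicator) (auto simp: less_top)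
   have "L2 lborel (indc ?X :: _ \<Rightarrow> real)"
   proof -
    have e: "(\<lambda>p. (indc ?X p :: real)\<^sup>2) = indc ?X" by (auto simp: indicator_def fun_eq_iff)
    show ?thesis unfolding L2_def e using iX borel_measurable_integrable by blast
   qed
   from L2_mult_integrable[OF L this] show ?thesis
    by (rule lintable_cong[OF refl, THEN iffD1, rotated]) (auto simp: indicator_def)
  qed
  have ind: "indc ?X (y, t) * z = indc ?B y * (indc {s..r} t * z)" for y :: "real^'d" and t z :: real
   by (auto simp: indicator_def)
  have AEQ: "AE y in lborel. y \<in> ?B \<longrightarrow> intble (\<lambda>t. indc {s..r} t * Qs (y, t))"
   and Qfst: "intble (\<lambda>y. indc ?B y * (LBINT t. indc {s..r} t * Qs (y, t)))"
  proof -
   have *: "integrable (lborel \<Otimes>\<^sub>M lborel) (\<lambda>(y, t). indc ?X (y, t) * Qs (y, t))"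
    using QX by (simp add: lborel_prod case_prod_beta')
   have "AE y in lborel. intble (\<lambda>t. indc ?X (y, t) * Qs (y, t))"
    using lborel_pair.AE_integrable_fst[OF *] by simp
   then show "AE y in lborel. y \<in> ?B \<longrightarrow> intble (\<lambda>t. indc {s..r} t * Qs (y, t))"
    unfolding ind by eventually_elim auto
   show "intble (\<lambda>y. indc ?B y * (LBINT t. indc {s..r} t * Qs (y, t)))"
    using lborel_pair.integrable_fst[OF *] unfolding ind by simp
  qed
  have Ei: "intble (\<lambda>y. indc ?B y * \<bar>E y\<bar>)"
  proof -
   have "intble (\<lambda>y. indc ?B y *\<^sub>R vs (y, t))" if "t \<in> {s, r}" for t
    using that sr by (intro borel_integrable_compact compact_cball continuous_on_compose2[OF vs_continuous]) (auto intro!: continuous_intros)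
   then have "intble (\<lambda>y. indc ?B y *\<^sub>R vs (y, r) - indc ?B y *\<^sub>R vs (y, s) - indc ?B y * (LBINT t. indc {s..r} t * Qs (y, t)))"
    using Qfst by (intro lintable_diff) auto
   then have "intble (\<lambda>y. \<bar>indc ?B y * E y\<bar>)" by (intro integrable_abs) (simp add: E_def algebra_simps)
   then show ?thesis by (simp add: abs_mult)
  qed
  have bound: "(LBINT y. indc ?B y * \<bar>E y\<bar>) \<le> e * (2 * measure lborel ?B + (1 + C) * M)" if e: "e > 0" for e
  proof -
   have "uniformly_continuous_on ?S u"
    by (rule compact_uniformly_continuous[OF continuous_on_subset[OF u_continuous S(2)] S(1)])
   then obtain d where d: "d > 0" "\<And>p q. p \<in> ?S \<Longrightarrow> q \<in> ?S \<Longrightarrow> dist q p < d \<Longrightarrow> dist (u q) (u p) < e"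
    using e unfolding uniformly_continuous_on_def by metis
   have "\<forall>\<^sub>F n in sequentially. eps n < d \<and> eps n < a \<and> (LBINT p. k n p) < e"
    using order_tendstoD(2)[OF klim e] by (intro eventually_conj eventually_eps_less d a)
   then obtain n where n: "eps n < d" "eps n < a" "(LBINT p. k n p) < e" by (auto simp: eventually_sequentially)
   define w where "w p = moll (eps n) f (flow_map p)" for p
   have wu: "\<bar>w p - vs p\<bar> \<le> e" if p: "p \<in> ?X" for p unfolding w_def
   proof (rule moll_close[OF fi eps_pos])
    fix q assume q: "norm (q - flow_map p) < eps n"
    have "q \<in> ?S" by (rule subsetD[OF in_S[OF p n(2)]]) (use q in \<open>simp add: dist_norm norm_minus_commute\<close>)
    moreover have "p \<in> slab T" using p inT by auto
    ultimately show "\<bar>f q - vs p\<bar> \<le> e"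
     using d(2)[OF in_S0[OF p], of q] q n by (simp add: f_def vs_def dist_norm)
   qed
   have FTC: "(LBINT t. indc {s..r} t * Qn n (y, t)) = w (y, r) - w (y, s)" for y
   proof -
    have "(LBINT t. Qn n (y, t) * indc {s..r} t) = w (y, r) - w (y, s)"
    proof (rule integral_FTC_Icc_real[OF sr(2)])
     fix t assume "s \<le> t" "t \<le> r"
     then have t: "t > 0" using sr by simp
     have "((\<lambda>t. (gsc t y, t)) has_derivative (\<lambda>h. (h *\<^sub>R c (y, t), h))) (at t)"
      using gsc_time_derivative[OF t, of y] by (intro has_derivative_Pair) (auto simp: c_def)
     from has_derivative_compose[OF this c1_has_derivative[OF c1_moll[OF fi eps_pos[of n]]]]
     have "((\<lambda>t. w (y, t)) has_derivative (\<lambda>h. D n (gsc t y, t) \<bullet> (h *\<^sub>R c (y, t), h))) (at t)"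
      by (simp add: w_def D_def flow_map_def)
     moreover have "(\<lambda>h. D n (gsc t y, t) \<bullet> (h *\<^sub>R c (y, t), h)) = (*) (Qn n (y, t))"
      by (auto simp: Qn_def flow_map_def inner_prod_def algebra_simps)
     ultimately show "((\<lambda>t. w (y, t)) has_real_derivative Qn n (y, t)) (at t)" by (simp add: has_field_derivative_def)
     have "continuous_on {0<..} (\<lambda>t. Qn n (y, t))" by (rule continuous_on_compose2[OF Qnc]) (auto intro!: continuous_intros)
     then show "isCont (\<lambda>t. Qn n (y, t)) t" using t by (simp add: continuous_on_eq_continuous_at)
    qed
    then show ?thesis by (simp add: mult.commute)
   qed
   have Qni: "intble (\<lambda>t. indc {s..r} t * Qn n (y, t))" for y
   proof -
    have "continuous_on {s..r} (\<lambda>t. Qn n (y, t))" by (rule continuous_on_compose2[OF Qnc]) (use sr in \<open>auto intro!: continuous_intros\<close>)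
    from borel_integrable_compact[OF compact_Icc this] show ?thesis by simp
   qed
   note kX = flow_map_L1[OF sr(1) ki[of n] _ m]
   have k0: "k n p \<ge> 0" for p by (simp add: k_def sum_nonneg)
   have kX1: "intble (\<lambda>p. indc ?X p * k n (flow_map p))" and kX2: "(LBINT p. indc ?X p * k n (flow_map p)) \<le> (LBINT p. k n p) * M"
    using kX[OF k0] by simp_all
   have *: "integrable (lborel \<Otimes>\<^sub>M lborel) (\<lambda>(y, t). indc ?X (y, t) * k n (flow_map (y, t)))"
    using kX1 by (simp add: lborel_prod case_prod_beta')
   let ?k = "\<lambda>y. LBINT t. indc ?X (y, t) * k n (flow_map (y, t))"
   have kf: "intble ?k" "AE y in lborel. intble (\<lambda>t. indc ?X (y, t) * k n (flow_map (y, t)))"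
    "(LBINT y. ?k y) = (LBINT p. indc ?X p * k n (flow_map p))"
    using lborel_pair.integrable_fst[OF *] lborel_pair.AE_integrable_fst[OF *] lborel_pair.integral_fst[OF *] by (simp_all add: lborel_prod case_prod_beta')
   have iB: "intble (indc ?B :: _ \<Rightarrow> real)"
    by (rule integrable_real_indicator) (use emeasure_lborel_cball_finite[of "0::real^'d" R] in auto)
   have "AE y in lborel. indc ?B y * \<bar>E y\<bar> \<le> 2 * e * indc ?B y + (1 + C) * ?k y"
    using AEQ kf(2)
   proof eventually_elim
    case (elim y)
    show ?case
    proof (cases "y \<in> ?B")
     case True
     then have Qi: "intble (\<lambda>t. indc {s..r} t * Qs (y, t))" using elim by simp
     have Ee: "E y = (vs (y, r) - w (y, r)) - (vs (y, s) - w (y, s)) + (LBINT t. indc {s..r} t * Qn n (y, t) - indc {s..r} t * Qs (y, t))"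
      by (simp add: E_def FTC lint_diff[OF Qni Qi])
     have "\<bar>LBINT t. indc {s..r} t * Qn n (y, t) - indc {s..r} t * Qs (y, t)\<bar>
      \<le> (LBINT t. \<bar>indc {s..r} t * Qn n (y, t) - indc {s..r} t * Qs (y, t)\<bar>)" by (rule integral_abs_bound)
     also have "\<dots> \<le> (LBINT t. (1 + C) * (indc ?X (y, t) * k n (flow_map (y, t))))"
     proof (rule integral_mono)
      show "intble (\<lambda>t. \<bar>indc {s..r} t * Qn n (y, t) - indc {s..r} t * Qs (y, t)\<bar>)"
       by (intro integrable_abs lintable_diff Qni Qi)
      show "intble (\<lambda>t. (1 + C) * (indc ?X (y, t) * k n (flow_map (y, t))))"
       by (intro integrable_mult_right elim)
      show "\<bar>indc {s..r} t * Qn n (y, t) - indc {s..r} t * Qs (y, t)\<bar> \<le> (1 + C) * (indc ?X (y, t) * k n (flow_map (y, t)))" for t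
       using Qdiff[of "(y, t)" n] n True by (cases "t \<in> {s..r}") auto
     qed
     finally have "\<bar>LBINT t. indc {s..r} t * Qn n (y, t) - indc {s..r} t * Qs (y, t)\<bar> \<le> (1 + C) * ?k y" by simp
     moreover have "\<bar>w (y, r) - vs (y, r)\<bar> \<le> e" "\<bar>w (y, s) - vs (y, s)\<bar> \<le> e" using wu True sr by auto
     ultimately have "\<bar>E y\<bar> \<le> 2 * e + (1 + C) * ?k y" unfolding Ee by linarith
     then show ?thesis using True by simp
    qed simp
   qed
   then have "(LBINT y. indc ?B y * \<bar>E y\<bar>) \<le> (LBINT y. 2 * e * indc ?B y + (1 + C) * ?k y)"
    using Ei iB kf(1) by (intro integral_mono_AE lintable_add integrable_mult_right)
   also have "\<dots> = 2 * e * measure lborel ?B + (1 + C) * (LBINT p. indc ?X p * k n (flow_map p))"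
    using iB kf by (subst lint_add) auto
   also have "\<dots> \<le> 2 * e * measure lborel ?B + (1 + C) * (e * M)"
    using order_trans[OF kX2 mult_right_mono[OF less_imp_le[OF n(3)] less_imp_le[OF M(1)]]] C(1) by (intro add_left_mono mult_left_mono) auto
   finally show ?thesis by (simp add: algebra_simps)
  qed
  have "(LBINT y. indc ?B y * \<bar>E y\<bar>) \<le> 0"
  proof (rule ccontr)
   \<comment> \<open>The summand 1 makes the bound strict for the choice
     \<open>e = ?i / ?c\<close>.\<close>
   let ?c = "2 * measure lborel ?B + (1 + C) * M + 1" and ?i = "LBINT y. indc ?B y * \<bar>E y\<bar>"
   assume "\<not> ?i \<le> 0"
   moreover have c: "?c > 0" using C M by (simp add: add_nonneg_pos)
   ultimately have "?i \<le> ?i / ?c * (?c - 1)" using bound[of "?i / ?c"] by simp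
   also have "\<dots> < ?i" using \<open>\<not> ?i \<le> 0\<close> c by (simp add: field_simps)
   finally show False by simp
  qed
  moreover have "(LBINT y. indc ?B y * \<bar>E y\<bar>) \<ge> 0" by simp
  ultimately have "(LBINT y. indc ?B y * \<bar>E y\<bar>) = 0" by linarith
  then have "AE y in lborel. indc ?B y * \<bar>E y\<bar> = 0"
   using integral_nonneg_eq_0_iff_AE[OF Ei] by simp
  then show ?thesis by eventually_elim auto
 qed
 have "AE y in lborel. \<forall>n. y \<in> cball 0 (real n) \<longrightarrow> E y = 0" by (intro AE_all_countable[THEN iffD2] allI ball)
 then show ?thesis
 proof eventually_elim
  case (elim y)
  obtain n where "norm y \<le> real n" using real_arch_simple by blast
  then show ?case using elim by (auto simp: E_def)
 qed
qed

text \<open>The determinant is controlled along rays in the radius, which is \<open>sqrt t\<close>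
  here; a power \<Upsilon> of the radius is the power \<open>\<Upsilon> / 2\<close> of
  \<open>t\<close>.\<close>

lemma W_monotone:
 assumes "0 < s" "s \<le> r"
 shows "s powr (\<Upsilon> / 2) * W (y, s) \<le> r powr (\<Upsilon> / 2) * W (y, r)"
  "r powr (- (\<Upsilon> / 2)) * W (y, r) \<le> s powr (- (\<Upsilon> / 2)) * W (y, s)"
proof -
 have p: "t powr (q / 2) = sqrt t powr q" if "t > 0" for t q :: real
  using that by (simp add: powr_half_sqrt[symmetric] powr_powr)
 have m: "- (\<Upsilon> / 2) = - \<Upsilon> / 2" by simp
 have r: "r > 0" using assms by simp
 have e: "ex y \<ge> 0" by (simp add: ex_def)
 show "s powr (\<Upsilon> / 2) * W (y, s) \<le> r powr (\<Upsilon> / 2) * W (y, r)"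
  unfolding p[OF assms(1)] p[OF r] W_def
  using mult_left_mono[OF gam_incr[of "sqrt s" "sqrt r" y] e] assms by (simp add: mult_ac)
 show "r powr (- (\<Upsilon> / 2)) * W (y, r) \<le> s powr (- (\<Upsilon> / 2)) * W (y, s)"
  unfolding m p[OF assms(1)] p[OF r] W_def
  using mult_left_mono[OF gam_decr[of "sqrt s" "sqrt r" y] e] assms by (simp add: mult_ac)
qed

lemma slice_Qs_equation:
 "AE s in lborel. 0 < s \<and> s < T \<longrightarrow> (\<forall>r R. 0 < r \<and> r < T \<and> R > 0 \<longrightarrow>
  (LBINT y. (P s y \<bullet> P r y) * (Phi R y * W (y, s))) + (LBINT y. (P s y \<bullet> dPhi R y) * (vs (y, r) * W (y, s)))
   = s * (LBINT y. Qs (y, s) * (vs (y, r) * Phi R y * W (y, s))))"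
 using cross_equation Ps_eq
proof eventually_elim
 case (elim s)
 show ?case
 proof (intro impI allI)
  fix r R :: real assume s: "0 < s \<and> s < T" and rR: "0 < r \<and> r < T \<and> R > 0"
  have ae: "AE y in lborel. Ps (y, s) = P s y" using elim s by simp
  let ?w = "\<lambda>y. u (gsc r y, r) * Phi R y * W (y, s)"
  have c: "borel_fun (\<lambda>y::real^'d. (y, s))" by (intro borel_measurable_continuous_onI continuous_intros)
  have w: "borel_fun ?w"
   using borel_measurable_continuous_onI[OF slice_u_gsc_continuous, of r] rR measurable_compose[OF c W_measurable]
   by (auto intro!: borel_measurable_times)
  have utm: "borel_fun (\<lambda>y. ut (gsc s y, s))"
   by (rule measurable_compose[OF gsc_measurable slice_measurable[OF locally_integrable_ut]]) (use s in auto)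
  have "s * (LBINT y. Qs (y, s) * ?w y) = (LBINT y. s * (Qs (y, s) * ?w y))" by simp
  also have "\<dots> = (LBINT y. (s * ut (gsc s y, s) + (P s y \<bullet> y) / 2) * ?w y)"
  proof (rule integral_cong_AE)
   show "(\<lambda>y. s * (Qs (y, s) * ?w y)) \<in> borel_measurable lborel"
    using measurable_compose[OF c Qs_measurable] w by (auto intro!: borel_measurable_times)
   have Psm: "P s \<in> borel_measurable borel" using P_measurable s by simp
   show "(\<lambda>y. (s * ut (gsc s y, s) + (P s y \<bullet> y) / 2) * ?w y) \<in> borel_measurable lborel"
    using utm w borel_measurable_inner[OF Psm measurable_ident_sets[OF refl]] by (auto intro!: borel_measurable_times borel_measurable_add borel_measurable_divide)
   show "AE y in lborel. s * (Qs (y, s) * ?w y) = (s * ut (gsc s y, s) + (P s y \<bullet> y) / 2) * ?w y"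
    using ae by eventually_elim (use s in \<open>simp add: Qs_def slab_slices inner_commute field_simps\<close>)
  qed
  also have "\<dots> = (LBINT y. (P s y \<bullet> P r y) * (Phi R y * W (y, s))) + (LBINT y. (P s y \<bullet> dPhi R y) * (vs (y, r) * W (y, s)))"
   using elim s rR by (simp add: slab_slices)
  finally show "(LBINT y. (P s y \<bullet> P r y) * (Phi R y * W (y, s))) + (LBINT y. (P s y \<bullet> dPhi R y) * (vs (y, r) * W (y, s)))
   = s * (LBINT y. Qs (y, s) * (vs (y, r) * Phi R y * W (y, s)))" using rR by (simp add: slab_slices)
 qed
qed

lemma L_fun_mono: "mono_on {0<..<T} (\<lambda>t. t powr \<Upsilon> * L_fun h u t)"
proof -
 interpret F: frequency vs W Qs Ps P T "\<Upsilon> / 2"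
 proof (unfold_locales, goal_cases)
  \<comment> \<open>\<Upsilon> is nonnegative because it bounds an absolute value; any point will
    do.\<close>
  case 2 show ?case using trHG_bound[of 0] by simp
 next
  case (11 y s r) then show ?case by (intro W_monotone)
 next
  case (12 y s r) then show ?case by (intro W_monotone)
 next
  case (14 t)
  then show ?case using slice_integrals(2)[of t] by (simp add: slab_slices)
 next
  case (18 a b)
  have e: "indc {a..b} t * (LBINT y. (vs (y, t))\<^sup>2 * W (y, t)) = indc {a..b} t * (LBINT y. (u (gsc t y, t))\<^sup>2 * W (y, t))" for t
   using 18 by (cases "t \<in> {a..b}") (auto simp: slab_slices)
  show ?case unfolding e by (rule slice_functionals_integrable(2)[OF 18])
 next
  case (21 t U dU R b)
  then show ?case using slice_ibp[of t U dU R b] by (simp add: slab_slices)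
 qed (fact T_pos vs_measurable W_measurable Qs_measurable Ps_measurable vs_continuous W_continuous Ps_eq slice_Qs_equation |
   rule W_pos Ps_eq slice_Qs_equation | (rule P_measurable slice_integrals(1) Qs_L2 slice_functionals_integrable(1) flow_increment; assumption))+
 \<comment> \<open>The powers of \<open>sqrt t\<close> cancel in the quotient, and the factor
   \<open>t\<close> of \<open>L_fun\<close> cancels the \<open>1 / t\<close> that the energy
   acquires from the scaling of the gradient.\<close>
 have L: "L_fun h u t = F.D t / F.H t" if t: "0 < t" "t < T" for t
  using slice_integrals(4,5)[OF t] t by (simp add: L_fun_def F.D_def F.H_def slab_slices)
 show ?thesis
 proof (rule mono_onI)
  fix s r assume "s \<in> {0<..<T}" "r \<in> {0<..<T}" "s \<le> r"
  then show "s powr \<Upsilon> * L_fun h u s \<le> r powr \<Upsilon> * L_fun h u r"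
   using F.frequency_mono[of s r] by (simp add: L)
 qed
qed

end

text \<open>Needed to exchange two almost everywhere equal time derivatives under the integral of
  the weak equation.\<close>

lemma (in diffeo) weak_solution_integrand_measurable:
 assumes Du: "\<And>i. locally_integrable (slab T) (\<lambda>p. Du p $ i)" and ut: "locally_integrable (slab T) ut" and \<phi>: "\<And>k. Ck k \<phi>"
 shows "borel_fun (\<lambda>p. indc (slab T) p *\<^sub>R (- ((coeffA h (fst p) *v Du p) \<bullet> (\<chi> i. frechet_derivative \<phi> (at p) (axis i 1, 0))) + ut p * \<phi> p))"
proof -
 have B: "(axis i 1, 0) \<in> (Basis :: ((real^'d) \<times> real) set)" for i by (auto simp: Basis_prod_def Basis_vec_def)
 have d: "borel_fun (\<lambda>p. \<chi> i. frechet_derivative \<phi> (at p) (axis i 1, 0))"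
  using \<phi>[of 1] B by (intro borel_measurable_continuous_onI continuous_on_vec_lambda) simp
 have \<phi>m: "borel_fun \<phi>" using \<phi>[of 0] by (simp add: borel_measurable_continuous_onI)
 have D: "borel_fun (\<lambda>p. indc (slab T) p *\<^sub>R Du p)"
  by (subst borel_measurable_euclidean_space)
   (use locally_integrable_measurable[OF Du open_slab] in \<open>auto simp: Basis_vec_def inner_axis\<close>)
 have A: "borel_fun (\<lambda>p. coeffA h (fst p) *v (indc (slab T) p *\<^sub>R Du p))"
  by (intro matrix_measurable D borel_measurable_continuous_onI continuous_intros continuous_on_compose2[OF coeffA_continuous[of UNIV]]) auto
 have "borel_fun (\<lambda>p. - ((coeffA h (fst p) *v (indc (slab T) p *\<^sub>R Du p)) \<bullet> (\<chi> i. frechet_derivative \<phi> (at p) (axis i 1, 0))) + (indc (slab T) p * ut p) * \<phi> p)"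
  by (intro borel_measurable_add borel_measurable_uminus borel_measurable_inner A d borel_measurable_times \<phi>m locally_integrable_measurable[OF ut open_slab])
 then show ?thesis by (simp add: matrix_vector_mult_scaleR algebra_simps)
qed

theorem theorem5p3:
  fixes g h :: "real^'d \<Rightarrow> real^'d" and T \<Upsilon> :: real and u :: "(real^'d) \<times> real \<Rightarrow> real"
  assumes "C2_diffeo g h"
    and "\<forall>z. det (Jac g z) > 0"
    and "in_Linf lborel (trHG g h)"
    and "T > 0"
    and "u \<in> class_A T g h"
    and "weak_solution T (coeffA h) u"
    and "\<exists>p\<in>cylinder T. u p \<noteq> 0"
    and "ereal \<Upsilon> \<ge> Linf_norm lborel (trHG g h)"
  shows "mono_on {0<..<T} (\<lambda>t. t powr \<Upsilon> * L_fun h u t)"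
proof -
 interpret diffeo g h \<Upsilon> using assms by unfold_locales auto
 have mg: "moderate_growth T h u" using assms(5) by (simp add: class_A_def)
 obtain ut where ut: "is_weak_tderiv T u ut"
  and int: "\<forall>t\<in>{0<..<T}. intble (H_ig h u t) \<and> intble (D_ig h u t) \<and> intble (T_ig h ut t)"
  and Lp: "in_Lp 1 (time_measure CARD('d) {0<..<T}) (H_fun h u)" "in_Lp 1 (time_measure CARD('d) {0<..<T}) (D_fun h u)"
   "in_Lp 1 (time_measure CARD('d) {0<..<T}) (T_fun h ut)"
  using mg unfolding moderate_growth_def by blast
 have cyl: "cylinder T = (slab T :: ((real^'d) \<times> real) set)" by (simp add: cylinder_def)
 obtain Du ut' where Du: "is_weak_xgradient T u Du" and ut': "is_weak_tderiv T u ut'"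
  and eq: "\<And>\<phi>. test_function (slab T) \<phi> \<Longrightarrow> (LINT p:slab T|lborel.
   - ((coeffA h (fst p) *v Du p) \<bullet> (\<chi> i. frechet_derivative \<phi> (at p) (axis i 1, 0))) + ut' p * \<phi> p) = 0"
  using assms(6) unfolding weak_solution_def cyl by blast
 \<comment> \<open>The growth condition and the weak equation choose their time derivatives of
   \<open>u\<close> independently; uniqueness of weak derivatives identifies them.\<close>
 have ae: "AE p in lborel. p \<in> slab T \<longrightarrow> ut p = ut' p"
  using weak_deriv_unique[OF _ _ open_slab] ut ut' by (auto simp: is_weak_tderiv_def cyl)
 have li: "locally_integrable (slab T) ut" "locally_integrable (slab T) ut'" "\<And>i. locally_integrable (slab T) (\<lambda>p. Du p $ i)"
  using ut ut' Du by (auto simp: is_weak_tderiv_def is_weak_xgradient_def cyl weak_deriv_def)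
 interpret solution g h \<Upsilon> T u ut Du
 proof
  show "continuous_on (slab T) u" using mg by (simp add: moderate_growth_def cyl)
  show "is_weak_gradient (\<lambda>x. u (x, t)) (\<lambda>x. xgrad u x t)" if "0 < t" "t < T" for t
  proof -
   have "\<exists>F. is_weak_gradient (\<lambda>x. u (x, t)) F" using mg that by (auto simp: moderate_growth_def)
   then show ?thesis unfolding xgrad_def by (rule someI_ex)
  qed
  fix \<phi> :: "(real^'d) \<times> real \<Rightarrow> real" assume \<phi>: "test_function (slab T) \<phi>"
  then have Ck: "Ck k \<phi>" for k by (simp add: test_function_def)
  have "(LINT p:slab T|lborel. - ((coeffA h (fst p) *v Du p) \<bullet> (\<chi> i. frechet_derivative \<phi> (at p) (axis i 1, 0))) + ut p * \<phi> p)
   = (LINT p:slab T|lborel. - ((coeffA h (fst p) *v Du p) \<bullet> (\<chi> i. frechet_derivative \<phi> (at p) (axis i 1, 0))) + ut' p * \<phi> p)"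
   unfolding set_lebesgue_integral_def
  proof (rule integral_cong_AE)
   show "AE p in lborel. indc (slab T) p *\<^sub>R (- ((coeffA h (fst p) *v Du p) \<bullet> (\<chi> i. frechet_derivative \<phi> (at p) (axis i 1, 0))) + ut p * \<phi> p)
    = indc (slab T) p *\<^sub>R (- ((coeffA h (fst p) *v Du p) \<bullet> (\<chi> i. frechet_derivative \<phi> (at p) (axis i 1, 0))) + ut' p * \<phi> p)"
    using ae
   proof eventually_elim
    case (elim p)
    then show ?case by (cases "p \<in> slab T") (simp_all del: mem_Times_iff)
   qed
  qed (simp_all only: measurable_lborel2 weak_solution_integrand_measurable[OF li(3) li(1) Ck] weak_solution_integrand_measurable[OF li(3) li(2) Ck])
  with eq[OF \<phi>] show "(LINT p:slab T|lborel. - ((coeffA h (fst p) *v Du p) \<bullet> (\<chi> i. frechet_derivative \<phi> (at p) (axis i 1, 0))) + ut p * \<phi> p) = 0"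
   by simp
 qed (use assms ut Du int Lp in auto)
 show ?thesis by (rule L_fun_mono)
qed

end
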